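(* Let $G=(V,E)$ be a finite connected undirected simple graph with $m=|E|$ edges and maximum degree $d_{\max}$, and let $k$ be an integer with $1\le k\le |V|$. The algorithm $\mathrm{TopK}(G,k)$ described in the context computes the top-$k$ results of the $h$-index based structural diversity search problem, that is, a set $S^*$ with $$S^*\in \mathop{\arg\max}_{S\subseteq V,\ |S|=k}\Bigl\{\min_{v\in S}h(v)\Bigr\}$$ consisting of $k$ vertices with the highest scores $h(v)$, in $O(\rho m)$ time and $O(m)$ space, where $\rho$ is the arboricity of $G$ and $\rho\le\min\{d_{\max},\sqrt{m}\}$.
   Context: Let $n=|V|$. $N(v)$ is the set of neighbours of $v$, $d(v)=|N(v)|$, and $d_{\max}=\max_{v\in V}d(v)$. The arboricity $\rho$ of $G$ is the minimum number of disjoint spanning forests that cover all the edges of $G$. The ego-network of $v$ is $G_{N(v)}$, the subgraph of $G$ induced by $N(v)$ (it does not contain $v$). Subgraphs are non-empty. For a subgraph $H$, its coreness is its minimum degree, $\varphi(H)=\min_{x\in V(H)} d_H(x)$, where $d_H(x)$ is the degree of $x$ in $H$. For a graph $F$ and $x\in V(F)$, the coreness of $x$ in $F$ is $\varphi_F(x)=\max\{\varphi(H): H\subseteq F,\ x\in V(H)\}$. Discriminative core: given a graph $F$ and a subgraph $H\subseteq F$, $H$ is a discriminative core of $F$ if and only if $H$ is a maximal connected subgraph such that there exists no subgraph $H'\subseteq H$ with $\varphi(H')>\varphi(H)$. Diversity score: for $1\le r\le n$ let $c_v(r)$ be the number of discriminative cores $H$ of $G_{N(v)}$ with $\varphi(H)=r$.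 Then $h(v)=\max\{r : \sum_{i=r}^{n}c_v(i)\geq r\}$, the maximum being over $1\le r\le n$ and taken to be $0$ if no such $r$ exists. Upper bound: for $u\in N(v)$ let $\widehat{\varphi}_{G_{N(v)}}(u)=\min\{\varphi_G(v),\varphi_G(u)-1\}$, and let $\widehat{h}(v)$ be the largest positive integer $x$ with $|\{u\in N(v): \widehat{\varphi}_{G_{N(v)}}(u)\geq x\}|\geq x(x+1)$ (and $0$ if there is none). Core decomposition of a graph: for $t=1,2,\dots$ repeatedly delete vertices of current degree less than $t$, assigning them coreness $t-1$, until the graph is empty. Algorithm $\mathrm{Score}(G,v)$, used to compute $h(v)$: (1) Extract the ego-network $G_{N(v)}$. (2) Run core decomposition on $G_{N(v)}$, obtaining $\varphi_{G_{N(v)}}(u)$ for all $u\in N(v)$; let $t_{\max}$ be the largest of these values. Sort the vertices of $G_{N(v)}$ in ascending order of coreness. (3) For $t=1,\dots,t_{\max}$: set $c_v(t)=0$; for each not yet visited vertex $u$ of coreness exactly $t$, run a breadth-first search from $u$ in $G_{N(v)}$ through vertices of coreness exactly $t$, marking them visited; if no vertex reached has a neighbour in $G_{N(v)}$ of coreness greater than $t$, increase $c_v(t)$ by $1$. (4) Set a counter $s=0$. For $t=t_{\max},t_{\max}-1,\dots,1$: add $c_v(t)$ to $s$; if $s\ge t$, output $t$ and stop. If the loop ends without output, output $0$. Algorithm $\mathrm{TopK}(G,k)$: (1) Run core decomposition on $G$ to obtain $\varphi_G(v)$ for all $v\in V$; compute $\widehat{h}(v)$ for all $v$; let $\mathcal{L}$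 be the list of all vertices in descending order of $\widehat{h}$; set $\mathcal{S}=\emptyset$. (2) While $\mathcal{L}\neq\emptyset$: remove from $\mathcal{L}$ a vertex $v^*$ with largest $\widehat{h}(v^* )$; if $|\mathcal{S}|=k$ and $\widehat{h}(v^* )\le\min_{v\in\mathcal{S}}h(v)$, stop the loop; otherwise compute $h(v^* )$ by $\mathrm{Score}(G,v^* )$; if $|\mathcal{S}|<k$, add $v^*$ to $\mathcal{S}$; else if $h(v^* )>\min_{v\in\mathcal{S}}h(v)$, replace a vertex of $\mathcal{S}$ with minimum score by $v^*$. (3) Return $\mathcal{S}$.
   Formalization: The bound ρ ≤ √m fails for the triangle (ρ=2, m=3), so it is proved for all other graphs, with ρ ≤ ⌈√m⌉ for all; for m=0 the O-bounds use max(1,·); "maximal" in discriminative core means no larger connected subgraph of at least the same coreness. *)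

theory Defs
  imports Complex_Main "HOL-Library.Monad_Syntax" "HOL-Library.While_Combinator"
begin

section \<open>Graphs\<close>

text \<open>A graph is a pair of a vertex set and a set of edges, an edge being the two-element set of
  its end points.\<close>

type_synonym 'a ugraph = "'a set \<times> 'a set set"

abbreviation verts :: "'a ugraph \<Rightarrow> 'a set" where "verts G \<equiv> fst G"
abbreviation edges :: "'a ugraph \<Rightarrow> 'a set set" where "edges G \<equiv> snd G"

definition simple_graph :: "'a ugraph \<Rightarrow> bool" where
  "simple_graph G \<longleftrightarrow> finite (verts G) \<and> (\<forall>e\<in>edges G. e \<subseteq> verts G \<and> card e = 2)"

definition nbrs :: "'a ugraph \<Rightarrow> 'a \<Rightarrow> 'a set" where
  "nbrs G v = {u. {u, v} \<in> edges G}"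

definition degree :: "'a ugraph \<Rightarrow> 'a \<Rightarrow> nat" where
  "degree G v = card (nbrs G v)"

definition max_degree :: "'a ugraph \<Rightarrow> nat" where
  "max_degree G = Max (degree G ` verts G)"

definition connected_graph :: "'a ugraph \<Rightarrow> bool" where
  "connected_graph G \<longleftrightarrow>
     verts G \<noteq> {} \<and> (\<forall>x\<in>verts G. \<forall>y\<in>verts G. (x, y) \<in> {(a, b). {a, b} \<in> edges G}\<^sup>*)"

definition subgraph :: "'a ugraph \<Rightarrow> 'a ugraph \<Rightarrow> bool" where
  "subgraph H F \<longleftrightarrow> verts H \<noteq> {} \<and> verts H \<subseteq> verts F \<and> edges H \<subseteq> edges F \<and> (\<forall>e\<in>edges H. e \<subseteq> verts H)"

definition induced :: "'a ugraph \<Rightarrow> 'a set \<Rightarrow> 'a ugraph" where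
  "induced G W = (W, {e \<in> edges G. e \<subseteq> W})"

definition ego :: "'a ugraph \<Rightarrow> 'a \<Rightarrow> 'a ugraph" where
  "ego G v = induced G (nbrs G v)"


section \<open>Arboricity\<close>

definition acyclic_edges :: "'a set set \<Rightarrow> bool" where
  "acyclic_edges A \<longleftrightarrow>
     \<not> (\<exists>c. 3 \<le> length c \<and> distinct c \<and> (\<forall>i<length c. {c ! i, c ! (Suc i mod length c)} \<in> A))"

text \<open>A spanning forest of \<open>G\<close> is given by its edge set; its vertex set is that of \<open>G\<close>.\<close>

definition spanning_forest :: "'a ugraph \<Rightarrow> 'a set set \<Rightarrow> bool" where
  "spanning_forest G A \<longleftrightarrow> A \<subseteq> edges G \<and> acyclic_edges A"

definition arboricity :: "'a ugraph \<Rightarrow> nat" where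
  "arboricity G = (LEAST r. \<exists>A. (\<forall>i<r. spanning_forest G (A i)) \<and>
     (\<forall>i<r. \<forall>j<r. i \<noteq> j \<longrightarrow> A i \<inter> A j = {}) \<and> (\<Union>i<r. A i) = edges G)"


section \<open>Coreness, discriminative cores and diversity score\<close>

definition coreness :: "'a ugraph \<Rightarrow> nat" where
  "coreness H = Min (degree H ` verts H)"

definition vertex_coreness :: "'a ugraph \<Rightarrow> 'a \<Rightarrow> nat" where
  "vertex_coreness F x = Max {coreness H |H. subgraph H F \<and> x \<in> verts H}"

text \<open>``Maximal connected subgraph'' refers to the coreness of \<open>H\<close>, as in ``maximal connected
  \<open>k\<close>-core'': no connected subgraph of coreness at least that of \<open>H\<close> properly contains \<open>H\<close>.
  Taking maximality among all connected subgraphs without a subgraph of larger coreness would be a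
  different notion, which the algorithm below does not count: in a 4-clique \<open>a,b,c,d\<close> with an
  additional path \<open>a,x,y,b\<close>, the whole graph minus the edge \<open>cd\<close> would be such a core of
  coreness 2.\<close>

definition discriminative_core :: "'a ugraph \<Rightarrow> 'a ugraph \<Rightarrow> bool" where
  "discriminative_core F H \<longleftrightarrow>
     subgraph H F \<and> connected_graph H \<and>
     \<not> (\<exists>H'. subgraph H' F \<and> connected_graph H' \<and> coreness H \<le> coreness H' \<and> subgraph H H' \<and> H' \<noteq> H) \<and>
     \<not> (\<exists>H'. subgraph H' H \<and> coreness H' > coreness H)"

definition core_count :: "'a ugraph \<Rightarrow> 'a \<Rightarrow> nat \<Rightarrow> nat" where
  "core_count G v r = card {H. discriminative_core (ego G v) H \<and> coreness H = r}"

definition hscore :: "'a ugraph \<Rightarrow> 'a \<Rightarrow> nat" where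
  "hscore G v =
     Max (insert 0 {r \<in> {1..card (verts G)}. (\<Sum>i=r..card (verts G). core_count G v i) \<ge> r})"

text \<open>The upper bound, as a function of the coreness values \<open>c\<close> of \<open>G\<close>.\<close>

definition upper_bound :: "'a ugraph \<Rightarrow> ('a \<Rightarrow> nat) \<Rightarrow> 'a \<Rightarrow> nat" where
  "upper_bound G c v =
     Max (insert 0 {x. 1 \<le> x \<and> card {u \<in> nbrs G v. min (c v) (c u - 1) \<ge> x} \<ge> x * (x + 1)})"


section \<open>The algorithms\<close>

text \<open>Ties and orders that the algorithms leave open are modelled by nondeterminism: each predicate
  below relates an input to every result that some run can produce.\<close>

text \<open>States of the core decomposition: current level \<open>t\<close>, remaining vertices, values assigned.\<close>

inductive core_step :: "'a ugraph \<Rightarrow> nat \<times> 'a set \<times> ('a \<Rightarrow> nat) \<Rightarrow> nat \<times> 'a set \<times> ('a \<Rightarrow> nat) \<Rightarrow> bool"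
  for F :: "'a ugraph" where
  delete: "x \<in> W \<Longrightarrow> degree (induced F W) x < t \<Longrightarrow>
    core_step F (t, W, c) (t, W - {x}, c(x := t - 1))"
| next_level: "W \<noteq> {} \<Longrightarrow> \<forall>x\<in>W. t \<le> degree (induced F W) x \<Longrightarrow>
    core_step F (t, W, c) (t + 1, W, c)"

definition core_decomposition :: "'a ugraph \<Rightarrow> ('a \<Rightarrow> nat) \<Rightarrow> bool" where
  "core_decomposition F c \<longleftrightarrow> (\<exists>t. (core_step F)\<^sup>*\<^sup>* (1, verts F, \<lambda>_. 0) (t, {}, c))"

text \<open>The vertices reached by a breadth-first search from \<open>u\<close> through vertices of coreness \<open>t\<close>.\<close>

definition bfs_reach :: "'a ugraph \<Rightarrow> ('a \<Rightarrow> nat) \<Rightarrow> nat \<Rightarrow> 'a \<Rightarrow> 'a set" where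
  "bfs_reach F c t u = {w. (u, w) \<in> {(a, b). {a, b} \<in> edges F \<and> c a = t \<and> c b = t}\<^sup>*}"

primrec count_level :: "'a ugraph \<Rightarrow> ('a \<Rightarrow> nat) \<Rightarrow> nat \<Rightarrow> 'a list \<Rightarrow> 'a set \<Rightarrow> nat" where
  "count_level F c t [] visited = 0"
| "count_level F c t (u # us) visited =
     (if c u = t \<and> u \<notin> visited then
        let R = bfs_reach F c t u in
        (if \<exists>x\<in>R. \<exists>y\<in>nbrs F x. c y > t then 0 else 1) + count_level F c t us (visited \<union> R)
      else count_level F c t us visited)"

text \<open>Step 4 of Score, entered with \<open>t\<close> and the counter \<open>s\<close>.\<close>

primrec descend :: "(nat \<Rightarrow> nat) \<Rightarrow> nat \<Rightarrow> nat \<Rightarrow> nat" where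
  "descend cv 0 s = 0"
| "descend cv (Suc t) s =
     (if s + cv (Suc t) \<ge> Suc t then Suc t else descend cv t (s + cv (Suc t)))"

definition Score :: "'a ugraph \<Rightarrow> 'a \<Rightarrow> nat \<Rightarrow> bool" where
  "Score G v s \<longleftrightarrow> (\<exists>c us.
     core_decomposition (ego G v) c \<and>
     distinct us \<and> set us = nbrs G v \<and> sorted (map c us) \<and>
     s = descend (\<lambda>t. count_level (ego G v) c t us {}) (Max (insert 0 (c ` nbrs G v))) 0)"

text \<open>The main loop of TopK. In \<open>topk_loop G k hh L S sc R\<close>, \<open>hh\<close> is the upper bound, \<open>L\<close> the
  remaining list, \<open>S\<close> the current set with computed scores \<open>sc\<close>, and \<open>R\<close> the final result.\<close>

inductive topk_loop ::
  "'a ugraph \<Rightarrow> nat \<Rightarrow> ('a \<Rightarrow> nat) \<Rightarrow> 'a list \<Rightarrow> 'a set \<Rightarrow> ('a \<Rightarrow> nat) \<Rightarrow> 'a set \<Rightarrow> bool"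
  for G :: "'a ugraph" and k :: nat and hh :: "'a \<Rightarrow> nat" where
  exhausted: "topk_loop G k hh [] S sc S"
| stop: "card S = k \<Longrightarrow> hh v \<le> Min (sc ` S) \<Longrightarrow> topk_loop G k hh (v # L) S sc S"
| add: "card S < k \<Longrightarrow> Score G v s \<Longrightarrow>
    topk_loop G k hh L (insert v S) (sc(v := s)) R \<Longrightarrow> topk_loop G k hh (v # L) S sc R"
| replace: "card S = k \<Longrightarrow> hh v > Min (sc ` S) \<Longrightarrow> Score G v s \<Longrightarrow> s > Min (sc ` S) \<Longrightarrow>
    w \<in> S \<Longrightarrow> sc w = Min (sc ` S) \<Longrightarrow>
    topk_loop G k hh L (insert v (S - {w})) (sc(v := s)) R \<Longrightarrow> topk_loop G k hh (v # L) S sc R"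
| skip: "card S = k \<Longrightarrow> hh v > Min (sc ` S) \<Longrightarrow> Score G v s \<Longrightarrow> s \<le> Min (sc ` S) \<Longrightarrow>
    topk_loop G k hh L S sc R \<Longrightarrow> topk_loop G k hh (v # L) S sc R"

definition TopK :: "'a ugraph \<Rightarrow> nat \<Rightarrow> 'a set \<Rightarrow> bool" where
  "TopK G k S \<longleftrightarrow> (\<exists>c L.
     core_decomposition G c \<and>
     distinct L \<and> set L = verts G \<and> sorted_wrt (\<lambda>x y. upper_bound G c x \<ge> upper_bound G c y) L \<and>
     topk_loop G k (upper_bound G c) L {} (\<lambda>_. 0) S)"


section \<open>A random access machine\<close>

text \<open>Running times and space are those of a unit-cost random access machine whose memory consists
  of named arrays of words. Programs are written in a state monad with failure. Each primitive
  operation costs at least one step, and allocating an array of length \<open>l\<close> costs \<open>l + 1\<close> steps.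
  Bound variables of a program are registers; a program has a fixed number of them, holding numbers
  and flags. Apart from array accesses, a program only uses addition, subtraction, multiplication
  and comparison of registers, a bounded number of them per step. Accessing an array outside its
  bounds fails. Nothing is ever deallocated, so the space is the total length of the arrays,
  the input included.\<close>

datatype arr =
  Off | Adj
  | Ids | Deg | OutDeg | OutAdj | Core
  | Upper | UHead | UNext | Ranked
  | SHead | SNext | Result
  | Mark | EgoDeg | EgoAdj | EgoCore | Visited | Bfs | Cnt
  | Cur | Deleted | Alive | Order

record mem =
  arrays :: "arr \<Rightarrow> nat list"
  time :: nat
  space :: nat

type_synonym 'a M = "mem \<Rightarrow> ('a \<times> mem) option"

definition ret :: "'a \<Rightarrow> 'a M" where
  "ret x = (\<lambda>s. Some (x, s\<lparr>time := time s + 1\<rparr>))"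

definition bind_M :: "'a M \<Rightarrow> ('a \<Rightarrow> 'b M) \<Rightarrow> 'b M" where
  "bind_M c f = (\<lambda>s. case c s of None \<Rightarrow> None | Some (x, s') \<Rightarrow> f x s')"

adhoc_overloading bind \<rightleftharpoons> bind_M

definition get :: "arr \<Rightarrow> nat \<Rightarrow> nat M" where
  "get A i = (\<lambda>s. if i < length (arrays s A)
     then Some (arrays s A ! i, s\<lparr>time := time s + 1\<rparr>) else None)"

definition put :: "arr \<Rightarrow> nat \<Rightarrow> nat \<Rightarrow> unit M" where
  "put A i x = (\<lambda>s. if i < length (arrays s A)
     then Some ((), s\<lparr>arrays := (arrays s)(A := (arrays s A)[i := x]), time := time s + 1\<rparr>) else None)"

definition new :: "arr \<Rightarrow> nat \<Rightarrow> unit M" where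
  "new A l = (\<lambda>s. Some ((), s\<lparr>arrays := (arrays s)(A := replicate l 0),
     time := time s + l + 1, space := space s + l\<rparr>))"

text \<open>\<open>loop\<close> is only used with lists of consecutive numbers (ascending or descending), and stands for
  a loop with a counter; \<open>x\<close> are the registers modified by the loop. Each iteration and the
  final test are charged one step (\<^const>\<open>ret\<close>).\<close>

fun loop :: "nat list \<Rightarrow> 'b \<Rightarrow> (nat \<Rightarrow> 'b \<Rightarrow> 'b M) \<Rightarrow> 'b M" where
  "loop [] x f = ret x"
| "loop (i # is) x f = do {x' \<leftarrow> ret x; x'' \<leftarrow> f i x'; loop is x'' f}"

definition while_M :: "('b \<Rightarrow> bool) \<Rightarrow> 'b \<Rightarrow> ('b \<Rightarrow> 'b M) \<Rightarrow> 'b M" where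
  "while_M b x f = (\<lambda>s.
     case while_option
       (\<lambda>r. case r of None \<Rightarrow> False | Some (y, s') \<Rightarrow> b y)
       (\<lambda>r. case r of None \<Rightarrow> None | Some (y, s') \<Rightarrow> f y (s'\<lparr>time := time s' + 1\<rparr>))
       (Some (x, s))
     of None \<Rightarrow> None | Some None \<Rightarrow> None | Some (Some (y, s')) \<Rightarrow> ret y s')"


section \<open>The implementation of TopK\<close>

text \<open>The vertices are numbered \<open>0..<n\<close>, and the neighbours of \<open>v\<close> are listed in
  \<open>Adj[Off[v]..<Off[v+1]]\<close>. All other adjacency structures use the same offsets: there the list
  of \<open>v\<close> starts at \<open>Off[v]\<close> and its length is kept in a separate array.\<close>

text \<open>Core decomposition of the graph whose vertices are \<open>VA[lo..<lo+cnt]\<close>, with degrees \<open>DA\<close> and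
  adjacency lists \<open>AA\<close>. It writes the coreness values to \<open>CA\<close> and the vertices in the order of
  deletion, hence sorted in ascending order of coreness, to \<open>Order\<close>, and returns the largest
  coreness. \<open>Order\<close> also serves as the queue of vertices found to have degree less than \<open>t\<close>:
  at level \<open>t\<close> the entries from \<open>h\<close> to \<open>q\<close> have not yet been removed from the degrees \<open>Cur\<close> of their
  neighbours.\<close>

definition core_prog :: "arr \<Rightarrow> nat \<Rightarrow> nat \<Rightarrow> arr \<Rightarrow> arr \<Rightarrow> arr \<Rightarrow> nat M" where
  "core_prog VA lo cnt DA AA CA = do {
     loop [0..<cnt] () (\<lambda>i _. do {
       u \<leftarrow> get VA (lo + i); d \<leftarrow> get DA u;
       put Cur u d; put Deleted u 0; put Alive i u});
     while_M (\<lambda>(t, a, q). q < cnt) (1, cnt, 0) (\<lambda>(t, a, q). do {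
       (a', q') \<leftarrow> loop [0..<a] (0, q) (\<lambda>i (a', q'). do {
         u \<leftarrow> get Alive i; x \<leftarrow> get Deleted u; d \<leftarrow> get Cur u;
         if x = 1 then ret (a', q')
         else if d < t then do {put Deleted u 1; put CA u (t - 1); put Order q' u; ret (a', q' + 1)}
         else do {put Alive a' u; ret (a' + 1, q')}});
       (h, q'') \<leftarrow> while_M (\<lambda>(h, q'). h < q') (q, q') (\<lambda>(h, q'). do {
         u \<leftarrow> get Order h; o1 \<leftarrow> get Off u; d \<leftarrow> get DA u;
         q'' \<leftarrow> loop [o1..<o1 + d] q' (\<lambda>j q'. do {
           w \<leftarrow> get AA j; x \<leftarrow> get Deleted w;
           if x = 1 then ret q'
           else do {
             e \<leftarrow> get Cur w; put Cur w (e - 1);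
             if e - 1 < t then do {put Deleted w 1; put CA w (t - 1); put Order q' w; ret (q' + 1)}
             else ret q'}});
         ret (h + 1, q'')});
       ret (t + 1, a', q'')});
     if cnt = 0 then ret 0 else do {u \<leftarrow> get Order (cnt - 1); get CA u}}"

definition add_arc :: "nat \<Rightarrow> nat \<Rightarrow> unit M" where
  "add_arc u w = do {
     o1 \<leftarrow> get Off u; e \<leftarrow> get EgoDeg u; put EgoAdj (o1 + e) w; put EgoDeg u (e + 1)}"

text \<open>Extraction of the ego-network of \<open>v\<close>, whose neighbours are \<open>Adj[lo..<hi]\<close>. \<open>OutAdj\<close> contains
  each edge once, directed towards its end point of larger degree.\<close>

definition extract_prog :: "nat \<Rightarrow> nat \<Rightarrow> unit M" where
  "extract_prog lo hi = do {
     loop [lo..<hi] () (\<lambda>i _. do {u \<leftarrow> get Adj i; put Mark u 1; put EgoDeg u 0});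
     loop [lo..<hi] () (\<lambda>i _. do {
       u \<leftarrow> get Adj i; o1 \<leftarrow> get Off u; d \<leftarrow> get OutDeg u;
       loop [o1..<o1 + d] () (\<lambda>j _. do {
         w \<leftarrow> get OutAdj j; x \<leftarrow> get Mark w;
         if x = 1 then do {add_arc u w; add_arc w u} else ret ()})});
     loop [lo..<hi] () (\<lambda>i _. do {u \<leftarrow> get Adj i; put Mark u 0})}"

text \<open>Breadth-first search from \<open>u\<close> through vertices of coreness \<open>t\<close>; the result tells whether no
  vertex reached has a neighbour of larger coreness.\<close>

definition bfs_prog :: "nat \<Rightarrow> nat \<Rightarrow> bool M" where
  "bfs_prog u t = do {
     put Visited u 1; put Bfs 0 u;
     (h, q, b) \<leftarrow> while_M (\<lambda>(h, q, b). h < q) (0, 1, True) (\<lambda>(h, q, b). do {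
       x \<leftarrow> get Bfs h; o1 \<leftarrow> get Off x; d \<leftarrow> get EgoDeg x;
       (q', b') \<leftarrow> loop [o1..<o1 + d] (q, b) (\<lambda>j (q, b). do {
         w \<leftarrow> get EgoAdj j; c \<leftarrow> get EgoCore w; y \<leftarrow> get Visited w;
         if c > t then ret (q, False)
         else if c = t \<and> y = 0 then do {put Visited w 1; put Bfs q w; ret (q + 1, b)}
         else ret (q, b)});
       ret (h + 1, q', b')});
     ret b}"

text \<open>As \<open>Order\<close> is sorted, one pass over it visits the levels \<open>t = 1, 2, ...\<close> one after the other.\<close>

definition score_prog :: "nat \<Rightarrow> nat M" where
  "score_prog v = do {
     lo \<leftarrow> get Off v; hi \<leftarrow> get Off (v + 1);
     extract_prog lo hi;
     tmax \<leftarrow> core_prog Adj lo (hi - lo) EgoDeg EgoAdj EgoCore;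
     loop [1..<tmax + 1] () (\<lambda>t _. put Cnt t 0);
     loop [lo..<hi] () (\<lambda>i _. do {u \<leftarrow> get Adj i; put Visited u 0});
     loop [0..<hi - lo] () (\<lambda>i _. do {
       u \<leftarrow> get Order i; t \<leftarrow> get EgoCore u; x \<leftarrow> get Visited u;
       if 1 \<le> t \<and> x = 0 then do {
         b \<leftarrow> bfs_prog u t;
         if b then do {c \<leftarrow> get Cnt t; put Cnt t (c + 1)} else ret ()}
       else ret ()});
     (t, s, out) \<leftarrow> while_M (\<lambda>(t, s, out). 1 \<le> t \<and> out = 0) (tmax, 0, 0) (\<lambda>(t, s, out). do {
       c \<leftarrow> get Cnt t;
       if s + c \<ge> t then ret (t, s + c, t) else ret (t - 1, s + c, 0)});
     ret out}"

definition orient_prog :: "nat \<Rightarrow> unit M" where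
  "orient_prog n = loop [0..<n] () (\<lambda>v _. do {
     o1 \<leftarrow> get Off v; o2 \<leftarrow> get Off (v + 1); d \<leftarrow> get Deg v;
     p \<leftarrow> loop [o1..<o2] 0 (\<lambda>j p. do {
       w \<leftarrow> get Adj j; e \<leftarrow> get Deg w;
       if d < e \<or> (d = e \<and> v < w) then do {put OutAdj (o1 + p) w; ret (p + 1)} else ret p});
     put OutDeg v p})"

definition upper_prog :: "nat \<Rightarrow> unit M" where
  "upper_prog v = do {
     lo \<leftarrow> get Off v; hi \<leftarrow> get Off (v + 1); cv \<leftarrow> get Core v;
     loop [0..<hi - lo + 1] () (\<lambda>x _. put Cnt x 0);
     loop [lo..<hi] () (\<lambda>j _. do {
       u \<leftarrow> get Adj j; cu \<leftarrow> get Core u;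
       c \<leftarrow> get Cnt (min cv (cu - 1)); put Cnt (min cv (cu - 1)) (c + 1)});
     (x, s, out) \<leftarrow> while_M (\<lambda>(x, s, out). 1 \<le> x \<and> out = 0) (hi - lo, 0, 0) (\<lambda>(x, s, out). do {
       c \<leftarrow> get Cnt x;
       if s + c \<ge> x * (x + 1) then ret (x, s + c, x) else ret (x - 1, s + c, 0)});
     put Upper v out}"

text \<open>Buckets of linked lists: \<open>HA\<close> and \<open>NA\<close> hold the successor of an element plus one, and 0 at the
  end of a list.\<close>

definition push :: "arr \<Rightarrow> arr \<Rightarrow> nat \<Rightarrow> nat \<Rightarrow> unit M" where
  "push HA NA x i = do {y \<leftarrow> get HA x; put NA i y; put HA x (i + 1)}"

definition pop :: "arr \<Rightarrow> arr \<Rightarrow> nat \<Rightarrow> nat M" where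
  "pop HA NA x = do {y \<leftarrow> get HA x; z \<leftarrow> get NA (y - 1); put HA x z; ret (y - 1)}"

text \<open>\<open>Ranked\<close> receives the vertices in descending order of the upper bound.\<close>

definition rank_prog :: "nat \<Rightarrow> unit M" where
  "rank_prog n = do {
     loop [0..<n] () (\<lambda>v _. do {x \<leftarrow> get Upper v; push UHead UNext x v});
     loop (rev [0..<n]) 0 (\<lambda>x q. do {
       y \<leftarrow> get UHead x;
       (y', q') \<leftarrow> while_M (\<lambda>(y, q). 0 < y) (y, q) (\<lambda>(y, q). do {
         put Ranked q (y - 1); z \<leftarrow> get UNext (y - 1); ret (z, q + 1)});
       ret q'});
     ret ()}"

text \<open>The position of the first nonempty bucket, from \<open>p\<close> on.\<close>

definition min_prog :: "nat \<Rightarrow> nat M" where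
  "min_prog p = do {
     y \<leftarrow> get SHead p;
     (p', y') \<leftarrow> while_M (\<lambda>(p, y). y = 0) (p, y) (\<lambda>(p, y). do {
       y' \<leftarrow> get SHead (p + 1); ret (p + 1, y')});
     ret p'}"

text \<open>The current set is \<open>Result[0..<sz]\<close>; the indices of its elements are kept in buckets according
  to the scores. As soon as the set has size \<open>k\<close>, its minimum score never decreases, so that the
  search for it can resume from its last value \<open>p\<close>.\<close>

definition loop_prog :: "nat \<Rightarrow> nat \<Rightarrow> unit M" where
  "loop_prog n k = do {
     while_M (\<lambda>(i, sz, p, go). go \<and> i < n) (0, 0, 0, True) (\<lambda>(i, sz, p, go). do {
       v \<leftarrow> get Ranked i; b \<leftarrow> get Upper v;
       if sz < k then do {
         s \<leftarrow> score_prog v;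
         put Result sz v; push SHead SNext s sz; ret (i + 1, sz + 1, p, True)}
       else do {
         p' \<leftarrow> min_prog p;
         if b \<le> p' then ret (i, sz, p', False)
         else do {
           s \<leftarrow> score_prog v;
           if s > p' then do {
             j \<leftarrow> pop SHead SNext p';
             put Result j v; push SHead SNext s j; ret (i + 1, sz, p', True)}
           else ret (i + 1, sz, p', True)}}});
     ret ()}"

definition topk_prog :: "nat \<Rightarrow> nat \<Rightarrow> unit M" where
  "topk_prog n k = do {
     m2 \<leftarrow> get Off n;
     new Ids n; new Deg n; new OutDeg n; new OutAdj m2; new Core n;
     new Upper n; new UHead n; new UNext n; new Ranked n;
     new SHead n; new SNext k; new Result k;
     new Mark n; new EgoDeg n; new EgoAdj m2; new EgoCore n;
     new Visited n; new Bfs n; new Cnt (n + 1);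
     new Cur n; new Deleted n; new Alive n; new Order n;
     loop [0..<n] () (\<lambda>v _. do {
       o1 \<leftarrow> get Off v; o2 \<leftarrow> get Off (v + 1); put Ids v v; put Deg v (o2 - o1)});
     orient_prog n;
     core_prog Ids 0 n Deg Adj Core;
     loop [0..<n] () (\<lambda>v _. upper_prog v);
     rank_prog n;
     loop_prog n k}"


section \<open>Input and output\<close>

text \<open>The adjacency arrays \<open>off\<close> and \<open>adj\<close> represent \<open>G\<close>, with \<open>vs ! i\<close> as the vertex number \<open>i\<close>;
  neighbours may be listed in any order.\<close>

definition adj_arrays :: "'a ugraph \<Rightarrow> 'a list \<Rightarrow> nat list \<Rightarrow> nat list \<Rightarrow> bool" where
  "adj_arrays G vs off adj \<longleftrightarrow>
     distinct vs \<and> set vs = verts G \<and>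
     length off = length vs + 1 \<and> off ! 0 = 0 \<and> off ! length vs = length adj \<and> sorted off \<and>
     (\<forall>i<length vs. let ns = map ((!) adj) [off ! i..<off ! (i + 1)] in
        distinct ns \<and> set ns \<subseteq> {..<length vs} \<and> (!) vs ` set ns = nbrs G (vs ! i))"

definition init_mem :: "nat list \<Rightarrow> nat list \<Rightarrow> mem" where
  "init_mem off adj =
     \<lparr>arrays = (\<lambda>_. [])(Off := off, Adj := adj), time = 0, space = length off + length adj\<rparr>"

definition result_set :: "'a list \<Rightarrow> mem \<Rightarrow> 'a set" where
  "result_set vs s = (!) vs ` set (arrays s Result)"

end

theory Submission
  imports Defs
begin

text \<open>Correctness. For \<open>r \<ge> 1\<close>, the discriminative cores of coreness \<open>r\<close> are exactly the connected
  components of the set of vertices of core number \<open>r\<close> without an edge to a vertex of larger core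
  number: such a component is a whole component of the \<open>r\<close>-core, and conversely a component of the
  \<open>r\<close>-core meeting the \<open>(r + 1)\<close>-core contains a subgraph of larger coreness. So Score returns the
  diversity score. The upper bound is valid because \<open>x\<close> disjoint cores of coreness at least \<open>x\<close>
  contain \<open>x (x + 1)\<close> vertices, and adding \<open>v\<close> to a core of its ego-network increases the coreness.

  Running time. A forest has an injection from edges to end points, hence the sum of
  \<open>min (d u) (d w)\<close> over all edges \<open>uw\<close> is at most \<open>2 \<rho> m\<close>. As each edge is oriented towards its end point
  of larger degree, this sum bounds the work of all calls of Score.

  Arboricity. A vertex of degree at most \<open>r\<close> can be added to a graph that is covered by \<open>r\<close> forests,
  which gives \<open>\<rho> \<le> d\<^sub>m\<^sub>a\<^sub>x\<close>. For the bound \<open>\<surd>m\<close>, a graph with less than \<open>(r + 1)\<^sup>2\<close> edges and minimum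
  degree greater than \<open>r\<close> has at most \<open>2 r + 1\<close> vertices, so that it is almost contained in a
  complete graph on \<open>2 r\<close> vertices, a union of \<open>r\<close> double stars.\<close>

section \<open>Arboricity\<close>

text \<open>Among connected graphs the square-root bound has one exception: the triangle has
  arboricity 2, but \<open>sqrt 3 < 2\<close>. It is the reason for the ceiling, and for the
  assumption \<open>2 \<le> r\<close> in the counting argument, whose inequality is tight for the
  triangle.

  Reading all neighbours of every neighbour of \<open>v\<close> would cost full degrees. Reading
  only outgoing arcs charges an arc once for each vertex adjacent to its tail, that is, as often as
  the smaller degree of its end points. Besides, the core decomposition of an ego-network must be
  linear in its size although vertices of small degree are searched for again at every level; a
  potential built from the core numbers ensures this.

  Cores are developed over a vertex set with a neighbourhood function, since the same facts are
  needed for \<open>G\<close>, for ego-networks and for the numbered copies in the machine. The main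
  loop of the program is shown to follow a run of the nondeterministic one, so that its result
  inherits the correctness of that algorithm.\<close>

text \<open>A vertex of largest rank on a cycle would have two neighbours of at most its rank. So ranked edge
  sets are forests, and a ranking is easier to extend than the absence of cycles.\<close>

definition ranked :: "('a \<Rightarrow> nat) \<Rightarrow> 'a set set \<Rightarrow> bool" where
  "ranked f A \<longleftrightarrow> (\<forall>x y z. {x, y} \<in> A \<longrightarrow> {x, z} \<in> A \<longrightarrow> f y \<le> f x \<longrightarrow> f z \<le> f x \<longrightarrow> y = z)"

lemma ranked_imp_acyclic:
  assumes "ranked f A"
  shows "acyclic_edges A"
  unfolding acyclic_edges_def
proof (rule notI, elim exE conjE)
  fix c assume l: "3 \<le> length c" and d: "distinct c"
    and c: "\<forall>i<length c. {c ! i, c ! (Suc i mod length c)} \<in> A"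
  let ?l = "length c"
  have "finite ((\<lambda>i. f (c ! i)) ` {..<?l})" "(\<lambda>i. f (c ! i)) ` {..<?l} \<noteq> {}"
    using l by (auto simp: lessThan_empty_iff)
  from Max_in[OF this] obtain i where i: "i < ?l" "f (c ! i) = Max ((\<lambda>i. f (c ! i)) ` {..<?l})"
    by auto
  have m: "f (c ! j) \<le> f (c ! i)" if "j < ?l" for j using that i(2) by auto
  \<comment> \<open>\<open>j\<close> and \<open>k\<close> are the positions before and after
    \<open>i\<close> on the cycle. They differ because the cycle has at least three vertices, while
    the ranking forces the vertices there to be equal.\<close>
  define j where "j = (if i = 0 then ?l - 1 else i - 1)"
  define k where "k = Suc i mod ?l"
  have k: "k = (if i = ?l - 1 then 0 else Suc i)"
    using i(1) l by (cases "Suc i = ?l") (auto simp: k_def)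
  have jl: "j < ?l" "k < ?l" "j \<noteq> k" using i(1) l unfolding k by (auto simp: j_def)
  have "Suc j mod ?l = i" using i(1) l by (cases "i = 0") (simp_all add: j_def)
  then have "{c ! j, c ! i} \<in> A" "{c ! i, c ! k} \<in> A" using c i(1) jl by (auto simp: k_def)
  then have "c ! j = c ! k" using assms m jl unfolding ranked_def by (metis insert_commute)
  then show False using jl d nth_eq_iff_index_eq by blast
qed

lemma ranked_subset: "ranked f A \<Longrightarrow> B \<subseteq> A \<Longrightarrow> ranked f B"
  unfolding ranked_def by blast

lemma edge_avoiding_vertex:
  assumes "{x, y} \<in> E \<union> (\<lambda>x. {v, x}) ` X" "x \<noteq> v" "y \<noteq> v"
  shows "{x, y} \<in> E"
proof -
  have "\<forall>e\<in>(\<lambda>x. {v, x}) ` X. v \<in> e" by blast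
  then show ?thesis using assms by (metis UnE insertE singletonD)
qed

text \<open>A partition into forests is encoded as a colouring \<open>g\<close> of the edges, so
  that disjointness is automatic; a ranking \<open>f i\<close> of each colour class certifies that
  it is acyclic.\<close>

definition forests_cover :: "nat \<Rightarrow> 'a set set \<Rightarrow> bool" where
  "forests_cover r E \<longleftrightarrow> (\<exists>g f. (\<forall>e\<in>E. g e < r) \<and> (\<forall>i<r. ranked (f i) {e \<in> E. g e = i}))"

lemma arboricity_le: "forests_cover r (edges G) \<Longrightarrow> arboricity G \<le> r"
  unfolding arboricity_def
proof (rule Least_le)
  assume "forests_cover r (edges G)"
  then obtain g f where gf: "\<forall>e\<in>edges G. g e < r" "\<forall>i<r. ranked (f i) {e \<in> edges G. g e = i}"
    unfolding forests_cover_def by blast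
  show "\<exists>A. (\<forall>i<r. spanning_forest G (A i)) \<and>
     (\<forall>i<r. \<forall>j<r. i \<noteq> j \<longrightarrow> A i \<inter> A j = {}) \<and> (\<Union>i<r. A i) = edges G"
    by (rule exI[of _ "\<lambda>i. {e \<in> edges G. g e = i}"])
      (use gf in \<open>auto simp: spanning_forest_def intro: ranked_imp_acyclic\<close>)
qed

lemma forests_cover_subset: "forests_cover r E \<Longrightarrow> E' \<subseteq> E \<Longrightarrow> forests_cover r E'"
  unfolding forests_cover_def
  by (elim exE conjE, intro exI conjI) (auto intro: ranked_subset)

lemma inj_into_less:
  assumes "finite X" "card X \<le> r"
  obtains h :: "'b \<Rightarrow> nat" where "inj_on h X" "\<And>x. x \<in> X \<Longrightarrow> h x < r"
proof -
  obtain h where "bij_betw h X {0..<card X}" using ex_bij_betw_finite_nat[OF assms(1)] by blast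
  then have h: "inj_on h X" "h ` X = {0..<card X}" by (auto simp: bij_betw_def)
  then have "h x < r" if "x \<in> X" for x using that assms(2) by (metis atLeastLessThan_iff imageI order_less_le_trans)
  then show ?thesis using that h by blast
qed

text \<open>The new edges receive pairwise different colours, so each colour class gains at most one
  edge, with \<open>v\<close> as a leaf. Ranking \<open>v\<close> by one more than the sum of the
  ranks of \<open>X\<close> puts it above all of its neighbours: \<open>v\<close> itself has only
  one neighbour in the class, and for an old vertex \<open>v\<close> is not among the neighbours of
  smaller or equal rank.\<close>

lemma forests_cover_add_vertex:
  assumes E: "forests_cover r E" and v: "v \<notin> \<Union>E" and X: "finite X" "card X \<le> r" "v \<notin> X"
  shows "forests_cover r (E \<union> (\<lambda>x. {v, x}) ` X)"
proof -
  obtain g f where g: "\<forall>e\<in>E. g e < r" and f: "\<forall>i<r. ranked (f i) {e \<in> E. g e = i}"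
    using E unfolding forests_cover_def by blast
  obtain h where h: "inj_on h X" "\<And>x. x \<in> X \<Longrightarrow> h x < r" using inj_into_less[OF X(1,2)] by blast
  define g' where "g' e = (if e \<in> E then g e else h (the_elem (e - {v})))" for e
  define f' where "f' i = (f i)(v := Suc (\<Sum>x\<in>X. f i x))" for i
  have gX: "g' {v, x} = h x" if "x \<in> X" for x
  proof -
    have "{v, x} \<notin> E" using v by blast
    moreover have "{v, x} - {v} = {x}" using that X by auto
    ultimately show ?thesis by (simp add: g'_def)
  qed
  have gv: "x \<in> X \<and> g' {v, x} = h x" "x \<noteq> v" if "{v, x} \<in> E \<union> (\<lambda>x. {v, x}) ` X" for x
    using that v X gX by (auto simp: doubleton_eq_iff)
  have fx: "f i x < f' i v" if "x \<in> X" for i x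
    using member_le_sum[of x X "f i"] that X by (simp add: f'_def less_Suc_eq_le)
  have "ranked (f' i) {e \<in> E \<union> (\<lambda>x. {v, x}) ` X. g' e = i}" if i: "i < r" for i
    unfolding ranked_def
  proof (intro allI impI)
    fix x y z
    assume *: "{x, y} \<in> {e \<in> E \<union> (\<lambda>x. {v, x}) ` X. g' e = i}"
      "{x, z} \<in> {e \<in> E \<union> (\<lambda>x. {v, x}) ` X. g' e = i}" "f' i y \<le> f' i x" "f' i z \<le> f' i x"
    show "y = z"
    proof (cases "x = v")
      case True
      then show ?thesis using * gv[of y] gv[of z] h(1) by (auto simp: inj_on_def)
    next
      case False
      have nv: "y \<noteq> v" if "{x, y} \<in> E \<union> (\<lambda>x. {v, x}) ` X" "f' i y \<le> f' i x" for y
      proof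
        assume "y = v"
        then have "x \<in> X" using gv(1)[of x] that by (simp add: insert_commute)
        then show False using fx[of x i] that \<open>y = v\<close> False by (simp add: f'_def)
      qed
      have yz: "y \<noteq> v" "z \<noteq> v" using nv[OF _ *(3)] nv[OF _ *(4)] *(1,2) by blast+
      have "{x, y} \<in> E" "{x, z} \<in> E"
        using edge_avoiding_vertex[of x y E v X] edge_avoiding_vertex[of x z E v X] *(1,2) False yz by simp_all
      moreover have "f i y \<le> f i x" "f i z \<le> f i x" using *(3,4) False yz by (auto simp: f'_def)
      ultimately have "{x, y} \<in> {e \<in> E. g e = i}" "{x, z} \<in> {e \<in> E. g e = i}"
        "f i y \<le> f i x" "f i z \<le> f i x" using *(1,2) by (auto simp: g'_def)
      then show ?thesis using f i unfolding ranked_def by blast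
    qed
  qed
  moreover have "\<forall>e\<in>E \<union> (\<lambda>x. {v, x}) ` X. g' e < r"
  proof
    fix e assume "e \<in> E \<union> (\<lambda>x. {v, x}) ` X"
    then have "e \<in> E \<or> (\<exists>x\<in>X. e = {v, x})" by blast
    then show "g' e < r" using g h(2) gX by (metis g'_def)
  qed
  ultimately show ?thesis unfolding forests_cover_def by blast
qed

text \<open>The complete graph on \<open>2 * r\<close> vertices \<open>0, \<dots>, 2 * r - 1\<close> is a union of \<open>r\<close> double stars,
  the centres of the \<open>i\<close>-th one being \<open>2 * i\<close> and \<open>2 * i + 1\<close>.\<close>

lemma forests_cover_complete:
  assumes V: "finite V" "card V \<le> 2 * r" and E: "\<forall>e\<in>E. e \<subseteq> V \<and> card e = 2"
  shows "forests_cover r E"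
proof -
  obtain h where h: "inj_on h V" "\<And>x. x \<in> V \<Longrightarrow> h x < 2 * r" using inj_into_less[OF V] by blast
  \<comment> \<open>Colour \<open>i\<close> belongs to the centres \<open>2 * i\<close> and
    \<open>2 * i + 1\<close>, and an edge of that colour contains one of them. A vertex of a later
    pair is joined in colour \<open>i\<close> to the centre of its own parity (the minimum case), a
    vertex of an earlier pair to the centre of the other parity (the maximum case), and the two
    centres are joined to each other.\<close>
  define col :: "nat \<Rightarrow> nat \<Rightarrow> nat" where
    "col a b = (if a mod 2 = b mod 2 then min (a div 2) (b div 2) else max (a div 2) (b div 2))" for a b
  have cc: "col a b = col b a" for a b by (auto simp: col_def)
  define g where "g e = col (Min (h ` e)) (Max (h ` e))" for e
  have g: "g {x, y} = col (h x) (h y)" for x y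
    by (cases "h x \<le> h y") (auto simp: g_def cc min_def max_def)
  define f where "f i x = (if h x = 2 * i then 0 else if h x = 2 * i + 1 then 1 else 2 :: nat)" for i x
  have E2: "x \<in> V \<and> y \<in> V \<and> x \<noteq> y \<and> h x \<noteq> h y" if "{x, y} \<in> E" for x y
  proof -
    have "{x, y} \<subseteq> V \<and> card {x, y} = 2" using E that by blast
    then have "x \<in> V" "y \<in> V" "x \<noteq> y" by auto
    then show ?thesis by (simp add: inj_on_eq_iff[OF h(1)])
  qed
  have "g e < r" if "e \<in> E" for e
  proof -
    have "card e = 2" using E that by blast
    then obtain x y where e: "e = {x, y}" by (auto simp: card_2_iff)
    then have "h x < 2 * r" "h y < 2 * r" using that E2 h(2) by blast+
    then show ?thesis unfolding e g col_def by (auto simp: min_def max_def)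
  qed
  moreover have "ranked (f i) {e \<in> E. g e = i}" if "i < r" for i
    unfolding ranked_def
  proof (intro allI impI)
    fix x y z
    assume *: "{x, y} \<in> {e \<in> E. g e = i}" "{x, z} \<in> {e \<in> E. g e = i}"
      "f i y \<le> f i x" "f i z \<le> f i x"
    have c: "col (h x) (h y) = i" "col (h x) (h z) = i" using *(1,2) g by simp_all
    have d: "h x \<noteq> h y" "h x \<noteq> h z" using E2 *(1,2) by blast+
    \<comment> \<open>An edge of colour \<open>i\<close>, read from an end point \<open>a\<close> of
      larger or equal rank, is determined by \<open>a\<close>: it leads from the second centre to
      the first, or from an outer vertex to its only centre. This is the ranking condition.\<close>
    have key: "(a = 2 * i + 1 \<and> b = 2 * i) \<or>
      (a \<noteq> 2 * i \<and> a \<noteq> 2 * i + 1 \<and> b = 2 * i + (if a div 2 > i then a mod 2 else 1 - a mod 2))"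
      if "col a b = i" "a \<noteq> b"
      "(if b = 2 * i then 0 else if b = 2 * i + 1 then 1 else 2 :: nat) \<le>
       (if a = 2 * i then 0 else if a = 2 * i + 1 then 1 else 2 :: nat)" for a b
    proof -
      obtain p q s t where ab: "a = 2 * p + s" "b = 2 * q + t" "s = 0 \<or> s = 1" "t = 0 \<or> t = 1"
        by (metis mult_div_mod_eq not_mod_2_eq_0_eq_1)
      have "a div 2 = p" "a mod 2 = s" "b div 2 = q" "b mod 2 = t" using ab by auto
      then show ?thesis using that(1)[unfolded col_def] that(2,3) ab(3,4) unfolding ab(1,2)
        by (elim disjE; simp split: if_splits; linarith?)
    qed
    have "h y = h z" using key[OF c(1) d(1)] key[OF c(2) d(2)] *(3,4)[unfolded f_def] by auto
    moreover have "y \<in> V" "z \<in> V" using E2 *(1,2) by blast+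
    ultimately show "y = z" using h(1) by (simp add: inj_on_eq_iff)
  qed
  ultimately show ?thesis unfolding forests_cover_def by blast
qed

text \<open>\<open>v\<close> has one neighbour more than there are colours. The edge
  \<open>{x, y}\<close>, present only in the given cover, makes up for this: it is replaced by the
  path \<open>x\<close>, \<open>v\<close>, \<open>y\<close> of the same colour, and the
  \<open>r - 1\<close> other neighbours of \<open>v\<close> use the \<open>r - 1\<close> other
  colours.\<close>

lemma forests_cover_subdivide:
  assumes E: "forests_cover r (insert {x, y} E)" and v: "v \<notin> \<Union>E" "v \<noteq> x" "v \<noteq> y"
    and xy: "x \<noteq> y" "{x, y} \<notin> E"
    and X: "finite X" "card X = Suc r" "v \<notin> X" "x \<in> X" "y \<in> X"
  shows "forests_cover r (E \<union> (\<lambda>x. {v, x}) ` X)"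
proof -
  obtain g f where g: "\<forall>e\<in>insert {x, y} E. g e < r"
    and f: "\<forall>i<r. ranked (f i) {e \<in> insert {x, y} E. g e = i}"
    using E unfolding forests_cover_def by blast
  define k where "k = g {x, y}"
  have k: "k < r" using g by (simp add: k_def)
  have main: ?thesis if xy': "x \<noteq> y" "{x, y} \<notin> E" "x \<in> X" "y \<in> X" "v \<noteq> x" "v \<noteq> y"
    and k: "k = g {x, y}" "k < r"
    and f: "\<And>i. i < r \<Longrightarrow> ranked (f i) {e \<in> insert {x, y} E. g e = i}" and le: "f k x \<le> f k y" for x y
  proof -
    define g0 where "g0 e = (if e = {v, x} \<or> e = {v, y} then k else g e)" for e
    \<comment> \<open>Doubling makes room for \<open>v\<close> directly below \<open>y\<close>, the
      end point of larger or equal rank. Then at most \<open>x\<close> is below \<open>v\<close>,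
      and where \<open>{x, y}\<close> used to be the edge from an end point to a vertex of smaller
      or equal rank, the edge to \<open>v\<close> takes its place.\<close>
    define f0 where "f0 = f(k := \<lambda>z. if z = v then 2 * f k y + 1 else 2 * f k z + 2)"
    let ?E0 = "E \<union> {{v, x}, {v, y}}"
    have v0: "{v, z} \<in> ?E0 \<longleftrightarrow> z = x \<or> z = y" for z
      using v(1) by (auto simp: doubleton_eq_iff)
    have g0: "g0 {z, w} = g {z, w}" if "z \<noteq> v" "w \<noteq> v" for z w
      using that by (auto simp: g0_def doubleton_eq_iff)
    have r0: "ranked (f0 i) {e \<in> ?E0. g0 e = i}" if i: "i < r" for i
      unfolding ranked_def
    proof (intro allI impI)
      fix z a b
      assume *: "{z, a} \<in> {e \<in> ?E0. g0 e = i}" "{z, b} \<in> {e \<in> ?E0. g0 e = i}"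
        "f0 i a \<le> f0 i z" "f0 i b \<le> f0 i z"
      have old: "a = b" if "{z, a} \<in> insert {x, y} E" "{z, b} \<in> insert {x, y} E" "g {z, a} = i" "g {z, b} = i"
        "f i a \<le> f i z" "f i b \<le> f i z" for a b
        using f[OF i] that unfolding ranked_def by blast
      show "a = b"
      proof (cases "z = v")
        case True
        then have "a = x \<or> a = y" "b = x \<or> b = y" "i = k" using * v0 by (auto simp: g0_def)
        then show ?thesis using * True le xy' by (auto simp: f0_def split: if_splits)
      next
        case zv: False
        have nv: "{z, c} \<in> E \<and> g {z, c} = i \<and> f i c \<le> f i z" if "c \<noteq> v"
          "{z, c} \<in> {e \<in> ?E0. g0 e = i}" "f0 i c \<le> f0 i z" for c
          using that zv g0[of z c] by (auto simp: doubleton_eq_iff f0_def split: if_splits)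
        have iv: "i = k \<and> (z = x \<or> z = y) \<and> f k y \<le> f k z" if "{z, v} \<in> {e \<in> ?E0. g0 e = i}" "f0 i v \<le> f0 i z"
          using that zv v0[of z] by (auto simp: g0_def insert_commute f0_def split: if_splits)
        have oth: "c = v" if "{z, v} \<in> {e \<in> ?E0. g0 e = i}" "f0 i v \<le> f0 i z"
          "{z, c} \<in> {e \<in> ?E0. g0 e = i}" "f0 i c \<le> f0 i z" for c
        proof (rule ccontr)
          assume "c \<noteq> v"
          with nv that have c: "{z, c} \<in> E" "g {z, c} = i" "f i c \<le> f i z" by auto
          have i': "i = k" "z = x \<or> z = y" "f k y \<le> f k z" using iv that by auto
          define w where "w = (if z = x then y else x)"
          have "{z, w} = {x, y}" using i' by (auto simp: w_def)
          moreover have "f i w \<le> f i z" using i' le by (auto simp: w_def)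
          ultimately have "c = w" using old[of c w] c i' k by auto
          then show False using c \<open>{z, w} = {x, y}\<close> xy' by auto
        qed
        show ?thesis
        proof (cases "a = v \<or> b = v")
          case True
          then show ?thesis using oth[of a] oth[of b] * by auto
        next
          case False
          then show ?thesis using old[of a b] nv[of a] nv[of b] * by blast
        qed
      qed
    qed
    let ?Y = "X - {x, y}"
    have cY: "card ?Y = r - 1" using X xy' by (simp add: card_Diff_subset)
    obtain h0 where h0: "inj_on h0 ?Y" "\<And>z. z \<in> ?Y \<Longrightarrow> h0 z < r - 1"
      using inj_into_less[of ?Y "r - 1"] X cY by auto
    \<comment> \<open>The shift skips colour \<open>k\<close>, which is reserved for the subdivided
      edge.\<close>
    define h where "h z = (if h0 z < k then h0 z else Suc (h0 z))" for z
    have h: "inj_on h ?Y"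
    proof (rule inj_onI)
      fix a b assume ab: "a \<in> ?Y" "b \<in> ?Y" "h a = h b"
      then have "h0 a = h0 b" by (simp add: h_def split: if_splits)
      then show "a = b" using inj_onD[OF h0(1)] ab(1,2) by blast
    qed
    have hr: "h z < r \<and> h z \<noteq> k" if "z \<in> ?Y" for z using h0(2)[OF that] k by (auto simp: h_def)
    define g' where "g' e = (if e \<in> ?E0 then g0 e else h (the_elem (e - {v})))" for e
    define f' where "f' i = (if i = k then f0 i else (f0 i)(v := Suc (\<Sum>x\<in>X. f0 i x)))" for i
    have gY: "g' {v, z} = h z" if "z \<in> ?Y" for z
    proof -
      have "{v, z} \<notin> ?E0" using v0[of z] that by auto
      moreover have "{v, z} - {v} = {z}" using that X by auto
      ultimately show ?thesis by (simp add: g'_def)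
    qed
    let ?E' = "E \<union> (\<lambda>x. {v, x}) ` X"
    have E': "?E' = ?E0 \<union> (\<lambda>x. {v, x}) ` ?Y" using xy' by auto
    have gv: "z \<in> ?Y \<and> g' {v, z} = h z" "z \<noteq> v" if "{v, z} \<in> ?E'" "g' {v, z} = i" "i \<noteq> k" for z i
    proof -
      have z: "z \<in> X" using that v(1) by (auto simp: doubleton_eq_iff)
      have "z \<noteq> x" "z \<noteq> y" using that v0[of z] by (auto simp: g'_def g0_def)
      then show "z \<in> ?Y \<and> g' {v, z} = h z" "z \<noteq> v" using gY z X by auto
    qed
    have fx: "f0 i z < f' i v" if "z \<in> X" "i \<noteq> k" for i z
      using member_le_sum[of z X "f0 i"] that X by (simp add: f'_def less_Suc_eq_le)
    have "ranked (f' i) {e \<in> ?E'. g' e = i}" if i: "i < r" for i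
    proof (cases "i = k")
      case True
      have "e \<in> ?E0 \<and> g0 e = i" if "e \<in> ?E'" "g' e = i" for e
      proof -
        have "e \<noteq> {v, z}" if "z \<in> ?Y" for z
          using gY[OF that] hr[OF that] \<open>g' e = i\<close> True by metis
        then have "e \<in> ?E0" using \<open>e \<in> ?E'\<close> unfolding E' by blast
        then show ?thesis using \<open>g' e = i\<close> by (metis g'_def)
      qed
      then have "{e \<in> ?E'. g' e = i} \<subseteq> {e \<in> ?E0. g0 e = i}" by blast
      then show ?thesis using ranked_subset[OF r0[OF i]] True by (simp add: f'_def)
    next
      case ik: False
      show ?thesis unfolding ranked_def
      proof (intro allI impI)
        fix z a b
        assume *: "{z, a} \<in> {e \<in> ?E'. g' e = i}" "{z, b} \<in> {e \<in> ?E'. g' e = i}"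
          "f' i a \<le> f' i z" "f' i b \<le> f' i z"
        show "a = b"
        proof (cases "z = v")
          case True
          then have "a \<in> ?Y \<and> h a = i" "b \<in> ?Y \<and> h b = i"
            using gv(1)[of a i] gv(1)[of b i] *(1,2) ik by simp_all
          then show ?thesis using inj_onD[OF h] by metis
        next
          case False
          have nv: "c \<noteq> v" if "{z, c} \<in> {e \<in> ?E'. g' e = i}" "f' i c \<le> f' i z" for c
          proof
            assume "c = v"
            then have "z \<in> X" using gv(1)[of z i] that ik by (simp add: insert_commute)
            then show False using fx[of z i] that \<open>c = v\<close> False ik by (simp add: f'_def)
          qed
          have ab: "a \<noteq> v" "b \<noteq> v" using nv[OF *(1,3)] nv[OF *(2,4)] by blast+
          have "{z, a} \<in> ?E0" "{z, b} \<in> ?E0"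
            using edge_avoiding_vertex[of z a E v X] edge_avoiding_vertex[of z b E v X] *(1,2) False ab by simp_all
          moreover have "f0 i a \<le> f0 i z" "f0 i b \<le> f0 i z" using *(3,4) False ab ik by (auto simp: f'_def)
          ultimately have "{z, a} \<in> {e \<in> ?E0. g0 e = i}" "{z, b} \<in> {e \<in> ?E0. g0 e = i}"
            "f0 i a \<le> f0 i z" "f0 i b \<le> f0 i z" using *(1,2) by (auto simp: g'_def)
          then show ?thesis using r0[OF i] unfolding ranked_def by blast
        qed
      qed
    qed
    moreover have "\<forall>e\<in>?E'. g' e < r"
    proof
      fix e assume "e \<in> ?E'"
      then have "e \<in> ?E0 \<or> (\<exists>z\<in>?Y. e = {v, z})" unfolding E' by blast
      then show "g' e < r"
      proof
        assume "e \<in> ?E0"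
        then show ?thesis using g k by (auto simp: g'_def g0_def)
      next
        assume "\<exists>z\<in>?Y. e = {v, z}"
        then show ?thesis using gY hr by metis
      qed
    qed
    ultimately show ?thesis unfolding forests_cover_def by blast
  qed
  show ?thesis
  proof (cases "f k x \<le> f k y")
    case True
    show ?thesis by (rule main[of x y]) (use f k k_def v xy X True in auto)
  next
    case False
    show ?thesis by (rule main[of y x]) (use f k k_def v xy X False in \<open>auto simp: insert_commute\<close>)
  qed
qed

section \<open>Degrees, edge counts and removal of a vertex\<close>

lemma simple_graph_nbrs:
  assumes "simple_graph G"
  shows "nbrs G v \<subseteq> verts G" "v \<notin> nbrs G v" "finite (nbrs G v)" "v \<notin> verts G \<Longrightarrow> nbrs G v = {}"
    "u \<in> nbrs G v \<longleftrightarrow> v \<in> nbrs G u"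
proof -
  have *: "u \<in> verts G \<and> v \<in> verts G \<and> u \<noteq> v" if "{u, v} \<in> edges G" for u v
  proof -
    have "{u, v} \<subseteq> verts G" "card {u, v} = 2" using assms that unfolding simple_graph_def by blast+
    then show ?thesis by auto
  qed
  show s: "nbrs G v \<subseteq> verts G" "v \<notin> nbrs G v" "v \<notin> verts G \<Longrightarrow> nbrs G v = {}"
    using * unfolding nbrs_def by blast+
  show "finite (nbrs G v)" using s(1) assms finite_subset unfolding simple_graph_def by blast
  show "u \<in> nbrs G v \<longleftrightarrow> v \<in> nbrs G u" by (simp add: nbrs_def insert_commute)
qed

lemma simple_graph_finite_edges: "simple_graph G \<Longrightarrow> finite (edges G)"
  by (rule finite_subset[of _ "Pow (verts G)"]) (auto simp: simple_graph_def)

lemma edge_endpoints: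
  assumes "simple_graph G" "e \<in> edges G"
  obtains x y where "e = {x, y}" "x \<noteq> y" "x \<in> verts G" "y \<in> verts G" "y \<in> nbrs G x"
proof -
  have "card e = 2" "e \<subseteq> verts G" using assms unfolding simple_graph_def by auto
  then obtain x y where "e = {x, y}" "x \<noteq> y" by (auto simp: card_2_iff)
  then show ?thesis using that[of x y] \<open>e \<subseteq> verts G\<close> assms(2) by (auto simp: nbrs_def insert_commute)
qed

lemma degree_eq_card_edges:
  assumes "simple_graph G"
  shows "degree G v = card {e \<in> edges G. v \<in> e}"
proof -
  have "bij_betw (\<lambda>u. {u, v}) (nbrs G v) {e \<in> edges G. v \<in> e}"
  proof (rule bij_betw_imageI)
    show "inj_on (\<lambda>u. {u, v}) (nbrs G v)" by (auto simp: inj_on_def doubleton_eq_iff)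
    have "e \<in> (\<lambda>u. {u, v}) ` nbrs G v" if e: "e \<in> edges G" "v \<in> e" for e
    proof -
      obtain x y where "e = {x, y}" using edge_endpoints[OF assms e(1)] by metis
      then have "e = {x, v} \<or> e = {y, v}" using e(2) by auto
      then show ?thesis using e(1) by (auto simp: nbrs_def)
    qed
    then show "(\<lambda>u. {u, v}) ` nbrs G v = {e \<in> edges G. v \<in> e}" by (auto simp: nbrs_def)
  qed
  then show ?thesis unfolding degree_def by (rule bij_betw_same_card)
qed

lemma sum_degree:
  assumes "simple_graph G"
  shows "(\<Sum>v\<in>verts G. degree G v) = 2 * card (edges G)"
proof -
  have "{v \<in> verts G. v \<in> e} = e" if "e \<in> edges G" for e using assms that unfolding simple_graph_def by auto
  then have "\<forall>e\<in>edges G. card {v \<in> verts G. v \<in> e} = 2" using assms unfolding simple_graph_def by simp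
  then show ?thesis
    using sum_multicount[where S = "verts G" and T = "edges G" and R = "\<lambda>v e. v \<in> e" and k = 2] assms simple_graph_finite_edges[OF assms]
    by (simp add: degree_eq_card_edges simple_graph_def)
qed

lemma degree_less_card:
  assumes "simple_graph G" "v \<in> verts G"
  shows "degree G v < card (verts G)"
  unfolding degree_def
  by (rule psubset_card_mono) (use assms simple_graph_nbrs(1,2)[OF assms(1), of v] in \<open>auto simp: simple_graph_def\<close>)

lemma forests_cover_remove_vertex:
  assumes G: "simple_graph G" and v: "degree G v \<le> r"
    and E: "forests_cover r {e \<in> edges G. v \<notin> e}"
  shows "forests_cover r (edges G)"
proof -
  have "edges G \<subseteq> {e \<in> edges G. v \<notin> e} \<union> (\<lambda>x. {v, x}) ` nbrs G v"
  proof
    fix e assume e: "e \<in> edges G"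
    then obtain x y where "e = {x, y}" "x \<in> nbrs G y" "y \<in> nbrs G x"
      using edge_endpoints[OF G e] simple_graph_nbrs(5)[OF G] by metis
    then show "e \<in> {e \<in> edges G. v \<notin> e} \<union> (\<lambda>x. {v, x}) ` nbrs G v" using e by auto
  qed
  moreover have "forests_cover r ({e \<in> edges G. v \<notin> e} \<union> (\<lambda>x. {v, x}) ` nbrs G v)"
    by (rule forests_cover_add_vertex[OF E])
      (use simple_graph_nbrs(1-4)[OF G] v in \<open>auto simp: degree_def\<close>)
  ultimately show ?thesis by (rule forests_cover_subset[rotated])
qed

abbreviation remove_vertex :: "'a ugraph \<Rightarrow> 'a \<Rightarrow> 'a ugraph" where
  "remove_vertex G v \<equiv> (verts G - {v}, {e \<in> edges G. v \<notin> e})"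

lemma simple_graph_remove_vertex: "simple_graph G \<Longrightarrow> simple_graph (remove_vertex G v)"
  unfolding simple_graph_def by auto

lemma degree_remove_vertex: "simple_graph G \<Longrightarrow> degree (remove_vertex G v) u \<le> degree G u"
  unfolding degree_def by (rule card_mono[OF simple_graph_nbrs(3)]) (auto simp: nbrs_def)

lemma forests_cover_max_degree:
  assumes "simple_graph G" "\<And>v. degree G v \<le> r"
  shows "forests_cover r (edges G)"
  using assms
proof (induction "card (verts G)" arbitrary: G rule: less_induct)
  case less
  show ?case
  proof (cases "verts G = {}")
    case True
    then have "edges G = {}" using less.prems(1) unfolding simple_graph_def by fastforce
    then show ?thesis by (simp add: forests_cover_def ranked_def)
  next
    case False
    then obtain v where v: "v \<in> verts G" by blast
    have "card (verts (remove_vertex G v)) < card (verts G)"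
      using card_Diff1_less[of "verts G" v] less.prems(1) v by (simp add: simple_graph_def)
    then have "forests_cover r (edges (remove_vertex G v))"
      using less.hyps simple_graph_remove_vertex[OF less.prems(1)]
        degree_remove_vertex[OF less.prems(1), of v] less.prems(2) le_trans by blast
    then show ?thesis using forests_cover_remove_vertex[OF less.prems(1,2)] by simp
  qed
qed

section \<open>Arboricity against the maximum degree and the number of edges\<close>

lemma arboricity_le_max_degree:
  assumes "simple_graph G" "verts G \<noteq> {}"
  shows "arboricity G \<le> max_degree G"
proof (rule arboricity_le, rule forests_cover_max_degree[OF assms(1)])
  fix v
  have "finite (verts G)" using assms by (simp add: simple_graph_def)
  moreover have "degree G v = 0" if "v \<notin> verts G" using simple_graph_nbrs(4)[OF assms(1) that] by (simp add: degree_def)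
  ultimately show "degree G v \<le> max_degree G" unfolding max_degree_def by (cases "v \<in> verts G") auto
qed

lemma degree_bound_times_card:
  assumes "simple_graph G" "\<And>v. v \<in> verts G \<Longrightarrow> d \<le> degree G v"
  shows "card (verts G) * d \<le> 2 * card (edges G)"
  using sum_bounded_below[of "verts G" d "degree G"] assms sum_degree[OF assms(1)] by simp

text \<open>A smallest counterexample has minimum degree greater than \<open>r\<close>, hence exactly
  \<open>2 * r + 1\<close> vertices, one of them, \<open>v\<close>, of degree \<open>r + 1\<close>. If two neighbours of \<open>v\<close> were
  nonadjacent, subdividing that missing edge of the complete graph on the remaining \<open>2 * r\<close>
  vertices would give a cover. So \<open>v\<close> and its neighbours form a clique, which is joined to the
  remaining \<open>r - 1\<close> vertices by too many edges.\<close>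

lemma forests_cover_sqrt:
  assumes "simple_graph G" "card (edges G) \<le> r * r + 2 * r" "2 \<le> r"
  shows "forests_cover r (edges G)"
  using assms(1,2)
proof (induction "card (verts G)" arbitrary: G rule: less_induct)
  case less
  note G = less.prems(1)
  have fin: "finite (verts G)" using G by (simp add: simple_graph_def)
  have E: "\<forall>e\<in>edges G. e \<subseteq> verts G \<and> card e = 2" using G by (simp add: simple_graph_def)
  show ?case
  proof (cases "card (verts G) \<le> 2 * r")
    case True
    then show ?thesis using forests_cover_complete[OF fin] E by blast
  next
    case big: False
    show ?thesis
    proof (cases "\<exists>v\<in>verts G. degree G v \<le> r")
      case True
      then obtain v where v: "v \<in> verts G" "degree G v \<le> r" by blast
      have "card (verts (remove_vertex G v)) < card (verts G)"
        using card_Diff1_less[OF fin v(1)] by simp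
      moreover have "card (edges (remove_vertex G v)) \<le> card (edges G)"
        by (rule card_mono[OF simple_graph_finite_edges[OF G]]) auto
      ultimately have "forests_cover r (edges (remove_vertex G v))"
        using less.hyps[of "remove_vertex G v"] simple_graph_remove_vertex[OF G] less.prems(2) le_trans by blast
      then show ?thesis using forests_cover_remove_vertex[OF G v(2)] by simp
    next
      case False
      then have d: "Suc r \<le> degree G v" if "v \<in> verts G" for v using that by (simp add: not_less_eq_eq)
      let ?n = "card (verts G)"
      have m2: "2 * card (edges G) \<le> 2 * (r * r) + 4 * r" using less.prems(2) by simp
      \<comment> \<open>With \<open>2 * r + 2\<close> vertices of degree at least
        \<open>r + 1\<close> the degree sum would be at least \<open>2 * (r + 1) * (r + 1)\<close>,
        two more than allowed.\<close>
      have "?n = 2 * r + 1"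
      proof (rule ccontr)
        assume "?n \<noteq> 2 * r + 1"
        then have "2 * r + 2 \<le> ?n" using big by simp
        then have "(2 * r + 2) * Suc r \<le> ?n * Suc r" by (rule mult_right_mono) simp
        then show False using degree_bound_times_card[OF G d] m2 by (simp add: algebra_simps)
      qed
      note n = this
      obtain v where v: "v \<in> verts G" "degree G v = Suc r"
      proof -
        \<comment> \<open>If all degrees were at least \<open>r + 2\<close>, their sum would be at
          least \<open>(2 * r + 1) * (r + 2)\<close>, which exceeds the largest possible value
          \<open>2 * r * r + 4 * r\<close>.\<close>
        have "\<exists>v\<in>verts G. degree G v = Suc r"
        proof (rule ccontr)
          assume "\<not> ?thesis"
          then have "Suc (Suc r) \<le> degree G v" if "v \<in> verts G" for v
            using d[OF that] that le_neq_implies_less by (metis Suc_leI)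
          from degree_bound_times_card[OF G this] m2 show False unfolding n by (simp add: algebra_simps)
        qed
        then show ?thesis using that by blast
      qed
      note vn = simple_graph_nbrs(1-3)[OF G, of v]
      show ?thesis
      proof (cases "\<exists>x\<in>nbrs G v. \<exists>y\<in>nbrs G v. x \<noteq> y \<and> {x, y} \<notin> edges G")
        case True
        then obtain x y where xy: "x \<in> nbrs G v" "y \<in> nbrs G v" "x \<noteq> y" "{x, y} \<notin> edges G" by blast
        let ?E = "{e \<in> edges G. v \<notin> e}"
        have "\<forall>e\<in>insert {x, y} ?E. e \<subseteq> verts G - {v} \<and> card e = 2" using E xy vn by auto
        then have "forests_cover r (insert {x, y} ?E)"
          using forests_cover_complete[of "verts G - {v}" r] fin v n by simp
        then have "forests_cover r (?E \<union> (\<lambda>x. {v, x}) ` nbrs G v)"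
          by (rule forests_cover_subdivide) (use xy vn v in \<open>auto simp: degree_def\<close>)
        moreover have "edges G \<subseteq> ?E \<union> (\<lambda>x. {v, x}) ` nbrs G v"
        proof
          fix e assume e: "e \<in> edges G"
          then obtain x y where "e = {x, y}" "x \<in> nbrs G y" "y \<in> nbrs G x"
            using edge_endpoints[OF G e] simple_graph_nbrs(5)[OF G] by metis
          then show "e \<in> ?E \<union> (\<lambda>x. {v, x}) ` nbrs G v" using e by auto
        qed
        ultimately show ?thesis by (rule forests_cover_subset)
      next
        case False
        define Q where "Q = insert v (nbrs G v)"
        define Z where "Z = verts G - Q"
        have Q: "finite Q" "card Q = r + 2" "Q \<subseteq> verts G"
          using vn v by (auto simp: Q_def degree_def)
        have Z: "finite Z" "card Z = r - 1" using Q n fin by (auto simp: Z_def card_Diff_subset)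
        have clique: "Q - {q} \<subseteq> nbrs G q" if "q \<in> Q" for q
        proof
          fix x assume x: "x \<in> Q - {q}"
          show "x \<in> nbrs G q"
          proof (cases "q = v \<or> x = v")
            case True
            then show ?thesis using x that simple_graph_nbrs(5)[OF G, of v q] by (auto simp: Q_def)
          next
            case nv: False
            then have "{x, q} \<in> edges G" using x that False by (auto simp: Q_def)
            then show ?thesis by (simp add: nbrs_def)
          qed
        qed
        have dq: "Suc r + card {z \<in> Z. z \<in> nbrs G q} \<le> degree G q" if "q \<in> Q" for q
        proof -
          have "card (Q - {q}) + card {z \<in> Z. z \<in> nbrs G q} = card ((Q - {q}) \<union> {z \<in> Z. z \<in> nbrs G q})"
            using Q(1) Z(1) by (intro card_Un_disjoint[symmetric]) (auto simp: Z_def)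
          also have "\<dots> \<le> degree G q" unfolding degree_def
            using clique[OF that] by (intro card_mono simple_graph_nbrs(3)[OF G]) auto
          finally show ?thesis using that Q by simp
        qed
        \<comment> \<open>Of the at least \<open>r + 1\<close> neighbours of \<open>z\<close>, at
          most \<open>r - 2\<close> are in \<open>Z\<close>, a set of \<open>r - 1\<close> elements
          that contains \<open>z\<close> itself.\<close>
        have dz: "3 \<le> card {q \<in> Q. z \<in> nbrs G q}" if "z \<in> Z" for z
        proof -
          have "nbrs G z \<subseteq> (Z - {z}) \<union> {q \<in> Q. z \<in> nbrs G q}"
          proof
            fix x assume "x \<in> nbrs G z"
            then have "x \<in> verts G" "x \<noteq> z" "z \<in> nbrs G x"
              using simple_graph_nbrs(1,2)[OF G, of z] simple_graph_nbrs(5)[OF G, of x z] by blast+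
            then show "x \<in> (Z - {z}) \<union> {q \<in> Q. z \<in> nbrs G q}" by (simp add: Z_def)
          qed
          then have "degree G z \<le> card ((Z - {z}) \<union> {q \<in> Q. z \<in> nbrs G q})" unfolding degree_def
            using Z(1) Q(1) by (intro card_mono) auto
          also have "\<dots> \<le> card (Z - {z}) + card {q \<in> Q. z \<in> nbrs G q}" by (rule card_Un_le)
          finally show ?thesis using d[of z] that Z assms(3) by (simp add: Z_def)
        qed
        have "(\<Sum>q\<in>Q. card {z \<in> Z. z \<in> nbrs G q}) = (\<Sum>z\<in>Z. card {q \<in> Q. z \<in> nbrs G q})"
          by (rule sum_multicount_gen) (use Q Z in auto)
        moreover have "(r - 1) * 3 \<le> (\<Sum>z\<in>Z. card {q \<in> Q. z \<in> nbrs G q})"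
          using sum_bounded_below[of Z 3 "\<lambda>z. card {q \<in> Q. z \<in> nbrs G q}"] dz Z(2) by simp
        moreover have "(\<Sum>q\<in>Q. Suc r + card {z \<in> Z. z \<in> nbrs G q}) \<le> (\<Sum>q\<in>Q. degree G q)"
          by (rule sum_mono) (rule dq)
        moreover have "(r - 1) * Suc r \<le> (\<Sum>z\<in>Z. degree G z)"
          using sum_bounded_below[of Z "Suc r" "degree G"] d Z by (simp add: Z_def)
        moreover have "(\<Sum>q\<in>Q. degree G q) + (\<Sum>z\<in>Z. degree G z) = 2 * card (edges G)"
          using sum.subset_diff[OF Q(3) fin, of "degree G"] sum_degree[OF G] by (simp add: Z_def)
        moreover have "(\<Sum>q\<in>Q. Suc r + card {z \<in> Z. z \<in> nbrs G q}) =
            (r + 2) * Suc r + (\<Sum>q\<in>Q. card {z \<in> Z. z \<in> nbrs G q})"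
          by (subst sum.distrib) (simp add: Q)
        \<comment> \<open>The lower bounds for the degrees within the clique \<open>Q\<close>, for
          the edges from \<open>Q\<close> to \<open>Z\<close>, and for the degrees of the vertices
          in \<open>Z\<close> add up to \<open>2 * r * r + 6 * r - 2\<close>. This is too much for
          \<open>r \<ge> 2\<close>; for \<open>r = 1\<close> there is equality, attained by the
          triangle.\<close>
        ultimately have "(r + 2) * Suc r + (r - 1) * 3 + (r - 1) * Suc r \<le> 2 * (r * r) + 4 * r"
          using m2 by linarith
        moreover obtain r' where "r = Suc (Suc r')" using assms(3) by (metis Suc_le_D numeral_2_eq_2 Suc_le_mono)
        ultimately show ?thesis by (simp add: algebra_simps)
      qed
    qed
  qed
qed

text \<open>For \<open>r = 1\<close> up to three edges have to form a single forest. Minimum degree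
  2 requires at least three vertices and hence three edges; so with at most two edges a nonempty
  graph has a vertex of degree at most 1, which can be removed.\<close>

lemma forests_cover_1:
  assumes "simple_graph G" "card (edges G) \<le> 2"
  shows "forests_cover 1 (edges G)"
  using assms
proof (induction "card (verts G)" arbitrary: G rule: less_induct)
  case less
  note G = less.prems(1)
  have fin: "finite (verts G)" using G by (simp add: simple_graph_def)
  show ?case
  proof (cases "\<exists>v\<in>verts G. degree G v \<le> 1")
    case True
    then obtain v where v: "v \<in> verts G" "degree G v \<le> 1" by blast
    have "card (verts (remove_vertex G v)) < card (verts G)"
      using card_Diff1_less[OF fin v(1)] by simp
    moreover have "card (edges (remove_vertex G v)) \<le> card (edges G)"
      by (rule card_mono[OF simple_graph_finite_edges[OF G]]) auto
    ultimately have "forests_cover 1 (edges (remove_vertex G v))"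
      using less.hyps[of "remove_vertex G v"] simple_graph_remove_vertex[OF G] less.prems(2) le_trans by blast
    then show ?thesis using forests_cover_remove_vertex[OF G v(2)] by simp
  next
    case False
    then have "card (verts G) * 2 \<le> 2 * card (edges G)"
      using degree_bound_times_card[OF G, of 2] by force
    moreover have "verts G = {}"
    proof (rule ccontr)
      assume "verts G \<noteq> {}"
      then obtain v where v: "v \<in> verts G" by blast
      have "degree G v < card (verts G)" by (rule degree_less_card[OF G v])
      then show False using False v calculation less.prems(2) by force
    qed
    then have "edges G = {}" using G unfolding simple_graph_def by fastforce
    then show ?thesis by (simp add: forests_cover_def ranked_def)
  qed
qed

lemma degree_0_connected:
  assumes "simple_graph G" "connected_graph G" "v \<in> verts G" "degree G v = 0"
  shows "verts G = {v}"
proof -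
  have "nbrs G v = {}" using assms(4) simple_graph_nbrs(3)[OF assms(1)] by (simp add: degree_def)
  then have no: "{v, w} \<notin> edges G" for w by (auto simp: nbrs_def insert_commute)
  have "w = v" if "w \<in> verts G" for w
  proof -
    have "(v, w) \<in> {(a, b). {a, b} \<in> edges G}\<^sup>*" using assms that by (simp add: connected_graph_def)
    then show ?thesis by (rule converse_rtranclE) (use no in auto)
  qed
  then show ?thesis using assms(3) by blast
qed

text \<open>With three edges, minimum degree 2 leaves only the triangle. Otherwise there is a vertex
  of degree at most 1; connectedness excludes degree 0, so removing this vertex takes an edge away
  and leaves two.\<close>

lemma forests_cover_1_connected:
  assumes G: "simple_graph G" "connected_graph G" and m: "card (edges G) = 3" "card (verts G) \<noteq> 3"
  shows "forests_cover 1 (edges G)"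
proof -
  have "\<exists>v\<in>verts G. degree G v \<le> 1"
  proof (rule ccontr)
    assume *: "\<not> ?thesis"
    then have "card (verts G) \<le> 3" using degree_bound_times_card[OF G(1), of 2] m by force
    moreover obtain v where "v \<in> verts G" using G(2) by (auto simp: connected_graph_def)
    moreover have "degree G v < card (verts G)" by (rule degree_less_card[OF G(1)]) fact
    ultimately show False using * m(2) by force
  qed
  then obtain v where v: "v \<in> verts G" "degree G v \<le> 1" by blast
  have "degree G v \<noteq> 0"
  proof
    assume "degree G v = 0"
    from degree_0_connected[OF G v(1) this] have "\<forall>u\<in>verts G. degree G u = 0" using \<open>degree G v = 0\<close> by simp
    then show False using sum_degree[OF G(1)] m by simp
  qed
  then have "card {e \<in> edges G. v \<in> e} = 1" using v(2) degree_eq_card_edges[OF G(1), of v] by simp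
  moreover have "edges G - {e \<in> edges G. v \<in> e} = {e \<in> edges G. v \<notin> e}" by blast
  then have "card {e \<in> edges G. v \<notin> e} = card (edges G) - card {e \<in> edges G. v \<in> e}"
    using card_Diff_subset[of "{e \<in> edges G. v \<in> e}" "edges G"] simple_graph_finite_edges[OF G(1)] by simp
  ultimately have "card (edges (remove_vertex G v)) \<le> 2" using m by simp
  then have "forests_cover 1 (edges (remove_vertex G v))"
    by (rule forests_cover_1[OF simple_graph_remove_vertex[OF G(1)]])
  then show ?thesis using forests_cover_remove_vertex[OF G(1) v(2)] by simp
qed

text \<open>With \<open>r\<close> the integer part of the square root, the number of edges is less
  than \<open>(r + 1) * (r + 1)\<close>, hence at most \<open>r * r + 2 * r\<close>, and
  \<open>r\<close> forests suffice. The excluded case is the triangle, where \<open>r = 1\<close>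
  but a single forest is not enough.\<close>

lemma arboricity_le_sqrt:
  assumes G: "simple_graph G" "connected_graph G" and no: "\<not> (card (verts G) = 3 \<and> card (edges G) = 3)"
  shows "real (arboricity G) \<le> sqrt (real (card (edges G)))"
proof -
  let ?m = "card (edges G)"
  define r where "r = nat \<lfloor>sqrt (real ?m)\<rfloor>"
  have "0 \<le> \<lfloor>sqrt (real ?m)\<rfloor>" by simp
  then have "real r = real_of_int \<lfloor>sqrt (real ?m)\<rfloor>" by (simp add: r_def)
  then have r: "real r \<le> sqrt ?m" "sqrt ?m < real (r + 1)" by linarith+
  have "real ?m < (real (r + 1))\<^sup>2" using r(2) real_less_lsqrt sqrt_le_D not_less real_sqrt_ge_zero
    by (metis of_nat_0_le_iff real_le_rsqrt)
  then have "real ?m < real ((r + 1)\<^sup>2)" by (simp only: of_nat_power)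
  then have m: "?m \<le> r * r + 2 * r" unfolding of_nat_less_iff by (simp add: power2_eq_square)
  have "forests_cover r (edges G)"
  proof (cases "2 \<le> r")
    case True
    then show ?thesis by (rule forests_cover_sqrt[OF G(1) m])
  next
    case False
    then consider "r = 0" | "r = 1" by force
    then show ?thesis
    proof cases
      case 1
      then have "edges G = {}" using m simple_graph_finite_edges[OF G(1)] by simp
      then show ?thesis by (simp add: forests_cover_def ranked_def)
    next
      case 2
      then have "?m \<le> 2 \<or> ?m = 3" using m by auto
      then show ?thesis using 2 forests_cover_1[OF G(1)] forests_cover_1_connected[OF G] no by auto
    qed
  qed
  then have "arboricity G \<le> r" by (rule arboricity_le)
  then show ?thesis using r(1) by linarith
qed

text \<open>Rounding up absorbs the exception: the triangle needs two forests, and 2 is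
  \<open>sqrt 3\<close> rounded up.\<close>

lemma arboricity_le_ceiling_sqrt:
  assumes G: "simple_graph G" "connected_graph G"
  shows "real (arboricity G) \<le> real_of_int \<lceil>sqrt (real (card (edges G)))\<rceil>"
proof (cases "card (verts G) = 3 \<and> card (edges G) = 3")
  case True
  have "degree G v \<le> 2" for v
    using degree_less_card[OF G(1), of v] simple_graph_nbrs(4)[OF G(1), of v] True
    by (cases "v \<in> verts G") (auto simp: degree_def)
  then have "arboricity G \<le> 2" by (intro arboricity_le forests_cover_max_degree[OF G(1)])
  moreover have "\<lceil>sqrt 3\<rceil> > (1 :: int)" by (simp add: less_ceiling_iff)
  then have "2 \<le> real_of_int \<lceil>sqrt 3\<rceil>" by linarith
  ultimately have "real (arboricity G) \<le> real_of_int \<lceil>sqrt 3\<rceil>" by linarith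
  then show ?thesis using True by simp
next
  case False
  then show ?thesis using arboricity_le_sqrt[OF G] by linarith
qed

text \<open>The first vertex of a longest path is a leaf: a neighbour other than the second vertex
  would extend the path if it is new, and close a cycle if it lies on the path. A longest path
  exists because lengths are bounded by the number of end points of edges.\<close>

lemma acyclic_leaf:
  assumes A: "acyclic_edges A" "finite A" "A \<noteq> {}" "\<forall>e\<in>A. card e = 2"
  shows "\<exists>x y. {x, y} \<in> A \<and> (\<forall>z. {x, z} \<in> A \<longrightarrow> z = y)"
proof -
  define P where "P xs \<longleftrightarrow> distinct xs \<and> 2 \<le> length xs \<and> (\<forall>i. Suc i < length xs \<longrightarrow> {xs ! i, xs ! Suc i} \<in> A)" for xs
  obtain e where "e \<in> A" using A(3) by blast
  with A(4) obtain a b where ab: "{a, b} \<in> A" "a \<noteq> b" by (metis card_2_iff)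
  have fin: "finite (\<Union>A)" using A(2,4) card.infinite by (intro finite_Union) fastforce+
  have "P [a, b]" using ab by (simp add: P_def less_Suc_eq)
  moreover have "\<forall>xs. P xs \<longrightarrow> length xs < Suc (card (\<Union>A))"
  proof (intro allI impI)
    fix xs assume xs: "P xs"
    have "xs ! i \<in> \<Union>A" if "i < length xs" for i
    proof (cases "Suc i < length xs")
      case True
      then show ?thesis using xs unfolding P_def by blast
    next
      case False
      then have "Suc (i - 1) = i" "Suc (i - 1) < length xs" using xs that by (auto simp: P_def)
      then have "{xs ! (i - 1), xs ! i} \<in> A" using xs unfolding P_def by metis
      then show ?thesis by blast
    qed
    then have "set xs \<subseteq> \<Union>A" by (auto simp: in_set_conv_nth)
    then have "card (set xs) \<le> card (\<Union>A)" by (rule card_mono[OF fin])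
    then show "length xs < Suc (card (\<Union>A))" using xs by (simp add: P_def distinct_card)
  qed
  ultimately obtain xs where xs: "P xs" "\<And>ys. P ys \<Longrightarrow> length ys \<le> length xs"
    using ex_has_greatest_nat[of P "[a, b]" length "Suc (card (\<Union>A))"] by auto
  have z: "z = xs ! 1" if z: "{xs ! 0, z} \<in> A" for z
  proof (rule ccontr)
    assume z1: "z \<noteq> xs ! 1"
    show False
    proof (cases "z \<in> set xs")
      case False
      then have "P (z # xs)" using xs(1) z unfolding P_def by (auto simp: nth_Cons insert_commute split: nat.split)
      from xs(2)[OF this] show False by simp
    next
      case True
      then obtain i where i: "i < length xs" "z = xs ! i" by (auto simp: in_set_conv_nth)
      have "i \<noteq> 0" using z i A(4) by (metis card_2_iff doubleton_eq_iff)
      moreover have "i \<noteq> 1" using z1 i by auto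
      ultimately have i2: "2 \<le> i" by simp
      define c where "c = take (Suc i) xs"
      have l: "length c = Suc i" using i by (simp add: c_def)
      have "{c ! j, c ! (Suc j mod length c)} \<in> A" if "j < length c" for j
      proof (cases "j = i")
        case True
        then show ?thesis using z i by (simp add: l c_def insert_commute)
      next
        case False
        then show ?thesis using xs(1) that i unfolding l by (simp add: c_def P_def)
      qed
      moreover have "distinct c" using xs(1) by (simp add: c_def P_def)
      ultimately show False using A(1) i2 l unfolding acyclic_edges_def by (metis Suc_le_mono numeral_2_eq_2 numeral_3_eq_3)
    qed
  qed
  have "{xs ! 0, xs ! 1} \<in> A" using xs(1) by (simp add: P_def)
  then show ?thesis using z by blast
qed

text \<open>Repeatedly removing a leaf together with its edge charges each edge to an end point of its own.\<close>

lemma acyclic_endpoint_choice: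
  assumes "acyclic_edges A" "finite A" "\<forall>e\<in>A. card e = 2"
  shows "\<exists>p. inj_on p A \<and> (\<forall>e\<in>A. p e \<in> e)"
  using assms(2,1,3)
proof (induction "card A" arbitrary: A)
  case 0
  then show ?case by simp
next
  case (Suc n)
  then have "A \<noteq> {}" by auto
  then obtain x y where xy: "{x, y} \<in> A" "\<And>z. {x, z} \<in> A \<Longrightarrow> z = y"
    using acyclic_leaf[OF Suc.prems(2,1)] Suc.prems(3) by blast
  let ?B = "A - {{x, y}}"
  have "acyclic_edges ?B" using Suc.prems(2) unfolding acyclic_edges_def by blast
  moreover have "n = card ?B" using Suc.hyps(2) xy(1) Suc.prems(1) by simp
  ultimately obtain p where p: "inj_on p ?B" "\<forall>e\<in>?B. p e \<in> e"
    using Suc.hyps(1)[of ?B] Suc.prems by auto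
  have "x \<notin> e" if "e \<in> ?B" for e
  proof
    assume "x \<in> e"
    moreover have "card e = 2" using that Suc.prems(3) by blast
    ultimately obtain z where "e = {x, z}" by (auto simp: card_2_iff)
    then show False using xy(2) that by blast
  qed
  then have notx: "p e \<noteq> x" if "e \<in> ?B" for e using p(2) that by metis
  have "inj_on (p({x, y} := x)) A"
  proof (rule inj_onI)
    fix e e' assume e: "e \<in> A" "e' \<in> A" "(p({x, y} := x)) e = (p({x, y} := x)) e'"
    show "e = e'"
    proof (cases "e = {x, y} \<or> e' = {x, y}")
      case True
      then show ?thesis using e notx[of e] notx[of e'] by (auto split: if_splits)
    next
      case False
      then show ?thesis using e inj_onD[OF p(1), of e e'] by simp
    qed
  qed
  moreover have "\<forall>e\<in>A. (p({x, y} := x)) e \<in> e" using p(2) by auto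
  ultimately show ?case by metis
qed

lemma sum_UNION_le:
  fixes f :: "'b \<Rightarrow> nat" and r :: nat
  assumes "\<And>i. i < r \<Longrightarrow> finite (A i)"
  shows "(\<Sum>e\<in>(\<Union>i<r. A i). f e) \<le> (\<Sum>i<r. \<Sum>e\<in>A i. f e)"
  using assms
proof (induction r)
  case (Suc r)
  have "(\<Sum>e\<in>(\<Union>i<Suc r. A i). f e) \<le> (\<Sum>e\<in>(\<Union>i<r. A i). f e) + (\<Sum>e\<in>A r. f e)"
    using Suc.prems by (simp add: lessThan_Suc Un_commute sum_Un_nat)
  then show ?case using Suc by fastforce
qed simp

lemma sum_min_degree_le:
  assumes G: "simple_graph G"
  shows "(\<Sum>e\<in>edges G. Min (degree G ` e)) \<le> 2 * arboricity G * card (edges G)"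
proof -
  let ?P = "\<lambda>r. \<exists>A. (\<forall>i<r. spanning_forest G (A i)) \<and>
     (\<forall>i<r. \<forall>j<r. i \<noteq> j \<longrightarrow> A i \<inter> A j = {}) \<and> (\<Union>i<r. A i) = edges G"
  have fin: "finite (edges G)" "finite (verts G)" using simple_graph_finite_edges[OF G] G by (auto simp: simple_graph_def)
  have e2: "\<forall>e\<in>edges G. e \<subseteq> verts G \<and> card e = 2" using G by (simp add: simple_graph_def)
  \<comment> \<open>\<open>arboricity\<close> is a least number, so some cover has to be exhibited
    before \<open>LeastI\<close> provides one with \<open>arboricity G\<close> forests. As all
    degrees are at most the number of vertices, that many forests suffice.\<close>
  have "degree G v \<le> card (verts G)" for v
    unfolding degree_def by (rule card_mono[OF fin(2)]) (rule simple_graph_nbrs(1)[OF G])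
  then have "forests_cover (card (verts G)) (edges G)" by (rule forests_cover_max_degree[OF G])
  then obtain g f where gf: "\<forall>e\<in>edges G. g e < card (verts G)"
    "\<forall>i<card (verts G). ranked (f i) {e \<in> edges G. g e = i}"
    unfolding forests_cover_def by blast
  have "?P (card (verts G))"
    by (rule exI[of _ "\<lambda>i. {e \<in> edges G. g e = i}"])
      (use gf in \<open>auto simp: spanning_forest_def intro: ranked_imp_acyclic\<close>)
  then have "?P (arboricity G)" unfolding arboricity_def by (rule LeastI)
  then obtain A where A: "\<And>i. i < arboricity G \<Longrightarrow> spanning_forest G (A i)"
    "(\<Union>i<arboricity G. A i) = edges G" by blast
  have forest: "(\<Sum>e\<in>A i. Min (degree G ` e)) \<le> 2 * card (edges G)" if "i < arboricity G" for i
  proof -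
    have Ai: "A i \<subseteq> edges G" "acyclic_edges (A i)" using A(1)[OF that] by (auto simp: spanning_forest_def)
    obtain p where p: "inj_on p (A i)" "\<forall>e\<in>A i. p e \<in> e"
      using acyclic_endpoint_choice[OF Ai(2)] finite_subset[OF Ai(1) fin(1)] Ai(1) e2 by blast
    have "(\<Sum>e\<in>A i. Min (degree G ` e)) \<le> (\<Sum>e\<in>A i. degree G (p e))"
    proof (rule sum_mono)
      fix e assume e: "e \<in> A i"
      then have "finite e" using e2 Ai(1) fin(2) finite_subset by blast
      then show "Min (degree G ` e) \<le> degree G (p e)" using p(2) e by simp
    qed
    also have "\<dots> = (\<Sum>v\<in>p ` A i. degree G v)" using p(1) by (simp add: sum.reindex)
    also have "\<dots> \<le> (\<Sum>v\<in>verts G. degree G v)"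
      using p(2) Ai(1) e2 by (intro sum_mono2 fin(2)) blast+
    finally show ?thesis using sum_degree[OF G] by simp
  qed
  have "(\<Sum>e\<in>(\<Union>i<arboricity G. A i). Min (degree G ` e)) \<le> (\<Sum>i<arboricity G. \<Sum>e\<in>A i. Min (degree G ` e))"
  proof (rule sum_UNION_le)
    show "finite (A i)" if "i < arboricity G" for i
      by (rule finite_subset[OF _ fin(1)]) (use A(1)[OF that] in \<open>simp add: spanning_forest_def\<close>)
  qed
  also have "\<dots> \<le> (\<Sum>i<arboricity G. 2 * card (edges G))" by (rule sum_mono) (simp add: forest)
  finally show ?thesis using A(2) by (simp add: algebra_simps)
qed

section \<open>Cores and the diversity score\<close>

text \<open>Cores are stated for a vertex set with a neighbourhood function rather than for a graph,
  since the same facts serve \<open>G\<close>, its ego-networks and the numbered copies used by the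
  program. A union of sets with inner degrees at least \<open>t\<close> has inner degrees at least
  \<open>t\<close>, so this is the greatest such set.\<close>

definition kcore :: "'a set \<Rightarrow> ('a \<Rightarrow> 'a set) \<Rightarrow> nat \<Rightarrow> 'a set" where
  "kcore V N t = \<Union>{W. W \<subseteq> V \<and> (\<forall>x\<in>W. t \<le> card (N x \<inter> W))}"

definition core_number :: "'a set \<Rightarrow> ('a \<Rightarrow> 'a set) \<Rightarrow> 'a \<Rightarrow> nat" where
  "core_number V N x = (GREATEST t. x \<in> kcore V N t)"

definition level_comp :: "'a set \<Rightarrow> ('a \<Rightarrow> 'a set) \<Rightarrow> 'a \<Rightarrow> 'a set" where
  "level_comp V N u = {w. (u, w) \<in> {(a, b). a \<in> V \<and> b \<in> N a \<and>
     core_number V N a = core_number V N u \<and> core_number V N b = core_number V N u}\<^sup>*}"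

definition top_comp :: "'a set \<Rightarrow> ('a \<Rightarrow> 'a set) \<Rightarrow> 'a \<Rightarrow> bool" where
  "top_comp V N u \<longleftrightarrow> (\<forall>x\<in>level_comp V N u. \<forall>y\<in>N x. core_number V N y \<le> core_number V N u)"

definition top_comps :: "'a set \<Rightarrow> ('a \<Rightarrow> 'a set) \<Rightarrow> nat \<Rightarrow> 'a set set" where
  "top_comps V N t = level_comp V N ` {u \<in> V. core_number V N u = t \<and> top_comp V N u}"

text \<open>\<open>s\<close> is the value of the descending counter on entering level
  \<open>T\<close>; carrying it along makes the recursion of \<open>descend\<close> an induction on
  \<open>T\<close>.\<close>

definition h_set :: "(nat \<Rightarrow> nat) \<Rightarrow> nat \<Rightarrow> nat \<Rightarrow> nat set" where
  "h_set f T s = insert 0 {r \<in> {1..T}. r \<le> s + (\<Sum>i=r..T. f i)}"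

definition h_index :: "'a set \<Rightarrow> ('a \<Rightarrow> 'a set) \<Rightarrow> nat" where
  "h_index V N = Max (h_set (\<lambda>i. card (top_comps V N i)) (card V) 0)"

lemma h_set_Suc:
  "h_set f (Suc T) s = (if Suc T \<le> s + f (Suc T) then insert (Suc T) else id) (h_set f T (s + f (Suc T)))"
proof -
  have "(\<Sum>i=r..Suc T. f i) = f (Suc T) + (\<Sum>i=r..T. f i)" if "r \<le> Suc T" for r
    using that by (simp add: sum.nat_ivl_Suc')
  then show ?thesis unfolding h_set_def by (auto simp: le_Suc_eq add.assoc)
qed

lemma Max_h_set_Suc:
  "Max (h_set f (Suc T) s) = (if Suc T \<le> s + f (Suc T) then Suc T else Max (h_set f T (s + f (Suc T))))"
proof (cases "Suc T \<le> s + f (Suc T)")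
  case True
  have "Max (h_set f (Suc T) s) = Suc T"
    by (rule Max_eqI) (use True in \<open>auto simp: h_set_def\<close>)
  then show ?thesis using True by simp
qed (simp add: h_set_Suc)

lemma h_set_cut:
  assumes "T \<le> B" "\<And>i. T < i \<Longrightarrow> f i = 0"
  shows "h_set f B 0 = h_set f T 0"
proof -
  have 1: "(\<Sum>i=r..B. f i) = (\<Sum>i=r..T. f i)" for r
    by (rule sum.mono_neutral_right) (use assms in auto)
  have 2: "r \<le> T" if "1 \<le> r" "r \<le> (\<Sum>i=r..T. f i)" for r
    using that by (cases "r \<le> T") auto
  have "r \<in> {1..B} \<and> r \<le> 0 + (\<Sum>i=r..B. f i) \<longleftrightarrow> r \<in> {1..T} \<and> r \<le> 0 + (\<Sum>i=r..T. f i)" for r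
    unfolding 1 using 2[of r] assms(1) le_trans[of r T B] by (simp only: atLeastAtMost_iff add_0) blast
  then show ?thesis unfolding h_set_def by blast
qed

lemma descend_eq: "descend f T s = Max (h_set f T s)"
proof (induction T arbitrary: s)
  case 0
  then show ?case by (simp add: h_set_def)
next
  case (Suc T)
  then show ?case by (simp only: descend.simps Max_h_set_Suc)
qed

section \<open>Core numbers and components of a level\<close>

locale nbhd =
  fixes V :: "'a set" and N :: "'a \<Rightarrow> 'a set"
  assumes finite_V: "finite V"
    and N_sub: "x \<in> V \<Longrightarrow> N x \<subseteq> V"
    and N_irrefl: "x \<in> V \<Longrightarrow> x \<notin> N x"
    and N_sym: "x \<in> V \<Longrightarrow> y \<in> N x \<Longrightarrow> x \<in> N y"
begin

abbreviation "K \<equiv> kcore V N"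
abbreviation "cn \<equiv> core_number V N"
abbreviation "lc \<equiv> level_comp V N"

lemma finite_N: "x \<in> V \<Longrightarrow> finite (N x)"
  using N_sub finite_V finite_subset by blast

lemma kcore_sub: "K t \<subseteq> V" by (auto simp: kcore_def)

lemma kcore_max: "W \<subseteq> V \<Longrightarrow> (\<And>x. x \<in> W \<Longrightarrow> t \<le> card (N x \<inter> W)) \<Longrightarrow> W \<subseteq> K t"
  by (auto simp: kcore_def)

lemma kcore_degree:
  assumes "x \<in> K t"
  shows "t \<le> card (N x \<inter> K t)"
proof -
  obtain W where W: "x \<in> W" "W \<subseteq> V" "\<forall>x\<in>W. t \<le> card (N x \<inter> W)" using assms by (auto simp: kcore_def)
  then have "W \<subseteq> K t" by (intro kcore_max) auto
  then have "card (N x \<inter> W) \<le> card (N x \<inter> K t)"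
    using finite_N W by (intro card_mono) auto
  then show ?thesis using W le_trans by blast
qed

lemma kcore_le: "s \<le> t \<Longrightarrow> K t \<subseteq> K s"
  by (rule kcore_max[OF kcore_sub]) (use kcore_degree le_trans in blast)

lemma kcore_0: "K 0 = V" using kcore_max[of V 0] kcore_sub by auto

lemma kcore_card: "x \<in> K t \<Longrightarrow> t \<le> card (N x)"
  using kcore_degree[of x t] card_mono[OF finite_N, of x "N x \<inter> K t"] kcore_sub[of t] by force

text \<open>The greatest \<open>t\<close> exists because a vertex of the \<open>t\<close>-core has
  at least \<open>t\<close> neighbours; the equivalence then follows from the nesting of the
  cores.\<close>

lemma le_core_number:
  assumes "x \<in> V"
  shows "t \<le> cn x \<longleftrightarrow> x \<in> K t"
proof -
  have *: "\<forall>t. x \<in> K t \<longrightarrow> t \<le> card (N x)" using kcore_card by blast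
  have "x \<in> K (cn x)" unfolding core_number_def
    by (rule GreatestI_nat[where P = "\<lambda>t. x \<in> K t" and k = 0 and b = "card (N x)"]) (use * kcore_0 assms in auto)
  moreover have "t \<le> cn x" if "x \<in> K t" unfolding core_number_def
    by (rule Greatest_le_nat[where P = "\<lambda>t. x \<in> K t" and b = "card (N x)"]) (use * that in auto)
  ultimately show ?thesis using kcore_le by blast
qed

lemma core_number_eqI: "x \<in> K t \<Longrightarrow> x \<notin> K (Suc t) \<Longrightarrow> cn x = t"
  using le_core_number[of x t] le_core_number[of x "Suc t"] kcore_sub[of t] by fastforce

lemma core_number_le_card: "x \<in> V \<Longrightarrow> cn x \<le> card (N x)"
  using kcore_card le_core_number by blast

lemma card_N_less: "x \<in> V \<Longrightarrow> card (N x) < card V"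
  by (rule psubset_card_mono[OF finite_V]) (use N_sub N_irrefl in blast)

lemma core_number_less: "x \<in> V \<Longrightarrow> cn x < card V"
  using core_number_le_card card_N_less le_less_trans by blast

lemma level_comp_self: "u \<in> lc u" by (simp add: level_comp_def)

lemma level_comp_mem:
  assumes "u \<in> V" "w \<in> lc u"
  shows "w \<in> V \<and> cn w = cn u"
  using assms(2) unfolding level_comp_def mem_Collect_eq
  by (induction rule: rtrancl_induct) (use assms(1) N_sub in auto)

lemma level_comp_step:
  assumes "u \<in> V" "w \<in> lc u" "y \<in> N w" "cn y = cn u"
  shows "y \<in> lc u"
proof -
  have "w \<in> V" "cn w = cn u" using level_comp_mem assms(1,2) by auto
  then have "(w, y) \<in> {(a, b). a \<in> V \<and> b \<in> N a \<and> cn a = cn u \<and> cn b = cn u}"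
    using assms(3,4) by blast
  with assms(2) show ?thesis unfolding level_comp_def by (blast intro: rtrancl_into_rtrancl)
qed

lemma level_comp_closed:
  assumes "u \<in> C" "\<And>w y. w \<in> C \<Longrightarrow> w \<in> V \<Longrightarrow> y \<in> N w \<Longrightarrow> cn w = cn u \<Longrightarrow> cn y = cn u \<Longrightarrow> y \<in> C"
  shows "lc u \<subseteq> C"
proof
  fix w assume "w \<in> lc u"
  then show "w \<in> C" unfolding level_comp_def mem_Collect_eq
    by (induction rule: rtrancl_induct) (use assms in auto)
qed

lemma level_comp_eq:
  assumes u: "u \<in> V" and w: "w \<in> lc u"
  shows "lc w = lc u"
proof -
  have cw: "cn w = cn u" and wV: "w \<in> V" using level_comp_mem[OF u w] by auto
  let ?R = "{(a, b). a \<in> V \<and> b \<in> N a \<and> cn a = cn u \<and> cn b = cn u}"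
  have "(u, w) \<in> ?R\<^sup>*" using w by (simp add: level_comp_def)
  moreover have "sym ?R" unfolding sym_def using N_sym N_sub by blast
  then have "sym (?R\<^sup>*)" by (rule sym_rtrancl)
  ultimately have "(w, u) \<in> ?R\<^sup>*" by (meson symE)
  then show ?thesis using \<open>(u, w) \<in> ?R\<^sup>*\<close> unfolding level_comp_def cw
    by (auto intro: rtrancl_trans)
qed

lemma level_comp_disjoint: "u \<in> V \<Longrightarrow> w \<in> V \<Longrightarrow> lc u \<noteq> lc w \<Longrightarrow> lc u \<inter> lc w = {}"
  using level_comp_eq by blast

lemma top_comp_eq: "u \<in> V \<Longrightarrow> w \<in> lc u \<Longrightarrow> top_comp V N w = top_comp V N u"
  using level_comp_eq[of u w] level_comp_mem[of u w] by (simp add: top_comp_def)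

lemma finite_top_comps: "finite (top_comps V N t)"
  unfolding top_comps_def using finite_V by simp

text \<open>The score is summed up to different limits in different places: the size of the whole
  graph, the size of the ego-network, or the largest core number found. Levels above every core
  number have no components, so all these limits give the same maximum.\<close>

lemma h_index_alt:
  assumes "\<And>x. x \<in> V \<Longrightarrow> cn x \<le> T"
  shows "h_index V N = Max (h_set (\<lambda>i. card (top_comps V N i)) T 0)"
proof -
  have z: "card (top_comps V N i) = 0" if "T < i \<or> card V < i" for i
  proof -
    have "top_comps V N i = {}" using that assms core_number_less by (fastforce simp: top_comps_def)
    then show ?thesis by simp
  qed
  have "h_set (\<lambda>i. card (top_comps V N i)) (max T (card V)) 0 = h_set (\<lambda>i. card (top_comps V N i)) T 0"
    by (rule h_set_cut) (use z in auto)
  moreover have "h_set (\<lambda>i. card (top_comps V N i)) (max T (card V)) 0 = h_set (\<lambda>i. card (top_comps V N i)) (card V) 0"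
    by (rule h_set_cut) (use z in auto)
  ultimately show ?thesis by (simp add: h_index_def)
qed

text \<open>No neighbour of a vertex in a top component has a larger core number, so the neighbours
  of \<open>u\<close> in the \<open>t\<close>-core stay in the component. There are at least
  \<open>t\<close> of them, and \<open>u\<close> itself makes the inequality strict.\<close>

lemma top_comp_card:
  assumes "R \<in> top_comps V N t"
  shows "R \<subseteq> V" "t < card R" "\<And>x. x \<in> R \<Longrightarrow> cn x = t"
proof -
  obtain u where u: "u \<in> V" "cn u = t" "top_comp V N u" "R = lc u" using assms by (auto simp: top_comps_def)
  show R: "R \<subseteq> V" "\<And>x. x \<in> R \<Longrightarrow> cn x = t" using level_comp_mem[OF u(1)] u by auto
  have "N u \<inter> K t \<subseteq> R"
  proof
    fix y assume y: "y \<in> N u \<inter> K t"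
    then have "cn y \<le> t" using u(2,3) level_comp_self unfolding top_comp_def by blast
    moreover have "t \<le> cn y" using y le_core_number kcore_sub by blast
    ultimately show "y \<in> R" using y level_comp_step[OF u(1) level_comp_self, of y] u by simp
  qed
  moreover have "u \<in> R" using level_comp_self u by simp
  ultimately have "insert u (N u \<inter> K t) \<subseteq> R" by blast
  then have "card (insert u (N u \<inter> K t)) \<le> card R"
    using card_mono finite_subset[OF R(1) finite_V] by blast
  moreover have "t \<le> card (N u \<inter> K t)" by (rule kcore_degree) (use le_core_number[OF u(1)] u(2) in auto)
  ultimately show "t < card R" using N_irrefl[OF u(1)] finite_N[OF u(1)] by simp
qed

lemma top_comps_disjoint:
  assumes "R \<in> top_comps V N t" "R' \<in> top_comps V N t'" "R \<noteq> R'"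
  shows "R \<inter> R' = {}"
  using assms level_comp_disjoint unfolding top_comps_def by blast

end

subsection \<open>The score is invariant under isomorphism\<close>

text \<open>Links vertices and their numbers: \<open>f\<close> will be \<open>(!) vs\<close>, once
  for the whole graph and once for each ego-network, so that the quantities computed on numbers are
  those of \<open>G\<close>.\<close>

locale nbhd_iso = nbhd V N + im: nbhd V' N' for V :: "'a set" and N and V' :: "'b set" and N' +
  fixes f :: "'a \<Rightarrow> 'b"
  assumes f_inj: "inj_on f V" and f_V: "V' = f ` V" and f_N: "x \<in> V \<Longrightarrow> N' (f x) = f ` N x"
begin

lemma image_mem_iff: "x \<in> V \<Longrightarrow> W \<subseteq> V \<Longrightarrow> f x \<in> f ` W \<longleftrightarrow> x \<in> W"
  using f_inj by (auto simp: inj_on_def)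

lemma card_image_Int:
  assumes "x \<in> V" "W \<subseteq> V"
  shows "card (N' (f x) \<inter> f ` W) = card (N x \<inter> W)"
proof -
  have "N' (f x) \<inter> f ` W = f ` (N x \<inter> W)"
    using f_N[OF assms(1)] inj_on_image_Int[OF f_inj N_sub[OF assms(1)] assms(2)] by simp
  moreover have "inj_on f (N x \<inter> W)" using f_inj assms by (meson Int_lower2 inj_on_subset)
  ultimately show ?thesis by (simp add: card_image)
qed

lemma kcore_image: "kcore V' N' t = f ` kcore V N t"
proof (rule antisym)
  show "f ` kcore V N t \<subseteq> kcore V' N' t"
  proof (rule im.kcore_max)
    show "f ` kcore V N t \<subseteq> V'" using kcore_sub f_V by blast
  next
    fix y assume "y \<in> f ` kcore V N t"
    then obtain x where "x \<in> kcore V N t" "y = f x" by blast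
    then show "t \<le> card (N' y \<inter> f ` kcore V N t)"
      using card_image_Int kcore_sub kcore_degree by (metis subsetD)
  qed
next
  have "kcore V' N' t \<subseteq> V'" unfolding kcore_def by blast
  then obtain W where W: "W \<subseteq> V" "kcore V' N' t = f ` W" unfolding f_V by (meson subset_imageE)
  have "W \<subseteq> kcore V N t"
  proof (rule kcore_max[OF W(1)])
    fix x assume x: "x \<in> W"
    then have "t \<le> card (N' (f x) \<inter> kcore V' N' t)"
      using im.kcore_degree W(2) by blast
    then show "t \<le> card (N x \<inter> W)" using card_image_Int[of x W] x W by auto
  qed
  then show "kcore V' N' t \<subseteq> f ` kcore V N t" using W(2) by blast
qed

lemma core_number_image: "x \<in> V \<Longrightarrow> core_number V' N' (f x) = core_number V N x"
  unfolding core_number_def kcore_image using image_mem_iff[OF _ kcore_sub] by simp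

lemma level_comp_image:
  assumes u: "u \<in> V"
  shows "level_comp V' N' (f u) = f ` level_comp V N u"
proof (rule antisym)
  show "level_comp V' N' (f u) \<subseteq> f ` level_comp V N u"
  proof (rule im.level_comp_closed)
    show "f u \<in> f ` level_comp V N u" using level_comp_self by blast
  next
    fix w y
    assume w: "w \<in> f ` level_comp V N u" "y \<in> N' w" and y: "core_number V' N' y = core_number V' N' (f u)"
    then obtain x where x: "x \<in> level_comp V N u" "w = f x" by blast
    then have xV: "x \<in> V" using level_comp_mem[OF u] by blast
    then obtain z where z: "z \<in> N x" "y = f z" using w(2) f_N x(2) by auto
    then have "z \<in> V" using N_sub xV by blast
    then have "core_number V N z = core_number V N u" using y z u core_number_image by simp
    then have "z \<in> level_comp V N u" using level_comp_step[OF u x(1) z(1)] by simp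
    then show "y \<in> f ` level_comp V N u" using z by blast
  qed
next
  have "level_comp V N u \<subseteq> {w \<in> V. f w \<in> level_comp V' N' (f u)}"
  proof (rule level_comp_closed)
    show "u \<in> {w \<in> V. f w \<in> level_comp V' N' (f u)}" using u im.level_comp_self by simp
  next
    fix w y
    assume w: "w \<in> {w \<in> V. f w \<in> level_comp V' N' (f u)}" "y \<in> N w"
      and y: "core_number V N y = core_number V N u"
    have yV: "y \<in> V" using w N_sub by blast
    have "f u \<in> V'" using u f_V by blast
    moreover have "f y \<in> N' (f w)" using w f_N by auto
    moreover have "core_number V' N' (f y) = core_number V' N' (f u)"
      using core_number_image[OF yV] core_number_image[OF u] y by simp
    ultimately have "f y \<in> level_comp V' N' (f u)" using im.level_comp_step w(1) by blast
    then show "y \<in> {w \<in> V. f w \<in> level_comp V' N' (f u)}" using yV by simp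
  qed
  then show "f ` level_comp V N u \<subseteq> level_comp V' N' (f u)" by blast
qed

lemma top_comp_image:
  assumes "u \<in> V"
  shows "top_comp V' N' (f u) \<longleftrightarrow> top_comp V N u"
proof -
  have "(\<forall>y\<in>N' (f x). core_number V' N' y \<le> core_number V' N' (f u)) \<longleftrightarrow>
      (\<forall>y\<in>N x. core_number V N y \<le> core_number V N u)" if "x \<in> level_comp V N u" for x
  proof -
    have x: "x \<in> V" using level_comp_mem[OF assms that] by blast
    have "core_number V' N' (f y) = core_number V N y" if "y \<in> N x" for y
      using core_number_image that N_sub[OF x] by blast
    then show ?thesis unfolding f_N[OF x] core_number_image[OF assms] by simp
  qed
  then show ?thesis unfolding top_comp_def level_comp_image[OF assms] by blast
qed

lemma card_top_comps_image: "card (top_comps V' N' t) = card (top_comps V N t)"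
proof -
  have "{v \<in> V'. core_number V' N' v = t \<and> top_comp V' N' v} =
      f ` {u \<in> V. core_number V N u = t \<and> top_comp V N u}"
  proof -
    have "v \<in> V' \<longleftrightarrow> (\<exists>u\<in>V. v = f u)" for v using f_V by blast
    then show ?thesis by (auto simp: core_number_image top_comp_image)
  qed
  then have "top_comps V' N' t = (`) f ` top_comps V N t"
    unfolding top_comps_def using level_comp_image by (simp add: image_image)
  moreover have "top_comps V N t \<subseteq> Pow V" using top_comp_card(1) by blast
  then have "inj_on ((`) f) (top_comps V N t)" using inj_on_image_Pow[OF f_inj] inj_on_subset by blast
  ultimately show ?thesis by (simp add: card_image)
qed

lemma h_index_image: "h_index V' N' = h_index V N"
proof -
  have "card V' = card V" using f_V f_inj card_image by metis
  then show ?thesis by (simp add: h_index_def card_top_comps_image)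
qed

end

section \<open>Correctness of the algorithms\<close>

lemma verts_induced [simp]: "verts (induced F W) = W" by (simp add: induced_def)

lemma nbrs_induced: "x \<in> W \<Longrightarrow> nbrs (induced F W) x = nbrs F x \<inter> W"
  by (auto simp: nbrs_def induced_def)

lemma simple_graph_induced: "simple_graph F \<Longrightarrow> W \<subseteq> verts F \<Longrightarrow> simple_graph (induced F W)"
  using finite_subset by (auto simp: simple_graph_def induced_def)

lemma subgraph_induced: "W \<noteq> {} \<Longrightarrow> W \<subseteq> verts F \<Longrightarrow> subgraph (induced F W) F"
  by (auto simp: subgraph_def induced_def)

lemma subgraph_trans: "subgraph A B \<Longrightarrow> subgraph B C \<Longrightarrow> subgraph A C"
  unfolding subgraph_def by (meson subset_trans)

lemma le_coreness_iff:
  assumes "finite (verts H)" "verts H \<noteq> {}"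
  shows "t \<le> coreness H \<longleftrightarrow> (\<forall>x\<in>verts H. t \<le> degree H x)"
  using assms by (simp add: coreness_def)

locale sgraph =
  fixes F :: "'a ugraph"
  assumes simple: "simple_graph F"
begin

sublocale nbhd "verts F" "nbrs F"
proof
  show "finite (verts F)" using simple by (simp add: simple_graph_def)
  fix x y
  show "nbrs F x \<subseteq> verts F" "x \<notin> nbrs F x" using simple_graph_nbrs[OF simple] by blast+
  show "y \<in> nbrs F x \<Longrightarrow> x \<in> nbrs F y" by (simp add: nbrs_def insert_commute)
qed

lemma nbrs_iff: "y \<in> nbrs F x \<longleftrightarrow> {x, y} \<in> edges F" by (simp add: nbrs_def insert_commute)

text \<open>The remaining vertices lie between the \<open>t\<close>-core and the
  \<open>(t - 1)\<close>-core. A vertex with fewer than \<open>t\<close> neighbours in a superset of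
  the \<open>t\<close>-core is outside the \<open>t\<close>-core, so the value \<open>t - 1\<close>
  is right for it; once no such vertex is left, the remaining set is the \<open>t\<close>-core.
  Hence the order of deletions does not influence the values.\<close>

lemma core_step_invariant:
  assumes "(core_step F)\<^sup>*\<^sup>* (1, verts F, \<lambda>_. 0) (t, W, c)"
  shows "1 \<le> t \<and> W \<subseteq> K (t - 1) \<and> K t \<subseteq> W \<and> (\<forall>x\<in>verts F - W. c x = cn x)"
  using assms
proof (induction "(t, W, c)" arbitrary: t W c rule: rtranclp_induct)
  case base
  then show ?case using kcore_0 kcore_sub by simp
next
  case (step y)
  obtain t' W' c' where y: "y = (t', W', c')" by (cases y)
  have IH: "1 \<le> t'" "W' \<subseteq> K (t' - 1)" "K t' \<subseteq> W'" "\<forall>x\<in>verts F - W'. c' x = cn x"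
    using step.hyps(3)[OF y] by auto
  from step.hyps(2) show ?case unfolding y
  proof (cases rule: core_step.cases)
    case (delete x)
    then have eqs: "t = t'" "W = W' - {x}" "c = c'(x := t' - 1)"
      and x': "x \<in> W'" "degree (induced F W') x < t'" by simp_all
    have xK: "x \<in> K (t' - 1)" using x' IH(2) by blast
    then have xV: "x \<in> verts F" using kcore_sub by blast
    have "degree (induced F W') x = card (nbrs F x \<inter> W')"
      using x'(1) by (simp add: degree_def nbrs_induced)
    moreover have "card (nbrs F x \<inter> K t') \<le> card (nbrs F x \<inter> W')"
      using IH(3) finite_N[OF xV] by (intro card_mono) auto
    ultimately have x: "x \<notin> K t'" using kcore_degree[of x t'] x'(2) by linarith
    have "cn x = t' - 1" by (rule core_number_eqI[OF xK]) (use x IH(1) in simp)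
    then have "\<forall>y\<in>verts F - W. c y = cn y" unfolding eqs using IH(4) by auto
    moreover have "1 \<le> t" "W \<subseteq> K (t - 1)" "K t \<subseteq> W" unfolding eqs using IH x by blast+
    ultimately show ?thesis by blast
  next
    case next_level
    then have eqs: "t = t' + 1" "W = W'" "c = c'" and W': "\<forall>x\<in>W'. t' \<le> degree (induced F W') x" by simp_all
    have "W' \<subseteq> K t'"
    proof (rule kcore_max)
      show "W' \<subseteq> verts F" using IH(2) kcore_sub by blast
      show "t' \<le> card (nbrs F x \<inter> W')" if "x \<in> W'" for x
        using W' that by (simp add: degree_def nbrs_induced)
    qed
    moreover have "K (t' + 1) \<subseteq> W'" using IH(3) kcore_le[of t' "t' + 1"] by simp
    ultimately show ?thesis unfolding eqs using IH(4) by simp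
  qed
qed

lemma core_decomposition_core_number:
  assumes "core_decomposition F c" "x \<in> verts F"
  shows "c x = cn x"
  using assms core_step_invariant unfolding core_decomposition_def by blast

text \<open>Deletions shrink \<open>W\<close>, and a level \<open>t\<close> can only be left upwards
  while some remaining vertex has degree at least \<open>t\<close>, hence only if
  \<open>t \<le> card (verts F)\<close>. The measure of the induction adds up both kinds of
  progress.\<close>

lemma core_decomposition_exists: "\<exists>c. core_decomposition F c"
proof -
  have "\<exists>t' c'. (core_step F)\<^sup>*\<^sup>* (t, W, c) (t', {}, c')" if "W \<subseteq> verts F" for t W c
    using that
  proof (induction "card W + (card (verts F) + 1 - t)" arbitrary: t W c rule: less_induct)
    case less
    have fin: "finite W" using less.prems finite_V finite_subset by blast
    show ?case
    proof (cases "W = {}")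
      case False
      show ?thesis
      proof (cases "\<exists>x\<in>W. degree (induced F W) x < t")
        case True
        then obtain x where x: "x \<in> W" "degree (induced F W) x < t" by blast
        have "card (W - {x}) < card W" by (rule card_Diff1_less[OF fin x(1)])
        then have "\<exists>t' c'. (core_step F)\<^sup>*\<^sup>* (t, W - {x}, c(x := t - 1)) (t', {}, c')"
          by (intro less.hyps) (use less.prems in auto)
        moreover have "core_step F (t, W, c) (t, W - {x}, c(x := t - 1))" by (rule core_step.delete[OF x])
        ultimately show ?thesis by (meson converse_rtranclp_into_rtranclp)
      next
        case no: False
        obtain x where x: "x \<in> W" using False by blast
        then have "t \<le> card (nbrs F x \<inter> W)" using no by (auto simp: degree_def nbrs_induced not_less)
        also have "\<dots> \<le> card (verts F)" using less.prems by (intro card_mono finite_V) blast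
        finally have "card W + (card (verts F) + 1 - (t + 1)) < card W + (card (verts F) + 1 - t)" by linarith
        then have "\<exists>t' c'. (core_step F)\<^sup>*\<^sup>* (t + 1, W, c) (t', {}, c')"
          by (intro less.hyps) (use less.prems in auto)
        moreover have "core_step F (t, W, c) (t + 1, W, c)"
          by (rule core_step.next_level[OF False]) (use no in \<open>auto simp: not_less\<close>)
        ultimately show ?thesis by (meson converse_rtranclp_into_rtranclp)
      qed
    qed blast
  qed
  from this[OF subset_refl] show ?thesis unfolding core_decomposition_def by blast
qed

lemma bfs_reach_eq:
  assumes "u \<in> verts F" "\<forall>x\<in>verts F. c x = cn x"
  shows "bfs_reach F c (cn u) u = lc u"
proof -
  have "{(a, b). {a, b} \<in> edges F \<and> c a = cn u \<and> c b = cn u} =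
      {(a, b). a \<in> verts F \<and> b \<in> nbrs F a \<and> cn a = cn u \<and> cn b = cn u}"
  proof -
    have "{a, b} \<in> edges F \<and> c a = cn u \<and> c b = cn u \<longleftrightarrow>
        a \<in> verts F \<and> b \<in> nbrs F a \<and> cn a = cn u \<and> cn b = cn u" for a b
    proof (cases "{a, b} \<in> edges F")
      case True
      then have "a \<in> verts F" "b \<in> verts F" using simple by (auto simp: simple_graph_def)
      then show ?thesis using True assms(2) by (simp add: nbrs_iff)
    qed (simp add: nbrs_iff)
    then show ?thesis by simp
  qed
  then show ?thesis by (simp add: bfs_reach_def level_comp_def)
qed

text \<open>On level \<open>t\<close> the visited set \<open>X\<close> consists of whole components,
  so an unvisited vertex of that level opens a component not counted before. Afterwards all of it is
  visited, and the later vertices contribute only other components.\<close>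

lemma count_level_eq:
  assumes c: "\<forall>x\<in>verts F. c x = cn x" and "set us \<subseteq> verts F"
    and "\<And>x. x \<in> verts F \<Longrightarrow> x \<in> X \<Longrightarrow> cn x = t \<Longrightarrow> lc x \<subseteq> X"
  shows "count_level F c t us X =
    card (lc ` {u \<in> set us. cn u = t \<and> u \<notin> X \<and> top_comp (verts F) (nbrs F) u})"
  using assms(2,3)
proof (induction us arbitrary: X)
  case Nil
  then show ?case by simp
next
  case (Cons u us)
  let ?top = "top_comp (verts F) (nbrs F)"
  have u: "u \<in> verts F" "c u = cn u" using Cons.prems(1) c by auto
  show ?case
  proof (cases "c u = t \<and> u \<notin> X")
    case False
    then have "{w \<in> set (u # us). cn w = t \<and> w \<notin> X \<and> ?top w} = {w \<in> set us. cn w = t \<and> w \<notin> X \<and> ?top w}"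
      using u by auto
    moreover have "count_level F c t (u # us) X = count_level F c t us X"
      by (simp only: count_level.simps False if_False)
    moreover have "count_level F c t us X = card (lc ` {w \<in> set us. cn w = t \<and> w \<notin> X \<and> ?top w})"
      by (rule Cons.IH) (use Cons.prems in auto)
    ultimately show ?thesis by simp
  next
    case True
    have R: "bfs_reach F c t u = lc u" using bfs_reach_eq[OF u(1) c] u(2) True by simp
    have "(\<exists>x\<in>lc u. \<exists>y\<in>nbrs F x. t < c y) \<longleftrightarrow> \<not> ?top u"
    proof -
      have "c y = cn y" if "x \<in> lc u" "y \<in> nbrs F x" for x y
        using that c level_comp_mem[OF u(1)] N_sub by blast
      then show ?thesis unfolding top_comp_def using True u(2) by (auto simp: not_le)
    qed
    moreover have "count_level F c t us (X \<union> lc u) = card (lc ` {w \<in> set us. cn w = t \<and> w \<notin> X \<union> lc u \<and> ?top w})"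
    proof (rule Cons.IH)
      show "set us \<subseteq> verts F" using Cons.prems(1) by simp
      show "lc x \<subseteq> X \<union> lc u" if "x \<in> verts F" "x \<in> X \<union> lc u" "cn x = t" for x
        using that Cons.prems(2)[of x] level_comp_eq[OF u(1), of x] by blast
    qed
    moreover have "lc ` {w \<in> set (u # us). cn w = t \<and> w \<notin> X \<and> ?top w} =
      (if ?top u then insert (lc u) else id) (lc ` {w \<in> set us. cn w = t \<and> w \<notin> X \<union> lc u \<and> ?top w})"
      (is "?A = ?B")
    proof (rule antisym)
      show "?A \<subseteq> ?B"
      proof
        fix R assume "R \<in> ?A"
        then obtain w where w: "w \<in> set (u # us)" "cn w = t" "w \<notin> X" "?top w" "R = lc w" by blast
        show "R \<in> ?B"
        proof (cases "w \<in> lc u")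
          case True
          then show ?thesis using w level_comp_eq[OF u(1) True] top_comp_eq[OF u(1) True] by simp
        next
          case False
          then have "w \<noteq> u" using level_comp_self by blast
          then show ?thesis using w False by auto
        qed
      qed
      show "?B \<subseteq> ?A" using True u(2) by auto
    qed
    moreover have "lc u \<notin> lc ` {w \<in> set us. cn w = t \<and> w \<notin> X \<union> lc u \<and> ?top w}"
      using level_comp_self by blast
    ultimately show ?thesis using True R by (simp add: Let_def)
  qed
qed

lemma count_level_all:
  assumes "\<forall>x\<in>verts F. c x = cn x" "set us = verts F"
  shows "count_level F c t us {} = card (top_comps (verts F) (nbrs F) t)"
  using count_level_eq[OF assms(1), of us "{}" t] assms(2) by (simp add: top_comps_def)

lemma le_coreness_kcore:
  assumes "subgraph H F" "t \<le> coreness H"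
  shows "verts H \<subseteq> K t"
proof (rule kcore_max)
  show sub: "verts H \<subseteq> verts F" using assms(1) by (simp add: subgraph_def)
  fix x assume x: "x \<in> verts H"
  have "finite (verts H)" using sub finite_V finite_subset by blast
  then have "t \<le> degree H x" using assms x le_coreness_iff[of H t] by (auto simp: subgraph_def)
  moreover have "nbrs H x \<subseteq> nbrs F x \<inter> verts H" using assms(1) by (auto simp: nbrs_def subgraph_def)
  then have "degree H x \<le> card (nbrs F x \<inter> verts H)" unfolding degree_def
    using finite_N x sub by (intro card_mono) blast+
  ultimately show "t \<le> card (nbrs F x \<inter> verts H)" by linarith
qed

lemma le_coreness_induced:
  assumes "W \<subseteq> verts F" "W \<noteq> {}" "\<And>x. x \<in> W \<Longrightarrow> t \<le> card (nbrs F x \<inter> W)"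
  shows "t \<le> coreness (induced F W)"
proof -
  have "finite W" using assms(1) finite_V finite_subset by blast
  then show ?thesis using assms by (simp add: le_coreness_iff degree_def nbrs_induced)
qed

lemma connected_induced:
  assumes "u \<in> T" "T \<subseteq> verts F" "\<And>w. w \<in> T \<Longrightarrow> (u, w) \<in> {(a, b). a \<in> T \<and> b \<in> T \<and> {a, b} \<in> edges F}\<^sup>*"
  shows "connected_graph (induced F T)"
proof -
  let ?R = "{(a, b). a \<in> T \<and> b \<in> T \<and> {a, b} \<in> edges F}"
  have R: "{(a, b). {a, b} \<in> edges (induced F T)} = ?R" by (auto simp: induced_def)
  have "sym (?R\<^sup>*)" by (rule sym_rtrancl) (auto simp: sym_def insert_commute)
  then have "(x, y) \<in> ?R\<^sup>*" if "x \<in> T" "y \<in> T" for x y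
    using assms(3)[OF that(1)] assms(3)[OF that(2)] by (meson rtrancl_trans symE)
  then show ?thesis unfolding connected_graph_def R using assms(1) by auto
qed

lemma connected_closed_subset:
  assumes "connected_graph H" "subgraph H F" "u \<in> verts H" "u \<in> T"
    and T: "\<And>x y. x \<in> T \<Longrightarrow> y \<in> verts H \<Longrightarrow> y \<in> nbrs F x \<Longrightarrow> y \<in> T"
  shows "verts H \<subseteq> T"
proof
  fix w assume "w \<in> verts H"
  then have "(u, w) \<in> {(a, b). {a, b} \<in> edges H}\<^sup>*" using assms by (simp add: connected_graph_def)
  then show "w \<in> T"
  proof (induction rule: rtrancl_induct)
    case base
    then show ?case using assms by simp
  next
    case (step y z)
    then have "z \<in> verts H" "{y, z} \<in> edges F" using assms(2) by (auto simp: subgraph_def)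
    then show ?case using T[OF step.IH] by (simp add: nbrs_iff)
  qed
qed

lemma subgraph_induced_verts: "subgraph H F \<Longrightarrow> verts H \<subseteq> W \<Longrightarrow> subgraph H (induced F W)"
  by (simp add: subgraph_def induced_def) blast

text \<open>The set \<open>T\<close> is the component of the \<open>r\<close>-core around a vertex
  of \<open>H\<close>. Its induced subgraph is connected, has coreness at least \<open>r\<close> and
  contains \<open>H\<close>, so maximality makes the two equal, edges included. It remains to see
  that all core numbers in \<open>T\<close> are \<open>r\<close>, which turns \<open>T\<close> into
  a level component without edges to higher levels.\<close>

lemma discriminative_core_top_comp:
  assumes D: "discriminative_core F H" and r: "coreness H = r"
  shows "H \<in> induced F ` top_comps (verts F) (nbrs F) r"
proof -
  have H: "subgraph H F" "connected_graph H" using D by (auto simp: discriminative_core_def)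
  have max: "H' = H" if "subgraph H' F" "connected_graph H'" "r \<le> coreness H'" "subgraph H H'" for H'
    using D that r unfolding discriminative_core_def by blast
  have no: "coreness H' \<le> r" if "subgraph H' H" for H'
    using D that r unfolding discriminative_core_def by (meson not_le)
  obtain u where u: "u \<in> verts H" using H by (auto simp: subgraph_def)
  have HK: "verts H \<subseteq> K r" using le_coreness_kcore[OF H(1)] r by simp
  let ?S = "{(a, b). a \<in> K r \<and> b \<in> K r \<and> {a, b} \<in> edges F}"
  define T where "T = {w. (u, w) \<in> ?S\<^sup>*}"
  have uT: "u \<in> T" by (simp add: T_def)
  have TK: "T \<subseteq> K r"
  proof
    fix w assume "w \<in> T"
    then have "(u, w) \<in> ?S\<^sup>*" by (simp add: T_def)
    then show "w \<in> K r" by (cases rule: rtranclE) (use u HK in auto)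
  qed
  have TV: "T \<subseteq> verts F" using TK kcore_sub by blast
  have closed: "y \<in> T" if "x \<in> T" "y \<in> nbrs F x" "y \<in> K r" for x y
  proof -
    have "(x, y) \<in> ?S" using that TK by (auto simp: nbrs_iff)
    then show ?thesis using that(1) unfolding T_def by (auto intro: rtrancl_into_rtrancl)
  qed
  have "(u, w) \<in> {(a, b). a \<in> T \<and> b \<in> T \<and> {a, b} \<in> edges F}\<^sup>*" if "w \<in> T" for w
  proof -
    have "(u, w) \<in> ?S\<^sup>*" using that by (simp add: T_def)
    then show ?thesis
    proof (induction rule: rtrancl_induct)
      case (step y z)
      then have "y \<in> T" by (simp add: T_def)
      moreover have "z \<in> T" using closed[OF \<open>y \<in> T\<close>, of z] step.hyps(2) by (auto simp: nbrs_iff)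
      ultimately have "(y, z) \<in> {(a, b). a \<in> T \<and> b \<in> T \<and> {a, b} \<in> edges F}"
        using step.hyps(2) by simp
      with step.IH show ?case by (rule rtrancl_into_rtrancl)
    qed simp
  qed
  then have conn: "connected_graph (induced F T)" by (rule connected_induced[OF uT TV])
  have core: "r \<le> coreness (induced F T)"
  proof (rule le_coreness_induced[OF TV])
    show "T \<noteq> {}" using uT by blast
    fix x assume x: "x \<in> T"
    then have "nbrs F x \<inter> K r \<subseteq> nbrs F x \<inter> T" using closed by blast
    moreover have "r \<le> card (nbrs F x \<inter> K r)" using kcore_degree x TK by blast
    ultimately show "r \<le> card (nbrs F x \<inter> T)"
      using card_mono[of "nbrs F x \<inter> T" "nbrs F x \<inter> K r"] finite_N[of x] x TV by fastforce
  qed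
  have "verts H \<subseteq> T" by (rule connected_closed_subset[OF H(2,1) u uT]) (use closed HK in blast)
  then have eq: "induced F T = H"
    using max[OF subgraph_induced conn core] subgraph_induced_verts[OF H(1)] uT TV by blast
  have cT: "cn x = r" if "x \<in> T" for x
  proof (rule ccontr)
    assume "cn x \<noteq> r"
    moreover have "r \<le> cn x" using that TK le_core_number TV by blast
    ultimately have xK: "x \<in> K (Suc r)" using that TV le_core_number[of x "Suc r"] by auto
    \<comment> \<open>\<open>T\<close> is closed under neighbours within the \<open>r\<close>-core,
      so the vertices of \<open>T\<close> in the \<open>(r + 1)\<close>-core keep all their
      neighbours there and induce a subgraph of \<open>H\<close> of coreness larger than
      \<open>r\<close>.\<close>
    let ?W = "T \<inter> K (Suc r)"
    have "Suc r \<le> coreness (induced F ?W)"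
    proof (rule le_coreness_induced)
      show "?W \<subseteq> verts F" "?W \<noteq> {}" using TV that xK by auto
      fix z assume z: "z \<in> ?W"
      then have "nbrs F z \<inter> K (Suc r) \<subseteq> ?W" using closed[of z] kcore_le[of r "Suc r"] by auto
      then have "nbrs F z \<inter> K (Suc r) = nbrs F z \<inter> ?W" by blast
      then show "Suc r \<le> card (nbrs F z \<inter> ?W)" using kcore_degree[of z "Suc r"] z by simp
    qed
    moreover have "subgraph (induced F ?W) H" unfolding eq[symmetric]
      using that xK by (auto simp: subgraph_def induced_def)
    ultimately show False using no by fastforce
  qed
  have lcT: "lc u = T"
  proof (rule antisym)
    show "lc u \<subseteq> T"
    proof (rule level_comp_closed[OF uT])
      fix w y assume w: "w \<in> T" "y \<in> nbrs F w" and y: "cn y = cn u"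
      have "y \<in> verts F" using w N_sub TV by blast
      then have "y \<in> K r" using y cT[OF uT] le_core_number[of y r] by simp
      then show "y \<in> T" using closed w by blast
    qed
    show "T \<subseteq> lc u"
    proof
      fix w assume "w \<in> T"
      then have "(u, w) \<in> ?S\<^sup>*" by (simp add: T_def)
      then show "w \<in> lc u"
      proof (induction rule: rtrancl_induct)
        case (step y z)
        then have "z \<in> T" unfolding T_def by (simp add: rtrancl_into_rtrancl)
        then show ?case using level_comp_step[of u y z] step cT uT TV by (auto simp: nbrs_iff)
      qed (rule level_comp_self)
    qed
  qed
  have "top_comp (verts F) (nbrs F) u"
    unfolding top_comp_def lcT
  proof (intro ballI, rule ccontr)
    fix x y assume xy: "x \<in> T" "y \<in> nbrs F x" "\<not> cn y \<le> cn u"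
    then have "y \<in> K r" using le_core_number[of y r] N_sub TV cT[OF uT] by fastforce
    then have "y \<in> T" using closed xy by blast
    then show False using xy cT uT by simp
  qed
  then have "T \<in> top_comps (verts F) (nbrs F) r"
    unfolding top_comps_def using lcT cT[OF uT] uT TV by blast
  then show ?thesis using eq by blast
qed

text \<open>\<open>R\<close> is closed under neighbours within the \<open>r\<close>-core. So a
  connected subgraph of coreness at least \<open>r\<close> that contains \<open>R\<close> cannot
  leave \<open>R\<close>, while a subgraph of larger coreness would put some vertex of
  \<open>R\<close> into the \<open>(r + 1)\<close>-core.\<close>

lemma top_comp_discriminative_core:
  assumes R: "R \<in> top_comps (verts F) (nbrs F) r"
  shows "discriminative_core F (induced F R)" "coreness (induced F R) = r"
proof -
  obtain u where u: "u \<in> verts F" "cn u = r" "top_comp (verts F) (nbrs F) u" "R = lc u"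
    using R by (auto simp: top_comps_def)
  have RV: "R \<subseteq> verts F" and cR: "\<And>x. x \<in> R \<Longrightarrow> cn x = r" using top_comp_card[OF R] by auto
  have uR: "u \<in> R" using u level_comp_self by simp
  have closed: "y \<in> R" if "x \<in> R" "y \<in> nbrs F x" "y \<in> K r" for x y
  proof -
    have "cn y \<le> r" using that u unfolding top_comp_def by blast
    moreover have "r \<le> cn y" using that(3) le_core_number kcore_sub by blast
    ultimately show ?thesis using level_comp_step[OF u(1), of x y] that u by simp
  qed
  have deg: "r \<le> card (nbrs F x \<inter> R)" if "x \<in> R" for x
  proof -
    have "x \<in> K r" using le_core_number[of x r] cR[OF that] that RV by auto
    then have "r \<le> card (nbrs F x \<inter> K r)" by (rule kcore_degree)
    also have "\<dots> \<le> card (nbrs F x \<inter> R)"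
      using closed[OF that] finite_N[of x] that RV by (intro card_mono) auto
    finally show ?thesis .
  qed
  have sub: "subgraph (induced F R) F" by (rule subgraph_induced[OF _ RV]) (use uR in blast)
  have le: "coreness H' \<le> r" if "subgraph H' (induced F R)" for H'
  proof (rule ccontr)
    assume "\<not> ?thesis"
    moreover have "subgraph H' F" by (rule subgraph_trans[OF that sub])
    ultimately have "verts H' \<subseteq> K (Suc r)" using le_coreness_kcore[of H' "Suc r"] by simp
    moreover have "verts H' \<noteq> {}" "verts H' \<subseteq> R" using that by (simp_all add: subgraph_def)
    then obtain x where x: "x \<in> verts H'" "x \<in> R" by blast
    ultimately have "Suc r \<le> cn x" using le_core_number[of x "Suc r"] RV by blast
    then show False using cR[OF x(2)] by simp
  qed
  have ge: "r \<le> coreness (induced F R)"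
    by (rule le_coreness_induced[OF RV]) (use uR deg in auto)
  moreover have "subgraph (induced F R) (induced F R)" using uR by (auto simp: subgraph_def induced_def)
  ultimately show cor: "coreness (induced F R) = r" using le le_antisym by blast
  have "(u, w) \<in> {(a, b). a \<in> R \<and> b \<in> R \<and> {a, b} \<in> edges F}\<^sup>*" if "w \<in> R" for w
  proof -
    have "(u, w) \<in> {(a, b). a \<in> verts F \<and> b \<in> nbrs F a \<and> cn a = cn u \<and> cn b = cn u}\<^sup>*"
      using that u by (simp add: level_comp_def)
    then show ?thesis
    proof (induction rule: rtrancl_induct)
      case (step y z)
      have "y \<in> R" using step.hyps(1) u by (simp add: level_comp_def)
      moreover have "z \<in> R" using level_comp_step[OF u(1), of y z] calculation step.hyps(2) u by auto
      ultimately have "(y, z) \<in> {(a, b). a \<in> R \<and> b \<in> R \<and> {a, b} \<in> edges F}"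
        using step.hyps(2) by (simp add: nbrs_iff)
      with step.IH show ?case by (rule rtrancl_into_rtrancl)
    qed simp
  qed
  then have conn: "connected_graph (induced F R)" by (rule connected_induced[OF uR RV])
  have "H' = induced F R" if H': "subgraph H' F" "connected_graph H'" "r \<le> coreness H'" "subgraph (induced F R) H'" for H'
  proof -
    have "u \<in> verts H'" using H'(4) uR by (auto simp: subgraph_def)
    then have "verts H' \<subseteq> R"
      by (rule connected_closed_subset[OF H'(2,1)]) (use uR closed le_coreness_kcore[OF H'(1,3)] in blast)+
    then have "subgraph H' (induced F R)" using H'(1) by (rule subgraph_induced_verts[rotated])
    then show ?thesis using H'(4) by (auto simp: subgraph_def intro: prod_eqI)
  qed
  then show "discriminative_core F (induced F R)"
    unfolding discriminative_core_def cor using sub conn le by (meson not_le)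
qed

lemma card_discriminative_cores:
  "card {H. discriminative_core F H \<and> coreness H = r} = card (top_comps (verts F) (nbrs F) r)"
proof -
  have "{H. discriminative_core F H \<and> coreness H = r} = induced F ` top_comps (verts F) (nbrs F) r"
    using discriminative_core_top_comp top_comp_discriminative_core by blast
  moreover have "inj_on (induced F) (top_comps (verts F) (nbrs F) r)" by (auto simp: inj_on_def induced_def)
  ultimately show ?thesis by (simp add: card_image)
qed

end

section \<open>Score and upper bound in terms of ego-networks\<close>

lemma verts_ego [simp]: "verts (ego G v) = nbrs G v" by (simp add: ego_def)

lemma nbrs_ego: "u \<in> nbrs G v \<Longrightarrow> nbrs (ego G v) u = nbrs G u \<inter> nbrs G v"
  by (simp add: ego_def nbrs_induced)

lemma simple_graph_ego: "simple_graph G \<Longrightarrow> simple_graph (ego G v)"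
  unfolding ego_def by (rule simple_graph_induced[OF _ simple_graph_nbrs(1)])

lemma sgraph_ego: "simple_graph G \<Longrightarrow> sgraph (ego G v)"
  by (simp add: sgraph_def simple_graph_ego)

lemma hscore_eq:
  assumes "simple_graph G"
  shows "hscore G v = h_index (nbrs G v) (nbrs (ego G v))"
proof -
  interpret E: sgraph "ego G v" by (rule sgraph_ego[OF assms])
  have c: "core_count G v = (\<lambda>i. card (top_comps (nbrs G v) (nbrs (ego G v)) i))"
    by (rule ext) (simp add: core_count_def E.card_discriminative_cores)
  have "finite (verts G)" using assms by (simp add: simple_graph_def)
  then have le: "card (nbrs G v) \<le> card (verts G)"
    using card_mono simple_graph_nbrs(1)[OF assms] by blast
  have "E.cn x \<le> card (verts G)" if "x \<in> verts (ego G v)" for x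
    using E.core_number_less[OF that] le by simp
  then have "h_index (nbrs G v) (nbrs (ego G v)) = Max (h_set (core_count G v) (card (verts G)) 0)"
    using E.h_index_alt[of "card (verts G)"] unfolding c by simp
  then show ?thesis by (simp add: hscore_def h_set_def)
qed

lemma Score_imp_hscore:
  assumes "simple_graph G" "Score G v s"
  shows "s = hscore G v"
proof -
  interpret E: sgraph "ego G v" by (rule sgraph_ego[OF assms(1)])
  obtain c us where c: "core_decomposition (ego G v) c" and us: "set us = nbrs G v"
    and s: "s = descend (\<lambda>t. count_level (ego G v) c t us {}) (Max (insert 0 (c ` nbrs G v))) 0"
    using assms(2) unfolding Score_def by blast
  have cn: "\<forall>x\<in>verts (ego G v). c x = E.cn x" using E.core_decomposition_core_number[OF c] by blast
  have "finite (nbrs G v)" by (rule simple_graph_nbrs(3)[OF assms(1)])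
  then have "E.cn x \<le> Max (insert 0 (c ` nbrs G v))" if "x \<in> verts (ego G v)" for x
    using cn that by simp
  from E.h_index_alt[OF this] have "hscore G v =
      Max (h_set (\<lambda>i. card (top_comps (nbrs G v) (nbrs (ego G v)) i)) (Max (insert 0 (c ` nbrs G v))) 0)"
    unfolding hscore_eq[OF assms(1)] by simp
  moreover have "count_level (ego G v) c t us {} = card (top_comps (nbrs G v) (nbrs (ego G v)) t)" for t
    using E.count_level_all[OF cn] us by simp
  ultimately show ?thesis unfolding s descend_eq by simp
qed

text \<open>Uniqueness of the result does not yet provide a run, and the program has to be matched
  with an actual run of \<open>Score\<close>. One exists because core decomposition terminates and
  \<open>sort_key\<close> supplies the required order of the vertices.\<close>

lemma Score_hscore:
  assumes "simple_graph G"
  shows "Score G v (hscore G v)"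
proof -
  interpret E: sgraph "ego G v" by (rule sgraph_ego[OF assms])
  obtain c where c: "core_decomposition (ego G v) c" using E.core_decomposition_exists by blast
  obtain xs where xs: "set xs = nbrs G v" "distinct xs"
    using finite_distinct_list[OF simple_graph_nbrs(3)[OF assms]] by blast
  have "Score G v (descend (\<lambda>t. count_level (ego G v) c t (sort_key c xs) {}) (Max (insert 0 (c ` nbrs G v))) 0)"
    unfolding Score_def using c xs
    by (intro exI[of _ c] exI[of _ "sort_key c xs"] conjI) simp_all
  from this Score_imp_hscore[OF assms this] show ?thesis by simp
qed

lemma core_number_ego_less:
  assumes G: "simple_graph G" and v: "v \<in> verts G" and u: "u \<in> nbrs G v"
  shows "core_number (nbrs G v) (nbrs (ego G v)) u < core_number (verts G) (nbrs G) u"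
    "core_number (nbrs G v) (nbrs (ego G v)) u < core_number (verts G) (nbrs G) v"
proof -
  interpret E: sgraph "ego G v" by (rule sgraph_ego[OF G])
  interpret G: sgraph G by (rule sgraph.intro[OF G])
  let ?c = "core_number (nbrs G v) (nbrs (ego G v)) u"
  let ?C = "kcore (nbrs G v) (nbrs (ego G v)) ?c"
  have uC: "u \<in> ?C" using E.le_core_number[of u ?c] u by (simp only: verts_ego order_refl)
  have Csub: "?C \<subseteq> nbrs G v" using E.kcore_sub by simp
  have fin: "finite ?C" by (rule finite_subset[OF Csub simple_graph_nbrs(3)[OF G]])
  have v_notin: "v \<notin> ?C" using Csub simple_graph_nbrs(2)[OF G, of v] by blast
  have deg: "?c \<le> card (nbrs G x \<inter> ?C)" if "x \<in> ?C" for x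
  proof -
    have "?c \<le> card (nbrs (ego G v) x \<inter> ?C)" using E.kcore_degree[of x ?c] that by simp
    also have "nbrs (ego G v) x \<inter> ?C = nbrs G x \<inter> ?C" using nbrs_ego[of x G v] that Csub by blast
    finally show ?thesis .
  qed
  have vx: "v \<in> nbrs G x" if "x \<in> ?C" for x using that Csub simple_graph_nbrs(5)[OF G, of x v] by blast
  have "insert v ?C \<subseteq> G.K (Suc ?c)"
  proof (rule G.kcore_max)
    show "insert v ?C \<subseteq> verts G" using v Csub simple_graph_nbrs(1)[OF G, of v] by blast
    fix x assume x: "x \<in> insert v ?C"
    show "Suc ?c \<le> card (nbrs G x \<inter> insert v ?C)"
    proof (cases "x = v")
      case True
      \<comment> \<open>\<open>v\<close> is adjacent to the whole of \<open>?C\<close>, which has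
        more than \<open>?c\<close> elements: \<open>u\<close> has at least \<open>?c\<close>
        neighbours in it and is not its own neighbour.\<close>
      have "?c \<le> card (nbrs G u \<inter> ?C)" by (rule deg[OF uC])
      also have "\<dots> < card ?C"
        by (rule psubset_card_mono[OF fin]) (use uC simple_graph_nbrs(2)[OF G, of u] in blast)
      also have "\<dots> \<le> card (nbrs G x \<inter> insert v ?C)"
        using True Csub fin by (intro card_mono) auto
      finally show ?thesis by simp
    next
      case False
      then have xC: "x \<in> ?C" using x by simp
      have "nbrs G x \<inter> insert v ?C = insert v (nbrs G x \<inter> ?C)" using vx[OF xC] by blast
      then have "card (nbrs G x \<inter> insert v ?C) = Suc (card (nbrs G x \<inter> ?C))" using fin v_notin by simp
      then show ?thesis using deg[OF xC] by simp
    qed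
  qed
  then have "u \<in> G.K (Suc ?c)" "v \<in> G.K (Suc ?c)" using uC by blast+
  then show "?c < core_number (verts G) (nbrs G) u" "?c < core_number (verts G) (nbrs G) v"
    using G.le_core_number G.kcore_sub by (meson Suc_le_eq subsetD)+
qed

lemma finite_upper_bound_set:
  assumes "simple_graph G"
  shows "finite {x::nat. 1 \<le> x \<and> x * (x + 1) \<le> card {u \<in> nbrs G v. x \<le> f u}}"
proof (rule finite_subset)
  show "finite {..card (nbrs G v)}" by simp
  have "x \<le> card (nbrs G v)" if "1 \<le> x" "x * (x + 1) \<le> card {u \<in> nbrs G v. x \<le> f u}" for x
  proof -
    have "x \<le> x * (x + 1)" by simp
    also have "\<dots> \<le> card {u \<in> nbrs G v. x \<le> f u}" by (rule that(2))
    also have "\<dots> \<le> card (nbrs G v)" by (rule card_mono[OF simple_graph_nbrs(3)[OF assms]]) auto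
    finally show ?thesis .
  qed
  then show "{x. 1 \<le> x \<and> x * (x + 1) \<le> card {u \<in> nbrs G v. x \<le> f u}} \<subseteq> {..card (nbrs G v)}" by blast
qed

lemma hscore_le_upper_bound:
  assumes G: "simple_graph G" and c: "core_decomposition G c" and v: "v \<in> verts G"
  shows "hscore G v \<le> upper_bound G c v"
proof -
  interpret E: sgraph "ego G v" by (rule sgraph_ego[OF G])
  interpret G: sgraph G by (rule sgraph.intro[OF G])
  let ?x = "hscore G v"
  let ?T = "\<lambda>i. top_comps (nbrs G v) (nbrs (ego G v)) i"
  let ?U = "{u \<in> nbrs G v. ?x \<le> min (c v) (c u - 1)}"
  show ?thesis
  proof (cases "?x = 0")
    case False
    have "?x \<in> h_set (\<lambda>i. card (?T i)) (card (nbrs G v)) 0"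
      unfolding hscore_eq[OF G] h_index_def by (rule Max_in) (auto simp: h_set_def)
    then have x: "1 \<le> ?x" "?x \<le> (\<Sum>i=?x..card (nbrs G v). card (?T i))"
      using False by (auto simp: h_set_def)
    let ?A = "\<Union>i\<in>{?x..card (nbrs G v)}. ?T i"
    have finA: "finite ?A" using E.finite_top_comps by simp
    have A: "R \<subseteq> nbrs G v \<and> ?x < card R \<and> (\<forall>y\<in>R. ?x \<le> E.cn y)" if R: "R \<in> ?A" for R
    proof -
      obtain i where i: "?x \<le> i" "R \<in> ?T i" using R by auto
      then have "R \<in> top_comps (verts (ego G v)) (nbrs (ego G v)) i" by simp
      from E.top_comp_card[OF this] i(1) show ?thesis by auto
    qed
    \<comment> \<open>A component is nonempty and its level is the core number of its vertices, so
      no component is counted on two levels.\<close>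
    have "?T i \<inter> ?T j = {}" if "i \<noteq> j" for i j
    proof (rule ccontr)
      assume "?T i \<inter> ?T j \<noteq> {}"
      then obtain R where R: "R \<in> top_comps (verts (ego G v)) (nbrs (ego G v)) i"
        "R \<in> top_comps (verts (ego G v)) (nbrs (ego G v)) j" by auto
      obtain y where "y \<in> R" using E.top_comp_card(2)[OF R(1)] by fastforce
      then show False using E.top_comp_card(3)[OF R(1)] E.top_comp_card(3)[OF R(2)] that by metis
    qed
    then have "card ?A = (\<Sum>i=?x..card (nbrs G v). card (?T i))"
      using E.finite_top_comps by (intro card_UN_disjoint) auto
    then have "?x \<le> card ?A" using x(2) by simp
    then have "?x * (?x + 1) \<le> card ?A * (?x + 1)" by (rule mult_right_mono) simp
    also have "\<dots> \<le> (\<Sum>R\<in>?A. card R)"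
      using sum_bounded_below[of ?A "?x + 1" card] A by (simp add: Suc_le_eq)
    also have "\<dots> = card (\<Union>?A)"
    proof (rule card_Union_disjoint[symmetric])
      show "pairwise disjnt ?A"
      proof (rule pairwiseI)
        fix R R' assume R: "R \<in> ?A" "R' \<in> ?A" "R \<noteq> R'"
        then obtain i j where "R \<in> ?T i" "R' \<in> ?T j" by blast
        then show "disjnt R R'" using E.top_comps_disjoint[of R i R' j] R(3) by (simp add: disjnt_def)
      qed
      show "finite R" if "R \<in> ?A" for R
        by (rule finite_subset[OF _ simple_graph_nbrs(3)[OF G]]) (use A[OF that] in blast)
    qed
    also have "\<dots> \<le> card ?U"
    proof (rule card_mono)
      show "finite ?U" using simple_graph_nbrs(3)[OF G] by simp
      show "\<Union>?A \<subseteq> ?U"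
      proof
        fix u assume "u \<in> \<Union>?A"
        then obtain R where R: "R \<in> ?A" "u \<in> R" by blast
        then have u: "u \<in> nbrs G v" "?x \<le> E.cn u" using A[OF R(1)] by auto
        have "c u = G.cn u" "c v = G.cn v"
          using G.core_decomposition_core_number[OF c] v u(1) simple_graph_nbrs(1)[OF G] by blast+
        then show "u \<in> ?U" using core_number_ego_less[OF G v u(1)] u by simp
      qed
    qed
    finally have "?x \<in> {x. 1 \<le> x \<and> x * (x + 1) \<le> card {u \<in> nbrs G v. x \<le> min (c v) (c u - 1)}}"
      using x(1) by blast
    then show ?thesis unfolding upper_bound_def
      using finite_upper_bound_set[OF G, of v "\<lambda>u. min (c v) (c u - 1)"] by (intro Max_ge) auto
  qed simp
qed

section \<open>Optimality of the result of the main loop\<close>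

text \<open>The set \<open>S\<close> holds the best \<open>k\<close> of the vertices not in \<open>L\<close>; a vertex at which the loop stops
  bounds the scores of all later ones.\<close>

lemma topk_loop_correct:
  assumes "topk_loop G k hh L S sc R"
    and G: "simple_graph G" and k: "1 \<le> k" "k \<le> card (verts G)"
    and "\<forall>x\<in>S. sc x = hscore G x" "S \<subseteq> verts G" "card S \<le> k"
    and "distinct L" "set L \<subseteq> verts G" "set L \<inter> S = {}"
    and "sorted_wrt (\<lambda>x y. hh x \<ge> hh y) L" "\<forall>x\<in>set L. hscore G x \<le> hh x"
    and "card S < k \<Longrightarrow> S \<union> set L = verts G"
    and "\<forall>u\<in>S. \<forall>w\<in>verts G - S - set L. hscore G w \<le> hscore G u"
  shows "R \<subseteq> verts G \<and> card R = k \<and> (\<forall>u\<in>R. \<forall>w\<in>verts G - R. hscore G w \<le> hscore G u)"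
  using assms(1,5-)
proof (induction rule: topk_loop.induct)
  case (exhausted S sc)
  \<comment> \<open>If \<open>S\<close> had fewer than \<open>k\<close> elements, then, the list
    being empty, \<open>S\<close> would be all of \<open>verts G\<close>, contradicting
    \<open>k \<le> card (verts G)\<close>.\<close>
  then have "card S = k" using k by (metis Un_empty_right empty_set le_neq_implies_less not_le)
  then show ?case using exhausted by auto
next
  case (stop S v sc L)
  have fin: "finite S" using stop k by (metis card.infinite not_one_le_zero)
  have "hscore G w \<le> hscore G u" if "u \<in> S" "w \<in> verts G - S" for u w
  proof (cases "w \<in> set (v # L)")
    case True
    have "hscore G w \<le> hh w" using stop.prems(8) True by blast
    also have "\<dots> \<le> hh v" using stop.prems(7) True by auto
    also have "\<dots> \<le> Min (sc ` S)" by (rule stop.hyps)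
    also have "\<dots> \<le> sc u" using fin that by simp
    also have "\<dots> = hscore G u" using stop.prems(1) that by blast
    finally show ?thesis .
  next
    case False
    then show ?thesis using stop.prems(10) that by blast
  qed
  then show ?case using stop by blast
next
  case (add S v s L sc R)
  have s: "s = hscore G v" using Score_imp_hscore[OF G add.hyps(2)] .
  have fin: "finite S" using add.prems(2) G finite_subset unfolding simple_graph_def by blast
  have v: "v \<in> verts G" "v \<notin> S" "v \<notin> set L" using add.prems by auto
  have all: "verts G = S \<union> set (v # L)" using add.prems(9) add.hyps(1) by simp
  show ?case
  proof (rule add.IH)
    show "\<forall>x\<in>insert v S. (sc(v := s)) x = hscore G x" using add.prems(1) s by simp
    show "insert v S \<subseteq> verts G" using v add.prems(2) by simp
    show "card (insert v S) \<le> k" using add.hyps(1) v fin by simp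
    show "distinct L" "set L \<subseteq> verts G" "set L \<inter> insert v S = {}"
      "sorted_wrt (\<lambda>x y. hh x \<ge> hh y) L" "\<forall>x\<in>set L. hscore G x \<le> hh x" using add.prems v by auto
    show "insert v S \<union> set L = verts G" using all by simp
    show "\<forall>u\<in>insert v S. \<forall>w\<in>verts G - insert v S - set L. hscore G w \<le> hscore G u" using all by auto
  qed
next
  case (replace S v sc s w L R)
  have s: "s = hscore G v" using Score_imp_hscore[OF G replace.hyps(3)] .
  have fin: "finite S" using replace.prems(2) G finite_subset unfolding simple_graph_def by blast
  have v: "v \<in> verts G" "v \<notin> S" "v \<notin> set L" using replace.prems by auto
  have w: "hscore G w \<le> hscore G u" if "u \<in> S" for u
  proof -
    have "sc w \<le> sc u" using replace.hyps(6) fin that by simp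
    then show ?thesis using replace.prems(1) replace.hyps(5) that by simp
  qed
  have wv: "hscore G w < hscore G v" using replace.hyps(4,5,6) replace.prems(1) s by simp
  show ?case
  proof (rule replace.IH)
    show "\<forall>x\<in>insert v (S - {w}). (sc(v := s)) x = hscore G x" using replace.prems(1) s v by auto
    show "insert v (S - {w}) \<subseteq> verts G" using v replace.prems(2) by auto
    have "card (insert v (S - {w})) = k"
      using replace.hyps(1,5) v fin k card_Suc_Diff1[OF fin replace.hyps(5)] by simp
    then show "card (insert v (S - {w})) \<le> k"
      "card (insert v (S - {w})) < k \<Longrightarrow> insert v (S - {w}) \<union> set L = verts G" by simp_all
    show "distinct L" "set L \<subseteq> verts G" "set L \<inter> insert v (S - {w}) = {}"
      "sorted_wrt (\<lambda>x y. hh x \<ge> hh y) L" "\<forall>x\<in>set L. hscore G x \<le> hh x" using replace.prems v by auto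
    show "\<forall>u\<in>insert v (S - {w}). \<forall>z\<in>verts G - insert v (S - {w}) - set L. hscore G z \<le> hscore G u"
    proof (intro ballI)
      fix u z assume u: "u \<in> insert v (S - {w})" and z: "z \<in> verts G - insert v (S - {w}) - set L"
      have "hscore G z \<le> hscore G w"
        using z replace.prems(10) replace.hyps(5) by (cases "z = w") auto
      also have "\<dots> \<le> hscore G u" using u w wv by auto
      finally show "hscore G z \<le> hscore G u" .
    qed
  qed
next
  case (skip S v sc s L R)
  have s: "s = hscore G v" using Score_imp_hscore[OF G skip.hyps(3)] .
  have fin: "finite S" using skip.prems(2) G finite_subset unfolding simple_graph_def by blast
  have v: "hscore G v \<le> hscore G u" if "u \<in> S" for u
  proof -
    have "s \<le> Min (sc ` S)" by (rule skip.hyps)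
    also have "\<dots> \<le> sc u" using fin that by simp
    finally show ?thesis using skip.prems(1) that s by simp
  qed
  show ?case
  proof (rule skip.IH)
    show "\<forall>u\<in>S. \<forall>w\<in>verts G - S - set L. hscore G w \<le> hscore G u"
    proof (intro ballI)
      fix u w assume "u \<in> S" "w \<in> verts G - S - set L"
      then show "hscore G w \<le> hscore G u" using v skip.prems(10) by (cases "w = v") auto
    qed
  next
    show "\<forall>x\<in>S. sc x = hscore G x" "S \<subseteq> verts G" "card S \<le> k" by (rule skip.prems)+
    show "distinct L" "set L \<subseteq> verts G" "set L \<inter> S = {}"
      "sorted_wrt (\<lambda>x y. hh x \<ge> hh y) L" "\<forall>x\<in>set L. hscore G x \<le> hh x" using skip.prems by auto
    show "card S < k \<Longrightarrow> S \<union> set L = verts G" using skip.hyps(1) by simp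
  qed
qed

lemma TopK_correct:
  assumes G: "simple_graph G" and k: "1 \<le> k" "k \<le> card (verts G)" and T: "TopK G k S"
  shows "S \<subseteq> verts G \<and> card S = k \<and> (\<forall>u\<in>S. \<forall>w\<in>verts G - S. hscore G w \<le> hscore G u)"
proof -
  obtain c L where c: "core_decomposition G c" and L: "distinct L" "set L = verts G"
    "sorted_wrt (\<lambda>x y. upper_bound G c x \<ge> upper_bound G c y) L"
    and loop: "topk_loop G k (upper_bound G c) L {} (\<lambda>_. 0) S"
    using T unfolding TopK_def by blast
  show ?thesis
    by (rule topk_loop_correct[OF loop G k]) (use L hscore_le_upper_bound[OF G c] in auto)
qed

text \<open>A set \<open>T\<close> of the same size with a larger minimum is not contained in
  \<open>S\<close>. An element of \<open>T\<close> outside \<open>S\<close> has a value at most that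
  of any element of \<open>S\<close>, in particular of one attaining the minimum of
  \<open>S\<close>.\<close>

lemma best_imp_arg_max:
  fixes f :: "'a \<Rightarrow> nat"
  assumes V: "finite V" and S: "S \<subseteq> V" "card S = k" "1 \<le> k"
    and best: "\<forall>u\<in>S. \<forall>w\<in>V - S. f w \<le> f u"
  shows "is_arg_max (\<lambda>S. Min (f ` S)) (\<lambda>S. S \<subseteq> V \<and> card S = k) S"
  unfolding is_arg_max_def
proof (intro conjI notI)
  assume "\<exists>T. (T \<subseteq> V \<and> card T = k) \<and> Min (f ` S) < Min (f ` T)"
  then obtain T where T: "T \<subseteq> V" "card T = k" "Min (f ` S) < Min (f ` T)" by blast
  have fin: "finite S" "finite T" using V S(1) T(1) finite_subset by auto
  have "S \<noteq> {}" using S by auto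
  then have "Min (f ` S) \<in> f ` S" using fin by (intro Min_in) auto
  then obtain u where u: "u \<in> S" "Min (f ` S) = f u" by blast
  have "\<not> T \<subseteq> S" using card_subset_eq[OF fin(1), of T] T S(2) by auto
  then obtain w where w: "w \<in> T" "w \<notin> S" by blast
  have "Min (f ` T) \<le> f w" using fin w by simp
  also have "\<dots> \<le> f u" using best u(1) w T(1) by blast
  finally show False using T(3) u(2) by simp
qed (use S in auto)

section \<open>Reasoning about programs\<close>

text \<open>Total correctness: an array access out of bounds and a nonterminating loop both yield
  \<open>None\<close>, so a proof of \<open>wp\<close> excludes them. As the state contains
  \<open>time\<close> and \<open>space\<close>, cost bounds are ordinary postconditions.\<close>

definition wp :: "'x M \<Rightarrow> ('x \<Rightarrow> mem \<Rightarrow> bool) \<Rightarrow> mem \<Rightarrow> bool" where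
  "wp c Q s = (case c s of None \<Rightarrow> False | Some (x, s') \<Rightarrow> Q x s')"

definition tick :: "mem \<Rightarrow> mem" where
  "tick s = s\<lparr>time := time s + 1\<rparr>"

definition upd :: "arr \<Rightarrow> nat \<Rightarrow> nat \<Rightarrow> mem \<Rightarrow> mem" where
  "upd A i x s = s\<lparr>arrays := (arrays s)(A := (arrays s A)[i := x]), time := time s + 1\<rparr>"

lemma tick_simps [simp]: "arrays (tick s) = arrays s" "time (tick s) = Suc (time s)" "space (tick s) = space s"
  by (simp_all add: tick_def)

lemma upd_simps [simp]: "arrays (upd A i x s) = (arrays s)(A := (arrays s A)[i := x])"
  "time (upd A i x s) = Suc (time s)" "space (upd A i x s) = space s"
  by (simp_all add: upd_def)

lemma wp_mono: "wp c P s \<Longrightarrow> (\<And>x s'. P x s' \<Longrightarrow> Q x s') \<Longrightarrow> wp c Q s"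
  by (auto simp: wp_def split: option.splits)

lemma wp_ret [simp]: "wp (ret x) Q = (\<lambda>s. Q x (tick s))"
  by (simp add: wp_def ret_def tick_def fun_eq_iff)

lemma wp_bind [simp]: "wp (bind_M c f) Q = wp c (\<lambda>x. wp (f x) Q)"
  by (auto simp: wp_def bind_M_def fun_eq_iff split: option.splits)

lemma wp_get [simp]: "wp (get A i) Q = (\<lambda>s. i < length (arrays s A) \<and> Q (arrays s A ! i) (tick s))"
  by (simp add: wp_def get_def tick_def fun_eq_iff)

lemma wp_put [simp]: "wp (put A i x) Q = (\<lambda>s. i < length (arrays s A) \<and> Q () (upd A i x s))"
  by (simp add: wp_def put_def upd_def fun_eq_iff)

lemma wp_new: "wp (new A l) Q s \<longleftrightarrow> Q () (s\<lparr>arrays := (arrays s)(A := replicate l 0),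
     time := time s + l + 1, space := space s + l\<rparr>)"
  by (simp add: wp_def new_def)

lemma wp_case_prod [simp]: "wp (case p of (x, y) \<Rightarrow> f x y) Q = wp (f (fst p) (snd p)) Q"
  by (cases p) simp

lemma wp_if [simp]: "wp (if b then c else d) Q = (\<lambda>s. (b \<longrightarrow> wp c Q s) \<and> (\<not> b \<longrightarrow> wp d Q s))"
  by auto

lemma wp_loop_list:
  assumes "I [] x s"
    and "\<And>done i todo x s. is = done @ i # todo \<Longrightarrow> I done x s \<Longrightarrow> wp (f i x) (I (done @ [i])) (tick s)"
    and "\<And>x s. I is x s \<Longrightarrow> Q x (tick s)"
  shows "wp (loop is x f) Q s"
proof -
  have "wp (loop todo x f) Q s" if "is = done @ todo" "I done x s" for "done" todo x s
    using that
  proof (induction todo arbitrary: "done" x s)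
    case Nil
    then show ?case using assms(3) by simp
  next
    case (Cons i todo)
    have "wp (f i x) (I (done @ [i])) (tick s)" using assms(2) Cons.prems by blast
    then have "wp (f i x) (\<lambda>x. wp (loop todo x f) Q) (tick s)"
      by (rule wp_mono) (use Cons in auto)
    then show ?case by simp
  qed
  then show ?thesis using assms(1) by simp
qed

lemma wp_loop:
  assumes "lo \<le> hi" "I lo x s"
    and step: "\<And>i x s. lo \<le> i \<Longrightarrow> i < hi \<Longrightarrow> I i x s \<Longrightarrow> wp (f i x) (I (Suc i)) (tick s)"
    and Q: "\<And>x s. I hi x s \<Longrightarrow> Q x (tick s)"
  shows "wp (loop [lo..<hi] x f) Q s"
proof (rule wp_loop_list[where I = "\<lambda>done x s. I (lo + length done) x s"])
  show "I (lo + length []) x s" using assms(2) by simp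
  show "Q x (tick s)" if "I (lo + length [lo..<hi]) x s" for x s using that Q assms(1) by simp
  fix "done" i todo x s
  assume d: "[lo..<hi] = done @ i # todo" and I: "I (lo + length done) x s"
  have "length done < length [lo..<hi]" unfolding d by simp
  moreover have "[lo..<hi] ! length done = i" unfolding d by simp
  ultimately have "i = lo + length done" "i < hi" by auto
  then show "wp (f i x) (I (lo + length (done @ [i]))) (tick s)" using step[of i x s] I by simp
qed

text \<open>The measure \<open>m\<close> only ensures termination. Running times are tracked by the
  invariant, which speaks about the state and therefore about \<open>time\<close>; the step charged
  for each iteration and for the final test appears as \<open>tick\<close>.\<close>

lemma wp_while:
  fixes m :: "'b \<Rightarrow> nat"
  assumes "I x s"
    and step: "\<And>x s. I x s \<Longrightarrow> b x \<Longrightarrow> wp (f x) (\<lambda>x' s'. I x' s' \<and> m x' < m x) (tick s)"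
    and Q: "\<And>x s. I x s \<Longrightarrow> \<not> b x \<Longrightarrow> Q x (tick s)"
  shows "wp (while_M b x f) Q s"
proof -
  define P where "P r = (case r of None \<Rightarrow> False | Some (y, s') \<Rightarrow> I y s')" for r :: "('b \<times> mem) option"
  define w where "w r = (case r of None \<Rightarrow> 0 | Some (y, s') \<Rightarrow> m y)" for r :: "('b \<times> mem) option"
  let ?b = "\<lambda>r. case r of None \<Rightarrow> False | Some (y, s') \<Rightarrow> b y"
  let ?c = "\<lambda>r. case r of None \<Rightarrow> None | Some (y, s') \<Rightarrow> f y (s'\<lparr>time := time s' + 1\<rparr>)"
  have 1: "P (?c r) \<and> w (?c r) < w r" if r: "P r" "?b r" for r
  proof -
    obtain y s' where y: "r = Some (y, s')" "I y s'" "b y" using r by (auto simp: P_def split: option.splits)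
    then show ?thesis using step[OF y(2,3)]
      by (auto simp: P_def w_def wp_def tick_def split: option.splits)
  qed
  have 0: "P (Some (x, s))" using assms(1) by (simp add: P_def)
  obtain r where r: "while_option ?b ?c (Some (x, s)) = Some r"
    using measure_while_option_Some[where P = P and f = w, OF 1 0] by blast
  have "P r" by (rule while_option_rule[where P = P, OF _ r 0]) (use 1 in blast)
  moreover have "\<not> ?b r" by (rule while_option_stop[OF r])
  ultimately obtain y s' where "r = Some (y, s')" "I y s'" "\<not> b y" by (auto simp: P_def split: option.splits)
  moreover from this have "while_M b x f s = ret y s'" using r by (simp only: while_M_def option.case prod.case)
  ultimately show ?thesis using Q[of y s'] by (simp add: wp_def ret_def tick_def)
qed

text \<open>Lengths and \<open>space\<close> are preserved as well, since all allocation happens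
  before the subprograms run; index bounds established once remain valid.\<close>

definition frame :: "arr set \<Rightarrow> mem \<Rightarrow> mem \<Rightarrow> bool" where
  "frame X s s' \<longleftrightarrow> (\<forall>A. A \<notin> X \<longrightarrow> arrays s' A = arrays s A) \<and>
     (\<forall>A. length (arrays s' A) = length (arrays s A)) \<and> space s' = space s"

lemma frame_refl [simp]: "frame X s s" by (simp add: frame_def)

lemma frame_tick [simp]: "frame X s (tick s') = frame X s s'" "frame X (tick s) s' = frame X s s'"
  by (simp_all add: frame_def)

lemma frame_upd [simp]: "frame X s s' \<Longrightarrow> A \<in> X \<Longrightarrow> frame X s (upd A i x s')"
  by (auto simp: frame_def)

lemma frame_trans: "frame X s s' \<Longrightarrow> frame Y s' s'' \<Longrightarrow> Y \<subseteq> X \<Longrightarrow> frame X s s''"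
  unfolding frame_def by (metis subsetD)

lemma frame_arr: "frame X s s' \<Longrightarrow> A \<notin> X \<Longrightarrow> arrays s' A = arrays s A"
  by (simp add: frame_def)

lemma frame_length: "frame X s s' \<Longrightarrow> length (arrays s' A) = length (arrays s A)"
  by (simp add: frame_def)

section \<open>Core decomposition\<close>

locale nat_nbhd = nbhd V N for V :: "nat set" and N
begin

text \<open>The first \<open>q\<close> entries of \<open>ord\<close> are the vertices deleted so
  far. Comparing them with the last one is what makes the final entry of \<open>Order\<close> a
  vertex of largest core number, whose value \<open>core_prog\<close> returns.\<close>

definition deleted :: "nat \<Rightarrow> nat list \<Rightarrow> nat list \<Rightarrow> nat list \<Rightarrow> bool" where
  "deleted q del ord ca \<longleftrightarrow> q \<le> length ord \<and> distinct (take q ord) \<and> set (take q ord) \<subseteq> V \<and>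
     (\<forall>u\<in>V. del ! u = (if u \<in> set (take q ord) then 1 else 0)) \<and>
     (\<forall>u\<in>set (take q ord). ca ! u = cn u \<and> cn u \<le> cn (last (take q ord)))"

lemma deleted_card:
  assumes "deleted q del ord ca"
  shows "q = card (set (take q ord))" "q \<le> card V" "u \<in> V - set (take q ord) \<Longrightarrow> q < card V"
proof -
  show q: "q = card (set (take q ord))" using assms by (simp add: deleted_def distinct_card)
  show "q \<le> card V" using q assms card_mono[OF finite_V] unfolding deleted_def by metis
  show "q < card V" if "u \<in> V - set (take q ord)"
    by (subst q) (rule psubset_card_mono[OF finite_V], use that assms in \<open>auto simp: deleted_def\<close>)
qed

lemma take_Suc_update: "q < length xs \<Longrightarrow> take (Suc q) (xs[q := x]) = take q xs @ [x]"
  by (simp add: take_Suc_conv_app_nth)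

lemma deleted_step:
  assumes d: "deleted q del ord ca" and u: "u \<in> V" "u \<notin> set (take q ord)"
    and len: "q < length ord" "\<forall>x\<in>V. x < length del" "\<forall>x\<in>V. x < length ca"
    and c: "c = cn u" "\<forall>x\<in>set (take q ord). cn x \<le> cn u"
  shows "deleted (Suc q) (del[u := Suc 0]) (ord[q := u]) (ca[u := c])"
proof -
  have t: "take (Suc q) (ord[q := u]) = take q ord @ [u]" by (rule take_Suc_update[OF len(1)])
  have "\<forall>w\<in>set (take q ord). w \<in> V \<and> w \<noteq> u" using d u unfolding deleted_def by blast
  then show ?thesis unfolding deleted_def t using d u len c
    by (simp add: deleted_def nth_list_update Suc_leI)
qed

text \<open>\<open>D0\<close> and \<open>D\<close> are the vertices deleted before the current level
  and up to now, \<open>P\<close> those whose deletion has already been subtracted from the stored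
  degrees. A stored degree may thus be too large but never too small; if it is below
  \<open>t\<close>, so is the number of neighbours in the \<open>t\<close>-core.\<close>

lemma level_core_number:
  assumes t: "1 \<le> t" and D: "V - D0 = K (t - 1)" and KD: "K t \<subseteq> V - D" and P: "P \<subseteq> D"
    and u: "u \<in> V - D0" "card (N u - P) < t"
  shows "cn u = t - 1" "u \<notin> K t"
proof -
  show n: "u \<notin> K t"
  proof
    assume "u \<in> K t"
    then have "t \<le> card (N u \<inter> K t)" by (rule kcore_degree)
    also have "\<dots> \<le> card (N u - P)" using KD P finite_N[of u] u(1) by (intro card_mono) auto
    finally show False using u(2) by simp
  qed
  show "cn u = t - 1" by (rule core_number_eqI) (use n u(1) D t in auto)
qed

lemma level_end:
  assumes "K t \<subseteq> V - D" and "\<forall>w\<in>V - D. t \<le> card (N w - D)"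
  shows "V - D = K t"
proof (rule antisym)
  show "V - D \<subseteq> K t"
  proof (rule kcore_max)
    fix w assume w: "w \<in> V - D"
    have "N w - D = N w \<inter> (V - D)" using N_sub[of w] w by blast
    then show "t \<le> card (N w \<inter> (V - D))" using assms(2) w by metis
  qed blast
qed (rule assms(1))

lemma degree_without_insert:
  assumes "w \<in> V" "u \<in> N w" "u \<notin> P"
  shows "card (N w - insert u P) = card (N w - P) - 1" "1 \<le> card (N w - P)"
proof -
  have "N w - insert u P = (N w - P) - {u}" by blast
  moreover have "u \<in> N w - P" "finite (N w - P)" using assms finite_N by auto
  ultimately show "card (N w - insert u P) = card (N w - P) - 1" "1 \<le> card (N w - P)"
    by (simp_all add: Suc_le_eq card_gt_0_iff, blast)
qed

text \<open>A vertex is scanned at level \<open>t\<close> only if it survived the previous scan, hence has core number at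
  least \<open>t - 2\<close>. So each scanned vertex contributes to the growth of the potential, which stays
  linear in the size of the graph.\<close>

lemma potential_step:
  assumes L: "L \<subseteq> V" "\<forall>u\<in>L. t \<le> cn u + 2"
  shows "(\<Sum>u\<in>V. min t (cn u + 3)) + card L \<le> (\<Sum>u\<in>V. min (Suc t) (cn u + 3))"
proof -
  have "(\<Sum>u\<in>V. if u \<in> L then 1 else 0) = card L"
    using L(1) finite_V by (simp add: sum.If_cases Int_absorb1)
  then have "(\<Sum>u\<in>V. min t (cn u + 3)) + card L = (\<Sum>u\<in>V. min t (cn u + 3) + (if u \<in> L then 1 else 0))"
    by (simp add: sum.distrib)
  \<comment> \<open>A scanned vertex has \<open>t \<le> cn u + 2\<close>, below the cap
    \<open>cn u + 3\<close>, so its summand really grows by one.\<close>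
  also have "\<dots> \<le> (\<Sum>u\<in>V. min (Suc t) (cn u + 3))"
    by (rule sum_mono) (use L(2) in auto)
  finally show ?thesis .
qed

end

definition adj_rep :: "arr \<Rightarrow> arr \<Rightarrow> nat set \<Rightarrow> (nat \<Rightarrow> nat set) \<Rightarrow> mem \<Rightarrow> bool" where
  "adj_rep DA AA V N s \<longleftrightarrow> (\<forall>u\<in>V. u < length (arrays s Off) \<and> u < length (arrays s DA) \<and>
     arrays s DA ! u = card (N u) \<and> arrays s Off ! u + card (N u) \<le> length (arrays s AA) \<and>
     bij_betw (\<lambda>j. arrays s AA ! j) {arrays s Off ! u..<arrays s Off ! u + card (N u)} (N u))"

lemma adj_rep_frame: "adj_rep DA AA V N s \<Longrightarrow> frame X s s' \<Longrightarrow> {Off, DA, AA} \<inter> X = {} \<Longrightarrow> adj_rep DA AA V N s'"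
  by (simp add: adj_rep_def frame_def)

lemma wp_mono_pair:
  "wp c (\<lambda>(a, b) s'. P a b s') s \<Longrightarrow> (\<And>a b s'. P a b s' \<Longrightarrow> Q (a, b) s') \<Longrightarrow> wp c Q s"
  by (erule wp_mono) auto

text \<open>Used twice: for the whole graph, and for each ego-network with \<open>Adj\<close> itself
  as the list of its vertices. The assumptions keep the arrays that are read apart from those that
  are written, and the output apart from the auxiliary arrays.\<close>

locale core_arrays = nat_nbhd V N for V N +
  fixes VA DA AA CA :: arr
  assumes arrs: "{VA, DA, AA, Off} \<inter> {CA, Cur, Deleted, Alive, Order} = {}" "CA \<notin> {Cur, Deleted, Alive, Order}"
begin

lemma arr_neq [simp]: "CA \<noteq> Cur" "CA \<noteq> Deleted" "CA \<noteq> Alive" "CA \<noteq> Order" "CA \<noteq> VA" "CA \<noteq> DA" "CA \<noteq> AA" "CA \<noteq> Off"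
  "Cur \<noteq> CA" "Deleted \<noteq> CA" "Alive \<noteq> CA" "Order \<noteq> CA" "VA \<noteq> CA" "DA \<noteq> CA" "AA \<noteq> CA" "Off \<noteq> CA"
  "VA \<noteq> Cur" "VA \<noteq> Deleted" "VA \<noteq> Alive" "VA \<noteq> Order" "DA \<noteq> Cur" "DA \<noteq> Deleted" "DA \<noteq> Alive" "DA \<noteq> Order"
  "AA \<noteq> Cur" "AA \<noteq> Deleted" "AA \<noteq> Alive" "AA \<noteq> Order"
  using arrs by auto

definition sizes :: "mem \<Rightarrow> bool" where
  "sizes s \<longleftrightarrow> (\<forall>u\<in>V. u < length (arrays s Cur) \<and> u < length (arrays s Deleted) \<and> u < length (arrays s CA)) \<and>
     card V \<le> length (arrays s Order) \<and> card V \<le> length (arrays s Alive)"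

lemma sizes_frame: "sizes s \<Longrightarrow> frame X s s' \<Longrightarrow> sizes s'"
  by (simp add: sizes_def frame_length)

lemma sizes_tick [simp]: "sizes (tick s) = sizes s" by (simp add: sizes_def)

text \<open>The state at level \<open>t\<close> after \<open>q\<close> deletions; the degrees \<open>f\<close> in \<open>Cur\<close> lag behind the deletions.\<close>

definition level :: "nat \<Rightarrow> nat \<Rightarrow> (nat \<Rightarrow> nat) \<Rightarrow> mem \<Rightarrow> bool" where
  "level t q f s \<longleftrightarrow> deleted q (arrays s Deleted) (arrays s Order) (arrays s CA) \<and>
     K t \<subseteq> V - set (take q (arrays s Order)) \<and> V - set (take q (arrays s Order)) \<subseteq> K (t - 1) \<and>
     (\<forall>w\<in>V - set (take q (arrays s Order)). arrays s Cur ! w = f w)"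

lemma level_tick [simp]: "level t q f (tick s) = level t q f s" by (simp add: level_def)

lemma level_upd_Alive [simp]: "level t q f (upd Alive i x s) = level t q f s"
  by (simp add: level_def)

lemma level_cong:
  "level t q f s \<Longrightarrow> (\<And>w. w \<in> V \<Longrightarrow> w \<notin> set (take q (arrays s Order)) \<Longrightarrow> f w = f' w) \<Longrightarrow> level t q f' s"
  by (simp add: level_def)

lemma level_upd_Cur:
  assumes "level t q f s" "sizes s" "w \<in> V" "f' w = x" "\<And>v. v \<noteq> w \<Longrightarrow> v \<in> V \<Longrightarrow> f' v = f v"
  shows "level t q f' (upd Cur w x s)"
  using assms by (simp add: level_def sizes_def nth_list_update)

lemma level_q: "level t q f s \<Longrightarrow> q \<le> length (arrays s Order) \<and> q \<le> card V"
  using deleted_card(2) by (auto simp: level_def deleted_def)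

lemma level_deleted: "level t q f s \<Longrightarrow> u \<in> V \<Longrightarrow> arrays s Deleted ! u = (if u \<in> set (take q (arrays s Order)) then 1 else 0)"
  by (simp add: level_def deleted_def)

text \<open>The step shared by the scan and by the propagation: a vertex whose stored degree is
  below \<open>t\<close> gets the value \<open>t - 1\<close> and the next place in
  \<open>Order\<close>. As the vertex was not yet deleted, \<open>q\<close> is less than
  \<open>card V\<close>, so the place exists.\<close>

lemma level_mark:
  assumes L: "level t q f s" and S: "sizes s" and t: "1 \<le> t"
    and u: "u \<in> V" "u \<notin> set (take q (arrays s Order))"
    and P: "P \<subseteq> set (take q (arrays s Order))" "card (N u - P) < t"
  shows "q < card V"
    "level t (Suc q) f (upd Order q u (upd CA u (t - 1) (upd Deleted u 1 s)))"
    "take (Suc q) ((arrays s Order)[q := u]) = take q (arrays s Order) @ [u]"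
proof -
  let ?D = "set (take q (arrays s Order))"
  have del: "deleted q (arrays s Deleted) (arrays s Order) (arrays s CA)" and KD: "K t \<subseteq> V - ?D"
    and DK: "V - ?D \<subseteq> K (t - 1)" and f: "\<forall>w\<in>V - ?D. arrays s Cur ! w = f w"
    using L by (auto simp: level_def)
  show q: "q < card V" by (rule deleted_card(3)[OF del]) (use u in blast)
  then have ql: "q < length (arrays s Order)" using S by (simp add: sizes_def)
  have "u \<in> V - (V - K (t - 1))" using DK u kcore_sub by blast
  moreover have "V - (V - K (t - 1)) = K (t - 1)" using kcore_sub by blast
  ultimately have cu: "cn u = t - 1" "u \<notin> K t"
    using level_core_number[OF t _ KD P(1) _ P(2), of "V - K (t - 1)"] by auto
  have "cn x \<le> cn u" if "x \<in> ?D" for x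
  proof -
    have "x \<in> V" using that del unfolding deleted_def by blast
    moreover have "x \<notin> K t" using that KD by blast
    ultimately show ?thesis using le_core_number[of x t] cu(1) by simp
  qed
  then have del': "deleted (Suc q) ((arrays s Deleted)[u := Suc 0]) ((arrays s Order)[q := u]) ((arrays s CA)[u := t - 1])"
    by (intro deleted_step[OF del u ql]) (use S cu in \<open>auto simp: sizes_def\<close>)
  show t: "take (Suc q) ((arrays s Order)[q := u]) = take q (arrays s Order) @ [u]"
    by (rule take_Suc_update[OF ql])
  show "level t (Suc q) f (upd Order q u (upd CA u (t - 1) (upd Deleted u 1 s)))"
    unfolding level_def using del' KD DK f cu(2) by (simp add: t) blast
qed

text \<open>The nested loops of \<open>core_prog\<close> are split into named pieces, so that each
  loop has its own invariant and lemma; the pieces are the program text itself, as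
  \<open>core_prog_unfold\<close> confirms by reflexivity.\<close>

definition relax_nbrs :: "nat \<Rightarrow> nat \<Rightarrow> nat \<Rightarrow> nat \<Rightarrow> nat M" where
  "relax_nbrs t o1 d q' = loop [o1..<o1 + d] q' (\<lambda>j q'. do {
           w \<leftarrow> get AA j; x \<leftarrow> get Deleted w;
           if x = 1 then ret q'
           else do {
             e \<leftarrow> get Cur w; put Cur w (e - 1);
             if e - 1 < t then do {put Deleted w 1; put CA w (t - 1); put Order q' w; ret (q' + 1)}
             else ret q'}})"

lemma relax_nbrs_wp:
  assumes S: "sizes s" and t: "1 \<le> t" and h: "h < q" "arrays s Order ! h = u" "P = set (take h (arrays s Order))"
    and L: "level t q (\<lambda>w. card (N w - P)) s"
    and ge: "\<forall>w\<in>V - set (take q (arrays s Order)). t \<le> card (N w - P)"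
    and adj: "o1 + d \<le> length (arrays s AA)" "bij_betw (\<lambda>j. arrays s AA ! j) {o1..<o1 + d} (N u)"
  shows "wp (relax_nbrs t o1 d q) (\<lambda>q' s'. frame {CA, Cur, Deleted, Order} s s' \<and> q \<le> q' \<and>
    take q (arrays s' Order) = take q (arrays s Order) \<and> level t q' (\<lambda>w. card (N w - insert u P)) s' \<and>
    (\<forall>w\<in>V - set (take q' (arrays s' Order)). t \<le> card (N w - insert u P)) \<and>
    time s' \<le> time s + 9 * d + 1) s"
proof -
  let ?Z = "\<lambda>j. (\<lambda>j. arrays s AA ! j) ` {o1..<j}"
  \<comment> \<open>While the list of \<open>u\<close> is being traversed, the deletion of
    \<open>u\<close> has been taken into account for the neighbours \<open>?Z j\<close> read so far,
    but not yet for the others.\<close>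
  let ?f = "\<lambda>j w. card (N w - (if w \<in> ?Z j then insert u P else P))"
  let ?D = "set (take q (arrays s Order))"
  have lq: "q \<le> length (arrays s Order)" using level_q[OF L] by simp
  have DV: "?D \<subseteq> V" "distinct (take q (arrays s Order))" using L unfolding level_def deleted_def by blast+
  have "take q (arrays s Order) ! h = u" using h by simp
  then have uD: "u \<in> ?D" using h lq by (metis length_take min.absorb2 nth_mem)
  have PD: "P \<subseteq> ?D" unfolding h(3) using h(1) by (intro set_take_subset_set_take) simp
  have uP: "u \<notin> P"
  proof
    assume "u \<in> P"
    then obtain i where i: "i < h" "i < length (arrays s Order)" "arrays s Order ! i = u"
      unfolding h(3) by (auto simp: in_set_conv_nth)
    then have "take q (arrays s Order) ! i = take q (arrays s Order) ! h" using h by simp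
    moreover have "i < length (take q (arrays s Order))" "h < length (take q (arrays s Order))" using i h lq by auto
    ultimately have "i = h" using DV(2) nth_eq_iff_index_eq by blast
    then show False using i(1) by simp
  qed
  have uV: "u \<in> V" using uD DV by blast
  have inj: "inj_on (\<lambda>j. arrays s AA ! j) {o1..<o1 + d}" and img: "?Z (o1 + d) = N u"
    using adj(2) by (auto simp: bij_betw_def)
  define I where "I j q' s' \<longleftrightarrow> frame {CA, Cur, Deleted, Order} s s' \<and> q \<le> q' \<and>
    take q (arrays s' Order) = take q (arrays s Order) \<and> level t q' (?f j) s' \<and>
    (\<forall>w\<in>V - set (take q' (arrays s' Order)). t \<le> ?f j w) \<and> time s' \<le> time s + 9 * (j - o1)" for j q' s'
  show ?thesis
    unfolding relax_nbrs_def
  proof (rule wp_loop[where I = I])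
    show "I o1 q s" unfolding I_def using L ge by simp
  next
    fix q' s' assume I: "I (o1 + d) q' s'"
    have f: "?f (o1 + d) w = card (N w - insert u P)" if "w \<in> V" for w
    proof (cases "w \<in> N u")
      case False
      then have "u \<notin> N w" using N_sym that by blast
      then show ?thesis using False img by simp
    qed (simp add: img)
    have L': "level t q' (\<lambda>w. card (N w - insert u P)) s'"
      by (rule level_cong[of _ _ "?f (o1 + d)"]) (use I f in \<open>auto simp: I_def\<close>)
    have "\<forall>w\<in>V - set (take q' (arrays s' Order)). t \<le> card (N w - insert u P)"
      using I f by (simp add: I_def)
    then show "frame {CA, Cur, Deleted, Order} s (tick s') \<and> q \<le> q' \<and>
      take q (arrays (tick s') Order) = take q (arrays s Order) \<and> level t q' (\<lambda>w. card (N w - insert u P)) (tick s') \<and>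
      (\<forall>w\<in>V - set (take q' (arrays (tick s') Order)). t \<le> card (N w - insert u P)) \<and>
      time (tick s') \<le> time s + 9 * d + 1"
      using L' I by (simp add: I_def)
  next
    fix j q' s' assume j: "o1 \<le> j" "j < o1 + d" and I: "I j q' s'"
    let ?w = "arrays s AA ! j"
    let ?D' = "set (take q' (arrays s' Order))"
    have fr: "frame {CA, Cur, Deleted, Order} s s'" and qq: "q \<le> q'"
      and pre: "take q (arrays s' Order) = take q (arrays s Order)" and L': "level t q' (?f j) s'"
      and ge': "\<forall>w\<in>V - ?D'. t \<le> ?f j w" and tm: "time s' \<le> time s + 9 * (j - o1)"
      using I by (auto simp: I_def)
    have S': "sizes s'" by (rule sizes_frame[OF S fr])
    have AA': "arrays s' AA = arrays s AA" by (rule frame_arr[OF fr]) simp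
    have wN: "?w \<in> N u" using j img by (metis atLeastLessThan_iff imageI)
    have wV: "?w \<in> V" using wN N_sub uV by blast
    have uw: "u \<in> N ?w" using N_sym uV wN by blast
    have wZ: "?w \<notin> ?Z j"
    proof
      assume "?w \<in> ?Z j"
      then obtain i where "o1 \<le> i" "i < j" "?w = arrays s AA ! i" by auto
      then show False using inj_onD[OF inj, of j i] j by simp
    qed
    have Z: "?Z (Suc j) = insert ?w (?Z j)" using j by (auto simp: atLeastLessThanSuc)
    have lq': "q' \<le> length (arrays s' Order)" using level_q[OF L'] by simp
    have DD': "?D \<subseteq> ?D'" using pre qq by (metis set_take_subset_set_take)
    have len: "?w < length (arrays s' Deleted)" "?w < length (arrays s' Cur)" "?w < length (arrays s' CA)"
      "card V \<le> length (arrays s' Order)" "j < length (arrays s' AA)"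
      using S' wV adj j by (auto simp: sizes_def AA')
    have fs: "?f (Suc j) v = ?f j v" if "v \<noteq> ?w" for v using that Z by simp
    have f1: "?f j ?w = card (N ?w - P)" "?f (Suc j) ?w = card (N ?w - P) - 1" "1 \<le> card (N ?w - P)"
      using wZ Z degree_without_insert[OF wV uw uP] by simp_all
    have tm': "9 * (Suc j - o1) = 9 * (j - o1) + 9" using j by simp
    show "wp (do {
           w \<leftarrow> get AA j; x \<leftarrow> get Deleted w;
           if x = 1 then ret q'
           else do {
             e \<leftarrow> get Cur w; put Cur w (e - 1);
             if e - 1 < t then do {put Deleted w 1; put CA w (t - 1); put Order q' w; ret (q' + 1)}
             else ret q'}}) (I (Suc j)) (tick s')"
    proof (cases "?w \<in> ?D'")
      case True
      then have d: "arrays s' Deleted ! ?w = 1" using level_deleted[OF L' wV] by simp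
      have "level t q' (?f (Suc j)) s'"
        by (rule level_cong[OF L']) (metis fs True)
      moreover have "\<forall>w\<in>V - ?D'. t \<le> ?f (Suc j) w" using ge' fs True by (metis DiffD2)
      ultimately have "I (Suc j) q' (tick (tick (tick (tick s'))))"
        unfolding I_def tm' using fr qq pre tm by simp
      then show ?thesis using d len by (simp add: AA')
    next
      case False
      then have d: "arrays s' Deleted ! ?w = 0" using level_deleted[OF L' wV] by simp
      have c: "arrays s' Cur ! ?w = card (N ?w - P)" using L' False wV f1(1) by (simp add: level_def)
      let ?s1 = "upd Cur ?w (card (N ?w - P) - 1) (tick (tick (tick (tick s'))))"
      have L1: "level t q' (?f (Suc j)) ?s1"
        by (rule level_upd_Cur[of _ _ "?f j"]) (use L' S' wV f1 fs in simp_all)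
      have S1: "sizes ?s1" using S' by (simp add: sizes_def)
      have fr1: "frame {CA, Cur, Deleted, Order} s ?s1" using fr by simp
      show ?thesis
      proof (cases "card (N ?w - P) - 1 < t")
        case True
        have P': "insert u P \<subseteq> set (take q' (arrays ?s1 Order))" using uD PD DD' by auto
        have lt: "card (N ?w - insert u P) < t" using True degree_without_insert(1)[OF wV uw uP] by simp
        have wn: "?w \<notin> set (take q' (arrays ?s1 Order))" using False by simp
        note m = level_mark[OF L1 S1 t wV wn P' lt]
        let ?s2 = "upd Order q' ?w (upd CA ?w (t - 1) (upd Deleted ?w 1 ?s1))"
        have tk: "take (Suc q') (arrays ?s2 Order) = take q' (arrays s' Order) @ [?w]" using m(3) by simp
        have "take q (arrays ?s2 Order) = take q (take (Suc q') (arrays ?s2 Order))" using qq by simp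
        also have "\<dots> = take q (arrays s' Order)" unfolding tk using qq lq' by simp
        finally have pre2: "take q (arrays ?s2 Order) = take q (arrays s Order)" using pre by simp
        have ge2: "\<forall>w\<in>V - set (take (Suc q') (arrays ?s2 Order)). t \<le> ?f (Suc j) w"
          unfolding tk using ge' fs by auto
        have "frame {CA, Cur, Deleted, Order} s ?s2" by (intro frame_upd fr1) auto
        then have "I (Suc j) (Suc q') (tick ?s2)"
          unfolding I_def using m(2) pre2 ge2 qq tm tm' by simp
        then show ?thesis using d c len m(1) True by (simp add: AA')
      next
        case ge3: False
        have "\<forall>w\<in>V - set (take q' (arrays ?s1 Order)). t \<le> ?f (Suc j) w"
        proof
          fix v assume "v \<in> V - set (take q' (arrays ?s1 Order))"
          then have "v \<in> V - ?D'" by simp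
          then show "t \<le> ?f (Suc j) v" using ge' fs[of v] ge3 f1(2) by (cases "v = ?w") auto
        qed
        then have "I (Suc j) q' (tick ?s1)"
          unfolding I_def tm' using fr1 qq pre tm L1 by simp
        then show ?thesis using d c len ge3 by (simp add: AA')
      qed
    qed
  qed simp
qed

definition relax_queue :: "nat \<Rightarrow> nat \<Rightarrow> nat \<Rightarrow> (nat \<times> nat) M" where
  "relax_queue t q q' = while_M (\<lambda>(h, q'). h < q') (q, q') (\<lambda>(h, q'). do {
         u \<leftarrow> get Order h; o1 \<leftarrow> get Off u; d \<leftarrow> get DA u;
         q'' \<leftarrow> relax_nbrs t o1 d q';
         ret (h + 1, q'')})"

text \<open>Each vertex taken from the queue costs at most \<open>9 * (card (N u) + 1)\<close>, and
  over the whole decomposition a vertex is taken only once. The sum over the entries treated before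
  stands on the left of the time bound in place of a subtraction.\<close>

lemma relax_queue_wp:
  assumes S: "sizes s" and t: "1 \<le> t" and qq: "q \<le> q'" and adj: "adj_rep DA AA V N s"
    and L: "level t q' (\<lambda>w. card (N w - set (take q (arrays s Order)))) s"
    and ge: "\<forall>w\<in>V - set (take q' (arrays s Order)). t \<le> card (N w - set (take q (arrays s Order)))"
  shows "wp (relax_queue t q q') (\<lambda>(h, q'') s'. frame {CA, Cur, Deleted, Order} s s' \<and>
    take q' (arrays s' Order) = take q' (arrays s Order) \<and> q' \<le> q'' \<and>
    level t q'' (\<lambda>w. card (N w - set (take q'' (arrays s' Order)))) s' \<and>
    (\<forall>w\<in>V - set (take q'' (arrays s' Order)). t \<le> card (N w - set (take q'' (arrays s' Order)))) \<and>
    time s' + 9 * (\<Sum>u\<in>set (take q (arrays s Order)). card (N u) + 1) \<le>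
      time s + 9 * (\<Sum>u\<in>set (take q'' (arrays s' Order)). card (N u) + 1) + 1) s"
proof -
  define I where "I = (\<lambda>(h, q1) s1. frame {CA, Cur, Deleted, Order} s s1 \<and> q \<le> h \<and> h \<le> q1 \<and> q' \<le> q1 \<and>
    take q' (arrays s1 Order) = take q' (arrays s Order) \<and>
    level t q1 (\<lambda>w. card (N w - set (take h (arrays s1 Order)))) s1 \<and>
    (\<forall>w\<in>V - set (take q1 (arrays s1 Order)). t \<le> card (N w - set (take h (arrays s1 Order)))) \<and>
    time s1 + 9 * (\<Sum>u\<in>set (take q (arrays s Order)). card (N u) + 1) \<le>
      time s + 9 * (\<Sum>u\<in>set (take h (arrays s1 Order)). card (N u) + 1))"
  show ?thesis
    unfolding relax_queue_def
  proof (rule wp_while[where I = I and m = "\<lambda>(h, q1). card V - h"])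
    show "I (q, q') s" unfolding I_def using L ge qq by simp
  next
    fix x s1 assume I: "I x s1" and "\<not> (case x of (h, q') \<Rightarrow> h < q')"
    then obtain h where x: "x = (h, h)" by (cases x) (auto simp: I_def)
    show "(case x of (h, q'') \<Rightarrow> \<lambda>s'. frame {CA, Cur, Deleted, Order} s s' \<and>
      take q' (arrays s' Order) = take q' (arrays s Order) \<and> q' \<le> q'' \<and>
      level t q'' (\<lambda>w. card (N w - set (take q'' (arrays s' Order)))) s' \<and>
      (\<forall>w\<in>V - set (take q'' (arrays s' Order)). t \<le> card (N w - set (take q'' (arrays s' Order)))) \<and>
      time s' + 9 * (\<Sum>u\<in>set (take q (arrays s Order)). card (N u) + 1) \<le>
        time s + 9 * (\<Sum>u\<in>set (take q'' (arrays s' Order)). card (N u) + 1) + 1) (tick s1)"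
      using I unfolding x I_def by simp
  next
    fix x s1 assume I: "I x s1" and b: "case x of (h, q') \<Rightarrow> h < q'"
    obtain h q1 where x: "x = (h, q1)" by (cases x)
    have h: "h < q1" using b x by simp
    have fr: "frame {CA, Cur, Deleted, Order} s s1" and L1: "level t q1 (\<lambda>w. card (N w - set (take h (arrays s1 Order)))) s1"
      and ge1: "\<forall>w\<in>V - set (take q1 (arrays s1 Order)). t \<le> card (N w - set (take h (arrays s1 Order)))"
      and o1: "q \<le> h" "q' \<le> q1" "take q' (arrays s1 Order) = take q' (arrays s Order)"
      and tm: "time s1 + 9 * (\<Sum>u\<in>set (take q (arrays s Order)). card (N u) + 1) \<le>
        time s + 9 * (\<Sum>u\<in>set (take h (arrays s1 Order)). card (N u) + 1)"
      using I unfolding I_def x by simp_all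
    define u where "u = arrays s1 Order ! h"
    have S1: "sizes s1" by (rule sizes_frame[OF S fr])
    have q1: "q1 \<le> length (arrays s1 Order)" "q1 \<le> card V" using level_q[OF L1] by auto
    have D1: "distinct (take q1 (arrays s1 Order))" "set (take q1 (arrays s1 Order)) \<subseteq> V"
      using L1 unfolding level_def deleted_def by auto
    have "u \<in> set (take q1 (arrays s1 Order))" unfolding u_def using h q1
      by (metis length_take min.absorb2 nth_mem nth_take)
    then have uV: "u \<in> V" using D1(2) by blast
    have adj1: "adj_rep DA AA V N s1" by (rule adj_rep_frame[OF adj fr]) simp
    let ?o = "arrays s1 Off ! u"
    have a: "u < length (arrays s1 Off)" "u < length (arrays s1 DA)" "arrays s1 DA ! u = card (N u)"
      "?o + card (N u) \<le> length (arrays s1 AA)"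
      "bij_betw (\<lambda>j. arrays s1 AA ! j) {?o..<?o + card (N u)} (N u)"
      using adj1 uV unfolding adj_rep_def by blast+
    let ?s = "tick (tick (tick (tick s1)))"
    have R: "wp (relax_nbrs t ?o (card (N u)) q1) (\<lambda>q2 s2. frame {CA, Cur, Deleted, Order} ?s s2 \<and> q1 \<le> q2 \<and>
      take q1 (arrays s2 Order) = take q1 (arrays ?s Order) \<and>
      level t q2 (\<lambda>w. card (N w - insert u (set (take h (arrays ?s Order))))) s2 \<and>
      (\<forall>w\<in>V - set (take q2 (arrays s2 Order)). t \<le> card (N w - insert u (set (take h (arrays ?s Order))))) \<and>
      time s2 \<le> time ?s + 9 * card (N u) + 1) ?s"
      by (rule relax_nbrs_wp[OF _ t h]) (use S1 L1 ge1 a u_def in simp_all)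
    have "wp (relax_nbrs t ?o (card (N u)) q1)
      (\<lambda>q2 s2. I (h + 1, q2) (tick s2) \<and> card V - (h + 1) < card V - h) ?s"
    proof (rule wp_mono[OF R], elim conjE)
      fix q2 s2
      assume fr2: "frame {CA, Cur, Deleted, Order} ?s s2" and q2: "q1 \<le> q2"
        and pre: "take q1 (arrays s2 Order) = take q1 (arrays ?s Order)"
        and L2: "level t q2 (\<lambda>w. card (N w - insert u (set (take h (arrays ?s Order))))) s2"
        and ge2: "\<forall>w\<in>V - set (take q2 (arrays s2 Order)). t \<le> card (N w - insert u (set (take h (arrays ?s Order))))"
        and tm2: "time s2 \<le> time ?s + 9 * card (N u) + 1"
      have "take (Suc h) (arrays s2 Order) = take (Suc h) (take q1 (arrays s2 Order))" using h by simp
      also have "\<dots> = take (Suc h) (arrays s1 Order)" unfolding pre using h by simp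
      also have "\<dots> = take h (arrays s1 Order) @ [u]" unfolding u_def
        by (rule take_Suc_conv_app_nth) (use h q1 in simp)
      finally have tk: "take (Suc h) (arrays s2 Order) = take h (arrays s1 Order) @ [u]" .
      have "take (Suc h) (take q1 (arrays s1 Order)) = take h (arrays s1 Order) @ [u]"
        using h q1 by (simp add: take_Suc_conv_app_nth u_def)
      then have un: "u \<notin> set (take h (arrays s1 Order))" using distinct_take[OF D1(1), of "Suc h"] by simp
      have st: "set (take (Suc h) (arrays s2 Order)) = insert u (set (take h (arrays s1 Order)))" unfolding tk by simp
      have sm: "(\<Sum>v\<in>set (take (Suc h) (arrays s2 Order)). card (N v) + 1) =
          (\<Sum>v\<in>set (take h (arrays s1 Order)). card (N v) + 1) + (card (N u) + 1)"
        unfolding st using un by simp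
      have fr3: "frame {CA, Cur, Deleted, Order} s s2" by (rule frame_trans[OF fr]) (use fr2 in auto)
      have "take q' (arrays s2 Order) = take q' (take q1 (arrays s2 Order))" using o1 by simp
      also have "\<dots> = take q' (arrays s Order)" unfolding pre using o1 by simp
      finally have pre': "take q' (arrays s2 Order) = take q' (arrays s Order)" .
      have "time (tick s2) + 9 * (\<Sum>u\<in>set (take q (arrays s Order)). card (N u) + 1) \<le>
        time s + 9 * (\<Sum>v\<in>set (take (Suc h) (arrays s2 Order)). card (N v) + 1)"
        unfolding sm distrib_left using tm tm2 by (simp only: tick_simps)
      then have "I (Suc h, q2) (tick s2)"
        unfolding I_def using fr3 o1 h q2 pre' L2 ge2 by (simp add: st)
      then show "I (h + 1, q2) (tick s2) \<and> card V - (h + 1) < card V - h" using h q1 by simp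
    qed
    then show "wp (case x of (h, q') \<Rightarrow> do {
         u \<leftarrow> get Order h; o1 \<leftarrow> get Off u; d \<leftarrow> get DA u;
         q'' \<leftarrow> relax_nbrs t o1 d q';
         ret (h + 1, q'')}) (\<lambda>x' s'. I x' s' \<and> (case x' of (h, q1) \<Rightarrow> card V - h) < (case x of (h, q1) \<Rightarrow> card V - h)) (tick s1)"
      using h q1 a by (simp add: x u_def[symmetric])
  qed
qed

definition scan_alive :: "nat \<Rightarrow> nat \<Rightarrow> nat \<Rightarrow> (nat \<times> nat) M" where
  "scan_alive t a q = loop [0..<a] (0, q) (\<lambda>i (a', q'). do {
         u \<leftarrow> get Alive i; x \<leftarrow> get Deleted u; d \<leftarrow> get Cur u;
         if x = 1 then ret (a', q')
         else if d < t then do {put Deleted u 1; put CA u (t - 1); put Order q' u; ret (a', q' + 1)}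
         else do {put Alive a' u; ret (a' + 1, q')}})"

text \<open>\<open>Alive\<close> is compacted in place: the write position never passes the read
  position, so the entries still to be read are the old ones. What remains are exactly the undeleted
  vertices of the old list.\<close>

lemma scan_alive_wp:
  assumes S: "sizes s" and t: "1 \<le> t" and a: "a \<le> card V"
    and f: "f = (\<lambda>w. card (N w - set (take q (arrays s Order))))"
    and L: "level t q f s"
    and al: "distinct (take a (arrays s Alive))" "set (take a (arrays s Alive)) \<subseteq> V"
      "V - set (take q (arrays s Order)) \<subseteq> set (take a (arrays s Alive))"
  shows "wp (scan_alive t a q) (\<lambda>(a', q') s'. frame {CA, Alive, Deleted, Order} s s' \<and> q \<le> q' \<and>
    take q (arrays s' Order) = take q (arrays s Order) \<and> level t q' f s' \<and> a' \<le> a \<and>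
    distinct (take a' (arrays s' Alive)) \<and>
    set (take a' (arrays s' Alive)) = set (take a (arrays s Alive)) - set (take q' (arrays s' Order)) \<and>
    (\<forall>w\<in>V - set (take q' (arrays s' Order)). t \<le> f w) \<and> time s' \<le> time s + 8 * a + 1) s"
proof -
  let ?L = "take a (arrays s Alive)"
  have al_len: "a \<le> length (arrays s Alive)" using a S by (simp add: sizes_def)
  define I where "I i = (\<lambda>(a', q') s'. frame {CA, Alive, Deleted, Order} s s' \<and> q \<le> q' \<and>
    take q (arrays s' Order) = take q (arrays s Order) \<and> level t q' f s' \<and> a' \<le> i \<and>
    (\<forall>j. i \<le> j \<longrightarrow> j < a \<longrightarrow> arrays s' Alive ! j = arrays s Alive ! j) \<and>
    distinct (take a' (arrays s' Alive)) \<and>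
    set (take a' (arrays s' Alive)) = set (take i ?L) - set (take q' (arrays s' Order)) \<and>
    (\<forall>w\<in>set (take i ?L) - set (take q' (arrays s' Order)). t \<le> f w) \<and> time s' \<le> time s + 8 * i)" for i
  show ?thesis
    unfolding scan_alive_def
  proof (rule wp_loop[where I = I])
    show "I 0 (0, q) s" unfolding I_def using L by simp
  next
    fix x s' assume I: "I a x s'"
    obtain a' q' where x: "x = (a', q')" by (cases x)
    have i: "frame {CA, Alive, Deleted, Order} s s'" "q \<le> q'" "take q (arrays s' Order) = take q (arrays s Order)"
      "level t q' f s'" "a' \<le> a" "distinct (take a' (arrays s' Alive))"
      "set (take a' (arrays s' Alive)) = set ?L - set (take q' (arrays s' Order))"
      "\<forall>w\<in>set ?L - set (take q' (arrays s' Order)). t \<le> f w" "time s' \<le> time s + 8 * a"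
      using I unfolding x I_def by simp_all
    have "set (take q (arrays s Order)) \<subseteq> set (take q' (arrays s' Order))"
      using set_take_subset_set_take[OF i(2), of "arrays s' Order"] i(3) by simp
    then have "V - set (take q' (arrays s' Order)) \<subseteq> set ?L - set (take q' (arrays s' Order))" using al(3) by blast
    then have "\<forall>w\<in>V - set (take q' (arrays s' Order)). t \<le> f w" using i(8) by blast
    then show "(case x of (a', q') \<Rightarrow> \<lambda>s'. frame {CA, Alive, Deleted, Order} s s' \<and> q \<le> q' \<and>
      take q (arrays s' Order) = take q (arrays s Order) \<and> level t q' f s' \<and> a' \<le> a \<and>
      distinct (take a' (arrays s' Alive)) \<and>
      set (take a' (arrays s' Alive)) = set (take a (arrays s Alive)) - set (take q' (arrays s' Order)) \<and>
      (\<forall>w\<in>V - set (take q' (arrays s' Order)). t \<le> f w) \<and> time s' \<le> time s + 8 * a + 1) (tick s')"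
      using i unfolding x prod.case by simp
  next
    fix i x s' assume i: "0 \<le> i" "i < a" and I: "I i x s'"
    obtain a' q' where x: "x = (a', q')" by (cases x)
    let ?u = "arrays s Alive ! i"
    let ?D = "set (take q' (arrays s' Order))"
    have fr: "frame {CA, Alive, Deleted, Order} s s'" and qq: "q \<le> q'"
      and pre: "take q (arrays s' Order) = take q (arrays s Order)" and L': "level t q' f s'" and a': "a' \<le> i"
      and old: "\<forall>j. i \<le> j \<longrightarrow> j < a \<longrightarrow> arrays s' Alive ! j = arrays s Alive ! j"
      and dst: "distinct (take a' (arrays s' Alive))"
      and st: "set (take a' (arrays s' Alive)) = set (take i ?L) - ?D"
      and ge: "\<forall>w\<in>set (take i ?L) - ?D. t \<le> f w" and tm: "time s' \<le> time s + 8 * i"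
      using I unfolding x I_def by simp_all
    have S': "sizes s'" by (rule sizes_frame[OF S fr])
    have u': "arrays s' Alive ! i = ?u" using old i by simp
    have tk: "take (Suc i) ?L = take i ?L @ [?u]" using i al_len by (simp add: take_Suc_conv_app_nth)
    have un: "?u \<notin> set (take i ?L)" using distinct_take[OF al(1), of "Suc i"] unfolding tk by simp
    have "?u \<in> set ?L" using tk by (metis in_set_conv_decomp in_set_takeD)
    then have uV: "?u \<in> V" using al(2) by blast
    have len: "?u < length (arrays s' Deleted)" "?u < length (arrays s' Cur)" "?u < length (arrays s' CA)"
      "card V \<le> length (arrays s' Order)" "i < length (arrays s' Alive)" "a' < length (arrays s' Alive)"
      using S' uV i a a' by (auto simp: sizes_def)
    have lq': "q' \<le> length (arrays s' Order)" using level_q[OF L'] by simp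
    show "wp (case x of (a', q') \<Rightarrow> do {
         u \<leftarrow> get Alive i; x \<leftarrow> get Deleted u; d \<leftarrow> get Cur u;
         if x = 1 then ret (a', q')
         else if d < t then do {put Deleted u 1; put CA u (t - 1); put Order q' u; ret (a', q' + 1)}
         else do {put Alive a' u; ret (a' + 1, q')}}) (I (Suc i)) (tick s')"
    proof (cases "?u \<in> ?D")
      case True
      then have d: "arrays s' Deleted ! ?u = 1" using level_deleted[OF L' uV] by simp
      have "set (take (Suc i) ?L) - ?D = set (take i ?L) - ?D" unfolding tk using True by auto
      then have "I (Suc i) (a', q') (tick (tick (tick (tick (tick s')))))"
        unfolding I_def using fr qq pre L' a' old dst st ge tm by simp
      then show ?thesis using d len by (simp add: x u')
    next
      case False
      then have d: "arrays s' Deleted ! ?u = 0" using level_deleted[OF L' uV] by simp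
      have c: "arrays s' Cur ! ?u = f ?u" using L' False uV by (simp add: level_def)
      let ?s1 = "tick (tick (tick (tick s')))"
      show ?thesis
      proof (cases "f ?u < t")
        case True
        have P: "set (take q (arrays s Order)) \<subseteq> set (take q' (arrays ?s1 Order))"
          using set_take_subset_set_take[OF qq, of "arrays s' Order"] pre by simp
        have lt: "card (N ?u - set (take q (arrays s Order))) < t" using True by (simp add: f)
        note m = level_mark[of t q' f ?s1 ?u, OF _ _ t uV _ P lt]
        let ?s2 = "upd Order q' ?u (upd CA ?u (t - 1) (upd Deleted ?u 1 ?s1))"
        have m1: "q' < card V" and m2: "level t (Suc q') f ?s2"
          and m3: "take (Suc q') (arrays ?s2 Order) = take q' (arrays s' Order) @ [?u]"
          using m L' S' False by simp_all
        have "take q (arrays ?s2 Order) = take q (take (Suc q') (arrays ?s2 Order))" using qq by simp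
        also have "\<dots> = take q (arrays s' Order)" unfolding m3 using qq lq' by simp
        finally have pre2: "take q (arrays ?s2 Order) = take q (arrays s Order)" using pre by simp
        have st2: "set (take (Suc i) ?L) - set (take (Suc q') (arrays ?s2 Order)) = set (take i ?L) - ?D"
          unfolding m3 tk using un by auto
        have "frame {CA, Alive, Deleted, Order} s ?s2" by (intro frame_upd) (use fr in auto)
        moreover have al2: "arrays ?s2 Alive = arrays s' Alive" by simp
        moreover have "time ?s2 = time s' + 7" by simp
        ultimately have "I (Suc i) (a', Suc q') (tick ?s2)"
          unfolding I_def prod.case using m2 pre2 qq tm a' old dst st ge
          by (simp only: tick_simps level_tick frame_tick st2 al2) simp
        then show ?thesis using d c len m1 True by (simp add: x u')
      next
        case ge3: False
        let ?s2 = "upd Alive a' ?u ?s1"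
        have tk2: "take (Suc a') (arrays ?s2 Alive) = take a' (arrays s' Alive) @ [?u]"
          using take_Suc_update[OF len(6)] by simp
        have st2: "set (take (Suc i) ?L) - ?D = insert ?u (set (take i ?L) - ?D)"
          unfolding tk using False by auto
        have "frame {CA, Alive, Deleted, Order} s ?s2" by (intro frame_upd) (use fr in auto)
        moreover have "\<forall>j. Suc i \<le> j \<longrightarrow> j < a \<longrightarrow> arrays ?s2 Alive ! j = arrays s Alive ! j"
          using old a' by simp
        moreover have "distinct (take (Suc a') (arrays ?s2 Alive))" unfolding tk2 using dst st un by simp
        moreover have "set (take (Suc a') (arrays ?s2 Alive)) = set (take (Suc i) ?L) - ?D"
          unfolding tk2 st2 using st by simp
        moreover have "\<forall>w\<in>set (take (Suc i) ?L) - ?D. t \<le> f w" unfolding st2 using ge ge3 by simp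
        moreover have "arrays ?s2 Order = arrays s' Order" "time ?s2 = time s' + 5" "level t q' f ?s2"
          using L' by simp_all
        ultimately have "I (Suc i) (Suc a', q') (tick ?s2)"
          unfolding I_def prod.case using pre qq tm a'
          by (simp only: tick_simps level_tick frame_tick) simp
        then show ?thesis using d c len ge3 by (simp add: x u')
      qed
    qed
  qed simp
qed

definition core_level :: "nat \<Rightarrow> nat \<Rightarrow> nat \<Rightarrow> (nat \<times> nat \<times> nat) M" where
  "core_level t a q = do {
     (a', q') \<leftarrow> scan_alive t a q;
     (h, q'') \<leftarrow> relax_queue t q q';
     ret (t + 1, a', q'')}"

text \<open>Invariant at the loop head. The undeleted vertices form the \<open>(t - 1)\<close>-core,
  but \<open>Alive\<close> may also contain vertices deleted by the last propagation; they belong to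
  the \<open>(t - 2)\<close>-core, whence \<open>t \<le> cn u + 2\<close>. The time is split into
  the scans, paid by the potential, and the propagation, paid by the deleted vertices and their
  degrees.\<close>

definition head :: "mem \<Rightarrow> nat \<times> nat \<times> nat \<Rightarrow> mem \<Rightarrow> bool" where
  "head s0 = (\<lambda>(t, a, q) s. frame {CA, Cur, Deleted, Alive, Order} s0 s \<and> 1 \<le> t \<and> a \<le> card V \<and>
     level t q (\<lambda>w. card (N w - set (take q (arrays s Order)))) s \<and>
     V - set (take q (arrays s Order)) = K (t - 1) \<and>
     distinct (take a (arrays s Alive)) \<and> set (take a (arrays s Alive)) \<subseteq> V \<and>
     V - set (take q (arrays s Order)) \<subseteq> set (take a (arrays s Alive)) \<and>
     (\<forall>u\<in>set (take a (arrays s Alive)). t \<le> cn u + 2) \<and>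
     time s \<le> time s0 + 12 * (\<Sum>u\<in>V. min t (cn u + 3)) +
       9 * (\<Sum>u\<in>set (take q (arrays s Order)). card (N u) + 1))"

lemma core_level_wp:
  assumes S: "sizes s0" and adj: "adj_rep DA AA V N s0" and H: "head s0 (t, a, q) s" and q: "q < card V"
  shows "wp (core_level t a q) (\<lambda>x s'. head s0 x s' \<and> fst x = t + 1 \<and> t \<le> card V) (tick s)"
proof -
  let ?D = "set (take q (arrays s Order))"
  let ?f = "\<lambda>w. card (N w - ?D)"
  have fr: "frame {CA, Cur, Deleted, Alive, Order} s0 s" and t: "1 \<le> t" and a: "a \<le> card V"
    and L: "level t q ?f s" and VK: "V - ?D = K (t - 1)"
    and al: "distinct (take a (arrays s Alive))" "set (take a (arrays s Alive)) \<subseteq> V"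
      "V - ?D \<subseteq> set (take a (arrays s Alive))" "\<forall>u\<in>set (take a (arrays s Alive)). t \<le> cn u + 2"
    and tm: "time s \<le> time s0 + 12 * (\<Sum>u\<in>V. min t (cn u + 3)) + 9 * (\<Sum>u\<in>?D. card (N u) + 1)"
    using H[unfolded head_def prod.case] by blast+
  have S': "sizes s" by (rule sizes_frame[OF S fr])
  have adj': "adj_rep DA AA V N s" by (rule adj_rep_frame[OF adj fr]) simp
  have DV: "?D \<subseteq> V" and dl: "deleted q (arrays s Deleted) (arrays s Order) (arrays s CA)"
    using L unfolding level_def deleted_def by auto
  have "card ?D < card V" using deleted_card(1)[OF dl] q by simp
  then have "V - ?D \<noteq> {}" using DV by (metis Diff_eq_empty_iff antisym less_irrefl)
  then obtain w where w: "w \<in> V - ?D" by blast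
  then have "t - 1 \<le> cn w" "w \<in> V" using VK le_core_number by auto
  then have tV: "t \<le> card V" using core_number_less[of w] by linarith
  have "w \<in> set (take a (arrays s Alive))" using w al(3) by blast
  \<comment> \<open>Some vertex is scanned at every level, so the constant overhead of a level is
    covered too: \<open>8 * a + 4 \<le> 12 * a\<close>. This is where the factor 12 of the potential
    comes from.\<close>
  then have a1: "1 \<le> a" by (cases a) auto
  have al_len: "length (take a (arrays s Alive)) = a" using a S' by (simp add: sizes_def)
  then have ca: "card (set (take a (arrays s Alive))) = a" using al(1) distinct_card by metis
  have R: "wp (scan_alive t a q) (\<lambda>(a', q') s'. frame {CA, Alive, Deleted, Order} (tick s) s' \<and> q \<le> q' \<and>
    take q (arrays s' Order) = take q (arrays (tick s) Order) \<and> level t q' ?f s' \<and> a' \<le> a \<and>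
    distinct (take a' (arrays s' Alive)) \<and>
    set (take a' (arrays s' Alive)) = set (take a (arrays (tick s) Alive)) - set (take q' (arrays s' Order)) \<and>
    (\<forall>w\<in>V - set (take q' (arrays s' Order)). t \<le> ?f w) \<and> time s' \<le> time (tick s) + 8 * a + 1) (tick s)"
    by (rule scan_alive_wp[OF _ t a]) (use S' L al in simp_all)
  show ?thesis
    unfolding core_level_def wp_bind
  proof (rule wp_mono_pair[OF R], elim conjE)
    fix a' q' s1
    assume fr1: "frame {CA, Alive, Deleted, Order} (tick s) s1" and q': "q \<le> q'"
      and pre1: "take q (arrays s1 Order) = take q (arrays (tick s) Order)" and L1: "level t q' ?f s1" and a': "a' \<le> a"
      and dst1: "distinct (take a' (arrays s1 Alive))"
      and st1: "set (take a' (arrays s1 Alive)) = set (take a (arrays (tick s) Alive)) - set (take q' (arrays s1 Order))"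
      and ge1: "\<forall>w\<in>V - set (take q' (arrays s1 Order)). t \<le> ?f w"
      and tm1: "time s1 \<le> time (tick s) + 8 * a + 1"
    have fr1': "frame {CA, Cur, Deleted, Alive, Order} s0 s1" by (rule frame_trans[OF fr]) (use fr1 in auto)
    have S1: "sizes s1" by (rule sizes_frame[OF S fr1'])
    have adj1: "adj_rep DA AA V N s1" by (rule adj_rep_frame[OF adj fr1']) simp
    have D1: "set (take q (arrays s1 Order)) = ?D" using pre1 by simp
    have R2: "wp (relax_queue t q q') (\<lambda>(h, q'') s'. frame {CA, Cur, Deleted, Order} s1 s' \<and>
      take q' (arrays s' Order) = take q' (arrays s1 Order) \<and> q' \<le> q'' \<and>
      level t q'' (\<lambda>w. card (N w - set (take q'' (arrays s' Order)))) s' \<and>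
      (\<forall>w\<in>V - set (take q'' (arrays s' Order)). t \<le> card (N w - set (take q'' (arrays s' Order)))) \<and>
      time s' + 9 * (\<Sum>u\<in>set (take q (arrays s1 Order)). card (N u) + 1) \<le>
        time s1 + 9 * (\<Sum>u\<in>set (take q'' (arrays s' Order)). card (N u) + 1) + 1) s1"
      by (rule relax_queue_wp[OF S1 t q' adj1]) (use L1 ge1 D1 in simp_all)
    have "wp (relax_queue t q q') (\<lambda>x. wp (case x of (h, q'') \<Rightarrow> ret (t + 1, a', q''))
      (\<lambda>x s'. head s0 x s' \<and> fst x = t + 1 \<and> t \<le> card V)) s1"
    proof (rule wp_mono_pair[OF R2], elim conjE)
      fix h q2 s2
      assume fr2: "frame {CA, Cur, Deleted, Order} s1 s2"
        and pre2: "take q' (arrays s2 Order) = take q' (arrays s1 Order)" and q2: "q' \<le> q2"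
        and L2: "level t q2 (\<lambda>w. card (N w - set (take q2 (arrays s2 Order)))) s2"
        and ge2: "\<forall>w\<in>V - set (take q2 (arrays s2 Order)). t \<le> card (N w - set (take q2 (arrays s2 Order)))"
        and tm2: "time s2 + 9 * (\<Sum>u\<in>set (take q (arrays s1 Order)). card (N u) + 1) \<le>
          time s1 + 9 * (\<Sum>u\<in>set (take q2 (arrays s2 Order)). card (N u) + 1) + 1"
      let ?D2 = "set (take q2 (arrays s2 Order))"
      have fr2': "frame {CA, Cur, Deleted, Alive, Order} s0 s2" by (rule frame_trans[OF fr1' fr2]) auto
      have al2: "arrays s2 Alive = arrays s1 Alive" by (rule frame_arr[OF fr2]) simp
      have KD2: "K t \<subseteq> V - ?D2" using L2 by (simp add: level_def)
      have VK2: "V - ?D2 = K t" by (rule level_end[OF KD2 ge2])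
      have L3: "level (t + 1) q2 (\<lambda>w. card (N w - ?D2)) s2"
        using L2 VK2 kcore_le[of t "t + 1"] unfolding level_def by simp
      have sub12: "set (take q' (arrays s1 Order)) \<subseteq> ?D2"
        using set_take_subset_set_take[OF q2, of "arrays s2 Order"] pre2 by simp
      have D01: "?D \<subseteq> set (take q' (arrays s1 Order))"
        using set_take_subset_set_take[OF q', of "arrays s1 Order"] D1 by simp
      have st1': "set (take a' (arrays s1 Alive)) = set (take a (arrays s Alive)) - set (take q' (arrays s1 Order))"
        using st1 by simp
      have sub: "set (take a' (arrays s1 Alive)) \<subseteq> V" using st1' al(2) by blast
      have cov: "V - ?D2 \<subseteq> set (take a' (arrays s1 Alive))" using st1' al(3) sub12 D01 by blast
      have lv: "\<forall>u\<in>set (take a' (arrays s1 Alive)). t + 1 \<le> cn u + 2"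
      proof
        fix u assume "u \<in> set (take a' (arrays s1 Alive))"
        then have "u \<in> V - ?D" using st1' al(2) D01 by blast
        then have "t - 1 \<le> cn u" using VK le_core_number by auto
        then show "t + 1 \<le> cn u + 2" by simp
      qed
      have pot: "(\<Sum>u\<in>V. min t (cn u + 3)) + a \<le> (\<Sum>u\<in>V. min (t + 1) (cn u + 3))"
        using potential_step[OF al(2,4)] ca by simp
      have tm3: "time (tick s2) \<le> time s0 + 12 * (\<Sum>u\<in>V. min (t + 1) (cn u + 3)) + 9 * (\<Sum>u\<in>?D2. card (N u) + 1)"
        using tm tm1 tm2 pot a1 unfolding D1 tick_simps by linarith
      have "head s0 (t + 1, a', q2) (tick s2)"
        unfolding head_def using fr2' t L3 VK2 dst1 sub cov lv tm3 a' a by (simp add: al2)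
      then show "wp (case (h, q2) of (h, q'') \<Rightarrow> ret (t + 1, a', q''))
        (\<lambda>x s'. head s0 x s' \<and> fst x = t + 1 \<and> t \<le> card V) s2" using tV by simp
    qed
    then show "wp (case (a', q') of (a', q') \<Rightarrow> bind_M (relax_queue t q q') (\<lambda>(h, q''). ret (t + 1, a', q'')))
      (\<lambda>x s'. head s0 x s' \<and> fst x = t + 1 \<and> t \<le> card V) s1" by simp
  qed
qed

lemma core_prog_unfold:
  "core_prog VA lo cnt DA AA CA = do {
     loop [0..<cnt] () (\<lambda>i _. do {
       u \<leftarrow> get VA (lo + i); d \<leftarrow> get DA u;
       put Cur u d; put Deleted u 0; put Alive i u});
     while_M (\<lambda>(t, a, q). q < cnt) (1, cnt, 0) (\<lambda>(t, a, q). core_level t a q);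
     if cnt = 0 then ret 0 else do {u \<leftarrow> get Order (cnt - 1); get CA u}}"
  unfolding core_prog_def core_level_def scan_alive_def relax_queue_def relax_nbrs_def by (rule refl)

lemma core_prog_wp:
  assumes S: "sizes s" and adj: "adj_rep DA AA V N s" and cnt: "cnt = card V"
    and VA: "lo + cnt \<le> length (arrays s VA)" "bij_betw (\<lambda>i. arrays s VA ! (lo + i)) {0..<cnt} V"
  shows "wp (core_prog VA lo cnt DA AA CA) (\<lambda>r s'. frame {CA, Cur, Deleted, Alive, Order} s s' \<and>
    (\<forall>u\<in>V. arrays s' CA ! u = cn u) \<and> distinct (take cnt (arrays s' Order)) \<and>
    set (take cnt (arrays s' Order)) = V \<and> (\<forall>u\<in>V. cn u \<le> r) \<and> r \<le> cnt \<and>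
    time s' \<le> time s + 60 * (1 + cnt + (\<Sum>u\<in>V. card (N u)))) s"
proof -
  let ?v = "\<lambda>i. arrays s VA ! (lo + i)"
  have inj: "inj_on ?v {0..<cnt}" and img: "?v ` {0..<cnt} = V" using VA(2) by (auto simp: bij_betw_def)
  define I where "I i (x::unit) s' \<longleftrightarrow> frame {CA, Cur, Deleted, Alive, Order} s s' \<and>
    (\<forall>j<i. arrays s' Cur ! ?v j = card (N (?v j)) \<and> arrays s' Deleted ! ?v j = 0 \<and> arrays s' Alive ! j = ?v j) \<and>
    time s' \<le> time s + 6 * i" for i x s'
  show ?thesis
    unfolding core_prog_unfold wp_bind
  proof (rule wp_loop[where I = I])
    show "I 0 () s" by (simp add: I_def)
  next
    fix i x s' assume i: "0 \<le> i" "i < cnt" and I: "I i x s'"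
    have fr: "frame {CA, Cur, Deleted, Alive, Order} s s'" using I by (simp add: I_def)
    have S': "sizes s'" by (rule sizes_frame[OF S fr])
    have adj': "adj_rep DA AA V N s'" by (rule adj_rep_frame[OF adj fr]) simp
    have vV: "?v i \<in> V" using i img by (metis atLeastLessThan_iff imageI)
    have VA': "arrays s' VA = arrays s VA" by (rule frame_arr[OF fr]) simp
    have len: "lo + i < length (arrays s' VA)" "?v i < length (arrays s' DA)" "arrays s' DA ! ?v i = card (N (?v i))"
      "?v i < length (arrays s' Cur)" "?v i < length (arrays s' Deleted)" "i < length (arrays s' Alive)"
      using VA i cnt S' adj' vV unfolding sizes_def adj_rep_def VA' by (auto simp: frame_length)
    have ne: "?v j \<noteq> ?v i" if "j < i" for j
    proof
      assume "?v j = ?v i"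
      then show False using inj_onD[OF inj, of j i] that i by simp
    qed
    show "wp (do {u \<leftarrow> get VA (lo + i); d \<leftarrow> get DA u;
       put Cur u d; put Deleted u 0; put Alive i u}) (I (Suc i)) (tick s')"
      using I len ne by (auto simp: VA' I_def less_Suc_eq nth_list_update)
  next
    fix x s1 assume I: "I cnt x s1"
    have fr1: "frame {CA, Cur, Deleted, Alive, Order} s s1" using I by (simp add: I_def)
    have S1: "sizes (tick s1)" using sizes_frame[OF S fr1] by simp
    have adj1: "adj_rep DA AA V N (tick s1)" by (rule adj_rep_frame[OF adj]) (use fr1 in auto)
    have al_len: "cnt \<le> length (arrays s1 Alive)" using S1 cnt by (simp add: sizes_def)
    have al: "take cnt (arrays s1 Alive) = map ?v [0..<cnt]"
      by (rule nth_equalityI) (use I al_len in \<open>auto simp: I_def\<close>)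
    have z: "arrays s1 Cur ! u = card (N u) \<and> arrays s1 Deleted ! u = 0" if "u \<in> V" for u
    proof -
      have "u \<in> ?v ` {0..<cnt}" using img \<open>u \<in> V\<close> by simp
      then obtain j where "j < cnt" "u = ?v j" by auto
      then show ?thesis using I by (simp add: I_def)
    qed
    have al': "distinct (take cnt (arrays s1 Alive))" "set (take cnt (arrays s1 Alive)) = V"
      unfolding al using inj img by (simp_all add: distinct_map)
    have L: "level 1 0 (\<lambda>w. card (N w)) s1" using kcore_sub[of 1] z by (simp add: level_def deleted_def kcore_0)
    have H: "head (tick s1) (1, cnt, 0) (tick s1)"
      unfolding head_def using L al' cnt by (simp add: kcore_0)
    show "wp (while_M (\<lambda>(t, a, q). q < cnt) (1, cnt, 0) (\<lambda>(t, a, q). core_level t a q))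
      (\<lambda>x. wp (if cnt = 0 then ret 0 else do {u \<leftarrow> get Order (cnt - 1); get CA u})
        (\<lambda>r s'. frame {CA, Cur, Deleted, Alive, Order} s s' \<and>
          (\<forall>u\<in>V. arrays s' CA ! u = cn u) \<and> distinct (take cnt (arrays s' Order)) \<and>
          set (take cnt (arrays s' Order)) = V \<and> (\<forall>u\<in>V. cn u \<le> r) \<and> r \<le> cnt \<and>
          time s' \<le> time s + 60 * (1 + cnt + (\<Sum>u\<in>V. card (N u))))) (tick s1)"
    proof (rule wp_while[where I = "head (tick s1)" and m = "\<lambda>x. card V + 1 - fst x"])
      show "head (tick s1) (1, cnt, 0) (tick s1)" by (rule H)
    next
      fix x s2 assume h: "head (tick s1) x s2" "case x of (t, a, q) \<Rightarrow> q < cnt"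
      obtain t a q where x: "x = (t, a, q)" by (cases x)
      have "wp (core_level t a q) (\<lambda>x s'. head (tick s1) x s' \<and> fst x = t + 1 \<and> t \<le> card V) (tick s2)"
        by (rule core_level_wp[OF S1 adj1]) (use h x cnt in auto)
      then have "wp (core_level t a q) (\<lambda>x' s'. head (tick s1) x' s' \<and> card V + 1 - fst x' < card V + 1 - t) (tick s2)"
        by (rule wp_mono) auto
      then show "wp (case x of (t, a, q) \<Rightarrow> core_level t a q)
        (\<lambda>x' s'. head (tick s1) x' s' \<and> card V + 1 - fst x' < card V + 1 - fst x) (tick s2)"
        by (simp add: x)
    next
      fix x s2 assume h: "head (tick s1) x s2" "\<not> (case x of (t, a, q) \<Rightarrow> q < cnt)"
      obtain t a q where x: "x = (t, a, q)" by (cases x)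
      have fr: "frame {CA, Cur, Deleted, Alive, Order} s1 s2"
        and L2: "level t q (\<lambda>w. card (N w - set (take q (arrays s2 Order)))) s2"
        and tm: "time s2 \<le> time (tick s1) + 12 * (\<Sum>u\<in>V. min t (cn u + 3)) +
         9 * (\<Sum>u\<in>set (take q (arrays s2 Order)). card (N u) + 1)"
        using h(1) unfolding x head_def by simp_all
      have fr2: "frame {CA, Cur, Deleted, Alive, Order} s s2" by (rule frame_trans[OF fr1 fr]) simp
      have S2: "sizes s2" by (rule sizes_frame[OF S fr2])
      have q: "q = cnt" using level_q[OF L2] h(2) cnt x by simp
      let ?O = "take cnt (arrays s2 Order)"
      have dl: "deleted cnt (arrays s2 Deleted) (arrays s2 Order) (arrays s2 CA)" using L2 q by (simp add: level_def)
      have dO: "distinct ?O" "set ?O \<subseteq> V" using dl by (simp_all add: deleted_def)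
      have "card (set ?O) = card V" using deleted_card(1)[OF dl] cnt by simp
      then have OV: "set ?O = V" using card_subset_eq[OF finite_V dO(2)] by blast
      have cv: "\<forall>u\<in>V. arrays s2 CA ! u = cn u \<and> cn u \<le> cn (last ?O)"
        using dl OV by (simp add: deleted_def)
      \<comment> \<open>As core numbers are bounded by degrees, the potential never exceeds the
        degree sum plus three for each vertex.\<close>
      have "(\<Sum>u\<in>V. min t (cn u + 3)) \<le> (\<Sum>u\<in>V. card (N u) + 3)"
        using core_number_le_card by (intro sum_mono) (simp add: min.coboundedI2)
      then have m: "(\<Sum>u\<in>V. min t (cn u + 3)) \<le> (\<Sum>u\<in>V. card (N u)) + 3 * cnt"
        by (simp add: sum.distrib cnt)
      have m2: "(\<Sum>u\<in>V. card (N u) + 1) = (\<Sum>u\<in>V. card (N u)) + cnt"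
        unfolding cnt by (subst sum.distrib) simp
      have tm1: "time s1 \<le> time s + 6 * cnt" using I by (simp add: I_def)
      have tm2: "time s2 + 3 \<le> time s + 60 * (1 + cnt + (\<Sum>u\<in>V. card (N u)))"
        using tm tm1 m unfolding q OV m2 tick_simps distrib_left by linarith
      show "wp (if cnt = 0 then ret 0 else do {u \<leftarrow> get Order (cnt - 1); get CA u})
        (\<lambda>r s'. frame {CA, Cur, Deleted, Alive, Order} s s' \<and>
          (\<forall>u\<in>V. arrays s' CA ! u = cn u) \<and> distinct (take cnt (arrays s' Order)) \<and>
          set (take cnt (arrays s' Order)) = V \<and> (\<forall>u\<in>V. cn u \<le> r) \<and> r \<le> cnt \<and>
          time s' \<le> time s + 60 * (1 + cnt + (\<Sum>u\<in>V. card (N u)))) (tick s2)"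
      proof (cases "cnt = 0")
        case True
        then have "V = {}" using OV by simp
        then show ?thesis using True fr2 tm2 by simp
      next
        case False
        have ol: "cnt \<le> length (arrays s2 Order)" using S2 cnt by (simp add: sizes_def)
        then have "?O \<noteq> []" "length ?O = cnt" using False by auto
        then have ln: "arrays s2 Order ! (cnt - 1) = last ?O" using False by (simp add: last_conv_nth)
        have lV: "last ?O \<in> V" using OV False ol by (metis last_in_set length_take list.size(3) min.absorb2)
        have "last ?O < length (arrays s2 CA)" using S2 lV by (simp add: sizes_def)
        moreover have "cn (last ?O) \<le> cnt" using core_number_less[OF lV] cnt by simp
        ultimately show ?thesis using False ol ln lV cv fr2 dO(1) OV tm2 by simp
      qed
    qed
  qed simp
qed

end

section \<open>Extraction of the ego-network\<close>

lemma bij_betw_snoc: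
  assumes "bij_betw (\<lambda>j. xs ! j) {a..<a + card S} S" "finite S" "w \<notin> S" "a + card S < length xs"
  shows "bij_betw (\<lambda>j. xs[a + card S := w] ! j) {a..<a + card (insert w S)} (insert w S)"
proof -
  let ?k = "a + card S" and ?xs = "xs[a + card S := w]"
  have img: "(\<lambda>j. xs ! j) ` {a..<?k} = S" and inj: "inj_on (\<lambda>j. xs ! j) {a..<?k}"
    using assms(1) by (auto simp: bij_betw_def)
  have eq: "?xs ! j = xs ! j" if "j \<in> {a..<?k}" for j using that by simp
  have "bij_betw (\<lambda>j. ?xs ! j) (insert ?k {a..<?k}) (insert w S)"
  proof (rule bij_betw_imageI)
    have "inj_on (\<lambda>j. ?xs ! j) {a..<?k}" using inj eq by (metis (no_types, lifting) inj_on_cong)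
    moreover have "(\<lambda>j. ?xs ! j) ` {a..<?k} = S" using img eq by (metis (no_types, lifting) image_cong)
    ultimately show "inj_on (\<lambda>j. ?xs ! j) (insert ?k {a..<?k})" "(\<lambda>j. ?xs ! j) ` insert ?k {a..<?k} = insert w S"
      using assms(3,4) by simp_all
  qed
  moreover have "insert ?k {a..<?k} = {a..<a + card (insert w S)}" using assms(2,3) by auto
  ultimately show ?thesis by simp
qed

locale input =
  fixes n :: nat and off adj :: "nat list" and N :: "nat \<Rightarrow> nat set"
  assumes off: "length off = Suc n" "sorted off" "off ! n = length adj"
    and N_bij: "i < n \<Longrightarrow> bij_betw (\<lambda>j. adj ! j) {off ! i..<off ! Suc i} (N i)"
    and nbhd_N: "nbhd {..<n} N"
begin

sublocale nat_nbhd "{..<n}" N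
  using nbhd_N by (simp add: nat_nbhd_def)

lemma off_Suc: "i < n \<Longrightarrow> off ! Suc i = off ! i + card (N i)"
proof -
  assume i: "i < n"
  have "off ! i \<le> off ! Suc i" using off i by (intro sorted_nth_mono) auto
  moreover have "card (N i) = off ! Suc i - off ! i" using bij_betw_same_card[OF N_bij[OF i]] by simp
  ultimately show ?thesis by simp
qed

lemma off_disjoint: "u < n \<Longrightarrow> w < n \<Longrightarrow> u < w \<Longrightarrow> off ! u + card (N u) \<le> off ! w"
  using off sorted_nth_mono[of off "Suc u" w] off_Suc[of u] by simp

lemma off_le: "u < n \<Longrightarrow> off ! u + card (N u) \<le> length adj"
  using off sorted_nth_mono[of off "Suc u" n] off_Suc[of u] by simp

text \<open>The memory as every subprogram finds it: the input and the lengths of the work arrays.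
  \<open>SNext\<close> and \<open>Result\<close>, of length \<open>k\<close>, are used only by the
  main loop, which treats them separately.\<close>

definition work :: "mem \<Rightarrow> bool" where
  "work s \<longleftrightarrow> arrays s Off = off \<and> arrays s Adj = adj \<and>
     (\<forall>A\<in>{Ids, Deg, OutDeg, Core, Upper, UHead, UNext, Ranked, SHead, Mark, EgoDeg, EgoCore, Visited, Bfs,
       Cur, Deleted, Alive, Order}. length (arrays s A) = n) \<and>
     length (arrays s Cnt) = Suc n \<and> length (arrays s OutAdj) = length adj \<and> length (arrays s EgoAdj) = length adj"

lemma work_arr:
  assumes "work s"
  shows "arrays s Off = off" "arrays s Adj = adj" "length (arrays s Cnt) = Suc n"
    "length (arrays s OutAdj) = length adj" "length (arrays s EgoAdj) = length adj"
    "length (arrays s Ids) = n" "length (arrays s Deg) = n" "length (arrays s OutDeg) = n"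
    "length (arrays s Core) = n" "length (arrays s Upper) = n" "length (arrays s UHead) = n"
    "length (arrays s UNext) = n" "length (arrays s Ranked) = n" "length (arrays s SHead) = n"
    "length (arrays s Mark) = n" "length (arrays s EgoDeg) = n" "length (arrays s EgoCore) = n"
    "length (arrays s Visited) = n" "length (arrays s Bfs) = n" "length (arrays s Cur) = n"
    "length (arrays s Deleted) = n" "length (arrays s Alive) = n" "length (arrays s Order) = n"
  using assms by (simp_all add: work_def)

lemma work_frame: "work s \<Longrightarrow> frame X s s' \<Longrightarrow> Off \<notin> X \<Longrightarrow> Adj \<notin> X \<Longrightarrow> work s'"
  by (simp add: work_def frame_def)

lemma work_tick [simp]: "work (tick s) = work s" by (simp add: work_def)

text \<open>Breaking ties by the vertex number gives every edge exactly one direction, and the tail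
  of an arc always has the smaller or equal degree.\<close>

definition Out :: "nat \<Rightarrow> nat set" where
  "Out u = {w \<in> N u. card (N u) < card (N w) \<or> (card (N u) = card (N w) \<and> u < w)}"

lemma Out_sub: "Out u \<subseteq> N u" by (auto simp: Out_def)

lemma Out_asym: "w \<in> Out u \<Longrightarrow> u \<notin> Out w" by (auto simp: Out_def)

lemma Out_total: "u < n \<Longrightarrow> w \<in> N u \<Longrightarrow> w \<in> Out u \<or> u \<in> Out w"
  using N_sym[of u w] N_irrefl[of u] by (cases "u = w") (auto simp: Out_def)

text \<open>A partially filled adjacency list: only the first \<open>card S\<close> places of the
  range of \<open>u\<close> are meaningful. As \<open>S\<close> is a subset of \<open>N u\<close>,
  the list does not outgrow its range.\<close>

definition slot :: "nat \<Rightarrow> nat set \<Rightarrow> mem \<Rightarrow> bool" where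
  "slot u S s \<longleftrightarrow> S \<subseteq> N u \<and> arrays s EgoDeg ! u = card S \<and>
     bij_betw (\<lambda>j. arrays s EgoAdj ! j) {off ! u..<off ! u + card S} S"

lemma slot_tick [simp]: "slot u S (tick s) = slot u S s" by (simp add: slot_def)

text \<open>The cell written lies in the range of \<open>u\<close>, since \<open>S\<close> lacks
  \<open>w\<close> and so has fewer than \<open>card (N u)\<close> elements; ranges of different
  vertices are disjoint, so the other lists stay intact.\<close>

lemma add_arc_wp:
  assumes W: "work s" and u: "u < n" and S: "slot u S s" "w \<in> N u" "w \<notin> S"
  shows "wp (add_arc u w) (\<lambda>_ s'. frame {EgoDeg, EgoAdj} s s' \<and> slot u (insert w S) s' \<and>
     (\<forall>u' S'. u' < n \<longrightarrow> u' \<noteq> u \<longrightarrow> slot u' S' s \<longrightarrow> slot u' S' s') \<and> time s' \<le> time s + 4) s"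
proof -
  have fin: "finite (N u)" using finite_N u by simp
  have SN: "insert w S \<subseteq> N u" using S by (simp add: slot_def)
  have finS: "finite S" using SN fin finite_subset by auto
  have cS: "card S < card (N u)"
    by (rule psubset_card_mono[OF fin]) (use SN S(3) in blast)
  let ?k = "off ! u + card S"
  let ?s = "upd EgoDeg u (card S + 1) (upd EgoAdj ?k w (tick (tick s)))"
  have d: "arrays s EgoDeg ! u = card S" and b: "bij_betw (\<lambda>j. arrays s EgoAdj ! j) {off ! u..<?k} S"
    using S(1) by (auto simp: slot_def)
  have len: "u < length (arrays s EgoDeg)" "?k < length (arrays s EgoAdj)" "u < length (arrays s Off)" "arrays s Off = off"
    using u off_le[OF u] cS by (simp_all add: work_arr[OF W] off(1))
  have "bij_betw (\<lambda>j. (arrays s EgoAdj)[?k := w] ! j) {off ! u..<off ! u + card (insert w S)} (insert w S)"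
    by (rule bij_betw_snoc[OF b finS S(3) len(2)])
  then have "slot u (insert w S) ?s"
    unfolding slot_def using SN S(3) finS len by simp
  moreover have "slot u' S' ?s" if u': "u' < n" "u' \<noteq> u" and S': "slot u' S' s" for u' S'
  proof -
    have "card S' \<le> card (N u')" using S' finite_N[of u'] u' by (simp add: slot_def card_mono)
    then have "?k \<notin> {off ! u'..<off ! u' + card S'}"
      using off_disjoint[OF u u'(1)] off_disjoint[OF u'(1) u] u'(2) cS by (cases "u < u'") auto
    then have "bij_betw (\<lambda>j. ((arrays s EgoAdj)[?k := w]) ! j) {off ! u'..<off ! u' + card S'} S' =
        bij_betw (\<lambda>j. arrays s EgoAdj ! j) {off ! u'..<off ! u' + card S'} S'"
      by (intro bij_betw_cong) auto
    then show ?thesis using S' u' by (simp add: slot_def)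
  qed
  moreover have "frame {EgoDeg, EgoAdj} s ?s" by simp
  ultimately show ?thesis using len d by (simp add: add_arc_def)
qed

definition arc_nbrs :: "(nat \<times> nat) set \<Rightarrow> nat \<Rightarrow> nat set" where
  "arc_nbrs P u = {w. (u, w) \<in> P \<or> (w, u) \<in> P}"

text \<open>An edge of the ego-network is met exactly once, from its tail, and then entered into the
  lists of both end points; so the scan of \<open>u\<close> costs its out-degree instead of its
  degree. Clearing \<open>Mark\<close> takes time proportional to \<open>card (N v)\<close>, whereas
  a fresh array for each call would cost \<open>n\<close>.\<close>

lemma extract_prog_wp:
  assumes W: "work s" and v: "v < n" and out: "adj_rep OutDeg OutAdj {..<n} Out s"
    and mark: "\<forall>u<n. arrays s Mark ! u = 0"
  shows "wp (extract_prog (off ! v) (off ! Suc v)) (\<lambda>_ s'. frame {Mark, EgoDeg, EgoAdj} s s' \<and>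
     (\<forall>u<n. arrays s' Mark ! u = 0) \<and> adj_rep EgoDeg EgoAdj (N v) (\<lambda>u. N u \<inter> N v) s' \<and>
     time s' \<le> time s + 20 * (1 + card (N v) + (\<Sum>u\<in>N v. card (Out u)))) s"
proof -
  let ?lo = "off ! v" and ?hi = "off ! Suc v"
  let ?A = "\<lambda>i j. (\<lambda>j. adj ! j) ` {i..<j}"
  let ?X = "{Mark, EgoDeg, EgoAdj}"
  have inj: "inj_on (\<lambda>j. adj ! j) {?lo..<?hi}" and img: "?A ?lo ?hi = N v" using N_bij[OF v] by (auto simp: bij_betw_def)
  have hi: "?lo \<le> ?hi" "?hi \<le> length adj" "?hi - ?lo = card (N v)" using off_Suc[OF v] off_le[OF v] by auto
  have Nv: "N v \<subseteq> {..<n}" using N_sub v by simp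
  have aN: "adj ! i \<in> N v" if "?lo \<le> i" "i < ?hi" for i
    using that img by (metis atLeastLessThan_iff imageI)
  have an: "adj ! i < n" if "?lo \<le> i" "i < ?hi" for i using aN[OF that] Nv by blast
  have A_Suc: "?A ?lo (Suc i) = insert (adj ! i) (?A ?lo i)" if "?lo \<le> i" for i
    using that by (simp add: atLeastLessThanSuc)
  have fresh: "adj ! i \<notin> ?A ?lo i" if "?lo \<le> i" "i < ?hi" for i
  proof
    assume "adj ! i \<in> ?A ?lo i"
    then obtain j where "?lo \<le> j" "j < i" "adj ! i = adj ! j" by auto
    then show False using inj_onD[OF inj, of i j] that by simp
  qed
  define I1 where "I1 i (x::unit) s' \<longleftrightarrow> frame ?X s s' \<and>
    (\<forall>w<n. arrays s' Mark ! w = (if w \<in> ?A ?lo i then 1 else 0)) \<and>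
    (\<forall>w\<in>?A ?lo i. arrays s' EgoDeg ! w = 0) \<and> time s' \<le> time s + 4 * (i - ?lo)" for i x s'
  define I2 where "I2 P s' \<longleftrightarrow> frame ?X s s' \<and> (\<forall>w<n. arrays s' Mark ! w = (if w \<in> N v then 1 else 0)) \<and>
    (\<forall>u\<in>N v. slot u (arc_nbrs P u) s')" for P s'
  define I3 where "I3 i (x::unit) s' \<longleftrightarrow> frame ?X s s' \<and>
    (\<forall>w<n. arrays s' Mark ! w = (if w \<in> N v - ?A ?lo i then 1 else 0)) \<and>
    (\<forall>u\<in>N v. slot u (N u \<inter> N v) s') \<and>
    time s' \<le> time s + 9 * card (N v) + 12 * (\<Sum>u\<in>N v. card (Out u)) + 10 + 3 * (i - ?lo)" for i x s'
  have L1: "wp (loop [?lo..<?hi] () (\<lambda>i _. do {u \<leftarrow> get Adj i; put Mark u 1; put EgoDeg u 0}))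
    (\<lambda>_ s'. I2 {} s' \<and> time s' \<le> time s + 4 * card (N v) + 1) s"
  proof (rule wp_loop[where I = I1, OF hi(1)])
    show "I1 ?lo () s" using mark by (simp add: I1_def)
    fix i x s' assume i: "?lo \<le> i" "i < ?hi" and I: "I1 i x s'"
    then have W': "work s'" using work_frame[OF W, of ?X s'] by (simp add: I1_def)
    have ar: "arrays s' Adj = adj" "length (arrays s' Mark) = n" "length (arrays s' EgoDeg) = n" by (simp_all add: work_arr[OF W'])
    have t: "4 * (Suc i - ?lo) = 4 * (i - ?lo) + 4" using i by simp
    show "wp (do {u \<leftarrow> get Adj i; put Mark u 1; put EgoDeg u 0}) (I1 (Suc i)) (tick s')"
      using I hi an[OF i] i ar unfolding I1_def t A_Suc[OF i(1)] by (auto simp: nth_list_update)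
  next
    fix x s' assume I: "I1 ?hi x s'"
    have "slot u {} (tick s')" if "u \<in> N v" for u
      using I that img by (simp add: I1_def slot_def bij_betw_def)
    then show "I2 {} (tick s') \<and> time (tick s') \<le> time s + 4 * card (N v) + 1"
      using I img hi by (simp add: I1_def I2_def arc_nbrs_def)
  qed
  define arcs where "arcs i = {(u, w). u \<in> ?A ?lo i \<and> w \<in> Out u \<inter> N v}" for i
  define J where "J i (x::unit) s' \<longleftrightarrow> I2 (arcs i) s' \<and>
    time s' \<le> time s + 4 * card (N v) + 1 + (\<Sum>u\<in>?A ?lo i. 12 * card (Out u) + 5)" for i x s'
  have L2: "wp (loop [?lo..<?hi] () (\<lambda>i _. do {
       u \<leftarrow> get Adj i; o1 \<leftarrow> get Off u; d \<leftarrow> get OutDeg u;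
       loop [o1..<o1 + d] () (\<lambda>j _. do {
         w \<leftarrow> get OutAdj j; x \<leftarrow> get Mark w;
         if x = 1 then do {add_arc u w; add_arc w u} else ret ()})})) (\<lambda>_ s'. I3 ?lo () s') s1"
    if s1: "I2 {} s1" "time s1 \<le> time s + 4 * card (N v) + 1" for s1
  proof (rule wp_loop[where I = J, OF hi(1)])
    show "J ?lo () s1" using s1 by (simp add: J_def arcs_def)
  next
    fix x s' assume I: "J ?hi x s'"
    have "arc_nbrs (arcs ?hi) u = N u \<inter> N v" if u: "u \<in> N v" for u
    proof -
      have "w \<in> arc_nbrs (arcs ?hi) u \<longleftrightarrow> w \<in> N u \<inter> N v" for w
      proof -
        have un: "u < n" using u Nv by blast
        have "w \<in> arc_nbrs (arcs ?hi) u \<longleftrightarrow> (w \<in> Out u \<and> w \<in> N v) \<or> (w \<in> N v \<and> u \<in> Out w)"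
          unfolding arc_nbrs_def arcs_def img using u by auto
        also have "\<dots> \<longleftrightarrow> w \<in> N u \<inter> N v"
        proof (cases "w \<in> N v")
          case True
          then have wn: "w < n" using Nv by blast
          show ?thesis using True Out_total[OF un, of w] Out_sub[of u] Out_sub[of w] N_sym[of w u] wn by auto
        qed simp
        finally show ?thesis .
      qed
      then show ?thesis by blast
    qed
    moreover have "(\<Sum>u\<in>N v. 12 * card (Out u) + 5) = 12 * (\<Sum>u\<in>N v. card (Out u)) + 5 * card (N v)"
      by (subst sum.distrib) (simp add: sum_distrib_left)
    ultimately show "I3 ?lo () (tick s')" using I by (simp add: J_def I2_def I3_def img)
  next
    fix i x s' assume i: "?lo \<le> i" "i < ?hi" and J: "J i x s'"
    let ?u = "adj ! i"
    have fr: "frame ?X s s'" and I2: "I2 (arcs i) s'" and tm: "time s' \<le> time s + 4 * card (N v) + 1 + (\<Sum>u\<in>?A ?lo i. 12 * card (Out u) + 5)"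
      using J by (simp_all add: J_def I2_def)
    have W': "work s'" by (rule work_frame[OF W fr]) simp_all
    have out': "adj_rep OutDeg OutAdj {..<n} Out s'" by (rule adj_rep_frame[OF out fr]) simp
    have un: "?u < n" and uN: "?u \<in> N v" using an[OF i] aN[OF i] by auto
    have ar: "arrays s' Adj = adj" "arrays s' Off = off" by (simp_all add: work_arr[OF W'])
    let ?o = "off ! ?u" and ?d = "card (Out ?u)"
    have o: "?u < length off" "?u < length (arrays s' OutDeg)" "arrays s' OutDeg ! ?u = ?d" "?o + ?d \<le> length (arrays s' OutAdj)"
      "bij_betw (\<lambda>j. arrays s' OutAdj ! j) {?o..<?o + ?d} (Out ?u)"
      using out' un by (auto simp: adj_rep_def ar)
    let ?B = "\<lambda>j. (\<lambda>j. arrays s' OutAdj ! j) ` {?o..<j}"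
    have injB: "inj_on (\<lambda>j. arrays s' OutAdj ! j) {?o..<?o + ?d}" and imgB: "?B (?o + ?d) = Out ?u" using o(5) by (auto simp: bij_betw_def)
    define P where "P j = arcs i \<union> {?u} \<times> (?B j \<inter> N v)" for j
    define J' where "J' j (x::unit) s2 \<longleftrightarrow> I2 (P j) s2 \<and> time s2 \<le> time s' + 4 + 12 * (j - ?o)" for j x s2
    have A: "?A ?lo (Suc i) = insert ?u (?A ?lo i)" by (rule A_Suc[OF i(1)])
    have sumA: "(\<Sum>u\<in>?A ?lo (Suc i). 12 * card (Out u) + 5) = (\<Sum>u\<in>?A ?lo i. 12 * card (Out u) + 5) + (12 * ?d + 5)"
      unfolding A using fresh[OF i] by simp
    have Pend: "P (?o + ?d) = arcs (Suc i)"
      unfolding P_def arcs_def A imgB by auto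
    have inner: "wp (loop [?o..<?o + ?d] () (\<lambda>j _. do {
         w \<leftarrow> get OutAdj j; x \<leftarrow> get Mark w;
         if x = 1 then do {add_arc ?u w; add_arc w ?u} else ret ()})) (J (Suc i)) (tick (tick (tick (tick s'))))"
    proof (rule wp_loop[where I = J'])
      have "I2 (arcs i) (tick (tick (tick (tick s'))))" using I2 by (simp add: I2_def)
      then show "J' ?o () (tick (tick (tick (tick s'))))" by (simp add: J'_def P_def)
    next
      fix x s2 assume "J' (?o + ?d) x s2"
      then show "J (Suc i) x (tick s2)"
        unfolding J'_def J_def Pend sumA using tm by (simp add: I2_def)
    next
      fix j x s2 assume j: "?o \<le> j" "j < ?o + ?d" and J': "J' j x s2"
      have fr2: "frame ?X s s2" and mk: "\<forall>w<n. arrays s2 Mark ! w = (if w \<in> N v then 1 else 0)"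
        and sl: "\<forall>u\<in>N v. slot u (arc_nbrs (P j) u) s2" and tm2: "time s2 \<le> time s' + 4 + 12 * (j - ?o)"
        using J' by (auto simp: J'_def I2_def)
      have W2: "work s2" by (rule work_frame[OF W fr2]) simp_all
      let ?w = "arrays s' OutAdj ! j"
      have "arrays s2 OutAdj = arrays s OutAdj" "arrays s' OutAdj = arrays s OutAdj"
        using frame_arr[OF fr2, of OutAdj] frame_arr[OF fr, of OutAdj] by simp_all
      then have OA: "arrays s2 OutAdj = arrays s' OutAdj" by simp
      have wO: "?w \<in> Out ?u" using j imgB by (metis atLeastLessThan_iff imageI)
      have wNu: "?w \<in> N ?u" using wO Out_sub by blast
      have wn: "?w < n" "?w \<in> N ?u" "?u \<in> N ?w" "?w \<noteq> ?u"
        using wNu N_sub[of ?u] N_sym[of ?u ?w] un N_irrefl[of ?u] by (simp_all, blast, metis)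
      have wB: "?w \<notin> ?B j"
      proof
        assume "?w \<in> ?B j"
        then obtain k where "?o \<le> k" "k < j" "?w = arrays s' OutAdj ! k" by auto
        then show False using inj_onD[OF injB, of j k] j by simp
      qed
      have B: "?B (Suc j) = insert ?w (?B j)" using j by (simp add: atLeastLessThanSuc)
      have len: "j < length (arrays s2 OutAdj)" "?w < length (arrays s2 Mark)" using o(4) j wn by (simp_all add: OA work_arr[OF W2])
      have t12: "12 * (Suc j - ?o) = 12 * (j - ?o) + 12" using j by simp
      show "wp (do {
         w \<leftarrow> get OutAdj j; x \<leftarrow> get Mark w;
         if x = 1 then do {add_arc ?u w; add_arc w ?u} else ret ()}) (J' (Suc j)) (tick s2)"
      proof (cases "?w \<in> N v")
        case False
        then have "P (Suc j) = P j" unfolding P_def B by auto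
        then have "J' (Suc j) () (tick (tick (tick (tick s2))))"
          unfolding J'_def I2_def t12 using fr2 mk sl tm2 by simp
        then show ?thesis using False mk wn len by (simp add: OA)
      next
        case True
        let ?s = "tick (tick (tick s2))"
        \<comment> \<open>\<open>?u\<close> is the tail of no recorded arc except those to earlier
          entries of its own list, and there is no arc from \<open>?w\<close> to \<open>?u\<close>
          because the orientation is asymmetric. So neither list receives an entry twice.\<close>
        have nP: "(?u, ?w) \<notin> P j" "(?w, ?u) \<notin> P j"
          using wB fresh[OF i] Out_asym[OF wO] wn(4) unfolding P_def arcs_def by auto
        then have new: "?w \<notin> arc_nbrs (P j) ?u" "?u \<notin> arc_nbrs (P j) ?w" by (auto simp: arc_nbrs_def)
        have Ps: "P (Suc j) = insert (?u, ?w) (P j)" unfolding P_def B using True by auto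
        have ns: "arc_nbrs (P (Suc j)) u = (if u = ?u then insert ?w (arc_nbrs (P j) u)
            else if u = ?w then insert ?u (arc_nbrs (P j) u) else arc_nbrs (P j) u)" for u
          using wn(4) unfolding Ps arc_nbrs_def by auto
        have "wp (add_arc ?u ?w) (\<lambda>_. wp (add_arc ?w ?u) (J' (Suc j))) ?s"
        proof (rule wp_mono[OF add_arc_wp[OF _ un _ wn(2) new(1)]], goal_cases)
          case 1 show ?case using W2 by simp
        next
          case 2 show ?case using sl uN by simp
        next
          case (3 _ s3)
          then have fr3: "frame {EgoDeg, EgoAdj} ?s s3" and sl3: "slot ?u (insert ?w (arc_nbrs (P j) ?u)) s3"
            and oth3: "\<forall>u' S'. u' < n \<longrightarrow> u' \<noteq> ?u \<longrightarrow> slot u' S' ?s \<longrightarrow> slot u' S' s3" and tm3: "time s3 \<le> time ?s + 4" by blast+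
          have W3: "work s3" by (rule work_frame[OF _ fr3]) (use W2 in simp_all)
          have slw: "slot ?w (arc_nbrs (P j) ?w) s3" using oth3 wn(1,4) sl True by simp
          show ?case
          proof (rule wp_mono[OF add_arc_wp[OF W3 wn(1) slw wn(3) new(2)]])
            fix y s4
            assume 4: "frame {EgoDeg, EgoAdj} s3 s4 \<and> slot ?w (insert ?u (arc_nbrs (P j) ?w)) s4 \<and>
              (\<forall>u' S'. u' < n \<longrightarrow> u' \<noteq> ?w \<longrightarrow> slot u' S' s3 \<longrightarrow> slot u' S' s4) \<and> time s4 \<le> time s3 + 4"
            have fr4: "frame ?X s s4"
              by (rule frame_trans[OF fr2, of "{EgoDeg, EgoAdj}"], rule frame_trans[of _ _ s3 "{EgoDeg, EgoAdj}"])
                (use fr3 4 in auto)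
            have "arrays s4 Mark = arrays s3 Mark" "arrays s3 Mark = arrays s2 Mark"
              using frame_arr[OF fr3, of Mark] 4 frame_arr[of _ s3 s4 Mark] by auto
            then have mk4: "\<forall>w<n. arrays s4 Mark ! w = (if w \<in> N v then 1 else 0)" using mk by simp
            have "slot u (arc_nbrs (P (Suc j)) u) s4" if u: "u \<in> N v" for u
            proof -
              have un': "u < n" using u Nv by blast
              consider "u = ?u" | "u = ?w" | "u \<noteq> ?u" "u \<noteq> ?w" by blast
              then show ?thesis
              proof cases
                case 1
                then show ?thesis using ns[of u] 4 sl3 wn un by simp
              next
                case 2
                then show ?thesis using ns[of u] 4 wn by simp
              next
                case 3
                then have "slot u (arc_nbrs (P j) u) s3" using oth3 un' sl u by simp
                then have "slot u (arc_nbrs (P j) u) s4" using 4 un' 3 by blast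
                then show ?thesis using ns[of u] 3 by simp
              qed
            qed
            then show "J' (Suc j) y s4"
              unfolding J'_def I2_def t12 using fr4 mk4 tm2 tm3 4 by simp
          qed
        qed
        then show ?thesis using True mk wn len by (simp add: OA)
      qed
    qed simp
    show "wp (do {
       u \<leftarrow> get Adj i; o1 \<leftarrow> get Off u; d \<leftarrow> get OutDeg u;
       loop [o1..<o1 + d] () (\<lambda>j _. do {
         w \<leftarrow> get OutAdj j; x \<leftarrow> get Mark w;
         if x = 1 then do {add_arc u w; add_arc w u} else ret ()})}) (J (Suc i)) (tick s')"
      using inner o i hi by (simp only: wp_bind wp_get tick_simps ar) simp
  qed
  have L3: "wp (loop [?lo..<?hi] () (\<lambda>i _. do {u \<leftarrow> get Adj i; put Mark u 0})) (\<lambda>_ s'. frame ?X s s' \<and>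
     (\<forall>u<n. arrays s' Mark ! u = 0) \<and> adj_rep EgoDeg EgoAdj (N v) (\<lambda>u. N u \<inter> N v) s' \<and>
     time s' \<le> time s + 20 * (1 + card (N v) + (\<Sum>u\<in>N v. card (Out u)))) s3" if s3: "I3 ?lo () s3" for s3
  proof (rule wp_loop[where I = I3, OF hi(1)])
    show "I3 ?lo () s3" by (rule s3)
  next
    fix i x s' assume i: "?lo \<le> i" "i < ?hi" and I: "I3 i x s'"
    then have W': "work s'" using work_frame[OF W, of ?X s'] by (simp add: I3_def)
    have ar: "arrays s' Adj = adj" "length (arrays s' Mark) = n" by (simp_all add: work_arr[OF W'])
    have t: "3 * (Suc i - ?lo) = 3 * (i - ?lo) + 3" using i by simp
    have sl: "slot u S (upd Mark w y s') = slot u S s'" for u S w y s' by (simp add: slot_def)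
    show "wp (do {u \<leftarrow> get Adj i; put Mark u 0}) (I3 (Suc i)) (tick s')"
      using I hi an[OF i] i ar unfolding I3_def t A_Suc[OF i(1)] by (auto simp: nth_list_update sl)
  next
    fix x s' assume I: "I3 ?hi x s'"
    then have fr: "frame ?X s s'" and sl: "\<forall>u\<in>N v. slot u (N u \<inter> N v) s'" by (simp_all add: I3_def)
    have W': "work s'" by (rule work_frame[OF W fr]) simp_all
    have "adj_rep EgoDeg EgoAdj (N v) (\<lambda>u. N u \<inter> N v) (tick s')"
      unfolding adj_rep_def
    proof (intro ballI)
      fix u assume u: "u \<in> N v"
      then have un: "u < n" using Nv by blast
      have "card (N u \<inter> N v) \<le> card (N u)" using finite_N[of u] un by (intro card_mono) auto
      then show "u < length (arrays (tick s') Off) \<and> u < length (arrays (tick s') EgoDeg) \<and>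
        arrays (tick s') EgoDeg ! u = card (N u \<inter> N v) \<and>
        arrays (tick s') Off ! u + card (N u \<inter> N v) \<le> length (arrays (tick s') EgoAdj) \<and>
        bij_betw (\<lambda>j. arrays (tick s') EgoAdj ! j)
          {arrays (tick s') Off ! u..<arrays (tick s') Off ! u + card (N u \<inter> N v)} (N u \<inter> N v)"
        using sl u un off_le[OF un] by (simp add: slot_def work_arr[OF W'] off(1))
    qed
    then show "frame ?X s (tick s') \<and> (\<forall>u<n. arrays (tick s') Mark ! u = 0) \<and>
      adj_rep EgoDeg EgoAdj (N v) (\<lambda>u. N u \<inter> N v) (tick s') \<and>
      time (tick s') \<le> time s + 20 * (1 + card (N v) + (\<Sum>u\<in>N v. card (Out u)))"
      using I img hi by (simp add: I3_def)
  qed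
  show ?thesis
    unfolding extract_prog_def wp_bind
    by (rule wp_mono[OF L1], rule wp_mono[OF L2], simp, simp, rule L3)
qed

end

section \<open>Breadth-first search and the score\<close>

context nat_nbhd
begin

definition marks :: "nat set \<Rightarrow> mem \<Rightarrow> bool" where
  "marks X s \<longleftrightarrow> (\<forall>w\<in>V. arrays s Visited ! w = (if w \<in> X then 1 else 0))"

lemma marks_tick [simp]: "marks X (tick s) = marks X s" by (simp add: marks_def)

lemma marks_upd_Bfs [simp]: "marks X (upd Bfs i x s) = marks X s" by (simp add: marks_def)

lemma marks_insert: "marks X s \<Longrightarrow> \<forall>w\<in>V. w < length (arrays s Visited) \<Longrightarrow> w \<in> V \<Longrightarrow> marks (insert w X) (upd Visited w (Suc 0) s)"
  by (auto simp: marks_def nth_list_update)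

definition bfs_inv :: "mem \<Rightarrow> nat \<Rightarrow> nat set \<Rightarrow> nat \<Rightarrow> mem \<Rightarrow> bool" where
  "bfs_inv s u X q s' \<longleftrightarrow> frame {Visited, Bfs} s s' \<and> q \<le> length (arrays s' Bfs) \<and> distinct (take q (arrays s' Bfs)) \<and>
    u \<in> set (take q (arrays s' Bfs)) \<and> set (take q (arrays s' Bfs)) \<subseteq> lc u \<and>
    marks (X \<union> set (take q (arrays s' Bfs))) s'"

definition bfs_nbrs :: "nat \<Rightarrow> nat \<Rightarrow> nat \<Rightarrow> nat \<times> bool \<Rightarrow> (nat \<times> bool) M" where
  "bfs_nbrs t o1 d x = loop [o1..<o1 + d] x (\<lambda>j (q, b). do {
         w \<leftarrow> get EgoAdj j; c \<leftarrow> get EgoCore w; y \<leftarrow> get Visited w;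
         if c > t then ret (q, False)
         else if c = t \<and> y = 0 then do {put Visited w 1; put Bfs q w; ret (q + 1, b)}
         else ret (q, b)})"

lemma bfs_nbrs_wp:
  assumes u: "u \<in> V" "t = cn u" and X: "X \<inter> lc u = {}"
    and len: "\<forall>w\<in>V. w < length (arrays s0 Visited) \<and> w < length (arrays s0 EgoCore) \<and> arrays s0 EgoCore ! w = cn w"
      "card V \<le> length (arrays s0 Bfs)"
    and I: "bfs_inv s0 u X q s" and x: "x \<in> lc u"
    and adj: "o1 + d \<le> length (arrays s0 EgoAdj)" "bij_betw (\<lambda>j. arrays s0 EgoAdj ! j) {o1..<o1 + d} (N x)"
  shows "wp (bfs_nbrs t o1 d (q, b)) (\<lambda>(q', b') s'. bfs_inv s0 u X q' s' \<and> q \<le> q' \<and>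
     take q (arrays s' Bfs) = take q (arrays s Bfs) \<and>
     (\<forall>y\<in>N x. cn y = t \<longrightarrow> y \<in> set (take q' (arrays s' Bfs))) \<and>
     (b' \<longleftrightarrow> b \<and> (\<forall>y\<in>N x. cn y \<le> t)) \<and> time s' \<le> time s + 7 * d + 1) s"
proof -
  let ?Z = "\<lambda>j. (\<lambda>j. arrays s0 EgoAdj ! j) ` {o1..<j}"
  have img: "?Z (o1 + d) = N x" using adj(2) by (simp add: bij_betw_def)
  have xV: "x \<in> V" using level_comp_mem[OF u(1) x] by blast
  define J where "J j = (\<lambda>(q', b') s'. bfs_inv s0 u X q' s' \<and> q \<le> q' \<and>
     take q (arrays s' Bfs) = take q (arrays s Bfs) \<and>
     (\<forall>y\<in>?Z j. cn y = t \<longrightarrow> y \<in> set (take q' (arrays s' Bfs))) \<and>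
     (b' \<longleftrightarrow> b \<and> (\<forall>y\<in>?Z j. cn y \<le> t)) \<and> time s' \<le> time s + 7 * (j - o1))" for j
  show ?thesis
    unfolding bfs_nbrs_def
  proof (rule wp_loop[where I = J])
    show "J o1 (q, b) s" using I by (simp add: J_def)
  next
    fix p s' assume "J (o1 + d) p s'"
    then show "(case p of (q', b') \<Rightarrow> \<lambda>s'. bfs_inv s0 u X q' s' \<and> q \<le> q' \<and>
     take q (arrays s' Bfs) = take q (arrays s Bfs) \<and>
     (\<forall>y\<in>N x. cn y = t \<longrightarrow> y \<in> set (take q' (arrays s' Bfs))) \<and>
     (b' \<longleftrightarrow> b \<and> (\<forall>y\<in>N x. cn y \<le> t)) \<and> time s' \<le> time s + 7 * d + 1) (tick s')"
      unfolding J_def img by (cases p) (simp add: bfs_inv_def)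
  next
    fix j p s' assume j: "o1 \<le> j" "j < o1 + d" and J: "J j p s'"
    obtain q' b' where p: "p = (q', b')" by (cases p)
    let ?w = "arrays s0 EgoAdj ! j" and ?Q = "set (take q' (arrays s' Bfs))"
    have inv: "bfs_inv s0 u X q' s'" and qq: "q \<le> q'" and pre: "take q (arrays s' Bfs) = take q (arrays s Bfs)"
      and vis: "\<forall>y\<in>?Z j. cn y = t \<longrightarrow> y \<in> ?Q" and b': "b' \<longleftrightarrow> b \<and> (\<forall>y\<in>?Z j. cn y \<le> t)"
      and tm: "time s' \<le> time s + 7 * (j - o1)"
      using J[unfolded J_def p prod.case] by blast+
    have fr: "frame {Visited, Bfs} s0 s'" and ql: "q' \<le> length (arrays s' Bfs)" and dst: "distinct (take q' (arrays s' Bfs))"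
      and uQ: "u \<in> ?Q" and Q: "?Q \<subseteq> lc u" and mk: "marks (X \<union> ?Q) s'"
      using inv[unfolded bfs_inv_def] by blast+
    have ar: "arrays s' EgoAdj = arrays s0 EgoAdj" "arrays s' EgoCore = arrays s0 EgoCore" "length (arrays s' Visited) = length (arrays s0 Visited)"
      "length (arrays s' Bfs) = length (arrays s0 Bfs)"
      using fr by (simp_all add: frame_def)
    have wN: "?w \<in> N x" using j img by (metis atLeastLessThan_iff imageI)
    then have wV: "?w \<in> V" using N_sub[OF xV] by blast
    have Z: "?Z (Suc j) = insert ?w (?Z j)" using j by (simp add: atLeastLessThanSuc)
    have wl: "?w < length (arrays s0 Visited)" "?w < length (arrays s0 EgoCore)" "arrays s0 EgoCore ! ?w = cn ?w"
      "j < length (arrays s0 EgoAdj)" using len wV adj(1) j by auto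
    have t7: "7 * (Suc j - o1) = 7 * (j - o1) + 7" using j by simp
    have vw: "arrays s' Visited ! ?w = (if ?w \<in> X \<union> ?Q then 1 else 0)" using mk wV unfolding marks_def by blast
    have lw: "?w \<in> lc u" if "cn ?w = t" using level_comp_step[OF u(1) x wN] that u(2) by simp
    show "wp (case p of (q, b) \<Rightarrow> do {
         w \<leftarrow> get EgoAdj j; c \<leftarrow> get EgoCore w; y \<leftarrow> get Visited w;
         if c > t then ret (q, False)
         else if c = t \<and> y = 0 then do {put Visited w 1; put Bfs q w; ret (q + 1, b)}
         else ret (q, b)}) (J (Suc j)) (tick s')"
    proof (cases "cn ?w = t \<and> ?w \<notin> X \<union> ?Q")
      case False
      \<comment> \<open>A marked neighbour of level \<open>t\<close> lies in the component of
        \<open>u\<close>, which \<open>X\<close> misses; so it was marked in this search and is in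
        the queue.\<close>
      have "cn ?w = t \<longrightarrow> ?w \<in> ?Q" using False lw X by blast
      then have v2: "\<forall>y\<in>?Z (Suc j). cn y = t \<longrightarrow> y \<in> ?Q" unfolding Z using vis by blast
      show ?thesis
      proof (cases "cn ?w > t")
        case True
        have "J (Suc j) (q', False) (tick (tick (tick (tick (tick s')))))"
          unfolding J_def prod.case t7 using inv qq pre v2 tm True Z by (simp add: bfs_inv_def)
        then show ?thesis using True wl by (simp add: p ar)
      next
        case le: False
        have "J (Suc j) (q', b') (tick (tick (tick (tick (tick s')))))"
          unfolding J_def prod.case t7 using inv qq pre v2 tm le Z b' by (simp add: bfs_inv_def)
        moreover have "\<not> (cn ?w = t \<and> arrays s' Visited ! ?w = 0)" using False vw by auto
        ultimately show ?thesis using le wl by (auto simp: p ar)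
      qed
    next
      case True
      then have wQ: "?w \<notin> ?Q" and wt: "cn ?w = t" by auto
      have "lc u \<subseteq> V" using level_comp_mem[OF u(1)] by blast
      then have "insert ?w ?Q \<subseteq> V" using Q wV by blast
      then have "card (insert ?w ?Q) \<le> card V" by (rule card_mono[OF finite_V])
      then have "q' < card V" using wQ dst ql by (simp add: distinct_card)
      then have q'l: "q' < length (arrays s' Bfs)" using len(2) ar(4) by simp
      let ?s2 = "upd Bfs q' ?w (upd Visited ?w 1 (tick (tick (tick (tick s')))))"
      have tk: "take (Suc q') (arrays ?s2 Bfs) = take q' (arrays s' Bfs) @ [?w]"
        using take_Suc_update[OF q'l] by simp
      have fr2: "frame {Visited, Bfs} s0 ?s2" by (intro frame_upd) (use fr in auto)
      have "marks (insert ?w (X \<union> ?Q)) (upd Visited ?w (Suc 0) (tick (tick (tick (tick s')))))"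
        by (rule marks_insert) (use mk wV len ar in auto)
      then have mk2: "marks (X \<union> set (take (Suc q') (arrays ?s2 Bfs))) ?s2" unfolding tk by simp
      have inv2: "bfs_inv s0 u X (Suc q') ?s2"
        unfolding bfs_inv_def using fr2 mk2 q'l dst wQ uQ Q lw[OF wt] unfolding tk by simp
      have "take q (arrays ?s2 Bfs) = take q (take (Suc q') (arrays ?s2 Bfs))" using qq by simp
      also have "\<dots> = take q (arrays s' Bfs)" unfolding tk using qq ql by simp
      finally have pre2: "take q (arrays ?s2 Bfs) = take q (arrays s Bfs)" using pre by simp
      have v2: "\<forall>y\<in>?Z (Suc j). cn y = t \<longrightarrow> y \<in> set (take (Suc q') (arrays ?s2 Bfs))"
        unfolding Z tk using vis by auto
      have b2: "b' \<longleftrightarrow> b \<and> (\<forall>y\<in>?Z (Suc j). cn y \<le> t)" unfolding Z using b' wt by auto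
      have "J (Suc j) (Suc q', b') (tick ?s2)"
        unfolding J_def prod.case using inv2 qq pre2 v2 b2 tm t7 by (simp add: bfs_inv_def)
      moreover have "arrays s' Visited ! ?w = 0" using vw True by simp
      ultimately show ?thesis using wl wt q'l by (simp add: p ar)
    qed
  qed simp
qed

lemma bfs_prog_wp:
  assumes u: "u \<in> V" and X: "X \<inter> lc u = {}"
    and len: "\<forall>w\<in>V. w < length (arrays s Visited) \<and> w < length (arrays s EgoCore) \<and> arrays s EgoCore ! w = cn w"
      "card V \<le> length (arrays s Bfs)"
    and adj: "adj_rep EgoDeg EgoAdj V N s" and mk: "marks X s"
  shows "wp (bfs_prog u (cn u)) (\<lambda>b s'. frame {Visited, Bfs} s s' \<and> marks (X \<union> lc u) s' \<and>
     (b \<longleftrightarrow> top_comp V N u) \<and> time s' \<le> time s + 4 + 7 * (\<Sum>x\<in>lc u. card (N x) + 1)) s"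
proof -
  let ?t = "cn u"
  have V0: "0 < card V" using u finite_V by (auto simp: card_gt_0_iff)
  have lcV: "lc u \<subseteq> V" using level_comp_mem[OF u] by blast
  define s1 where "s1 = upd Bfs 0 u (upd Visited u 1 s)"
  have B1: "take (Suc 0) (arrays s1 Bfs) = [u]"
  proof -
    have "0 < length (arrays s Bfs)" using V0 len(2) by linarith
    from take_Suc_update[OF this, of u] show ?thesis by (simp add: s1_def)
  qed
  have mk1: "marks (insert u X) (upd Visited u (Suc 0) s)" by (rule marks_insert) (use mk u len in auto)
  have I1: "bfs_inv s u X 1 s1"
    unfolding bfs_inv_def using B1 mk1 V0 len(2) level_comp_self[of u] by (simp add: s1_def)
  define J where "J = (\<lambda>(h, q, b) s'. bfs_inv s u X q s' \<and> h \<le> q \<and>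
     (\<forall>x\<in>set (take h (arrays s' Bfs)). \<forall>y\<in>N x. cn y = ?t \<longrightarrow> y \<in> set (take q (arrays s' Bfs))) \<and>
     (b \<longleftrightarrow> (\<forall>x\<in>set (take h (arrays s' Bfs)). \<forall>y\<in>N x. cn y \<le> ?t)) \<and>
     time s' \<le> time s + 2 + 7 * (\<Sum>x\<in>set (take h (arrays s' Bfs)). card (N x) + 1))"
  have "wp (while_M (\<lambda>(h, q, b). h < q) (0, 1, True) (\<lambda>(h, q, b). do {
         x \<leftarrow> get Bfs h; o1 \<leftarrow> get Off x; d \<leftarrow> get EgoDeg x;
         (q', b') \<leftarrow> bfs_nbrs ?t o1 d (q, b);
         ret (h + 1, q', b')})) (\<lambda>(h, q, b) s'. frame {Visited, Bfs} s s' \<and> marks (X \<union> lc u) s' \<and>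
     (b \<longleftrightarrow> top_comp V N u) \<and> time s' \<le> time s + 3 + 7 * (\<Sum>x\<in>lc u. card (N x) + 1)) s1"
  proof (rule wp_while[where I = J and m = "\<lambda>(h, q, b). card V - h"])
    show "J (0, 1, True) s1" unfolding J_def using I1 by (simp add: s1_def)
  next
    fix p s' assume J: "J p s'" and "\<not> (case p of (h, q, b) \<Rightarrow> h < q)"
    then obtain h b where p: "p = (h, h, b)" by (cases p) (auto simp: J_def)
    let ?Q = "set (take h (arrays s' Bfs))"
    have inv: "bfs_inv s u X h s'" and vis: "\<forall>x\<in>?Q. \<forall>y\<in>N x. cn y = ?t \<longrightarrow> y \<in> ?Q"
      and b: "b \<longleftrightarrow> (\<forall>x\<in>?Q. \<forall>y\<in>N x. cn y \<le> ?t)"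
      and tm: "time s' \<le> time s + 2 + 7 * (\<Sum>x\<in>?Q. card (N x) + 1)"
      using J[unfolded J_def p prod.case] by blast+
    \<comment> \<open>An exhausted queue contains, with each of its vertices, all neighbours of the
      same core number, so it covers the whole component.\<close>
    have "lc u \<subseteq> ?Q" by (rule level_comp_closed) (use inv vis in \<open>auto simp: bfs_inv_def\<close>)
    then have Q: "?Q = lc u" using inv by (auto simp: bfs_inv_def)
    show "(case p of (h, q, b) \<Rightarrow> \<lambda>s'. frame {Visited, Bfs} s s' \<and> marks (X \<union> lc u) s' \<and>
     (b \<longleftrightarrow> top_comp V N u) \<and> time s' \<le> time s + 3 + 7 * (\<Sum>x\<in>lc u. card (N x) + 1)) (tick s')"
      using inv b tm unfolding Q p prod.case by (simp add: bfs_inv_def Q top_comp_def)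
  next
    fix p s' assume J: "J p s'" and c: "case p of (h, q, b) \<Rightarrow> h < q"
    obtain h q b where p: "p = (h, q, b)" by (cases p)
    have h: "h < q" using c p by simp
    let ?P = "set (take h (arrays s' Bfs))"
    have inv: "bfs_inv s u X q s'" and vis: "\<forall>x\<in>?P. \<forall>y\<in>N x. cn y = ?t \<longrightarrow> y \<in> set (take q (arrays s' Bfs))"
      and b: "b \<longleftrightarrow> (\<forall>x\<in>?P. \<forall>y\<in>N x. cn y \<le> ?t)"
      and tm: "time s' \<le> time s + 2 + 7 * (\<Sum>x\<in>?P. card (N x) + 1)"
      using J[unfolded J_def p prod.case] by blast+
    have fr: "frame {Visited, Bfs} s s'" and ql: "q \<le> length (arrays s' Bfs)" and dst: "distinct (take q (arrays s' Bfs))"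
      and Q: "set (take q (arrays s' Bfs)) \<subseteq> lc u"
      using inv[unfolded bfs_inv_def] by blast+
    define x where "x = arrays s' Bfs ! h"
    have tk: "take (Suc h) (arrays s' Bfs) = take h (arrays s' Bfs) @ [x]"
      unfolding x_def by (rule take_Suc_conv_app_nth) (use h ql in simp)
    have xn: "x \<notin> ?P" using distinct_take[OF dst, of "Suc h"] h tk by (simp add: min_def)
    have sub: "set (take (Suc h) (arrays s' Bfs)) \<subseteq> set (take q (arrays s' Bfs))" by (rule set_take_subset_set_take) (use h in simp)
    then have xl: "x \<in> lc u" using Q tk by auto
    then have xV: "x \<in> V" using lcV by blast
    have "q \<le> card V"
    proof -
      have "card (set (take q (arrays s' Bfs))) \<le> card V" using Q lcV by (intro card_mono[OF finite_V]) blast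
      then show ?thesis using dst ql by (simp add: distinct_card)
    qed
    let ?o = "arrays s Off ! x"
    have a: "x < length (arrays s Off)" "x < length (arrays s EgoDeg)" "arrays s EgoDeg ! x = card (N x)"
      "?o + card (N x) \<le> length (arrays s EgoAdj)" "bij_betw (\<lambda>j. arrays s EgoAdj ! j) {?o..<?o + card (N x)} (N x)"
      using adj xV unfolding adj_rep_def by blast+
    have ar: "arrays s' Off = arrays s Off" "arrays s' EgoDeg = arrays s EgoDeg"
      using frame_arr[OF fr] by simp_all
    let ?s = "tick (tick (tick (tick s')))"
    have inv': "bfs_inv s u X q ?s" using inv by (simp add: bfs_inv_def)
    have "wp (bfs_nbrs ?t ?o (card (N x)) (q, b)) (\<lambda>y s'. J (Suc h, y) (tick s') \<and> card V - Suc h < card V - h) ?s"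
    proof (rule wp_mono_pair[OF bfs_nbrs_wp[OF u refl X len inv' xl a(4,5)]], elim conjE)
      fix q2 b2 s2
      assume inv2: "bfs_inv s u X q2 s2" and qq: "q \<le> q2" and pre: "take q (arrays s2 Bfs) = take q (arrays ?s Bfs)"
        and v2: "\<forall>y\<in>N x. cn y = ?t \<longrightarrow> y \<in> set (take q2 (arrays s2 Bfs))"
        and b2: "b2 = (b \<and> (\<forall>y\<in>N x. cn y \<le> ?t))" and tm2: "time s2 \<le> time ?s + 7 * card (N x) + 1"
      have "take (Suc h) (arrays s2 Bfs) = take (Suc h) (take q (arrays s2 Bfs))" using h by simp
      also have "\<dots> = take (Suc h) (arrays s' Bfs)" unfolding pre using h by simp
      finally have tk2: "take (Suc h) (arrays s2 Bfs) = take h (arrays s' Bfs) @ [x]" using tk by simp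
      have st: "set (take (Suc h) (arrays s2 Bfs)) = insert x ?P" unfolding tk2 by simp
      have sm: "(\<Sum>v\<in>insert x ?P. card (N v) + 1) = (\<Sum>v\<in>?P. card (N v) + 1) + (card (N x) + 1)" using xn by simp
      have Qs: "set (take q (arrays s' Bfs)) \<subseteq> set (take q2 (arrays s2 Bfs))"
        using set_take_subset_set_take[OF qq, of "arrays s2 Bfs"] pre by simp
      have "time (tick s2) \<le> time s + 2 + 7 * (\<Sum>v\<in>insert x ?P. card (N v) + 1)"
        unfolding sm distrib_left using tm tm2 by simp
      moreover have "bfs_inv s u X q2 (tick s2)" using inv2 by (simp add: bfs_inv_def)
      moreover have "\<forall>z\<in>insert x ?P. \<forall>y\<in>N z. cn y = ?t \<longrightarrow> y \<in> set (take q2 (arrays s2 Bfs))"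
        using v2 vis Qs by blast
      moreover have "b2 \<longleftrightarrow> (\<forall>z\<in>insert x ?P. \<forall>y\<in>N z. cn y \<le> ?t)" using b2 b by blast
      ultimately have "J (Suc h, q2, b2) (tick s2)" unfolding J_def prod.case tick_simps st using h qq by simp
      then show "J (Suc h, q2, b2) (tick s2) \<and> card V - Suc h < card V - h" using h \<open>q \<le> card V\<close> by simp
    qed
    then show "wp (case p of (h, q, b) \<Rightarrow> do {
         x \<leftarrow> get Bfs h; o1 \<leftarrow> get Off x; d \<leftarrow> get EgoDeg x;
         (q', b') \<leftarrow> bfs_nbrs ?t o1 d (q, b);
         ret (h + 1, q', b')}) (\<lambda>p' s'. J p' s' \<and> (case p' of (h, q, b) \<Rightarrow> card V - h) < (case p of (h, q, b) \<Rightarrow> card V - h)) (tick s')"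
      using a h ql by (simp add: p ar x_def[symmetric])
  qed
  moreover have "bfs_prog u ?t = do {
     put Visited u 1; put Bfs 0 u;
     (h, q, b) \<leftarrow> while_M (\<lambda>(h, q, b). h < q) (0, 1, True) (\<lambda>(h, q, b). do {
         x \<leftarrow> get Bfs h; o1 \<leftarrow> get Off x; d \<leftarrow> get EgoDeg x;
         (q', b') \<leftarrow> bfs_nbrs ?t o1 d (q, b);
         ret (h + 1, q', b')});
     ret b}"
    unfolding bfs_prog_def bfs_nbrs_def by (rule refl)
  moreover have "u < length (arrays s Visited)" "0 < length (arrays s Bfs)" using len u V0 by auto
  ultimately show ?thesis
    unfolding s1_def by (simp del: One_nat_def) (erule wp_mono, auto)
qed

end

text \<open>The common shape of step 4 of Score and of the computation of the upper bound: the largest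
  \<open>x\<close> with \<open>th x \<le> g x + \<dots> + g T\<close>.\<close>

definition search_down :: "(nat \<Rightarrow> nat) \<Rightarrow> nat \<Rightarrow> (nat \<times> nat \<times> nat) M" where
  "search_down th T = while_M (\<lambda>(t, s, out). 1 \<le> t \<and> out = 0) (T, 0, 0) (\<lambda>(t, s, out). do {
       c \<leftarrow> get Cnt t;
       if s + c \<ge> th t then ret (t, s + c, t) else ret (t - 1, s + c, 0)})"

lemma search_down_wp:
  assumes T: "T < length (arrays s Cnt)" and g: "\<And>t. 1 \<le> t \<Longrightarrow> t \<le> T \<Longrightarrow> arrays s Cnt ! t = g t"
  shows "wp (search_down th T) (\<lambda>x s'. frame {} s s' \<and>
    snd (snd x) = Max (insert 0 {x \<in> {1..T}. th x \<le> (\<Sum>i=x..T. g i)}) \<and> time s' \<le> time s + 3 * T + 1) s"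
proof -
  \<comment> \<open>\<open>out = 0\<close> means that nothing has been found, which is unambiguous
    as only positions \<open>t \<ge> 1\<close> are tested. For an arbitrary threshold
    \<open>th\<close> the condition need not be monotone, so the invariant records that all larger
    positions fail.\<close>
  define I where "I = (\<lambda>(t, r, out) s'. frame {} s s' \<and> t \<le> T \<and>
    (if out = 0 then r = (\<Sum>i=Suc t..T. g i) \<and> (\<forall>x\<in>{Suc t..T}. (\<Sum>i=x..T. g i) < th x)
     else out = t \<and> 1 \<le> t \<and> th t \<le> (\<Sum>i=t..T. g i) \<and> (\<forall>x\<in>{Suc t..T}. (\<Sum>i=x..T. g i) < th x)) \<and>
    time s' + 3 * (if out = 0 then t else t - 1) \<le> time s + 3 * T)"
  show ?thesis
    unfolding search_down_def
  proof (rule wp_while[where I = I and m = "\<lambda>(t, r, out). if out = 0 then t else 0"])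
    show "I (T, 0, 0) s" by (simp add: I_def)
  next
    fix x s' assume I: "I x s'" and b: "case x of (t, r, out) \<Rightarrow> 1 \<le> t \<and> out = 0"
    obtain t r where x: "x = (t, r, 0)" using b by (cases x) auto
    have t: "1 \<le> t" "t \<le> T" and fr: "frame {} s s'" and r: "r = (\<Sum>i=Suc t..T. g i)"
      and less: "\<forall>x\<in>{Suc t..T}. (\<Sum>i=x..T. g i) < th x" and tm: "time s' + 3 * t \<le> time s + 3 * T"
      using I b by (auto simp: I_def x)
    have c: "arrays s' Cnt = arrays s Cnt" by (rule frame_arr[OF fr]) simp
    have sm: "(\<Sum>i=t..T. g i) = g t + r" unfolding r by (rule sum.atLeast_Suc_atMost[OF t(2)])
    have 1: "I (t, r + g t, t) (tick (tick (tick s')))" if "th t \<le> r + g t"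
      using that t fr less tm sm by (simp add: I_def)
    have 2: "I (t - 1, r + g t, 0) (tick (tick (tick s')))" if "\<not> th t \<le> r + g t"
    proof -
      obtain t' where t': "t = Suc t'" using t(1) by (cases t) auto
      have "\<forall>x\<in>{t..T}. (\<Sum>i=x..T. g i) < th x"
      proof
        fix x assume "x \<in> {t..T}"
        then show "(\<Sum>i=x..T. g i) < th x" using less that sm by (cases "x = t") auto
      qed
      then show ?thesis using t fr tm sm by (simp add: I_def t')
    qed
    show "wp (case x of (t, s, out) \<Rightarrow> do {
       c \<leftarrow> get Cnt t;
       if s + c \<ge> th t then ret (t, s + c, t) else ret (t - 1, s + c, 0)})
      (\<lambda>x' s'. I x' s' \<and> (case x' of (t, r, out) \<Rightarrow> if out = 0 then t else 0) <
         (case x of (t, r, out) \<Rightarrow> if out = 0 then t else 0)) (tick s')"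
      using 1 2 t T g[OF t] c by (simp add: x)
  next
    fix x s' assume I: "I x s'" and b: "\<not> (case x of (t, r, out) \<Rightarrow> 1 \<le> t \<and> out = 0)"
    obtain t r out where x: "x = (t, r, out)" by (cases x)
    have "out = Max (insert 0 {x \<in> {1..T}. th x \<le> (\<Sum>i=x..T. g i)})"
    proof (rule Max_eqI[symmetric])
      fix y assume y: "y \<in> insert 0 {x \<in> {1..T}. th x \<le> (\<Sum>i=x..T. g i)}"
      have less: "\<forall>x\<in>{Suc t..T}. (\<Sum>i=x..T. g i) < th x" and o: "out = t" using I b by (auto simp: I_def x split: if_splits)
      show "y \<le> out"
      proof (rule ccontr)
        assume "\<not> y \<le> out"
        then have "y \<in> {Suc t..T}" "th y \<le> (\<Sum>i=y..T. g i)" using y o by auto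
        then show False using less by fastforce
      qed
    next
      show "out \<in> insert 0 {x \<in> {1..T}. th x \<le> (\<Sum>i=x..T. g i)}"
        using I b by (auto simp: I_def x split: if_splits)
    qed simp
    then show "frame {} s (tick s') \<and> snd (snd x) = Max (insert 0 {x \<in> {1..T}. th x \<le> (\<Sum>i=x..T. g i)}) \<and>
      time (tick s') \<le> time s + 3 * T + 1"
      using I by (simp add: I_def x split: if_splits)
  qed
qed

context nat_nbhd
begin

definition count_comps :: "nat \<Rightarrow> unit M" where
  "count_comps cnt = loop [0..<cnt] () (\<lambda>i _. do {
       u \<leftarrow> get Order i; t \<leftarrow> get EgoCore u; x \<leftarrow> get Visited u;
       if 1 \<le> t \<and> x = 0 then do {
         b \<leftarrow> bfs_prog u t;
         if b then do {c \<leftarrow> get Cnt t; put Cnt t (c + 1)} else ret ()}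
       else ret ()})"

text \<open>The counters of all levels exist side by side, so one pass over \<open>Order\<close>
  handles every level. Each component is searched once, from its first vertex in
  \<open>Order\<close>, and components are disjoint; therefore all searches together are linear in
  the size of the graph. Level 0 is left out, as it cannot contribute to the score.\<close>

lemma count_comps_wp:
  assumes len: "\<forall>w\<in>V. w < length (arrays s Visited) \<and> w < length (arrays s EgoCore) \<and> arrays s EgoCore ! w = cn w"
      "card V \<le> length (arrays s Bfs)" "card V \<le> length (arrays s Order)"
    and adj: "adj_rep EgoDeg EgoAdj V N s" and mk: "marks {} s"
    and ord: "distinct (take (card V) (arrays s Order))" "set (take (card V) (arrays s Order)) = V"
    and T: "\<And>u. u \<in> V \<Longrightarrow> cn u \<le> T" "T < length (arrays s Cnt)" "\<forall>t. 1 \<le> t \<and> t \<le> T \<longrightarrow> arrays s Cnt ! t = 0"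
  shows "wp (count_comps (card V)) (\<lambda>_ s'. frame {Visited, Bfs, Cnt} s s' \<and>
     (\<forall>t. 1 \<le> t \<and> t \<le> T \<longrightarrow> arrays s' Cnt ! t = card (top_comps V N t)) \<and>
     time s' \<le> time s + 20 * (1 + card V + (\<Sum>x\<in>V. card (N x)))) s"
proof -
  let ?os = "take (card V) (arrays s Order)"
  let ?top = "top_comp V N"
  have lcV: "lc u \<subseteq> V" if "u \<in> V" for u using level_comp_mem[OF that] by blast
  define X where "X i = \<Union>(lc ` {u \<in> set (take i ?os). 1 \<le> cn u})" for i
  define C where "C i t = lc ` {u \<in> set (take i ?os). cn u = t \<and> ?top u}" for i t
  define I where "I i (x::unit) s' \<longleftrightarrow> frame {Visited, Bfs, Cnt} s s' \<and> marks (X i) s' \<and>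
     (\<forall>t. 1 \<le> t \<and> t \<le> T \<longrightarrow> arrays s' Cnt ! t = card (C i t)) \<and>
     time s' \<le> time s + 10 * i + 7 * (\<Sum>x\<in>X i. card (N x) + 1)" for i x s'
  have XV: "X i \<subseteq> V" for i unfolding X_def using lcV ord(2) in_set_takeD by fast
  show ?thesis
    unfolding count_comps_def
  proof (rule wp_loop[where I = I])
    show "I 0 () s" unfolding I_def X_def C_def using mk T(3) by simp
  next
    fix x s' assume I: "I (card V) x s'"
    have "C (card V) t = top_comps V N t" for t unfolding C_def top_comps_def using ord(2) by simp
    moreover have "(\<Sum>x\<in>X (card V). card (N x) + 1) \<le> (\<Sum>x\<in>V. card (N x) + 1)"
      by (rule sum_mono2[OF finite_V XV]) simp
    moreover have "(\<Sum>x\<in>V. card (N x) + 1) = (\<Sum>x\<in>V. card (N x)) + card V" by (subst sum.distrib) simp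
    ultimately show "frame {Visited, Bfs, Cnt} s (tick s') \<and>
     (\<forall>t. 1 \<le> t \<and> t \<le> T \<longrightarrow> arrays (tick s') Cnt ! t = card (top_comps V N t)) \<and>
     time (tick s') \<le> time s + 20 * (1 + card V + (\<Sum>x\<in>V. card (N x)))"
      using I by (simp add: I_def)
  next
    fix i x s' assume i: "0 \<le> i" "i < card V" and I: "I i x s'"
    have fr: "frame {Visited, Bfs, Cnt} s s'" and mk': "marks (X i) s'"
      and cnt: "\<forall>t. 1 \<le> t \<and> t \<le> T \<longrightarrow> arrays s' Cnt ! t = card (C i t)"
      and tm: "time s' \<le> time s + 10 * i + 7 * (\<Sum>x\<in>X i. card (N x) + 1)"
      using I unfolding I_def by blast+
    define u where "u = arrays s Order ! i"
    have tk: "take (Suc i) ?os = take i ?os @ [u]" using i len(3) by (simp add: u_def take_Suc_conv_app_nth)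
    then have uV: "u \<in> V" using ord(2) by (metis in_set_conv_decomp in_set_takeD)
    have ar: "arrays s' Order = arrays s Order" "arrays s' EgoCore = arrays s EgoCore"
      "length (arrays s' Visited) = length (arrays s Visited)" "length (arrays s' Bfs) = length (arrays s Bfs)"
      "length (arrays s' Cnt) = length (arrays s Cnt)"
      using fr by (simp_all add: frame_def)
    have ul: "u < length (arrays s Visited)" "u < length (arrays s EgoCore)" "arrays s EgoCore ! u = cn u"
      "i < length (arrays s Order)" using len uV i by auto
    have vu: "arrays s' Visited ! u = (if u \<in> X i then 1 else 0)" using mk' uV unfolding marks_def by blast
    have X_Suc: "X (Suc i) = (if 1 \<le> cn u then X i \<union> lc u else X i)" unfolding X_def tk by auto
    have C_Suc: "C (Suc i) t = (if cn u = t \<and> ?top u then insert (lc u) (C i t) else C i t)" for t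
      unfolding C_def tk by auto
    have finC: "finite (C i t)" for t unfolding C_def by simp
    show "wp (do {
       u \<leftarrow> get Order i; t \<leftarrow> get EgoCore u; x \<leftarrow> get Visited u;
       if 1 \<le> t \<and> x = 0 then do {
         b \<leftarrow> bfs_prog u t;
         if b then do {c \<leftarrow> get Cnt t; put Cnt t (c + 1)} else ret ()}
       else ret ()}) (I (Suc i)) (tick s')"
    proof (cases "1 \<le> cn u \<and> u \<notin> X i")
      case False
      \<comment> \<open>A visited vertex lies in the component of an earlier vertex of
        \<open>Order\<close>, which has therefore been counted already if it is a top
        component.\<close>
      have old: "lc u \<subseteq> X i \<and> (cn u = t \<longrightarrow> ?top u \<longrightarrow> lc u \<in> C i t)" if "1 \<le> cn u" for t
      proof -
        have "u \<in> X i" using False that by blast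
        then obtain w where w: "w \<in> set (take i ?os)" "1 \<le> cn w" "u \<in> lc w" unfolding X_def by blast
        have wV: "w \<in> V" using w(1) ord(2) in_set_takeD by fast
        have e: "lc u = lc w" "cn u = cn w" "?top u = ?top w"
          using level_comp_eq[OF wV w(3)] level_comp_mem[OF wV w(3)] top_comp_eq[OF wV w(3)] by auto
        show ?thesis unfolding e X_def C_def using w by blast
      qed
      have "X (Suc i) = X i" unfolding X_Suc using old by auto
      moreover have "C (Suc i) t = C i t" if "1 \<le> t" for t unfolding C_Suc using old[of t] that by auto
      ultimately have "I (Suc i) () (tick (tick (tick (tick (tick s')))))"
        unfolding I_def using fr mk' cnt tm by simp
      moreover have "\<not> (1 \<le> cn u \<and> arrays s' Visited ! u = 0)" using False vu by auto
      ultimately show ?thesis using ul by (auto simp: ar u_def[symmetric])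
    next
      case True
      let ?s = "tick (tick (tick (tick s')))"
      have disj: "X i \<inter> lc u = {}"
      proof (rule ccontr)
        assume "X i \<inter> lc u \<noteq> {}"
        then obtain y w where w: "w \<in> set (take i ?os)" "1 \<le> cn w" "y \<in> lc w" "y \<in> lc u" unfolding X_def by blast
        have wV: "w \<in> V" using w(1) ord(2) in_set_takeD by fast
        have "lc w = lc u" using level_comp_eq[OF wV w(3)] level_comp_eq[OF uV w(4)] by simp
        then have "u \<in> X i" unfolding X_def using w level_comp_self by blast
        then show False using True by blast
      qed
      have new: "lc u \<notin> C i (cn u)"
      proof
        assume "lc u \<in> C i (cn u)"
        then obtain w where w: "w \<in> set (take i ?os)" "cn w = cn u" "lc u = lc w" unfolding C_def by blast
        then have "u \<in> X i" unfolding X_def using True level_comp_self[of u] by auto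
        then show False using True by blast
      qed
      have adj': "adj_rep EgoDeg EgoAdj V N ?s" by (rule adj_rep_frame[OF adj]) (use fr in auto)
      have len': "\<forall>w\<in>V. w < length (arrays ?s Visited) \<and> w < length (arrays ?s EgoCore) \<and> arrays ?s EgoCore ! w = cn w"
        "card V \<le> length (arrays ?s Bfs)" using len by (simp_all add: ar)
      have sm: "(\<Sum>x\<in>X (Suc i). card (N x) + 1) = (\<Sum>x\<in>X i. card (N x) + 1) + (\<Sum>x\<in>lc u. card (N x) + 1)"
        unfolding X_Suc using True disj finite_subset[OF XV finite_V] finite_subset[OF lcV[OF uV] finite_V]
        by (simp add: sum.union_disjoint)
      have cT: "1 \<le> cn u" "cn u \<le> T" using T(1)[OF uV] True by auto
      have cl: "cn u < length (arrays s Cnt)" using cT(2) T(2) by simp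
      have "wp (bfs_prog u (cn u)) (\<lambda>b. wp (if b then do {c \<leftarrow> get Cnt (cn u); put Cnt (cn u) (c + 1)} else ret ()) (I (Suc i))) ?s"
      proof (rule wp_mono[OF bfs_prog_wp[OF uV disj len' adj']])
        show "marks (X i) ?s" using mk' by simp
        fix b s2
        assume R: "frame {Visited, Bfs} ?s s2 \<and> marks (X i \<union> lc u) s2 \<and> b = ?top u \<and>
          time s2 \<le> time ?s + 4 + 7 * (\<Sum>x\<in>lc u. card (N x) + 1)"
        have fr2: "frame {Visited, Bfs, Cnt} s s2" by (rule frame_trans[OF fr, of "{Visited, Bfs}"]) (use R in auto)
        have Xs: "X (Suc i) = X i \<union> lc u" using X_Suc True by simp
        have cn2: "arrays s2 Cnt = arrays s' Cnt" using frame_arr[of _ ?s s2 Cnt] R by auto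
        have tm2: "time s2 \<le> time s + 10 * i + 8 + 7 * (\<Sum>x\<in>X (Suc i). card (N x) + 1)"
          unfolding sm distrib_left using tm R by simp
        show "wp (if b then do {c \<leftarrow> get Cnt (cn u); put Cnt (cn u) (c + 1)} else ret ()) (I (Suc i)) s2"
        proof (cases b)
          case True
          then have t: "?top u" using R by blast
          let ?s3 = "upd Cnt (cn u) (card (C i (cn u)) + 1) (tick s2)"
          have "\<forall>t. 1 \<le> t \<and> t \<le> T \<longrightarrow> arrays ?s3 Cnt ! t = card (C (Suc i) t)"
            using cnt new t cl finC unfolding C_Suc by (auto simp: cn2 ar nth_list_update)
          moreover have "frame {Visited, Bfs, Cnt} s ?s3" by (intro frame_upd) (use fr2 in auto)
          moreover have "marks (X (Suc i)) ?s3" using R Xs by (simp add: marks_def)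
          ultimately have "I (Suc i) () ?s3" unfolding I_def using tm2 by simp
          then show ?thesis using True cl cT cnt by (simp add: cn2 ar)
        next
          case False
          then have "\<not> ?top u" using R by blast
          then have "C (Suc i) t = C i t" for t unfolding C_Suc by simp
          then have "I (Suc i) () (tick s2)" unfolding I_def using fr2 R Xs cnt tm2 cn2 by simp
          then show ?thesis using False by simp
        qed
      qed
      then show ?thesis using ul True vu by (simp add: ar u_def[symmetric])
    qed
  qed simp
qed

end

context input
begin

lemma nbhd_ego: "v < n \<Longrightarrow> nbhd (N v) (\<lambda>u. N u \<inter> N v)"
proof
  assume v: "v < n"
  then have sub: "N v \<subseteq> {..<n}" using N_sub by blast
  show "finite (N v)" using finite_N v by simp
  fix x y assume x: "x \<in> N v"
  then have xn: "x \<in> {..<n}" using sub by blast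
  show "N x \<inter> N v \<subseteq> N v" by blast
  show "x \<notin> N x \<inter> N v" using N_irrefl[OF xn] by blast
  show "y \<in> N x \<inter> N v \<Longrightarrow> x \<in> N y \<inter> N v" using N_sym[OF xn] x by blast
qed

text \<open>Every edge of the ego-network is an arc of the orientation.\<close>

lemma sum_ego_degree:
  assumes v: "v < n"
  shows "(\<Sum>u\<in>N v. card (N u \<inter> N v)) \<le> 2 * (\<Sum>u\<in>N v. card (Out u))"
proof -
  have fin: "finite (N v)" and sub: "N v \<subseteq> {..<n}" using finite_N N_sub v by auto
  have finO: "finite (Out u)" if "u \<in> N v" for u
    using finite_subset[OF Out_sub finite_N] that sub by blast
  have "(\<Sum>u\<in>N v. card (N u \<inter> N v)) \<le> (\<Sum>u\<in>N v. card (Out u) + card {w \<in> N v. u \<in> Out w})"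
  proof (rule sum_mono)
    fix u assume u: "u \<in> N v"
    then have "N u \<inter> N v \<subseteq> Out u \<union> {w \<in> N v. u \<in> Out w}" using Out_total[of u] sub by blast
    then have "card (N u \<inter> N v) \<le> card (Out u \<union> {w \<in> N v. u \<in> Out w})"
      using finO[OF u] fin by (intro card_mono) auto
    then show "card (N u \<inter> N v) \<le> card (Out u) + card {w \<in> N v. u \<in> Out w}"
      using card_Un_le le_trans by blast
  qed
  \<comment> \<open>Double counting of the arcs inside \<open>N v\<close>: the in-degrees have the
    same sum as the out-degrees.\<close>
  also have "\<dots> = (\<Sum>u\<in>N v. card (Out u)) + (\<Sum>w\<in>N v. card {u \<in> N v. u \<in> Out w})"
    unfolding sum.distrib by (subst sum_multicount_gen[OF fin fin, of _ "\<lambda>w. card {u \<in> N v. u \<in> Out w}"]) auto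
  also have "(\<Sum>w\<in>N v. card {u \<in> N v. u \<in> Out w}) \<le> (\<Sum>w\<in>N v. card (Out w))"
    by (intro sum_mono card_mono finO) auto
  finally show ?thesis by simp
qed

abbreviation score_arrays :: "arr set" where
  "score_arrays \<equiv> {Mark, EgoDeg, EgoAdj, EgoCore, Cur, Deleted, Alive, Order, Visited, Bfs, Cnt}"

text \<open>The cost of one call of Score up to a constant. Only the last summand is not controlled
  by the degree of \<open>v\<close>; summed over all \<open>v\<close> it becomes the sum of the
  smaller degrees over all edges.\<close>

definition score_cost :: "nat \<Rightarrow> nat" where
  "score_cost v = 1 + card (N v) + (\<Sum>u\<in>N v. card (Out u))"

lemma score_prog_unfold: "score_prog v = do {
     lo \<leftarrow> get Off v; hi \<leftarrow> get Off (v + 1);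
     extract_prog lo hi;
     tmax \<leftarrow> core_prog Adj lo (hi - lo) EgoDeg EgoAdj EgoCore;
     loop [1..<tmax + 1] () (\<lambda>t _. put Cnt t 0);
     loop [lo..<hi] () (\<lambda>i _. do {u \<leftarrow> get Adj i; put Visited u 0});
     count_comps (hi - lo);
     (t, s, out) \<leftarrow> search_down (\<lambda>t. t) tmax;
     ret out}"
  unfolding score_prog_def count_comps_def search_down_def by (rule refl)

lemma score_prog_wp:
  assumes W: "work s" and v: "v < n" and out: "adj_rep OutDeg OutAdj {..<n} Out s"
    and mark: "\<forall>u<n. arrays s Mark ! u = 0"
  shows "wp (score_prog v) (\<lambda>r s'. frame score_arrays s s' \<and> (\<forall>u<n. arrays s' Mark ! u = 0) \<and>
     r = h_index (N v) (\<lambda>u. N u \<inter> N v) \<and> time s' \<le> time s + 300 * score_cost v) s"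
proof -
  interpret E: core_arrays "N v" "\<lambda>u. N u \<inter> N v" Adj EgoDeg EgoAdj EgoCore
    by (rule core_arrays.intro) (simp_all add: nat_nbhd_def nbhd_ego[OF v] core_arrays_axioms_def)
  let ?lo = "off ! v" and ?hi = "off ! Suc v" and ?d = "card (N v)"
  let ?A = "\<lambda>i j. (\<lambda>j. adj ! j) ` {i..<j}"
  let ?O = "\<Sum>u\<in>N v. card (Out u)"
  \<comment> \<open>Each of the following abbreviations is the precondition of the rest of the
    program in terms of the one before, so that the phases can be treated one inside the
    other.\<close>
  let ?post = "\<lambda>x s'. frame score_arrays s (tick s') \<and> (\<forall>u<n. arrays s' Mark ! u = 0) \<and>
    snd (snd x) = h_index (N v) (\<lambda>u. N u \<inter> N v) \<and> time (tick s') \<le> time s + 300 * score_cost v"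
  let ?search = "\<lambda>tmax. wp (search_down (\<lambda>t. t) tmax) ?post"
  let ?count = "\<lambda>tmax. wp (count_comps ?d) (\<lambda>_. ?search tmax)"
  let ?visit = "\<lambda>tmax. wp (loop [?lo..<?hi] () (\<lambda>i _. do {u \<leftarrow> get Adj i; put Visited u 0})) (\<lambda>_. ?count tmax)"
  let ?zero = "\<lambda>tmax. wp (loop [1..<tmax + 1] () (\<lambda>t _. put Cnt t 0)) (\<lambda>_. ?visit tmax)"
  let ?core = "wp (core_prog Adj ?lo ?d EgoDeg EgoAdj EgoCore) ?zero"
  have inj: "inj_on (\<lambda>j. adj ! j) {?lo..<?hi}" and img: "?A ?lo ?hi = N v" using N_bij[OF v] by (auto simp: bij_betw_def)
  have hi: "?lo \<le> ?hi" "?hi \<le> length adj" "?hi - ?lo = ?d" "?hi = ?lo + ?d" using off_Suc[OF v] off_le[OF v] by auto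
  have Nv: "N v \<subseteq> {..<n}" using N_sub v by simp
  have dn: "?d < n" using card_N_less[of v] v by simp
  have aN: "adj ! i \<in> N v" if "?lo \<le> i" "i < ?hi" for i
    using that img by (metis atLeastLessThan_iff imageI)
  have bij: "bij_betw (\<lambda>i. adj ! (?lo + i)) {0..<?d} (N v)"
  proof (rule bij_betw_imageI)
    show "inj_on (\<lambda>i. adj ! (?lo + i)) {0..<?d}"
    proof (rule inj_onI)
      fix i j assume "i \<in> {0..<?d}" "j \<in> {0..<?d}" "adj ! (?lo + i) = adj ! (?lo + j)"
      then show "i = j" using inj_onD[OF inj, of "?lo + i" "?lo + j"] hi(4) by simp
    qed
    have "(\<lambda>i. ?lo + i) ` {0..<?d} = {?lo..<?hi}" using hi(4) by (simp add: add.commute)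
    then show "(\<lambda>i. adj ! (?lo + i)) ` {0..<?d} = N v" using img by (metis image_image)
  qed
  note w = work_arr[OF W]
  let ?s0 = "tick (tick s)"
  have E_sizes: "E.sizes s'" if "work s'" for s'
    unfolding E.sizes_def using Nv dn by (auto simp: work_arr[OF that])
  have X1: "wp (extract_prog ?lo ?hi) (\<lambda>_ s'. frame {Mark, EgoDeg, EgoAdj} ?s0 s' \<and>
     (\<forall>u<n. arrays s' Mark ! u = 0) \<and> adj_rep EgoDeg EgoAdj (N v) (\<lambda>u. N u \<inter> N v) s' \<and>
     time s' \<le> time ?s0 + 20 * (1 + ?d + ?O)) ?s0"
    by (rule extract_prog_wp) (use W v mark adj_rep_frame[OF out, of "{}" ?s0] in simp_all)
  have "wp (extract_prog ?lo ?hi) (\<lambda>_. ?core) ?s0"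
  proof (rule wp_mono[OF X1], elim conjE)
    fix x1 s1
    assume fr1: "frame {Mark, EgoDeg, EgoAdj} ?s0 s1" and mk1: "\<forall>u<n. arrays s1 Mark ! u = 0"
      and adj1: "adj_rep EgoDeg EgoAdj (N v) (\<lambda>u. N u \<inter> N v) s1" and tm1: "time s1 \<le> time ?s0 + 20 * (1 + ?d + ?O)"
    have W1: "work s1" by (rule work_frame[OF _ fr1]) (use W in simp_all)
    have X2: "wp (core_prog Adj ?lo ?d EgoDeg EgoAdj EgoCore) (\<lambda>r s'. frame {EgoCore, Cur, Deleted, Alive, Order} s1 s' \<and>
      (\<forall>u\<in>N v. arrays s' EgoCore ! u = E.cn u) \<and> distinct (take ?d (arrays s' Order)) \<and>
      set (take ?d (arrays s' Order)) = N v \<and> (\<forall>u\<in>N v. E.cn u \<le> r) \<and> r \<le> ?d \<and>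
      time s' \<le> time s1 + 60 * (1 + ?d + (\<Sum>u\<in>N v. card (N u \<inter> N v)))) s1"
      by (rule E.core_prog_wp[OF E_sizes[OF W1] adj1 refl]) (use hi bij in \<open>simp_all add: work_arr[OF W1]\<close>)
    show "?core s1"
    proof (rule wp_mono[OF X2], elim conjE)
      fix tmax s2
      assume fr2: "frame {EgoCore, Cur, Deleted, Alive, Order} s1 s2"
        and core: "\<forall>u\<in>N v. arrays s2 EgoCore ! u = E.cn u" and ord: "distinct (take ?d (arrays s2 Order))"
          "set (take ?d (arrays s2 Order)) = N v" and tmax: "\<forall>u\<in>N v. E.cn u \<le> tmax" "tmax \<le> ?d"
        and tm2: "time s2 \<le> time s1 + 60 * (1 + ?d + (\<Sum>u\<in>N v. card (N u \<inter> N v)))"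
      have W2: "work s2" by (rule work_frame[OF W1 fr2]) simp_all
      define I3 where "I3 i (x::unit) s' \<longleftrightarrow> frame {Cnt} s2 s' \<and>
        (\<forall>t. 1 \<le> t \<and> t < i \<longrightarrow> arrays s' Cnt ! t = 0) \<and> time s' \<le> time s2 + 2 * (i - 1)" for i x s'
      show "?zero tmax s2"
      proof (rule wp_loop[where I = I3])
        show "1 \<le> tmax + 1" "I3 1 () s2" by (simp_all add: I3_def)
        fix i x s' assume i: "1 \<le> i" "i < tmax + 1" and I: "I3 i x s'"
        have "length (arrays s' Cnt) = Suc n" using I frame_length[of "{Cnt}" s2 s' Cnt] by (simp add: I3_def work_arr[OF W2])
        then show "wp (put Cnt i 0) (I3 (Suc i)) (tick s')"
          using I i tmax(2) dn by (auto simp: I3_def nth_list_update less_Suc_eq)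
      next
        fix x s3' assume I: "I3 (tmax + 1) x s3'"
        define s3 where "s3 = tick s3'"
        have fr3: "frame {Cnt} s2 s3" and z3: "\<forall>t. 1 \<le> t \<and> t \<le> tmax \<longrightarrow> arrays s3 Cnt ! t = 0"
          and tm3: "time s3 \<le> time s2 + 2 * tmax + 1" using I by (auto simp: I3_def s3_def)
        have W3: "work s3" by (rule work_frame[OF W2 fr3]) simp_all
        define I4 where "I4 i (x::unit) s' \<longleftrightarrow> frame {Visited} s3 s' \<and>
          (\<forall>w\<in>?A ?lo i. arrays s' Visited ! w = 0) \<and> time s' \<le> time s3 + 3 * (i - ?lo)" for i x s'
        have "?visit tmax s3"
        proof (rule wp_loop[where I = I4, OF hi(1)])
          show "I4 ?lo () s3" by (simp add: I4_def)
          fix i x s' assume i: "?lo \<le> i" "i < ?hi" and I: "I4 i x s'"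
          have ar: "arrays s' Adj = adj" "length (arrays s' Visited) = n"
            using I frame_arr[of "{Visited}" s3 s' Adj] frame_length[of "{Visited}" s3 s' Visited]
            by (simp_all add: I4_def work_arr[OF W3])
          have "adj ! i < n" using aN[OF i] Nv by blast
          then show "wp (do {u \<leftarrow> get Adj i; put Visited u 0}) (I4 (Suc i)) (tick s')"
            using I i hi(2) by (auto simp: I4_def ar nth_list_update atLeastLessThanSuc)
        next
          fix x s4' assume I: "I4 ?hi x s4'"
          define s4 where "s4 = tick s4'"
          have fr4: "frame {Visited} s3 s4" and z4: "\<forall>w\<in>N v. arrays s4 Visited ! w = 0"
            and tm4: "time s4 \<le> time s3 + 3 * ?d + 1" using I img hi(3) by (auto simp: I4_def s4_def)
          have W4: "work s4" by (rule work_frame[OF W3 fr4]) simp_all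
          have fr24: "frame {Cnt, Visited} s2 s4" by (rule frame_trans[of _ _ s3 "{Visited}"]) (use fr3 fr4 in \<open>auto simp: frame_def\<close>)
          have fr14: "frame {Cnt, Visited, EgoCore, Cur, Deleted, Alive, Order} s1 s4"
            by (rule frame_trans[of _ _ s2 "{Cnt, Visited}"]) (use fr2 fr24 in \<open>auto simp: frame_def\<close>)
          have fr04: "frame score_arrays s s4"
            by (rule frame_trans[of _ _ s1 "{Cnt, Visited, EgoCore, Cur, Deleted, Alive, Order}"])
              (use fr1 fr14 in \<open>auto simp: frame_def\<close>)
          have ar4: "arrays s4 EgoCore = arrays s2 EgoCore" "arrays s4 Order = arrays s2 Order" "arrays s4 Cnt = arrays s3 Cnt"
            "arrays s4 Mark = arrays s1 Mark"
            using frame_arr[OF fr24] frame_arr[OF fr4, of Cnt] frame_arr[OF fr14, of Mark] by auto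
          have adj4: "adj_rep EgoDeg EgoAdj (N v) (\<lambda>u. N u \<inter> N v) s4" by (rule adj_rep_frame[OF adj1 fr14]) simp
          have X5: "wp (count_comps ?d) (\<lambda>_ s'. frame {Visited, Bfs, Cnt} s4 s' \<and>
            (\<forall>t. 1 \<le> t \<and> t \<le> tmax \<longrightarrow> arrays s' Cnt ! t = card (top_comps (N v) (\<lambda>u. N u \<inter> N v) t)) \<and>
            time s' \<le> time s4 + 20 * (1 + ?d + (\<Sum>x\<in>N v. card (N x \<inter> N v)))) s4"
          proof (rule E.count_comps_wp)
            show "\<forall>w\<in>N v. w < length (arrays s4 Visited) \<and> w < length (arrays s4 EgoCore) \<and> arrays s4 EgoCore ! w = E.cn w"
              using Nv core by (auto simp: work_arr[OF W4] work_arr[OF W2] work_arr[OF W3] ar4)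
            show "E.marks {} s4" using z4 by (simp add: E.marks_def)
          qed (use dn adj4 ord tmax z3 in \<open>simp_all add: work_arr[OF W4] work_arr[OF W2] work_arr[OF W3] ar4\<close>)
          have "?count tmax s4"
          proof (rule wp_mono[OF X5], elim conjE)
            fix x5 s5
            assume fr5: "frame {Visited, Bfs, Cnt} s4 s5"
              and c5: "\<forall>t. 1 \<le> t \<and> t \<le> tmax \<longrightarrow> arrays s5 Cnt ! t = card (top_comps (N v) (\<lambda>u. N u \<inter> N v) t)"
              and tm5: "time s5 \<le> time s4 + 20 * (1 + ?d + (\<Sum>x\<in>N v. card (N x \<inter> N v)))"
            have fr05: "frame score_arrays s s5" by (rule frame_trans[OF fr04 fr5]) simp
            have "length (arrays s5 Cnt) = Suc n" using frame_length[OF fr5] by (simp add: work_arr[OF W4])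
            then have l5: "tmax < length (arrays s5 Cnt)" using tmax(2) dn by simp
            have h: "h_index (N v) (\<lambda>u. N u \<inter> N v) =
               Max (insert 0 {x \<in> {1..tmax}. x \<le> (\<Sum>i=x..tmax. card (top_comps (N v) (\<lambda>u. N u \<inter> N v) i))})"
              using E.h_index_alt[of tmax] tmax(1) by (simp add: h_set_def)
            show "?search tmax s5"
            proof (rule wp_mono[OF search_down_wp[OF l5, of "\<lambda>t. card (top_comps (N v) (\<lambda>u. N u \<inter> N v) t)"]])
              show "arrays s5 Cnt ! t = card (top_comps (N v) (\<lambda>u. N u \<inter> N v) t)" if "1 \<le> t" "t \<le> tmax" for t
                using c5 that by blast
              fix x s6
              assume R: "frame {} s5 s6 \<and> snd (snd x) = Max (insert 0 {x \<in> {1..tmax}.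
                  x \<le> (\<Sum>i=x..tmax. card (top_comps (N v) (\<lambda>u. N u \<inter> N v) i))}) \<and> time s6 \<le> time s5 + 3 * tmax + 1"
              have "frame score_arrays s s6" by (rule frame_trans[OF fr05, of "{}"]) (use R in auto)
              moreover have "arrays s6 Mark = arrays s5 Mark" "arrays s5 Mark = arrays s4 Mark"
                using R frame_arr[of "{}" s5 s6 Mark] frame_arr[OF fr5, of Mark] by auto
              \<comment> \<open>Core decomposition and searches are linear in the degrees within the
                ego-network; \<open>sum_ego_degree\<close> converts these into the out-degrees of
                \<open>score_cost\<close>.\<close>
              moreover have "time (tick s6) \<le> time s + 300 * score_cost v"
                using R tm5 tm4 tm3 tm2 tm1 tmax(2) sum_ego_degree[OF v]
                unfolding score_cost_def distrib_left tick_simps by linarith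
              ultimately show "frame score_arrays s (tick s6) \<and> (\<forall>u<n. arrays s6 Mark ! u = 0) \<and>
                snd (snd x) = h_index (N v) (\<lambda>u. N u \<inter> N v) \<and> time (tick s6) \<le> time s + 300 * score_cost v"
                using R mk1 ar4 unfolding h by simp
            qed
          qed
          then show "?count tmax (tick s4')"
            by (simp only: s4_def)
        qed
        then show "?visit tmax (tick s3')"
          by (simp only: s3_def)
      qed
    qed
  qed
  then have "wp (extract_prog ?lo ?hi) (\<lambda>_. wp (core_prog Adj ?lo (?hi - ?lo) EgoDeg EgoAdj EgoCore) (\<lambda>tmax.
      wp (loop [1..<tmax + 1] () (\<lambda>t _. put Cnt t 0)) (\<lambda>_.
      wp (loop [?lo..<?hi] () (\<lambda>i _. do {u \<leftarrow> get Adj i; put Visited u 0})) (\<lambda>_.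
      wp (count_comps (?hi - ?lo)) (\<lambda>_.
      wp (search_down (\<lambda>t. t) tmax) (\<lambda>x s'. frame score_arrays s (tick s') \<and> (\<forall>u<n. arrays (tick s') Mark ! u = 0) \<and>
     snd (snd x) = h_index (N v) (\<lambda>u. N u \<inter> N v) \<and> time (tick s') \<le> time s + 300 * score_cost v)))))) ?s0"
    unfolding hi(3) tick_simps .
  then show ?thesis
    unfolding score_prog_unfold using v
    by (simp only: wp_bind wp_get wp_case_prod wp_ret w off tick_simps Suc_eq_plus1[symmetric]) (simp only: less_SucI Suc_less_eq simp_thms)
qed

end

section \<open>Preprocessing\<close>

context input
begin

lemma adj_image: "v < n \<Longrightarrow> off ! v \<le> j \<Longrightarrow> j < off ! Suc v \<Longrightarrow> adj ! j \<in> N v"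
  using N_bij[of v] by (auto simp: bij_betw_def)

lemma adj_fresh:
  assumes "v < n" "off ! v \<le> i" "i < off ! Suc v"
  shows "adj ! i \<notin> (\<lambda>j. adj ! j) ` {off ! v..<i}"
proof
  assume "adj ! i \<in> (\<lambda>j. adj ! j) ` {off ! v..<i}"
  then obtain j where "off ! v \<le> j" "j < i" "adj ! i = adj ! j" by auto
  moreover have "inj_on (\<lambda>j. adj ! j) {off ! v..<off ! Suc v}" using N_bij[OF assms(1)] by (simp add: bij_betw_def)
  ultimately show False using inj_onD[of _ _ i j] assms by fastforce
qed

text \<open>The list of \<open>v\<close> is written at the front of the range of \<open>v\<close>,
  with at most one entry for each neighbour read, so it stays within this range and leaves the
  finished lists of smaller vertices untouched.\<close>

lemma orient_prog_wp:
  assumes W: "work s" and deg: "\<forall>v<n. arrays s Deg ! v = card (N v)"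
  shows "wp (orient_prog n) (\<lambda>_ s'. frame {OutAdj, OutDeg} s s' \<and> adj_rep OutDeg OutAdj {..<n} Out s' \<and>
    time s' \<le> time s + 1 + (\<Sum>v<n. 6 + 5 * card (N v))) s"
proof -
  let ?X = "{OutAdj, OutDeg}"
  let ?A = "\<lambda>i j. (\<lambda>j. adj ! j) ` {i..<j}"
  define ok where "ok u s' \<longleftrightarrow> arrays s' OutDeg ! u = card (Out u) \<and>
    bij_betw (\<lambda>j. arrays s' OutAdj ! j) {off ! u..<off ! u + card (Out u)} (Out u)" for u and s' :: mem
  define I where "I v (x::unit) s' \<longleftrightarrow> frame ?X s s' \<and> (\<forall>u<v. ok u s') \<and>
    time s' \<le> time s + (\<Sum>v<v. 6 + 5 * card (N v))" for v x s'
  have cO: "card (Out u) \<le> card (N u)" if "u < n" for u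
    using Out_sub finite_N that by (intro card_mono) auto
  show ?thesis
    unfolding orient_prog_def
  proof (rule wp_loop[where I = I])
    show "I 0 () s" by (simp add: I_def)
  next
    fix x s' assume I: "I n x s'"
    then have W': "work s'" using work_frame[OF W, of ?X s'] by (simp add: I_def)
    have "adj_rep OutDeg OutAdj {..<n} Out (tick s')"
      unfolding adj_rep_def
    proof (intro ballI)
      fix u assume "u \<in> {..<n}"
      then have u: "u < n" by simp
      then have "ok u s'" using I by (simp add: I_def)
      then show "u < length (arrays (tick s') Off) \<and> u < length (arrays (tick s') OutDeg) \<and>
        arrays (tick s') OutDeg ! u = card (Out u) \<and>
        arrays (tick s') Off ! u + card (Out u) \<le> length (arrays (tick s') OutAdj) \<and>
        bij_betw (\<lambda>j. arrays (tick s') OutAdj ! j)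
          {arrays (tick s') Off ! u..<arrays (tick s') Off ! u + card (Out u)} (Out u)"
        using u off_le[OF u] cO[OF u] off(1) by (simp add: ok_def work_arr[OF W'])
    qed
    then show "frame ?X s (tick s') \<and> adj_rep OutDeg OutAdj {..<n} Out (tick s') \<and>
      time (tick s') \<le> time s + 1 + (\<Sum>v<n. 6 + 5 * card (N v))" using I by (simp add: I_def)
  next
    fix v x s' assume "0 \<le> v" and v: "v < n" and I: "I v x s'"
    have fr: "frame ?X s s'" and oks: "\<forall>u<v. ok u s'" and tm: "time s' \<le> time s + (\<Sum>v<v. 6 + 5 * card (N v))"
      using I by (simp_all add: I_def)
    have W': "work s'" by (rule work_frame[OF W fr]) simp_all
    have deg': "arrays s' Deg = arrays s Deg" by (rule frame_arr[OF fr]) simp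
    let ?lo = "off ! v" and ?hi = "off ! Suc v"
    have hi: "?lo \<le> ?hi" "?hi - ?lo = card (N v)" "?hi \<le> length adj" "?hi = ?lo + card (N v)"
      using off_Suc[OF v] off_le[OF v] by auto
    define S where "S j = Out v \<inter> ?A ?lo j" for j
    define J where "J j p s2 \<longleftrightarrow> frame ?X s s2 \<and> (\<forall>u<v. ok u s2) \<and> p = card (S j) \<and> p \<le> j - ?lo \<and>
      bij_betw (\<lambda>j. arrays s2 OutAdj ! j) {?lo..<?lo + card (S j)} (S j) \<and>
      time s2 \<le> time s' + 4 + 5 * (j - ?lo)" for j p s2
    have fin: "finite (S j)" for j unfolding S_def by simp
    have S_end: "S ?hi = Out v" unfolding S_def using N_bij[OF v] Out_sub by (auto simp: bij_betw_def)
    let ?s = "tick (tick (tick (tick s')))"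
    have inner: "wp (loop [?lo..<?hi] 0 (\<lambda>j p. do {
       w \<leftarrow> get Adj j; e \<leftarrow> get Deg w;
       if card (N v) < e \<or> (card (N v) = e \<and> v < w) then do {put OutAdj (?lo + p) w; ret (p + 1)} else ret p}))
       (\<lambda>p. wp (put OutDeg v p) (I (Suc v))) ?s"
    proof (rule wp_loop[where I = J, OF hi(1)])
      show "J ?lo 0 ?s" unfolding J_def S_def using fr oks by (simp add: ok_def bij_betw_def)
    next
      fix p s2 assume J: "J ?hi p s2"
      have fr2: "frame ?X s s2" and oks2: "\<forall>u<v. ok u s2" using J by (simp_all add: J_def)
      have W2: "work s2" by (rule work_frame[OF W fr2]) simp_all
      have p: "p = card (Out v)" and b: "bij_betw (\<lambda>j. arrays s2 OutAdj ! j) {?lo..<?lo + card (Out v)} (Out v)"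
        using J unfolding J_def S_end by simp_all
      let ?s3 = "upd OutDeg v p (tick s2)"
      have "ok u ?s3" if "u < Suc v" for u
      proof (cases "u = v")
        case True
        then show ?thesis using v b p by (simp add: ok_def work_arr[OF W2])
      next
        case False
        then show ?thesis using oks2 that by (simp add: ok_def)
      qed
      moreover have "frame ?X s ?s3" by (intro frame_upd) (use fr2 in auto)
      moreover have "time s2 \<le> time s' + 4 + 5 * card (N v)" using J hi(2) by (simp add: J_def)
      ultimately have "I (Suc v) () ?s3" unfolding I_def using tm by simp
      then show "wp (put OutDeg v p) (I (Suc v)) (tick s2)" using v by (simp add: work_arr[OF W2])
    next
      fix j p s2 assume j: "?lo \<le> j" "j < ?hi" and J: "J j p s2"
      let ?w = "adj ! j"
      have fr2: "frame ?X s s2" and oks2: "\<forall>u<v. ok u s2" and p: "p = card (S j)" "p \<le> j - ?lo"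
        and b: "bij_betw (\<lambda>j. arrays s2 OutAdj ! j) {?lo..<?lo + card (S j)} (S j)"
        and tm2: "time s2 \<le> time s' + 4 + 5 * (j - ?lo)"
        using J by (simp_all add: J_def)
      have W2: "work s2" by (rule work_frame[OF W fr2]) simp_all
      have d2: "arrays s2 Deg = arrays s Deg" by (rule frame_arr[OF fr2]) simp
      have w: "?w \<in> N v" "?w < n" using adj_image[OF v j] N_sub[of v] v by auto
      have wS: "?w \<notin> S j" unfolding S_def using adj_fresh[OF v j] by blast
      have SS: "S (Suc j) = (if ?w \<in> Out v then insert ?w (S j) else S j)"
        using j by (auto simp: S_def atLeastLessThanSuc)
      have t5: "5 * (Suc j - ?lo) = 5 * (j - ?lo) + 5" using j by simp
      have wO: "?w \<in> Out v \<longleftrightarrow> card (N v) < card (N ?w) \<or> (card (N v) = card (N ?w) \<and> v < ?w)"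
        using w by (simp add: Out_def)
      show "wp (do {
       w \<leftarrow> get Adj j; e \<leftarrow> get Deg w;
       if card (N v) < e \<or> (card (N v) = e \<and> v < w) then do {put OutAdj (?lo + p) w; ret (p + 1)} else ret p})
        (J (Suc j)) (tick s2)"
      proof (cases "?w \<in> Out v")
        case False
        then have "J (Suc j) p (tick (tick (tick (tick s2))))"
          unfolding J_def SS t5 using fr2 oks2 p b tm2 by (simp add: ok_def)
        then show ?thesis using False w j hi deg unfolding wO by (auto simp: work_arr[OF W2] work_arr[OF W] d2)
      next
        case True
        let ?s3 = "upd OutAdj (?lo + p) ?w (tick (tick (tick s2)))"
        have l: "?lo + p < length (arrays s2 OutAdj)" using p j hi by (simp add: work_arr[OF W2])
        have "bij_betw (\<lambda>i. (arrays s2 OutAdj)[?lo + card (S j) := ?w] ! i) {?lo..<?lo + card (insert ?w (S j))} (insert ?w (S j))"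
          by (rule bij_betw_snoc[OF b fin wS]) (use l p in simp)
        then have b3: "bij_betw (\<lambda>j. arrays ?s3 OutAdj ! j) {?lo..<?lo + card (S (Suc j))} (S (Suc j))"
          using True p by (simp add: SS)
        have "ok u ?s3" if "u < v" for u
        proof -
          have un: "u < n" using that v by simp
          have "off ! u + card (Out u) \<le> ?lo" using off_disjoint[OF un v that] cO[OF un] by simp
          then have "bij_betw (\<lambda>j. (arrays s2 OutAdj)[?lo + p := ?w] ! j) {off ! u..<off ! u + card (Out u)} (Out u) =
            bij_betw (\<lambda>j. arrays s2 OutAdj ! j) {off ! u..<off ! u + card (Out u)} (Out u)"
            by (intro bij_betw_cong) auto
          then show ?thesis using oks2 that by (simp add: ok_def)
        qed
        moreover have "frame ?X s ?s3" by (intro frame_upd) (use fr2 in auto)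
        moreover have "card (S (Suc j)) = Suc p" using True wS fin p by (simp add: SS)
        ultimately have "J (Suc j) (p + 1) (tick ?s3)"
          unfolding J_def t5 using b3 p(2) j tm2 by (simp add: ok_def)
        then show ?thesis using True w j hi deg l unfolding wO by (auto simp: work_arr[OF W2] work_arr[OF W] d2)
      qed
    qed
    then show "wp (do {
     o1 \<leftarrow> get Off v; o2 \<leftarrow> get Off (v + 1); d \<leftarrow> get Deg v;
     p \<leftarrow> loop [o1..<o2] 0 (\<lambda>j p. do {
       w \<leftarrow> get Adj j; e \<leftarrow> get Deg w;
       if d < e \<or> (d = e \<and> v < w) then do {put OutAdj (o1 + p) w; ret (p + 1)} else ret p});
     put OutDeg v p}) (I (Suc v)) (tick s')"
      using v deg off(1) unfolding wp_bind wp_get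
      by (simp only: work_arr[OF W'] work_arr[OF W] tick_simps deg' Suc_eq_plus1[symmetric] Suc_less_eq less_SucI simp_thms)
  qed simp
qed

definition bound :: "nat \<Rightarrow> nat" where
  "bound v = Max (insert 0 {x. 1 \<le> x \<and> x * (x + 1) \<le> card {u \<in> N v. x \<le> min (cn v) (cn u - 1)}})"

text \<open>Written with a histogram of the values and cut off at the degree of \<open>v\<close>,
  the bound takes the form that \<open>search_down\<close> evaluates. The cut-off is harmless
  because \<open>x \<le> x * (x + 1)\<close> and at most \<open>card (N v)\<close> neighbours are
  counted.\<close>

lemma bound_alt:
  assumes v: "v < n"
  shows "bound v = Max (insert 0 {x \<in> {1..card (N v)}. x * (x + 1) \<le>
    (\<Sum>i=x..card (N v). card {u \<in> N v. min (cn v) (cn u - 1) = i})})"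
proof -
  let ?m = "\<lambda>u. min (cn v) (cn u - 1)"
  have fin: "finite (N v)" using finite_N v by simp
  have le: "?m u \<le> card (N v)" for u using core_number_le_card[of v] v by simp
  have sm: "(\<Sum>i=x..card (N v). card {u \<in> N v. ?m u = i}) = card {u \<in> N v. x \<le> ?m u}" for x
  proof -
    have "{u \<in> N v. x \<le> ?m u} = (\<Union>i\<in>{x..card (N v)}. {u \<in> N v. ?m u = i})" using le by auto
    then show ?thesis using fin by (simp only:) (subst card_UN_disjoint, auto)
  qed
  have "x \<le> card (N v)" if "1 \<le> x" "x * (x + 1) \<le> card {u \<in> N v. x \<le> ?m u}" for x
  proof -
    have "x \<le> x * (x + 1)" by simp
    also have "\<dots> \<le> card {u \<in> N v. x \<le> ?m u}" by (rule that(2))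
    also have "\<dots> \<le> card (N v)" by (rule card_mono[OF fin]) auto
    finally show ?thesis .
  qed
  then have "{x. 1 \<le> x \<and> x * (x + 1) \<le> card {u \<in> N v. x \<le> ?m u}} =
      {x \<in> {1..card (N v)}. x * (x + 1) \<le> card {u \<in> N v. x \<le> ?m u}}"
    by (intro Collect_cong) (metis atLeastAtMost_iff)
  then show ?thesis unfolding bound_def sm by simp
qed

lemma bound_le: "v < n \<Longrightarrow> bound v \<le> card (N v)"
  unfolding bound_alt by (rule Max.boundedI) auto

lemma bound_less: "v < n \<Longrightarrow> bound v < n"
  using bound_le[of v] card_N_less[of v] by simp

lemma upper_prog_unfold: "upper_prog v = do {
     lo \<leftarrow> get Off v; hi \<leftarrow> get Off (v + 1); cv \<leftarrow> get Core v;
     loop [0..<hi - lo + 1] () (\<lambda>x _. put Cnt x 0);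
     loop [lo..<hi] () (\<lambda>j _. do {
       u \<leftarrow> get Adj j; cu \<leftarrow> get Core u;
       c \<leftarrow> get Cnt (min cv (cu - 1)); put Cnt (min cv (cu - 1)) (c + 1)});
     (x, s, out) \<leftarrow> search_down (\<lambda>x. x * (x + 1)) (hi - lo);
     put Upper v out}"
  unfolding upper_prog_def search_down_def by (rule refl)

text \<open>The values \<open>min (cn v) (cn u - 1)\<close> do not exceed the degree of
  \<open>v\<close>, so counting them in an array takes time linear in the degree, without
  sorting.\<close>

lemma upper_prog_wp:
  assumes W: "work s" and v: "v < n" and core: "\<forall>u<n. arrays s Core ! u = cn u"
  shows "wp (upper_prog v) (\<lambda>_ s'. frame {Cnt, Upper} s s' \<and> arrays s' Upper = (arrays s Upper)[v := bound v] \<and>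
    time s' \<le> time s + 20 * (1 + card (N v))) s"
proof -
  let ?lo = "off ! v" and ?hi = "off ! Suc v" and ?d = "card (N v)"
  let ?A = "\<lambda>i j. (\<lambda>j. adj ! j) ` {i..<j}"
  let ?m = "\<lambda>u. min (cn v) (cn u - 1)"
  have hi: "?lo \<le> ?hi" "?hi - ?lo = ?d" "?hi \<le> length adj" "?hi = ?lo + ?d"
    using off_Suc[OF v] off_le[OF v] by auto
  have dn: "?d < n" using card_N_less[of v] v by simp
  have md: "?m u \<le> ?d" for u using core_number_le_card[of v] v by simp
  have img: "?A ?lo ?hi = N v" using N_bij[OF v] by (simp add: bij_betw_def)
  define g where "g j i = card {u \<in> ?A ?lo j. ?m u = i}" for j i
  have g_end: "g ?hi = (\<lambda>i. card {u \<in> N v. ?m u = i})" unfolding g_def img by (rule refl)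
  let ?s = "tick (tick (tick s))"
  define I1 where "I1 i (x::unit) s' \<longleftrightarrow> frame {Cnt} s s' \<and> (\<forall>t<i. arrays s' Cnt ! t = 0) \<and> time s' \<le> time s + 3 + 2 * i" for i x s'
  define I2 where "I2 j (x::unit) s' \<longleftrightarrow> frame {Cnt} s s' \<and> (\<forall>t\<le>?d. arrays s' Cnt ! t = g j t) \<and>
    time s' \<le> time s + 6 + 2 * ?d + 5 * (j - ?lo)" for j x s'
  define Q where "Q s' \<longleftrightarrow> frame {Cnt, Upper} s s' \<and> arrays s' Upper = (arrays s Upper)[v := bound v] \<and>
    time s' \<le> time s + 20 * (1 + card (N v))" for s'
  have L3: "wp (search_down (\<lambda>x. x * (x + 1)) ?d) (\<lambda>x. wp (put Upper v (snd (snd x))) (\<lambda>_. Q)) (tick s')"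
    if I: "I2 ?hi () s'" for s'
  proof -
    have fr: "frame {Cnt} s s'" using I by (simp add: I2_def)
    have W': "work s'" by (rule work_frame[OF W fr]) simp_all
    have l: "?d < length (arrays (tick s') Cnt)" using dn by (simp add: work_arr[OF W'])
    show ?thesis
    proof (rule wp_mono[OF search_down_wp[OF l, of "g ?hi"]])
      show "arrays (tick s') Cnt ! t = g ?hi t" if "1 \<le> t" "t \<le> ?d" for t using I that by (simp add: I2_def)
      fix x s2 assume R: "frame {} (tick s') s2 \<and> snd (snd x) = Max (insert 0 {x \<in> {1..?d}. x * (x + 1) \<le> (\<Sum>i=x..?d. g ?hi i)}) \<and>
        time s2 \<le> time (tick s') + 3 * ?d + 1"
      have out: "snd (snd x) = bound v" using R unfolding bound_alt[OF v] g_end by blast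
      have fr2: "frame {Cnt} s s2" by (rule frame_trans[OF fr, of "{}"]) (use R in auto)
      have u2: "arrays s2 Upper = arrays s Upper" by (rule frame_arr[OF fr2]) simp
      have fr3: "frame {Cnt, Upper} s (upd Upper v (bound v) s2)"
        by (intro frame_upd) (use fr2 in \<open>auto simp: frame_def\<close>)
      have "Q (upd Upper v (bound v) s2)"
        unfolding Q_def using fr3 R I hi(2) by (simp add: u2 I2_def)
      then show "wp (put Upper v (snd (snd x))) (\<lambda>_. Q) s2" using v by (simp add: out u2 work_arr[OF W])
    qed
  qed
  have L2: "wp (loop [?lo..<?hi] () (\<lambda>j _. do {
       u \<leftarrow> get Adj j; cu \<leftarrow> get Core u;
       c \<leftarrow> get Cnt (min (cn v) (cu - 1)); put Cnt (min (cn v) (cu - 1)) (c + 1)}))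
     (\<lambda>_. wp (search_down (\<lambda>x. x * (x + 1)) ?d) (\<lambda>x. wp (put Upper v (snd (snd x))) (\<lambda>_. Q))) (tick s')"
    if I: "I1 (?d + 1) () s'" for s'
  proof (rule wp_loop[where I = I2, OF hi(1)])
    show "I2 ?lo () (tick s')" using I by (simp add: I1_def I2_def g_def)
    show "wp (search_down (\<lambda>x. x * (x + 1)) ?d) (\<lambda>x. wp (put Upper v (snd (snd x))) (\<lambda>_. Q)) (tick s2)"
      if "I2 ?hi x s2" for x s2 using L3 that by simp
  next
    fix j x s2 assume j: "?lo \<le> j" "j < ?hi" and I: "I2 j x s2"
    have fr: "frame {Cnt} s s2" and c: "\<forall>t\<le>?d. arrays s2 Cnt ! t = g j t" and tm: "time s2 \<le> time s + 6 + 2 * ?d + 5 * (j - ?lo)"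
      using I by (simp_all add: I2_def)
    have W': "work s2" by (rule work_frame[OF W fr]) simp_all
    have core': "arrays s2 Core = arrays s Core" by (rule frame_arr[OF fr]) simp
    let ?w = "adj ! j"
    have w: "?w < n" using adj_image[OF v j] N_sub[of v] v by auto
    have t5: "5 * (Suc j - ?lo) = 5 * (j - ?lo) + 5" using j by simp
    have AS: "?A ?lo (Suc j) = insert ?w (?A ?lo j)" using j by (simp add: atLeastLessThanSuc)
    have gS: "g (Suc j) i = (if ?m ?w = i then g j i + 1 else g j i)" for i
    proof (cases "?m ?w = i")
      case True
      then have "{u \<in> ?A ?lo (Suc j). ?m u = i} = insert ?w {u \<in> ?A ?lo j. ?m u = i}" unfolding AS by auto
      moreover have "?w \<notin> {u \<in> ?A ?lo j. ?m u = i}" using adj_fresh[OF v j] by blast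
      ultimately show ?thesis using True by (simp add: g_def)
    next
      case False
      then have "{u \<in> ?A ?lo (Suc j). ?m u = i} = {u \<in> ?A ?lo j. ?m u = i}" unfolding AS by auto
      then show ?thesis using False by (simp add: g_def)
    qed
    have ml: "?m ?w < length (arrays s2 Cnt)" using md[of ?w] dn by (simp add: work_arr[OF W'])
    let ?s3 = "upd Cnt (?m ?w) (g j (?m ?w) + 1) (tick (tick (tick (tick s2))))"
    have "\<forall>t\<le>?d. arrays ?s3 Cnt ! t = g (Suc j) t" using c ml by (auto simp: gS nth_list_update)
    moreover have "frame {Cnt} s ?s3" by (intro frame_upd) (use fr in auto)
    ultimately have "I2 (Suc j) () ?s3" unfolding I2_def t5 using tm by simp
    moreover have "arrays s2 Cnt ! ?m ?w = g j (?m ?w)" using c md by blast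
    ultimately show "wp (do {
       u \<leftarrow> get Adj j; cu \<leftarrow> get Core u;
       c \<leftarrow> get Cnt (min (cn v) (cu - 1)); put Cnt (min (cn v) (cu - 1)) (c + 1)}) (I2 (Suc j)) (tick s2)"
      using j hi w ml core by (simp add: work_arr[OF W'] work_arr[OF W] core')
  qed
  have L1: "wp (loop [0..<?d + 1] () (\<lambda>x _. put Cnt x 0)) (\<lambda>_. wp (loop [?lo..<?hi] () (\<lambda>j _. do {
       u \<leftarrow> get Adj j; cu \<leftarrow> get Core u;
       c \<leftarrow> get Cnt (min (cn v) (cu - 1)); put Cnt (min (cn v) (cu - 1)) (c + 1)}))
     (\<lambda>_. wp (search_down (\<lambda>x. x * (x + 1)) ?d) (\<lambda>x. wp (put Upper v (snd (snd x))) (\<lambda>_. Q)))) ?s"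
  proof (rule wp_loop[where I = I1])
    show "I1 0 () ?s" by (simp add: I1_def)
  next
    fix i x s' assume i: "i < ?d + 1" and I: "I1 i x s'"
    have "length (arrays s' Cnt) = Suc n" using I frame_length[of "{Cnt}" s s' Cnt] by (simp add: I1_def work_arr[OF W])
    then show "wp (put Cnt i 0) (I1 (Suc i)) (tick s')"
      using I i dn by (auto simp: I1_def nth_list_update less_Suc_eq)
  qed (use L2 in simp_all)
  show ?thesis
    using L1 v core off(1) unfolding upper_prog_unfold wp_bind wp_get wp_case_prod hi(2)[symmetric] Q_def
    by (simp only: work_arr[OF W] tick_simps Suc_eq_plus1[symmetric] Suc_less_eq less_SucI simp_thms)
qed

end

section \<open>Buckets\<close>

primrec chain :: "nat list \<Rightarrow> nat \<Rightarrow> nat list \<Rightarrow> bool" where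
  "chain nx y [] \<longleftrightarrow> y = 0"
| "chain nx y (i # is) \<longleftrightarrow> y = Suc i \<and> i < length nx \<and> chain nx (nx ! i) is"

lemma chain_0 [simp]: "chain nx 0 is \<longleftrightarrow> is = []" by (cases "is") auto

lemma chain_update: "i \<notin> set is \<Longrightarrow> chain (nx[i := z]) y is = chain nx y is"
  by (induction "is" arbitrary: y) auto

definition buckets :: "nat \<Rightarrow> nat list \<Rightarrow> nat list \<Rightarrow> (nat \<Rightarrow> nat list) \<Rightarrow> bool" where
  "buckets m ha nx bs \<longleftrightarrow> m \<le> length ha \<and> (\<forall>x<m. chain nx (ha ! x) (bs x))"

text \<open>All buckets share the link array \<open>nx\<close>; overwriting the entry of
  \<open>i\<close> is safe because \<open>i\<close> is in none of them.\<close>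

lemma buckets_push:
  assumes "buckets m ha nx bs" "x < m" "i < length nx" "\<forall>y<m. i \<notin> set (bs y)"
  shows "buckets m (ha[x := Suc i]) (nx[i := ha ! x]) (bs(x := i # bs x))"
  using assms by (auto simp: buckets_def nth_list_update chain_update)

lemma buckets_pop:
  assumes "buckets m ha nx bs" "x < m" "bs x = i # is"
  shows "ha ! x = Suc i" "i < length nx" "buckets m (ha[x := nx ! i]) nx (bs(x := is))"
proof -
  have "chain nx (ha ! x) (i # is)" using assms by (auto simp: buckets_def)
  then show "ha ! x = Suc i" "i < length nx" "buckets m (ha[x := nx ! i]) nx (bs(x := is))"
    using assms by (auto simp: buckets_def nth_list_update)
qed

lemma sorted_wrt_concat:
  fixes f :: "'b \<Rightarrow> 'c :: preorder"
  assumes "\<And>x u. u \<in> set (B x) \<Longrightarrow> f u = x" "sorted_wrt (\<ge>) xs"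
  shows "sorted_wrt (\<lambda>u w. f u \<ge> f w) (concat (map B xs))"
  using assms(2)
proof (induction xs)
  case (Cons x xs)
  have 1: "sorted_wrt (\<lambda>u w. f u \<ge> f w) (B x)"
    unfolding sorted_wrt_iff_nth_less
  proof (intro allI impI)
    fix i j assume "i < j" "j < length (B x)"
    then have "f (B x ! i) = x" "f (B x ! j) = x" using assms(1)[OF nth_mem] by simp_all
    then show "f (B x ! i) \<ge> f (B x ! j)" by simp
  qed
  have 2: "f u \<ge> f w" if u: "u \<in> set (B x)" and w: "w \<in> set (concat (map B xs))" for u w
  proof -
    obtain y where "y \<in> set xs" "w \<in> set (B y)" using w by auto
    then show ?thesis using assms(1)[OF u] assms(1)[of w y] Cons.prems by simp
  qed
  show ?case using 1 2 Cons by (simp add: sorted_wrt_append)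
qed simp

context input
begin

text \<open>A bucket sort: bounds are smaller than \<open>n\<close>, so \<open>n\<close> buckets are
  enough, and reading them out costs a constant for each bucket and for each element.\<close>

lemma rank_prog_wp:
  assumes W: "work s" and f: "\<forall>v<n. arrays s Upper ! v < n" and z: "\<forall>x<n. arrays s UHead ! x = 0"
  shows "wp (rank_prog n) (\<lambda>_ s'. frame {UHead, UNext, Ranked} s s' \<and> distinct (arrays s' Ranked) \<and>
    set (arrays s' Ranked) = {..<n} \<and> sorted_wrt (\<lambda>u w. arrays s Upper ! u \<ge> arrays s Upper ! w) (arrays s' Ranked) \<and>
    time s' \<le> time s + 20 * (1 + n)) s"
proof -
  let ?X = "{UHead, UNext, Ranked}"
  let ?f = "\<lambda>v. arrays s Upper ! v"
  \<comment> \<open>Pushing puts an element in front, so every bucket lists its vertices in reverse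
    order of insertion.\<close>
  define B where "B v x = rev (filter (\<lambda>u. ?f u = x) [0..<v])" for v x
  have B_Suc: "B (Suc v) = (B v)(?f v := v # B v (?f v))" for v by (auto simp: B_def fun_eq_iff)
  let ?all = "concat (map (B n) (rev [0..<n]))"
  have B: "u \<in> set (B n x) \<longleftrightarrow> u < n \<and> ?f u = x" for u x by (auto simp: B_def)
  have all_set: "set ?all = {..<n}" using B f by auto
  have all_dist: "distinct (concat (map (B n) xs))" if "distinct xs" for xs
    using that
  proof (induction xs)
    case (Cons x xs)
    have "distinct (B n x)" by (simp add: B_def)
    moreover have "set (B n x) \<inter> set (concat (map (B n) xs)) = {}" using Cons.prems by (auto simp: B)
    ultimately show ?case using Cons by simp
  qed simp
  have all_len: "length ?all = n" using distinct_card[OF all_dist[of "rev [0..<n]"]] all_set by simp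
  have all_sorted: "sorted_wrt (\<lambda>u w. ?f u \<ge> ?f w) ?all"
    by (rule sorted_wrt_concat) (auto simp: B sorted_wrt_rev)
  define I where "I v (x::unit) s' \<longleftrightarrow> frame ?X s s' \<and> buckets n (arrays s' UHead) (arrays s' UNext) (B v) \<and>
    time s' \<le> time s + 5 * v" for v x s'
  define J where "J done q s' \<longleftrightarrow> frame ?X s s' \<and> buckets n (arrays s' UHead) (arrays s' UNext) (B n) \<and>
    take q (arrays s' Ranked) = concat (map (B n) done) \<and> q = length (concat (map (B n) done)) \<and>
    time s' \<le> time s + 5 * n + 1 + 4 * length done + 4 * q" for "done" q s'
  have L2: "wp (loop (rev [0..<n]) 0 (\<lambda>x q. do {
       y \<leftarrow> get UHead x;
       (y', q') \<leftarrow> while_M (\<lambda>(y, q). 0 < y) (y, q) (\<lambda>(y, q). do {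
         put Ranked q (y - 1); z \<leftarrow> get UNext (y - 1); ret (z, q + 1)});
       ret q'})) (\<lambda>_ s'. frame ?X s s' \<and> arrays s' Ranked = ?all \<and> time s' \<le> time s + 13 * n + 2) (tick s1)"
    if I: "I n () s1" for s1
  proof (rule wp_loop_list[where I = J])
    show "J [] 0 (tick s1)" using I by (simp add: I_def J_def)
  next
    fix q s2 assume J: "J (rev [0..<n]) q s2"
    have fr: "frame ?X s s2" using J by (simp add: J_def)
    have q: "q = n" using J all_len by (simp add: J_def)
    have "length (arrays s2 Ranked) = n" using frame_length[OF fr, of Ranked] by (simp add: work_arr[OF W])
    then have "arrays s2 Ranked = ?all" using J q by (simp add: J_def)
    then show "frame ?X s (tick s2) \<and> arrays (tick s2) Ranked = ?all \<and> time (tick s2) \<le> time s + 13 * n + 2"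
      using J fr q by (simp add: J_def)
  next
    fix "done" x todo q s2
    assume split: "rev [0..<n] = done @ x # todo" and J: "J done q s2"
    have fr: "frame ?X s s2" and bk: "buckets n (arrays s2 UHead) (arrays s2 UNext) (B n)"
      and tk: "take q (arrays s2 Ranked) = concat (map (B n) done)" and q: "q = length (concat (map (B n) done))"
      and tm: "time s2 \<le> time s + 5 * n + 1 + 4 * length done + 4 * q"
      using J unfolding J_def by blast+
    have "x \<in> set (rev [0..<n])" unfolding split by simp
    then have x: "x < n" by simp
    have "?all = concat (map (B n) (done @ [x])) @ concat (map (B n) todo)" unfolding split by simp
    then have "length (concat (map (B n) (done @ [x]))) \<le> n" using all_len by (metis le_add1 length_append)
    then have ql: "q + length (B n x) \<le> n" using q by simp
    let ?y = "arrays s2 UHead ! x"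
    \<comment> \<open>\<open>rest\<close> is the part of the bucket not yet copied; the written part
      of \<open>Ranked\<close> followed by \<open>rest\<close> is always the same list.\<close>
    define T where "T = (\<lambda>(y, q') s3. frame ?X s s3 \<and> arrays s3 UHead = arrays s2 UHead \<and> arrays s3 UNext = arrays s2 UNext \<and>
      (\<exists>rest. chain (arrays s2 UNext) y rest \<and> take q' (arrays s3 Ranked) @ rest = concat (map (B n) (done @ [x]))
        \<and> q' + length rest = q + length (B n x)) \<and> q \<le> q' \<and>
      time s3 \<le> time s2 + 2 + 4 * (q' - q))"
    have lh: "x < length (arrays s2 UHead)" using bk x by (simp add: buckets_def)
    have ch: "chain (arrays s2 UNext) ?y (B n x)" using bk x by (simp add: buckets_def)
    have "wp (while_M (\<lambda>(y, q). 0 < y) (?y, q) (\<lambda>(y, q). do {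
         put Ranked q (y - 1); z \<leftarrow> get UNext (y - 1); ret (z, q + 1)}))
       (\<lambda>r s3. J (done @ [x]) (snd r) (tick s3)) (tick (tick s2))"
    proof (rule wp_while[where I = T and m = "\<lambda>(y, q'). n - q'"])
      show "T (?y, q) (tick (tick s2))" unfolding T_def using fr ch tk by simp
    next
      fix r s3 assume T: "T r s3" and "\<not> (case r of (y, q) \<Rightarrow> 0 < y)"
      then obtain q' where r: "r = (0, q')" by (cases r) auto
      have T': "frame ?X s s3" "arrays s3 UHead = arrays s2 UHead" "arrays s3 UNext = arrays s2 UNext"
        "take q' (arrays s3 Ranked) = concat (map (B n) (done @ [x]))" "q' = q + length (B n x)"
        "time s3 \<le> time s2 + 2 + 4 * (q' - q)"
        using T by (auto simp: T_def r)
      show "J (done @ [x]) (snd r) (tick (tick s3))"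
        unfolding J_def using T' bk tm q by (simp add: r)
    next
      fix r s3 assume T: "T r s3" and c: "case r of (y, q) \<Rightarrow> 0 < y"
      obtain y q' where r: "r = (y, q')" by (cases r)
      obtain rest where T': "frame ?X s s3" "arrays s3 UHead = arrays s2 UHead" "arrays s3 UNext = arrays s2 UNext"
        "chain (arrays s2 UNext) y rest" "take q' (arrays s3 Ranked) @ rest = concat (map (B n) (done @ [x]))"
        "q' + length rest = q + length (B n x)" "q \<le> q'" "time s3 \<le> time s2 + 2 + 4 * (q' - q)"
        using T by (auto simp: T_def r)
      obtain i js where rest: "rest = i # js" using T'(4) c by (cases rest) (auto simp: r)
      have i: "y = Suc i" "i < length (arrays s2 UNext)" "chain (arrays s2 UNext) (arrays s2 UNext ! i) js"
        using T'(4) by (auto simp: rest)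
      have q'n: "q' < n" using T'(6) ql by (simp add: rest)
      have l: "q' < length (arrays s3 Ranked)" using q'n frame_length[OF T'(1), of Ranked] by (simp add: work_arr[OF W])
      let ?s4 = "tick (tick (upd Ranked q' i (tick s3)))"
      have "take (Suc q') (arrays ?s4 Ranked) @ js = concat (map (B n) (done @ [x]))"
        using T'(5) take_Suc_update[OF l] by (simp add: rest)
      moreover have "frame ?X s ?s4" using T'(1) by simp
      ultimately have "T (arrays s2 UNext ! i, Suc q') ?s4"
        unfolding T_def using T'(2,3,6,7,8) i(3) by (auto simp: rest intro!: exI[of _ "js"])
      then show "wp (case r of (y, q) \<Rightarrow> do {
         put Ranked q (y - 1); z \<leftarrow> get UNext (y - 1); ret (z, q + 1)})
        (\<lambda>x' s'. T x' s' \<and> (case x' of (y, q') \<Rightarrow> n - q') < (case r of (y, q') \<Rightarrow> n - q')) (tick s3)"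
        using l i(1,2) q'n T'(3) by (auto simp: r)
    qed
    then show "wp (do {
       y \<leftarrow> get UHead x;
       (y', q') \<leftarrow> while_M (\<lambda>(y, q). 0 < y) (y, q) (\<lambda>(y, q). do {
         put Ranked q (y - 1); z \<leftarrow> get UNext (y - 1); ret (z, q + 1)});
       ret q'}) (J (done @ [x])) (tick s2)"
      using lh by simp
  qed
  have L1: "wp (loop [0..<n] () (\<lambda>v _. do {x \<leftarrow> get Upper v; push UHead UNext x v}))
    (\<lambda>_. wp (loop (rev [0..<n]) 0 (\<lambda>x q. do {
       y \<leftarrow> get UHead x;
       (y', q') \<leftarrow> while_M (\<lambda>(y, q). 0 < y) (y, q) (\<lambda>(y, q). do {
         put Ranked q (y - 1); z \<leftarrow> get UNext (y - 1); ret (z, q + 1)});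
       ret q'})) (\<lambda>_ s'. frame ?X s s' \<and> arrays s' Ranked = ?all \<and> time s' \<le> time s + 13 * n + 2)) s"
  proof (rule wp_loop[where I = I])
    have "buckets n (arrays s UHead) (arrays s UNext) (B 0)" using z by (simp add: buckets_def B_def work_arr[OF W])
    then show "I 0 () s" by (simp add: I_def)
  next
    fix v x s' assume v: "v < n" and I: "I v x s'"
    have fr: "frame ?X s s'" and bk: "buckets n (arrays s' UHead) (arrays s' UNext) (B v)" and tm: "time s' \<le> time s + 5 * v"
      using I by (simp_all add: I_def)
    have W': "work s'" by (rule work_frame[OF W fr]) simp_all
    have u: "arrays s' Upper = arrays s Upper" by (rule frame_arr[OF fr]) simp
    have fv: "?f v < n" using f v by blast
    let ?s2 = "upd UHead (?f v) (Suc v) (upd UNext v (arrays s' UHead ! ?f v) (tick (tick (tick s'))))"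
    have "buckets n (arrays ?s2 UHead) (arrays ?s2 UNext) (B (Suc v))"
      unfolding B_Suc using buckets_push[OF bk fv, of v] v by (simp add: work_arr[OF W'] B_def)
    moreover have "frame ?X s ?s2" using fr by simp
    ultimately have "I (Suc v) () ?s2" unfolding I_def using tm by simp
    then show "wp (do {x \<leftarrow> get Upper v; push UHead UNext x v}) (I (Suc v)) (tick s')"
      using v fv by (simp add: push_def work_arr[OF W'] work_arr[OF W] u)
  qed (use L2 in simp_all)
  then have "wp (loop [0..<n] () (\<lambda>v _. do {x \<leftarrow> get Upper v; push UHead UNext x v}))
    (\<lambda>_. wp (loop (rev [0..<n]) 0 (\<lambda>x q. do {
       y \<leftarrow> get UHead x;
       (y', q') \<leftarrow> while_M (\<lambda>(y, q). 0 < y) (y, q) (\<lambda>(y, q). do {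
         put Ranked q (y - 1); z \<leftarrow> get UNext (y - 1); ret (z, q + 1)});
       ret q'})) (\<lambda>_ s'. frame ?X s (tick s') \<and> distinct (arrays (tick s') Ranked) \<and>
    set (arrays (tick s') Ranked) = {..<n} \<and> sorted_wrt (\<lambda>u w. ?f u \<ge> ?f w) (arrays (tick s') Ranked) \<and>
    time (tick s') \<le> time s + 20 * (1 + n))) s"
    by (elim wp_mono) (use all_set all_sorted all_dist[of "rev [0..<n]"] in auto)
  then show ?thesis unfolding rank_prog_def wp_bind wp_ret .
qed

end

section \<open>The main loop\<close>

text \<open>The cost is proportional to the distance moved, up to a constant. In the main loop
  \<open>p\<close> never moves back and stays below \<open>n\<close>, so all movements together are
  linear. A nonempty bucket from \<open>p\<close> on guarantees that the search ends inside the
  array.\<close>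

lemma min_prog_wp:
  assumes "\<exists>x\<ge>p. x < length (arrays s SHead) \<and> arrays s SHead ! x \<noteq> 0"
  shows "wp (min_prog p) (\<lambda>r s'. frame {} s s' \<and> p \<le> r \<and> r < length (arrays s SHead) \<and> arrays s SHead ! r \<noteq> 0 \<and>
    (\<forall>x. p \<le> x \<longrightarrow> x < r \<longrightarrow> arrays s SHead ! x = 0) \<and> time s' \<le> time s + 3 * (r - p) + 3) s"
proof -
  let ?H = "arrays s SHead"
  obtain m where m: "p \<le> m" "m < length ?H" "?H ! m \<noteq> 0" using assms by blast
  define I where "I = (\<lambda>(q, y) s'. frame {} s s' \<and> p \<le> q \<and> q \<le> m \<and> y = ?H ! q \<and>
    (\<forall>x. p \<le> x \<longrightarrow> x < q \<longrightarrow> ?H ! x = 0) \<and> time s' \<le> time s + 1 + 3 * (q - p))"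
  have "wp (while_M (\<lambda>(p, y). y = 0) (p, ?H ! p) (\<lambda>(p, y). do {y' \<leftarrow> get SHead (p + 1); ret (p + 1, y')}))
    (\<lambda>x s'. frame {} s (tick s') \<and> p \<le> fst x \<and> fst x < length ?H \<and> ?H ! fst x \<noteq> 0 \<and>
    (\<forall>z. p \<le> z \<longrightarrow> z < fst x \<longrightarrow> ?H ! z = 0) \<and> time (tick s') \<le> time s + 3 * (fst x - p) + 3) (tick s)"
  proof (rule wp_while[where I = I and m = "\<lambda>(q, y). m - q"])
    show "I (p, ?H ! p) (tick s)" using m by (simp add: I_def)
  next
    fix x s' assume I: "I x s'" and c: "case x of (p, y) \<Rightarrow> y = 0"
    obtain q where x: "x = (q, 0)" using c by (cases x) auto
    have q: "frame {} s s'" "p \<le> q" "q \<le> m" "?H ! q = 0" "\<forall>x. p \<le> x \<longrightarrow> x < q \<longrightarrow> ?H ! x = 0"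
      "time s' \<le> time s + 1 + 3 * (q - p)" using I by (auto simp: I_def x)
    have qm: "q < m" using q m by (cases "q = m") auto
    have H: "arrays s' SHead = ?H" by (rule frame_arr[OF q(1)]) simp
    have "I (Suc q, ?H ! Suc q) (tick (tick (tick s')))"
      unfolding I_def using q qm by (auto simp: less_Suc_eq)
    then show "wp (case x of (p, y) \<Rightarrow> do {y' \<leftarrow> get SHead (p + 1); ret (p + 1, y')})
      (\<lambda>x' s'. I x' s' \<and> (case x' of (q, y) \<Rightarrow> m - q) < (case x of (q, y) \<Rightarrow> m - q)) (tick s')"
      using qm m by (simp add: x H)
  next
    fix x s' assume I: "I x s'" and c: "\<not> (case x of (p, y) \<Rightarrow> y = 0)"
    then show "frame {} s (tick (tick s')) \<and> p \<le> fst x \<and> fst x < length ?H \<and> ?H ! fst x \<noteq> 0 \<and>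
      (\<forall>z. p \<le> z \<longrightarrow> z < fst x \<longrightarrow> ?H ! z = 0) \<and> time (tick (tick s')) \<le> time s + 3 * (fst x - p) + 3"
      using m by (cases x) (auto simp: I_def)
  qed
  moreover have "p < length ?H" using m by simp
  ultimately show ?thesis unfolding min_prog_def by simp
qed

locale topk_input = input n off adj N for n off adj N +
  fixes G :: "'a ugraph" and k :: nat and vs :: "'a list" and hh :: "'a \<Rightarrow> nat" and rk :: "nat list"
  assumes vs_inj: "inj_on (\<lambda>i. vs ! i) {..<n}"
    and score: "v < n \<Longrightarrow> Score G (vs ! v) (h_index (N v) (\<lambda>u. N u \<inter> N v))"
    and hh: "v < n \<Longrightarrow> hh (vs ! v) = bound v"
    and k: "1 \<le> k" "k \<le> n"
    and rk: "distinct rk" "set rk = {..<n}"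
begin

definition sc :: "nat \<Rightarrow> nat" where "sc v = h_index (N v) (\<lambda>u. N u \<inter> N v)"

lemma sc_less: "v < n \<Longrightarrow> sc v < n"
proof -
  assume v: "v < n"
  have "sc v \<le> card (N v)" unfolding sc_def h_index_def
    by (rule Max.boundedI) (auto simp: h_set_def)
  then show ?thesis using card_N_less[of v] v by simp
qed

lemma rk_length: "length rk = n" using distinct_card[OF rk(1)] rk(2) by simp

abbreviation full :: "'a set \<Rightarrow> bool" where
  "full R \<equiv> topk_loop G k hh (map (\<lambda>i. vs ! i) rk) {} (\<lambda>_. 0) R"

definition chosen :: "nat list \<Rightarrow> nat \<Rightarrow> 'a set" where
  "chosen res sz = (\<lambda>j. vs ! (res ! j)) ` {..<sz}"

text \<open>Any result of the remaining loop, started from the current state, is a result of the whole loop.\<close>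

definition simulates :: "nat \<Rightarrow> nat \<Rightarrow> nat list \<Rightarrow> bool" where
  "simulates i sz res \<longleftrightarrow> (\<exists>f. (\<forall>j<sz. f (vs ! (res ! j)) = sc (res ! j)) \<and>
     (\<forall>R. topk_loop G k hh (map (\<lambda>i. vs ! i) (drop i rk)) (chosen res sz) f R \<longrightarrow> full R))"

text \<open>The buckets \<open>bs\<close> hold positions of \<open>res\<close>, not vertices, so
  that a vertex can be replaced at its place. Until the set is full every vertex read is added,
  whence \<open>sz = i\<close>.\<close>

definition stored :: "nat \<Rightarrow> nat \<Rightarrow> nat list \<Rightarrow> (nat \<Rightarrow> nat list) \<Rightarrow> bool" where
  "stored i sz res bs \<longleftrightarrow> i \<le> n \<and> sz \<le> k \<and> length res = k \<and> inj_on (\<lambda>j. res ! j) {..<sz} \<and>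
     (\<forall>j<sz. res ! j \<in> set (take i rk)) \<and> (sz < k \<longrightarrow> sz = i) \<and>
     (\<forall>x. distinct (bs x) \<and> set (bs x) = {j. j < sz \<and> sc (res ! j) = x})"

lemma card_chosen:
  assumes "stored i sz res bs"
  shows "card (chosen res sz) = sz"
proof -
  have 1: "\<forall>j<sz. res ! j < n" using assms rk in_set_takeD unfolding stored_def by fast
  have "inj_on (\<lambda>j. vs ! (res ! j)) {..<sz}"
  proof (rule inj_onI)
    fix j l assume "j \<in> {..<sz}" "l \<in> {..<sz}" "vs ! (res ! j) = vs ! (res ! l)"
    then show "j = l" using inj_onD[OF vs_inj, of "res ! j" "res ! l"] 1 assms
      by (auto simp: stored_def inj_on_def)
  qed
  then show ?thesis unfolding chosen_def by (simp add: card_image)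
qed

context
  fixes i sz res bs v
  assumes st: "stored i sz res bs" and sim: "simulates i sz res" and i: "i < n" and v: "v = rk ! i"
begin

lemma next_vertex: "v < n" "v \<notin> set (take i rk)" "take (Suc i) rk = take i rk @ [v]" "drop i rk = v # drop (Suc i) rk"
proof -
  show tk: "take (Suc i) rk = take i rk @ [v]" unfolding v by (rule take_Suc_conv_app_nth) (simp add: rk_length i)
  have "v \<in> set rk" unfolding v using i rk_length by simp
  then show "v < n" using rk(2) by simp
  show "v \<notin> set (take i rk)" using distinct_take[OF rk(1), of "Suc i"] unfolding tk by simp
  show "drop i rk = v # drop (Suc i) rk" unfolding v using Cons_nth_drop_Suc[of i rk] i rk_length by simp
qed

lemma res_less: "j < sz \<Longrightarrow> res ! j < n" "j < sz \<Longrightarrow> res ! j \<noteq> v" "j < sz \<Longrightarrow> vs ! (res ! j) \<noteq> vs ! v"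
proof -
  assume j: "j < sz"
  then have m: "res ! j \<in> set (take i rk)" using st by (simp add: stored_def)
  then show l: "res ! j < n" using rk(2) in_set_takeD by fast
  show ne: "res ! j \<noteq> v" using m next_vertex(2) by auto
  show "vs ! (res ! j) \<noteq> vs ! v" using inj_onD[OF vs_inj, of "res ! j" v] l ne next_vertex(1) by auto
qed

lemma add_step:
  assumes sz: "sz < k"
  shows "stored (Suc i) (Suc sz) (res[sz := v]) (bs(sc v := sz # bs (sc v)))" "simulates (Suc i) (Suc sz) (res[sz := v])"
    "\<forall>y. sz \<notin> set (bs y)"
proof -
  have len: "sz < length res" using st sz by (simp add: stored_def)
  have nth: "res[sz := v] ! j = (if j = sz then v else res ! j)" for j using len by (simp add: nth_list_update)
  show new: "\<forall>y. sz \<notin> set (bs y)" using st by (simp add: stored_def)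
  show "stored (Suc i) (Suc sz) (res[sz := v]) (bs(sc v := sz # bs (sc v)))"
    unfolding stored_def
  proof (intro conjI)
    show "inj_on (\<lambda>j. res[sz := v] ! j) {..<Suc sz}"
    proof (rule inj_onI)
      fix j l assume "j \<in> {..<Suc sz}" "l \<in> {..<Suc sz}" "res[sz := v] ! j = res[sz := v] ! l"
      then show "j = l" using res_less(2)[of j] res_less(2)[of l] st
        unfolding nth stored_def by (auto split: if_splits simp: less_Suc_eq inj_on_def)
    qed
    show "\<forall>j<Suc sz. res[sz := v] ! j \<in> set (take (Suc i) rk)"
      using st unfolding nth next_vertex(3) stored_def by (auto simp: less_Suc_eq)
    show "\<forall>x. distinct ((bs(sc v := sz # bs (sc v))) x) \<and>
      set ((bs(sc v := sz # bs (sc v))) x) = {j. j < Suc sz \<and> sc (res[sz := v] ! j) = x}"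
      using st unfolding nth stored_def by (auto simp: less_Suc_eq)
  qed (use st i sz in \<open>auto simp: stored_def\<close>)
  have ch: "chosen (res[sz := v]) (Suc sz) = insert (vs ! v) (chosen res sz)"
    unfolding chosen_def nth lessThan_Suc by auto
  obtain f where f: "\<forall>j<sz. f (vs ! (res ! j)) = sc (res ! j)"
    "\<forall>R. topk_loop G k hh (map (\<lambda>i. vs ! i) (drop i rk)) (chosen res sz) f R \<longrightarrow> full R"
    using sim unfolding simulates_def by blast
  have "full R" if "topk_loop G k hh (map (\<lambda>i. vs ! i) (drop (Suc i) rk)) (insert (vs ! v) (chosen res sz)) (f(vs ! v := sc v)) R" for R
  proof -
    have "topk_loop G k hh (vs ! v # map (\<lambda>i. vs ! i) (drop (Suc i) rk)) (chosen res sz) f R"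
      by (rule topk_loop.add[OF _ _ that]) (use card_chosen[OF st] sz score[OF next_vertex(1)] in \<open>simp_all add: sc_def\<close>)
    then show ?thesis using f(2) unfolding next_vertex(4) by simp
  qed
  then show "simulates (Suc i) (Suc sz) (res[sz := v])"
    unfolding simulates_def ch nth
    by (intro exI[of _ "f(vs ! v := sc v)"]) (use f(1) res_less(3) in \<open>auto simp: less_Suc_eq\<close>)
qed

context
  fixes p
  assumes full_sz: "sz = k" and p: "bs p \<noteq> []" "\<And>j. j < sz \<Longrightarrow> p \<le> sc (res ! j)"
begin

lemma Min_chosen:
  assumes f: "\<forall>j<sz. f (vs ! (res ! j)) = sc (res ! j)"
  shows "Min (f ` chosen res sz) = p"
proof (rule Min_eqI)
  show "finite (f ` chosen res sz)" by (simp add: chosen_def)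
  show "p \<le> y" if "y \<in> f ` chosen res sz" for y using that f p(2) by (auto simp: chosen_def)
  obtain j where "j \<in> set (bs p)" using p(1) by (cases "bs p") auto
  then have "j < sz" "sc (res ! j) = p" using st by (auto simp: stored_def)
  then show "p \<in> f ` chosen res sz" using f by (force simp: chosen_def)
qed

lemma stop_step: "bound v \<le> p \<Longrightarrow> full (chosen res sz)"
proof -
  assume b: "bound v \<le> p"
  obtain f where f: "\<forall>j<sz. f (vs ! (res ! j)) = sc (res ! j)"
    "\<forall>R. topk_loop G k hh (map (\<lambda>i. vs ! i) (drop i rk)) (chosen res sz) f R \<longrightarrow> full R"
    using sim unfolding simulates_def by blast
  have "topk_loop G k hh (vs ! v # map (\<lambda>i. vs ! i) (drop (Suc i) rk)) (chosen res sz) f (chosen res sz)"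
    by (rule topk_loop.stop) (use card_chosen[OF st] full_sz Min_chosen[OF f(1)] b hh[OF next_vertex(1)] in simp_all)
  then show ?thesis using f(2) unfolding next_vertex(4) by simp
qed

lemma skip_step:
  assumes "p < bound v" "sc v \<le> p"
  shows "stored (Suc i) sz res bs" "simulates (Suc i) sz res"
proof -
  show "stored (Suc i) sz res bs" using st i full_sz unfolding stored_def next_vertex(3) by auto
  obtain f where f: "\<forall>j<sz. f (vs ! (res ! j)) = sc (res ! j)"
    "\<forall>R. topk_loop G k hh (map (\<lambda>i. vs ! i) (drop i rk)) (chosen res sz) f R \<longrightarrow> full R"
    using sim unfolding simulates_def by blast
  have "full R" if "topk_loop G k hh (map (\<lambda>i. vs ! i) (drop (Suc i) rk)) (chosen res sz) f R" for R
  proof -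
    have "topk_loop G k hh (vs ! v # map (\<lambda>i. vs ! i) (drop (Suc i) rk)) (chosen res sz) f R"
      by (rule topk_loop.skip[OF _ _ score[OF next_vertex(1)] _ that])
        (use card_chosen[OF st] full_sz Min_chosen[OF f(1)] assms hh[OF next_vertex(1)] in \<open>simp_all add: sc_def\<close>)
    then show ?thesis using f(2) unfolding next_vertex(4) by simp
  qed
  then show "simulates (Suc i) sz res" unfolding simulates_def using f(1) by blast
qed

text \<open>The algorithm may replace any vertex of minimum score; the program picks the one at the
  position \<open>j\<close> that heads bucket \<open>p\<close>, and reuses this position for
  \<open>v\<close>.\<close>

lemma replace_step:
  assumes b: "p < bound v" "p < sc v" and j: "bs p = j # js"
  shows "stored (Suc i) sz (res[j := v]) ((bs(p := js))(sc v := j # (bs(p := js)) (sc v)))"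
    "simulates (Suc i) sz (res[j := v])" "\<forall>y. j \<notin> set ((bs(p := js)) y)" "j < k"
proof -
  let ?bs = "bs(p := js)"
  have bsp: "distinct (bs x)" "set (bs x) = {j. j < sz \<and> sc (res ! j) = x}" for x using st by (simp_all add: stored_def)
  have jj: "j < sz" "sc (res ! j) = p" using bsp(2)[of p] j by auto
  then show jk: "j < k" using full_sz by simp
  have len: "j < length res" using st jj full_sz by (simp add: stored_def)
  have nth: "res[j := v] ! l = (if l = j then v else res ! l)" for l using len by (simp add: nth_list_update)
  have dj: "j \<notin> set js" "distinct js" using bsp(1)[of p] unfolding j by simp_all
  have "insert j (set js) = {l. l < sz \<and> sc (res ! l) = p}" using bsp(2)[of p] unfolding j by simp
  then have sj: "set js = {l. l < sz \<and> l \<noteq> j \<and> sc (res ! l) = p}" using dj(1) by blast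
  have bs': "set (?bs x) = {l. l < sz \<and> l \<noteq> j \<and> sc (res ! l) = x}" "distinct (?bs x)" for x
  proof -
    show "distinct (?bs x)" using dj(2) bsp(1)[of x] by simp
    show "set (?bs x) = {l. l < sz \<and> l \<noteq> j \<and> sc (res ! l) = x}"
    proof (cases "x = p")
      case True
      then show ?thesis using sj by simp
    next
      case False
      then have "l \<noteq> j" if "sc (res ! l) = x" for l using that jj(2) by blast
      then show ?thesis using False bsp(2)[of x] by auto
    qed
  qed
  show new: "\<forall>y. j \<notin> set (?bs y)" unfolding bs'(1) by simp
  have inj: "inj_on (\<lambda>j. res ! j) {..<sz}" using st by (simp add: stored_def)
  show "stored (Suc i) sz (res[j := v]) (?bs(sc v := j # ?bs (sc v)))"
    unfolding stored_def
  proof (intro conjI)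
    show "inj_on (\<lambda>l. res[j := v] ! l) {..<sz}"
    proof (rule inj_onI)
      fix a l assume "a \<in> {..<sz}" "l \<in> {..<sz}" "res[j := v] ! a = res[j := v] ! l"
      then show "a = l" using res_less(2)[of a] res_less(2)[of l] inj_onD[OF inj, of a l]
        unfolding nth by (auto split: if_splits)
    qed
    show "\<forall>l<sz. res[j := v] ! l \<in> set (take (Suc i) rk)"
      using st unfolding nth next_vertex(3) stored_def by auto
    have v1: "distinct (j # ?bs (sc v))" using new bs'(2)[of "sc v"] by simp
    have v2: "set (j # ?bs (sc v)) = {l. l < sz \<and> sc (res[j := v] ! l) = sc v}"
      unfolding nth using bs'(1)[of "sc v"] jj by auto
    have v3: "set (?bs x) = {l. l < sz \<and> sc (res[j := v] ! l) = x}" if "x \<noteq> sc v" for x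
      unfolding nth using bs'(1)[of x] that by auto
    show "\<forall>x. distinct ((?bs(sc v := j # ?bs (sc v))) x) \<and>
      set ((?bs(sc v := j # ?bs (sc v))) x) = {l. l < sz \<and> sc (res[j := v] ! l) = x}"
    proof
      fix x
      show "distinct ((?bs(sc v := j # ?bs (sc v))) x) \<and>
        set ((?bs(sc v := j # ?bs (sc v))) x) = {l. l < sz \<and> sc (res[j := v] ! l) = x}"
      proof (cases "x = sc v")
        case True
        then show ?thesis using v1 v2 by (simp only: fun_upd_same)
      next
        case False
        then have "(?bs(sc v := j # ?bs (sc v))) x = ?bs x" by (simp only: fun_upd_other not_False_eq_True)
        then show ?thesis using v3[OF False] bs'(2)[of x] by (simp only:)
      qed
    qed
  qed (use st i full_sz in \<open>auto simp: stored_def\<close>)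
  have "(\<lambda>l. vs ! (res[j := v] ! l)) ` {..<sz} = insert (vs ! v) ((\<lambda>l. vs ! (res ! l)) ` ({..<sz} - {j}))"
    unfolding nth using jj by auto
  also have "(\<lambda>l. vs ! (res ! l)) ` ({..<sz} - {j}) = chosen res sz - {vs ! (res ! j)}"
  proof -
    have "vs ! (res ! l) \<noteq> vs ! (res ! j)" if "l < sz" "l \<noteq> j" for l
      using inj_onD[OF vs_inj, of "res ! l" "res ! j"] inj_onD[OF inj, of l j] res_less(1) that jj by auto
    then show ?thesis unfolding chosen_def using jj by auto
  qed
  finally have ch: "chosen (res[j := v]) sz = insert (vs ! v) (chosen res sz - {vs ! (res ! j)})" by (simp add: chosen_def)
  obtain f where f: "\<forall>j<sz. f (vs ! (res ! j)) = sc (res ! j)"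
    "\<forall>R. topk_loop G k hh (map (\<lambda>i. vs ! i) (drop i rk)) (chosen res sz) f R \<longrightarrow> full R"
    using sim unfolding simulates_def by blast
  have "full R" if "topk_loop G k hh (map (\<lambda>i. vs ! i) (drop (Suc i) rk))
      (insert (vs ! v) (chosen res sz - {vs ! (res ! j)})) (f(vs ! v := sc v)) R" for R
  proof -
    have "topk_loop G k hh (vs ! v # map (\<lambda>i. vs ! i) (drop (Suc i) rk)) (chosen res sz) f R"
      by (rule topk_loop.replace[of _ _ _ _ _ _ _ "vs ! (res ! j)", OF _ _ _ _ _ _ that])
        (use card_chosen[OF st] full_sz Min_chosen[OF f(1)] b hh[OF next_vertex(1)] score[OF next_vertex(1)] jj f(1)
         in \<open>auto simp: sc_def chosen_def\<close>)
    then show ?thesis using f(2) unfolding next_vertex(4) by simp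
  qed
  then show "simulates (Suc i) sz (res[j := v])"
    unfolding simulates_def ch nth
    by (intro exI[of _ "f(vs ! v := sc v)"]) (use f(1) res_less(3) in auto)
qed

end

end

end

section \<open>Cost and simulation of the main loop\<close>

context topk_input
begin

lemma loop_prog_wp:
  assumes W: "work s" and out: "adj_rep OutDeg OutAdj {..<n} Out s" and mark: "\<forall>u<n. arrays s Mark ! u = 0"
    and ranked: "arrays s Ranked = rk" and upper: "\<forall>v<n. arrays s Upper ! v = bound v"
    and SHead: "\<forall>x<n. arrays s SHead ! x = 0" and len: "length (arrays s SNext) = k" "length (arrays s Result) = k"
  shows "wp (loop_prog n k) (\<lambda>_ s'. full (chosen (arrays s' Result) k) \<and> length (arrays s' Result) = k \<and>
    space s' = space s \<and> time s' \<le> time s + 300 * (\<Sum>v<n. score_cost v) + 23 * n + 12) s"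
proof -
  let ?X = "score_arrays \<union> {SHead, SNext, Result}"
  \<comment> \<open>The term \<open>3 * p\<close> pays for all movements of the minimum pointer, and
    the final 10 for the iteration that stops without increasing \<open>i\<close>. While the set is
    not full, a later vertex may have a smaller score, so the pointer stays at 0.\<close>
  define I where "I = (\<lambda>(i, sz, p, go) s'. frame ?X s s' \<and> (\<forall>u<n. arrays s' Mark ! u = 0) \<and>
    (\<exists>bs. stored i sz (arrays s' Result) bs \<and> buckets n (arrays s' SHead) (arrays s' SNext) bs) \<and>
    (go \<longrightarrow> simulates i sz (arrays s' Result)) \<and> (\<not> go \<longrightarrow> sz = k \<and> full (chosen (arrays s' Result) sz)) \<and>
    (sz < k \<longrightarrow> p = 0) \<and> (\<forall>j<sz. p \<le> sc (arrays s' Result ! j)) \<and> p < n \<and>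
    time s' \<le> time s + 300 * (\<Sum>v\<in>set (take i rk). score_cost v) + 20 * i + 3 * p + (if go then 0 else 10))"
  let ?post = "\<lambda>i x' s'. I x' s' \<and> (case x' of (i, sz, p, go) \<Rightarrow> if go then Suc (n - i) else 0) < Suc (n - i)"
  let ?body = "\<lambda>i sz p. do {
       v \<leftarrow> get Ranked i; b \<leftarrow> get Upper v;
       if sz < k then do {
         s \<leftarrow> score_prog v;
         put Result sz v; push SHead SNext s sz; ret (i + 1, sz + 1, p, True)}
       else do {
         p' \<leftarrow> min_prog p;
         if b \<le> p' then ret (i, sz, p', False)
         else do {
           s \<leftarrow> score_prog v;
           if s > p' then do {
             j \<leftarrow> pop SHead SNext p';
             put Result j v; push SHead SNext s j; ret (i + 1, sz, p', True)}
           else ret (i + 1, sz, p', True)}}}"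
  have step: "wp (?body i sz p)
      (?post i) (tick s')"
    if I: "I (i, sz, p, True) s'" and i: "i < n" for i sz p s'
  proof -
    let ?res = "arrays s' Result" and ?v = "rk ! i"
    obtain bs where fr: "frame ?X s s'" and mk: "\<forall>u<n. arrays s' Mark ! u = 0"
      and st: "stored i sz ?res bs" and bk: "buckets n (arrays s' SHead) (arrays s' SNext) bs"
      and sim: "simulates i sz ?res" and p0: "sz < k \<longrightarrow> p = 0" and ple: "\<forall>j<sz. p \<le> sc (?res ! j)" and pn: "p < n"
      and tm: "time s' \<le> time s + 300 * (\<Sum>v\<in>set (take i rk). score_cost v) + 20 * i + 3 * p"
      using I unfolding I_def by auto
    have W': "work s'" by (rule work_frame[OF W fr]) simp_all
    have out': "adj_rep OutDeg OutAdj {..<n} Out s'" by (rule adj_rep_frame[OF out fr]) simp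
    have ar: "arrays s' Ranked = rk" "arrays s' Upper = arrays s Upper"
      using frame_arr[OF fr] ranked by simp_all
    have ln: "length (arrays s' SNext) = k" "length ?res = k" using frame_length[OF fr] len by simp_all
    note nv = next_vertex[OF st sim i refl]
    have scv: "sc ?v < n" by (rule sc_less[OF nv(1)])
    have cost: "(\<Sum>v\<in>set (take (Suc i) rk). score_cost v) = (\<Sum>v\<in>set (take i rk). score_cost v) + score_cost ?v"
      unfolding nv(3) using nv(2) by simp
    have uv: "arrays s Upper ! ?v = bound ?v" using upper nv(1) by blast
    have SC: "wp (score_prog ?v) (\<lambda>r s3. frame score_arrays s2 s3 \<and> (\<forall>u<n. arrays s3 Mark ! u = 0) \<and>
      r = sc ?v \<and> time s3 \<le> time s2 + 300 * score_cost ?v) s2" if "frame {} s' s2" for s2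
      unfolding sc_def by (rule score_prog_wp[OF work_frame[OF W' that] nv(1) adj_rep_frame[OF out' that]])
        (use mk frame_arr[OF that, of Mark] in simp_all)
    let ?s2 = "tick (tick (tick s'))"
    let ?exchange = "\<lambda>p' r. if r > p' then do {
        j \<leftarrow> pop SHead SNext p';
        put Result j ?v; push SHead SNext r j; ret (i + 1, sz, p', True)}
      else ret (i + 1, sz, p', True)"
    let ?rest = "\<lambda>p'. if bound ?v \<le> p' then ret (i, sz, p', False)
      else do {s \<leftarrow> score_prog ?v; ?exchange p' s}"
    show ?thesis
    proof (cases "sz < k")
      case True
      note add = add_step[OF st sim i refl True]
      have "wp (score_prog ?v) (\<lambda>r. wp (do {put Result sz ?v; push SHead SNext r sz; ret (i + 1, sz + 1, p, True)})
        (?post i)) ?s2"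
      proof (rule wp_mono[OF SC], simp, elim conjE)
        fix r s3 assume fr3: "frame score_arrays ?s2 s3" and mk3: "\<forall>u<n. arrays s3 Mark ! u = 0" and r: "r = sc ?v"
          and tm3: "time s3 \<le> time ?s2 + 300 * score_cost ?v"
        have ar3: "arrays s3 SHead = arrays s' SHead" "arrays s3 SNext = arrays s' SNext" "arrays s3 Result = ?res"
          using frame_arr[OF fr3] by simp_all
        have fr3': "frame ?X s s3" by (rule frame_trans[OF fr, of score_arrays]) (use fr3 in auto)
        let ?s5 = "tick (upd SHead (sc ?v) (Suc sz) (upd SNext sz (arrays s' SHead ! sc ?v) (tick (upd Result sz ?v s3))))"
        have "buckets n (arrays ?s5 SHead) (arrays ?s5 SNext) (bs(sc ?v := sz # bs (sc ?v)))"
          using buckets_push[OF bk scv, of sz] True add(3) by (simp add: ln ar3)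
        then have "\<exists>bs. stored (Suc i) (Suc sz) (arrays ?s5 Result) bs \<and> buckets n (arrays ?s5 SHead) (arrays ?s5 SNext) bs"
          using add(1) by (intro exI[of _ "bs(sc ?v := sz # bs (sc ?v))"]) (simp add: ar3)
        moreover have "simulates (Suc i) (Suc sz) (arrays ?s5 Result)" using add(2) by (simp add: ar3)
        moreover have "frame ?X s ?s5" by (intro iffD2[OF frame_tick(1)] frame_upd fr3') simp_all
        moreover have "time ?s5 \<le> time s + 300 * (\<Sum>v\<in>set (take (Suc i) rk). score_cost v) + 20 * Suc i + 3 * p"
          unfolding cost distrib_left using tm tm3 by simp
        ultimately have "I (Suc i, Suc sz, p, True) ?s5"
          unfolding I_def prod.case using mk3 p0 pn True by simp
        moreover have "sc ?v < length (arrays s' SHead)" using scv by (simp add: work_arr[OF W'])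
        ultimately show "wp (do {put Result sz ?v; push SHead SNext r sz; ret (i + 1, sz + 1, p, True)})
          (?post i) s3"
          using True i by (simp add: push_def r ln ar3)
      qed
      then show ?thesis using True i nv(1) by (simp add: ar work_arr[OF W] rk_length)
    next
      case False
      then have szk: "sz = k" using st by (simp add: stored_def)
      have bsr: "set (bs x) = {j. j < sz \<and> sc (?res ! j) = x}" for x using st by (simp add: stored_def)
      have hd0: "arrays s' SHead ! x = 0 \<longleftrightarrow> bs x = []" if "x < n" for x
      proof -
        have "chain (arrays s' SNext) (arrays s' SHead ! x) (bs x)" using bk that by (simp add: buckets_def)
        then show ?thesis by (cases "bs x") auto
      qed
      have "0 < sz" using szk k by simp
      then have r0: "?res ! 0 < n" by (rule res_less(1)[OF st sim i refl])
      have "0 \<in> set (bs (sc (?res ! 0)))" using \<open>0 < sz\<close> bsr by simp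
      then have "arrays s' SHead ! sc (?res ! 0) \<noteq> 0" using hd0[OF sc_less[OF r0]] by auto
      then have ex: "\<exists>x\<ge>p. x < length (arrays ?s2 SHead) \<and> arrays ?s2 SHead ! x \<noteq> 0"
        using ple \<open>0 < sz\<close> sc_less[OF r0] by (intro exI[of _ "sc (?res ! 0)"]) (simp add: work_arr[OF W'])
      have "wp (min_prog p) (\<lambda>p'. wp (?rest p')
        (?post i)) ?s2"
      proof (rule wp_mono[OF min_prog_wp[OF ex]], elim conjE)
        fix p' s3 assume fr3: "frame {} ?s2 s3" and pp: "p \<le> p'" and pl: "p' < length (arrays ?s2 SHead)"
          and hd: "arrays ?s2 SHead ! p' \<noteq> 0" and zeros: "\<forall>x. p \<le> x \<longrightarrow> x < p' \<longrightarrow> arrays ?s2 SHead ! x = 0"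
          and tm3: "time s3 \<le> time ?s2 + 3 * (p' - p) + 3"
        have p'n: "p' < n" using pl by (simp add: work_arr[OF W'])
        have ne: "bs p' \<noteq> []" using hd hd0[OF p'n] by simp
        have ple': "p' \<le> sc (?res ! j)" if "j < sz" for j
        proof (rule ccontr)
          assume "\<not> p' \<le> sc (?res ! j)"
          then have "arrays s' SHead ! sc (?res ! j) = 0" "sc (?res ! j) < n" using zeros ple that p'n by auto
          then have "bs (sc (?res ! j)) = []" using hd0 by simp
          then show False using bsr[of "sc (?res ! j)"] that by auto
        qed
        have all: "arrays s3 = arrays s'" using fr3 by (auto simp: frame_def fun_eq_iff)
        have fr3': "frame ?X s s3" by (rule frame_trans[OF fr, of "{}"]) (use fr3 in auto)
        have frs3: "frame {} s' s3" using fr3 by simp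
        have tm3': "time s3 \<le> time s' + 6 + 3 * (p' - p)" using tm3 by simp
        have tp: "3 * p + 3 * (p' - p) = 3 * p'" using pp by simp
        show "wp (?rest p')
          (?post i) s3"
        proof (cases "bound ?v \<le> p'")
          case True
          have "full (chosen ?res sz)" by (rule stop_step[OF st sim i refl szk ne ple' True])
          then have "I (i, sz, p', False) (tick s3)"
            unfolding I_def prod.case using fr3' mk st bk szk ple' p'n tm tm3' tp by (auto simp: all)
          then show ?thesis using True by simp
        next
          case gt: False
          have "wp (score_prog ?v) (\<lambda>r. wp (?exchange p' r)
           (?post i)) s3"
          proof (rule wp_mono[OF SC[OF frs3]], elim conjE)
            fix r s4 assume fr4: "frame score_arrays s3 s4" and mk4: "\<forall>u<n. arrays s4 Mark ! u = 0" and r: "r = sc ?v"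
              and tm4: "time s4 \<le> time s3 + 300 * score_cost ?v"
            have ar4: "arrays s4 SHead = arrays s' SHead" "arrays s4 SNext = arrays s' SNext" "arrays s4 Result = ?res"
              using frame_arr[OF fr4] by (simp_all add: all)
            have fr4': "frame ?X s s4" by (rule frame_trans[OF fr3' fr4]) simp
            have tm4': "time s4 + 10 \<le> time s + 300 * (\<Sum>v\<in>set (take (Suc i) rk). score_cost v) + 20 * Suc i + 3 * p'"
              unfolding cost distrib_left using tm tm3' tm4 tp by simp
            show "wp (?exchange p' r)
             (?post i) s4"
            proof (cases "r > p'")
              case False
              have "stored (Suc i) sz ?res bs" "simulates (Suc i) sz ?res"
                using skip_step[OF st sim i refl szk ne ple'] gt False r by simp_all
              then have "I (Suc i, sz, p', True) (tick s4)"
                unfolding I_def prod.case using fr4' mk4 bk szk ple' p'n tm4' by (auto simp: ar4)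
              then show ?thesis using False i by simp
            next
              case True
              obtain j js where j: "bs p' = j # js" using ne by (cases "bs p'") auto
              have scp: "p' < sc ?v" "p' < bound ?v" using True r gt by simp_all
              note rep = replace_step[OF st sim i refl szk ne ple' scp(2,1) j]
              note bp = buckets_pop[OF bk p'n j]
              let ?H = "(arrays s' SHead)[p' := arrays s' SNext ! j]"
              let ?s6 = "upd Result j ?v (tick (upd SHead p' (arrays s' SNext ! j) (tick (tick s4))))"
              let ?s7 = "tick (upd SHead (sc ?v) (Suc j) (upd SNext j (?H ! sc ?v) (tick ?s6)))"
              let ?bs = "(bs(p' := js))(sc ?v := j # (bs(p' := js)) (sc ?v))"
              have "buckets n (arrays ?s7 SHead) (arrays ?s7 SNext) ?bs"
                using buckets_push[OF bp(3) scv bp(2)] rep(3) by (simp add: ar4)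
              then have "\<exists>bs. stored (Suc i) sz (arrays ?s7 Result) bs \<and> buckets n (arrays ?s7 SHead) (arrays ?s7 SNext) bs"
                using rep(1) by (intro exI[of _ ?bs]) (simp add: ar4)
              moreover have "simulates (Suc i) sz (arrays ?s7 Result)" using rep(2) by (simp add: ar4)
              moreover have "frame ?X s ?s7" by (intro iffD2[OF frame_tick(1)] frame_upd fr4') simp_all
              \<comment> \<open>The new score is larger than the minimum \<open>p'\<close>, so
                \<open>p'\<close> remains a lower bound and the search for the minimum never has to
                go back.\<close>
              moreover have "\<forall>l<sz. p' \<le> sc (arrays ?s7 Result ! l)"
                using ple' scp(1) rep(4) ln(2) by (simp add: ar4 nth_list_update)
              moreover have "time ?s7 \<le> time s + 300 * (\<Sum>v\<in>set (take (Suc i) rk). score_cost v) + 20 * Suc i + 3 * p'"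
                using tm4' by simp
              ultimately have "I (Suc i, sz, p', True) ?s7"
                unfolding I_def prod.case using mk4 szk p'n by simp
              then show ?thesis using True i bp(1,2) rep(4) p'n scv ln
                by (simp add: push_def pop_def r ar4 work_arr[OF W'])
            qed
          qed
          then show ?thesis using gt by simp
        qed
      qed
      then show ?thesis using False i nv(1) uv by (simp add: ar work_arr[OF W] rk_length)
    qed
  qed
  show ?thesis
    unfolding loop_prog_def wp_bind wp_ret
  proof (rule wp_while[where I = I and m = "\<lambda>(i, sz, p, go). if go then Suc (n - i) else 0"])
    have "stored 0 0 (arrays s Result) (\<lambda>_. [])" using len by (simp add: stored_def)
    moreover have "buckets n (arrays s SHead) (arrays s SNext) (\<lambda>_. [])" using SHead by (simp add: buckets_def work_arr[OF W])
    moreover have "simulates 0 0 (arrays s Result)"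
      unfolding simulates_def chosen_def by (intro exI[of _ "\<lambda>_. 0"]) simp
    ultimately show "I (0, 0, 0, True) s" unfolding I_def using mark k by auto
  next
    fix x s' assume I: "I x s'" and c: "case x of (i, sz, p, go) \<Rightarrow> go \<and> i < n"
    obtain i sz p go where x: "x = (i, sz, p, go)" by (cases x)
    show "wp (case x of (i, sz, p, go) \<Rightarrow> ?body i sz p)
      (\<lambda>x' s'. I x' s' \<and> (case x' of (i, sz, p, go) \<Rightarrow> if go then Suc (n - i) else 0) <
        (case x of (i, sz, p, go) \<Rightarrow> if go then Suc (n - i) else 0)) (tick s')"
      using step[of i sz p s'] I c unfolding x prod.case by simp
  next
    fix x s' assume I: "I x s'" and c: "\<not> (case x of (i, sz, p, go) \<Rightarrow> go \<and> i < n)"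
    obtain i sz p go where x: "x = (i, sz, p, go)" by (cases x)
    obtain bs where fr: "frame ?X s s'" and st: "stored i sz (arrays s' Result) bs"
      and sim: "go \<Longrightarrow> simulates i sz (arrays s' Result)" and fin: "\<not> go \<Longrightarrow> sz = k \<and> full (chosen (arrays s' Result) sz)" and pn: "p < n"
      and tm: "time s' \<le> time s + 300 * (\<Sum>v\<in>set (take i rk). score_cost v) + 20 * i + 3 * p + (if go then 0 else 10)"
      using I unfolding I_def x prod.case by blast
    have i: "i \<le> n" "sz \<le> k" "sz < k \<longrightarrow> sz = i" using st by (simp_all add: stored_def)
    have "sz = k \<and> full (chosen (arrays s' Result) sz)"
    proof (cases go)
      case True
      then have "i = n" using c i by (simp add: x)
      then have "sz = k" using i k by linarith
      obtain f where "\<forall>R. topk_loop G k hh (map (\<lambda>i. vs ! i) (drop i rk)) (chosen (arrays s' Result) sz) f R \<longrightarrow> full R"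
        using sim[OF True] unfolding simulates_def by blast
      moreover have "drop i rk = []" using \<open>i = n\<close> rk_length by simp
      ultimately show ?thesis using \<open>sz = k\<close> topk_loop.exhausted[of G k hh] by simp
    qed (rule fin)
    moreover have "set (take i rk) \<subseteq> {..<n}" using rk(2) set_take_subset by metis
    then have "(\<Sum>v\<in>set (take i rk). score_cost v) \<le> (\<Sum>v<n. score_cost v)" by (intro sum_mono2) auto
    moreover have "length (arrays s' Result) = k" using frame_length[OF fr] len by simp
    moreover have "space s' = space s" using fr by (simp add: frame_def)
    ultimately show "full (chosen (arrays (tick (tick s')) Result) k) \<and> length (arrays (tick (tick s')) Result) = k \<and>
      space (tick (tick s')) = space s \<and>
      time (tick (tick s')) \<le> time s + 300 * (\<Sum>v<n. score_cost v) + 23 * n + 12"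
      using tm pn i(1) by (auto split: if_splits)
  qed
qed

end

section \<open>Allocation and total cost of the program\<close>

definition alloc :: "arr \<Rightarrow> nat \<Rightarrow> mem \<Rightarrow> mem" where
  "alloc A l s = s\<lparr>arrays := (arrays s)(A := replicate l 0), time := time s + l + 1, space := space s + l\<rparr>"

lemma alloc_simps [simp]: "arrays (alloc A l s) = (arrays s)(A := replicate l 0)"
  "time (alloc A l s) = time s + l + 1" "space (alloc A l s) = space s + l"
  by (simp_all add: alloc_def)

lemma wp_new_alloc: "wp (new A l) Q = (\<lambda>s. Q () (alloc A l s))"
  by (simp add: wp_new alloc_def fun_eq_iff)

context input
begin

lemma sum_card_N: "(\<Sum>v<n. card (N v)) \<le> length adj"
proof -
  have "(\<Sum>v<i. card (N v)) \<le> off ! i" if "i \<le> n" for i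
    using that by (induction i) (auto simp: off_Suc)
  then show ?thesis using off(3) by force
qed

definition work_total :: nat where
  "work_total = 1 + n + length adj + (\<Sum>v<n. \<Sum>u\<in>N v. card (Out u))"

lemma topk_prog_wp:
  fixes G :: "'a ugraph"
  assumes vs: "inj_on (\<lambda>i. vs ! i) {..<n}"
    and score: "\<And>v. v < n \<Longrightarrow> Score G (vs ! v) (h_index (N v) (\<lambda>u. N u \<inter> N v))"
    and hh: "\<And>v. v < n \<Longrightarrow> hh (vs ! v) = bound v" and k: "1 \<le> k" "k \<le> n"
  shows "wp (topk_prog n k) (\<lambda>_ s'. (\<exists>rk. distinct rk \<and> set rk = {..<n} \<and> sorted_wrt (\<lambda>u w. bound u \<ge> bound w) rk \<and>
      topk_loop G k hh (map (\<lambda>i. vs ! i) rk) {} (\<lambda>_. 0) (result_set vs s')) \<and>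
    time s' \<le> 1000 * work_total \<and> space s' \<le> 22 * n + 2 + 3 * length adj) (init_mem off adj)"
proof -
  let ?m2 = "length adj"
  define s0 where "s0 = tick (init_mem off adj)"
  define s1 where "s1 = alloc Order n (alloc Alive n (alloc Deleted n (alloc Cur n
    (alloc Cnt (n + 1) (alloc Bfs n (alloc Visited n
    (alloc EgoCore n (alloc EgoAdj ?m2 (alloc EgoDeg n (alloc Mark n
    (alloc Result k (alloc SNext k (alloc SHead n
    (alloc Ranked n (alloc UNext n (alloc UHead n (alloc Upper n
    (alloc Core n (alloc OutAdj ?m2 (alloc OutDeg n (alloc Deg n (alloc Ids n s0))))))))))))))))))))))"
  have a0: "arrays s0 = (\<lambda>_. [])(Off := off, Adj := adj)" "time s0 = 1" "space s0 = length off + ?m2"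
    by (simp_all add: s0_def init_mem_def)
  have W1: "work s1" unfolding work_def s1_def by (simp add: a0)
  have z1: "arrays s1 Mark = replicate n 0" "arrays s1 UHead = replicate n 0" "arrays s1 SHead = replicate n 0"
    "length (arrays s1 SNext) = k" "length (arrays s1 Result) = k"
    by (simp_all add: s1_def)
  \<comment> \<open>Of the 23 arrays, 19 have length \<open>n\<close> or \<open>n + 1\<close>, two
    have length \<open>k \<le> n\<close> and two the length of \<open>adj\<close>. Nothing is
    allocated later, so the space after these allocations is already the final one.\<close>
  have t1: "time s1 \<le> 25 + 21 * n + 2 * ?m2" using k(2) by (simp add: s1_def a0)
  have sp1: "space s1 \<le> 22 * n + 2 + 3 * ?m2" using k(2) off(1) by (simp add: s1_def a0)
  define I where "I v (x::unit) s' \<longleftrightarrow> frame {Ids, Deg} s1 s' \<and> (\<forall>u<v. arrays s' Ids ! u = u \<and> arrays s' Deg ! u = card (N u)) \<and>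
    time s' \<le> time s1 + 5 * v" for v x s'
  define Q where "Q s' \<longleftrightarrow> (\<exists>rk. distinct rk \<and> set rk = {..<n} \<and> sorted_wrt (\<lambda>u w. bound u \<ge> bound w) rk \<and>
      topk_loop G k hh (map (\<lambda>i. vs ! i) rk) {} (\<lambda>_. 0) (result_set vs s')) \<and>
    time s' \<le> 1000 * work_total \<and> space s' \<le> 22 * n + 2 + 3 * ?m2" for s'
  interpret C: core_arrays "{..<n}" N Ids Deg Adj Core
    by (rule core_arrays.intro) (simp_all add: nat_nbhd_def nbhd_N core_arrays_axioms_def)
  have main: "wp (loop [0..<n] () (\<lambda>v _. do {
       o1 \<leftarrow> get Off v; o2 \<leftarrow> get Off (v + 1); put Ids v v; put Deg v (o2 - o1)}))
     (\<lambda>_. wp (orient_prog n) (\<lambda>_. wp (core_prog Ids 0 n Deg Adj Core) (\<lambda>_.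
       wp (loop [0..<n] () (\<lambda>v _. upper_prog v)) (\<lambda>_. wp (rank_prog n) (\<lambda>_. wp (loop_prog n k) (\<lambda>_. Q)))))) s1"
  proof (rule wp_loop[where I = I])
    show "I 0 () s1" by (simp add: I_def)
  next
    fix v x s' assume v: "v < n" and I: "I v x s'"
    have W': "work s'" by (rule work_frame[OF W1, of "{Ids, Deg}"]) (use I in \<open>simp_all add: I_def\<close>)
    show "wp (do {o1 \<leftarrow> get Off v; o2 \<leftarrow> get Off (v + 1); put Ids v v; put Deg v (o2 - o1)}) (I (Suc v)) (tick s')"
      using I v off_Suc[OF v] off(1) by (auto simp: I_def work_arr[OF W'] less_Suc_eq)
  next
    fix x s' assume I: "I n x s'"
    define s2 where "s2 = tick s'"
    have fr2: "frame {Ids, Deg} s1 s2" and d2: "\<forall>u<n. arrays s2 Ids ! u = u \<and> arrays s2 Deg ! u = card (N u)"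
      and t2: "time s2 \<le> time s1 + 5 * n + 1" using I by (simp_all add: I_def s2_def)
    have W2: "work s2" by (rule work_frame[OF W1 fr2]) simp_all
    have "wp (orient_prog n) (\<lambda>_. wp (core_prog Ids 0 n Deg Adj Core) (\<lambda>_.
       wp (loop [0..<n] () (\<lambda>v _. upper_prog v)) (\<lambda>_. wp (rank_prog n) (\<lambda>_. wp (loop_prog n k) (\<lambda>_. Q))))) s2"
    proof (rule wp_mono[OF orient_prog_wp[OF W2]], use d2 in simp, elim conjE)
      fix x s3 assume fr3: "frame {OutAdj, OutDeg} s2 s3" and out3: "adj_rep OutDeg OutAdj {..<n} Out s3"
        and t3: "time s3 \<le> time s2 + 1 + (\<Sum>v<n. 6 + 5 * card (N v))"
      have W3: "work s3" by (rule work_frame[OF W2 fr3]) simp_all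
      have ar3: "arrays s3 Ids = arrays s2 Ids" "arrays s3 Deg = arrays s2 Deg" using frame_arr[OF fr3] by simp_all
      have sz: "C.sizes s3" unfolding C.sizes_def by (simp add: work_arr[OF W3])
      have adj3: "adj_rep Deg Adj {..<n} N s3"
        unfolding adj_rep_def
      proof (intro ballI)
        fix u assume "u \<in> {..<n}"
        then have u: "u < n" by simp
        show "u < length (arrays s3 Off) \<and> u < length (arrays s3 Deg) \<and> arrays s3 Deg ! u = card (N u) \<and>
          arrays s3 Off ! u + card (N u) \<le> length (arrays s3 Adj) \<and>
          bij_betw (\<lambda>j. arrays s3 Adj ! j) {arrays s3 Off ! u..<arrays s3 Off ! u + card (N u)} (N u)"
          using u d2 off(1) off_le[OF u] N_bij[OF u] off_Suc[OF u] by (simp add: work_arr[OF W3] work_arr[OF W2] ar3)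
      qed
      have ids: "bij_betw (\<lambda>i. arrays s3 Ids ! (0 + i)) {0..<n} {..<n}"
        using d2 unfolding ar3 by (intro bij_betw_imageI) (auto simp: inj_on_def image_def)
      have cn': "n = card {..<n}" "0 + n \<le> length (arrays s3 Ids)" by (simp_all add: work_arr[OF W3])
      show "wp (core_prog Ids 0 n Deg Adj Core) (\<lambda>_. wp (loop [0..<n] () (\<lambda>v _. upper_prog v)) (\<lambda>_.
        wp (rank_prog n) (\<lambda>_. wp (loop_prog n k) (\<lambda>_. Q)))) s3"
      proof (rule wp_mono[OF C.core_prog_wp[OF sz adj3 cn' ids]], elim conjE)
        fix r s4 assume fr4: "frame {Core, Cur, Deleted, Alive, Order} s3 s4" and core4: "\<forall>u\<in>{..<n}. arrays s4 Core ! u = cn u"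
          and t4: "time s4 \<le> time s3 + 60 * (1 + n + (\<Sum>u\<in>{..<n}. card (N u)))"
        have W4: "work s4" by (rule work_frame[OF W3 fr4]) simp_all
        define J where "J v (x::unit) s' \<longleftrightarrow> frame {Cnt, Upper} s4 s' \<and> (\<forall>u<v. arrays s' Upper ! u = bound u) \<and>
          time s' \<le> time s4 + (\<Sum>u<v. 21 + 20 * card (N u))" for v x s'
        show "wp (loop [0..<n] () (\<lambda>v _. upper_prog v)) (\<lambda>_. wp (rank_prog n) (\<lambda>_. wp (loop_prog n k) (\<lambda>_. Q))) s4"
        proof (rule wp_loop[where I = J])
          show "J 0 () s4" by (simp add: J_def)
        next
          fix v x s' assume v: "v < n" and J: "J v x s'"
          have fr: "frame {Cnt, Upper} s4 s'" using J by (simp add: J_def)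
          have W': "work (tick s')" using work_frame[OF W4 fr] by simp
          have "\<forall>u<n. arrays (tick s') Core ! u = cn u" using core4 frame_arr[OF fr, of Core] by simp
          from upper_prog_wp[OF W' v this] show "wp (upper_prog v) (J (Suc v)) (tick s')"
          proof (rule wp_mono, elim conjE)
            fix y s5 assume fr5: "frame {Cnt, Upper} (tick s') s5" and u5: "arrays s5 Upper = (arrays (tick s') Upper)[v := bound v]"
              and t5: "time s5 \<le> time (tick s') + 20 * (1 + card (N v))"
            have "frame {Cnt, Upper} s4 s5" by (rule frame_trans[OF fr, of "{Cnt, Upper}"]) (use fr5 in auto)
            moreover have "\<forall>u<Suc v. arrays s5 Upper ! u = bound u"
              using J v u5 work_arr[OF W'] by (auto simp: J_def less_Suc_eq nth_list_update)
            ultimately show "J (Suc v) y s5" using J t5 by (simp add: J_def)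
          qed
        next
          fix x s5' assume J: "J n x s5'"
          define s5 where "s5 = tick s5'"
          have fr5: "frame {Cnt, Upper} s4 s5" and u5: "\<forall>u<n. arrays s5 Upper ! u = bound u"
            and t5: "time s5 \<le> time s4 + 1 + (\<Sum>u<n. 21 + 20 * card (N u))" using J by (simp_all add: J_def s5_def)
          have W5: "work s5" by (rule work_frame[OF W4 fr5]) simp_all
          have fr15: "frame {Ids, Deg, OutAdj, OutDeg, Core, Cur, Deleted, Alive, Order, Cnt, Upper} s1 s5"
            using fr2 fr3 fr4 fr5 unfolding frame_def by simp
          have out5: "adj_rep OutDeg OutAdj {..<n} Out s5"
            by (rule adj_rep_frame[OF adj_rep_frame[OF out3 fr4] fr5]) simp_all
          have uh: "\<forall>x<n. arrays s5 UHead ! x = 0" using frame_arr[OF fr15, of UHead] z1 by simp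
          have ub: "\<forall>v<n. arrays s5 Upper ! v < n" using u5 bound_less by simp
          have "wp (rank_prog n) (\<lambda>_. wp (loop_prog n k) (\<lambda>_. Q)) s5"
          proof (rule wp_mono[OF rank_prog_wp[OF W5 ub uh]], elim conjE)
            fix y s6
            assume fr6: "frame {UHead, UNext, Ranked} s5 s6" and rk: "distinct (arrays s6 Ranked)" "set (arrays s6 Ranked) = {..<n}"
              and sorted: "sorted_wrt (\<lambda>u w. arrays s5 Upper ! u \<ge> arrays s5 Upper ! w) (arrays s6 Ranked)"
              and t6: "time s6 \<le> time s5 + 20 * (1 + n)"
            interpret T: topk_input n off adj N G k vs hh "arrays s6 Ranked"
              by unfold_locales (use vs score hh k rk in auto)
            have W6: "work s6" by (rule work_frame[OF W5 fr6]) simp_all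
            have out6: "adj_rep OutDeg OutAdj {..<n} Out s6" by (rule adj_rep_frame[OF out5 fr6]) simp
            have fr16: "frame {Ids, Deg, OutAdj, OutDeg, Core, Cur, Deleted, Alive, Order, Cnt, Upper, UHead, UNext, Ranked} s1 s6"
              using fr15 fr6 unfolding frame_def by simp
            have ar6: "arrays s6 Mark = replicate n 0" "arrays s6 SHead = replicate n 0" "arrays s6 Upper = arrays s5 Upper"
              "length (arrays s6 SNext) = k" "length (arrays s6 Result) = k"
              using frame_arr[OF fr16] frame_arr[OF fr6, of Upper] frame_length[OF fr16] z1 by simp_all
            have sorted': "sorted_wrt (\<lambda>u w. bound u \<ge> bound w) (arrays s6 Ranked)"
              by (rule sorted_wrt_mono_rel[OF _ sorted]) (use u5 rk(2) in auto)
            have sp6: "space s6 = space s1" using fr16 by (simp add: frame_def)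
            have L: "wp (loop_prog n k) (\<lambda>_ s'. T.full (T.chosen (arrays s' Result) k) \<and> length (arrays s' Result) = k \<and>
              space s' = space s6 \<and> time s' \<le> time s6 + 300 * (\<Sum>v<n. score_cost v) + 23 * n + 12) s6"
              by (rule T.loop_prog_wp[OF W6 out6]) (use ar6 u5 in simp_all)
            show "wp (loop_prog n k) (\<lambda>_. Q) s6"
            proof (rule wp_mono[OF L], elim conjE)
              fix z and s7 :: mem assume full: "T.full (T.chosen (arrays s7 Result) k)" and l7: "length (arrays s7 Result) = k"
                and sp7: "space s7 = space s6" and t7: "time s7 \<le> time s6 + 300 * (\<Sum>v<n. score_cost v) + 23 * n + 12"
              have "set (arrays s7 Result) = (\<lambda>j. arrays s7 Result ! j) ` {..<k}"
                using l7 by (auto simp: set_conv_nth)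
              then have "T.chosen (arrays s7 Result) k = result_set vs s7"
                unfolding T.chosen_def result_set_def by (simp add: image_image)
              then have 1: "topk_loop G k hh (map (\<lambda>i. vs ! i) (arrays s6 Ranked)) {} (\<lambda>_. 0) (result_set vs s7)"
                using full by simp
              have s1': "(\<Sum>v<n. 6 + 5 * card (N v)) = 6 * n + 5 * (\<Sum>v<n. card (N v))"
                by (subst sum.distrib) (simp add: sum_distrib_left)
              have s2': "(\<Sum>v<n. 21 + 20 * card (N v)) = 21 * n + 20 * (\<Sum>v<n. card (N v))"
                by (subst sum.distrib) (simp add: sum_distrib_left)
              have s3': "(\<Sum>v<n. score_cost v) = n + (\<Sum>v<n. card (N v)) + (\<Sum>v<n. \<Sum>u\<in>N v. card (Out u))"
                unfolding score_cost_def sum.distrib by simp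
              \<comment> \<open>All phases before the main loop are linear in \<open>n\<close> and
                the length of \<open>adj\<close>; the sum of out-degrees enters through
                \<open>score_cost\<close> only.\<close>
              have "time s7 \<le> 1000 * work_total"
                using t7 t6 t5 t4 t3 t2 t1 sum_card_N unfolding s1' s2' s3' work_total_def distrib_left by linarith
              then show "Q s7" unfolding Q_def using 1 rk sorted' sp7 sp6 sp1 by auto
            qed
          qed
          then show "wp (rank_prog n) (\<lambda>_. wp (loop_prog n k) (\<lambda>_. Q)) (tick s5')" by (simp only: s5_def)
        qed simp
      qed
    qed
    then show "wp (orient_prog n) (\<lambda>_. wp (core_prog Ids 0 n Deg Adj Core) (\<lambda>_.
       wp (loop [0..<n] () (\<lambda>v _. upper_prog v)) (\<lambda>_. wp (rank_prog n) (\<lambda>_. wp (loop_prog n k) (\<lambda>_. Q))))) (tick s')"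
      by (simp only: s2_def)
  qed simp
  have off_n: "n < length (arrays (init_mem off adj) Off)" "arrays (init_mem off adj) Off ! n = ?m2"
    using off by (simp_all add: init_mem_def)
  show ?thesis
    unfolding topk_prog_def wp_bind wp_get wp_new_alloc off_n(2) s0_def[symmetric] s1_def[symmetric] Q_def[symmetric]
    by (rule conjI[OF off_n(1) main])
qed

end

section \<open>The bounds in terms of the arboricity\<close>

text \<open>A vertex \<open>u\<close> lies in \<open>N v\<close> for exactly
  \<open>card (N u)\<close> vertices \<open>v\<close>, so exchanging the sums gives
  \<open>card (N u)\<close> for every arc leaving \<open>u\<close>. As the tail of an arc has the
  smaller or equal degree, this is the sum of minimum degrees over the edges concerned.\<close>

lemma sum_out_degree_le:
  assumes "input n off adj N" and G: "simple_graph G"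
    and f: "inj_on f {..<n}" "\<And>v. v < n \<Longrightarrow> nbrs G (f v) = f ` N v"
  shows "(\<Sum>v<n. \<Sum>u\<in>N v. card (input.Out N u)) \<le> 2 * arboricity G * card (edges G)"
proof -
  interpret input n off adj N by fact
  have Nn: "N v \<subseteq> {..<n}" if "v < n" for v using N_sub that by simp
  have fin: "finite (Out u)" if "u < n" for u using finite_subset[OF Out_sub finite_N] that by simp
  have deg: "degree G (f u) = card (N u)" if "u < n" for u
    unfolding degree_def f(2)[OF that] by (rule card_image) (meson f(1) inj_on_subset Nn[OF that])
  let ?A = "Sigma {..<n} Out"
  let ?e = "\<lambda>(u, w). {f u, f w}"
  have A: "u < n \<and> w < n \<and> w \<in> Out u \<and> w \<in> N u" if "(u, w) \<in> ?A" for u w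
    using that Out_sub[of u] Nn[of u] by auto
  \<comment> \<open>Every edge has only one direction, so arcs may be counted as edges.\<close>
  have inj: "inj_on ?e ?A"
  proof (rule inj_onI)
    fix x y assume xy: "x \<in> ?A" "y \<in> ?A" "?e x = ?e y"
    obtain u w u' w' where x: "x = (u, w)" and y: "y = (u', w')" by (cases x, cases y)
    have m: "(u, w) \<in> ?A" "(u', w') \<in> ?A" and e: "{f u, f w} = {f u', f w'}" using xy unfolding x y by simp_all
    have ff: "f a = f b \<Longrightarrow> a = b" if "a < n" "b < n" for a b using f(1) that by (simp add: inj_on_eq_iff)
    from e consider "f u = f u'" "f w = f w'" | "f u = f w'" "f w = f u'" by (auto simp: doubleton_eq_iff)
    then have "u = u' \<and> w = w'"
    proof cases
      case 1
      then show ?thesis using ff A[OF m(1)] A[OF m(2)] by blast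
    next
      case 2
      then have "u = w'" "w = u'" using ff A[OF m(1)] A[OF m(2)] by blast+
      then show ?thesis using A[OF m(1)] A[OF m(2)] Out_asym by blast
    qed
    then show "x = y" by (simp add: x y)
  qed
  have sub: "?e ` ?A \<subseteq> edges G"
  proof
    fix e assume "e \<in> ?e ` ?A"
    then obtain u w where uw: "(u, w) \<in> ?A" "e = {f u, f w}" by auto
    then have "f w \<in> nbrs G (f u)" using A[OF uw(1)] f(2)[of u] by blast
    then show "e \<in> edges G" unfolding uw(2) by (simp add: nbrs_def insert_commute)
  qed
  have "(\<Sum>v<n. \<Sum>u\<in>N v. card (Out u)) = (\<Sum>v<n. \<Sum>u<n. if u \<in> N v then card (Out u) else 0)"
    by (rule sum.cong[OF refl]) (simp add: sum.If_cases Int_absorb1 Nn)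
  also have "\<dots> = (\<Sum>u<n. \<Sum>v<n. if u \<in> N v then card (Out u) else 0)" by (rule sum.swap)
  also have "\<dots> = (\<Sum>u<n. card (N u) * card (Out u))"
  proof (rule sum.cong[OF refl])
    fix u assume "u \<in> {..<n}"
    then have u: "u < n" by simp
    have "{..<n} \<inter> {v. u \<in> N v} = N u"
    proof (rule set_eqI)
      fix v show "v \<in> {..<n} \<inter> {v. u \<in> N v} \<longleftrightarrow> v \<in> N u"
        using N_sym[of v u] N_sym[of u v] Nn[OF u] u by auto
    qed
    then show "(\<Sum>v<n. if u \<in> N v then card (Out u) else 0) = card (N u) * card (Out u)"
      by (simp add: sum.If_cases)
  qed
  also have "\<dots> = (\<Sum>u<n. \<Sum>w\<in>Out u. card (N u))" by (simp add: mult.commute)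
  also have "\<dots> = (\<Sum>(u, w)\<in>?A. card (N u))" by (rule sum.Sigma) (use fin in auto)
  also have "\<dots> \<le> (\<Sum>a\<in>?A. Min (degree G ` ?e a))"
  proof (rule sum_mono)
    fix x assume x: "x \<in> ?A"
    obtain u w where uw: "x = (u, w)" by (cases x)
    then have a: "u < n" "w < n" "w \<in> Out u" using A[of u w] x by auto
    have "card (N u) \<le> card (N w)" using a(3) by (auto simp: Out_def)
    then show "(case x of (u, w) \<Rightarrow> card (N u)) \<le> Min (degree G ` ?e x)" using deg a by (simp add: uw)
  qed
  also have "\<dots> = (\<Sum>e\<in>?e ` ?A. Min (degree G ` e))" using inj by (simp add: sum.reindex)
  also have "\<dots> \<le> (\<Sum>e\<in>edges G. Min (degree G ` e))"
    by (rule sum_mono2[OF simple_graph_finite_edges[OF G] sub]) simp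
  also have "\<dots> \<le> 2 * arboricity G * card (edges G)" by (rule sum_min_degree_le[OF G])
  finally show ?thesis .
qed

text \<open>Each edge contributes at least 1 to the sum of the smaller degrees. This absorbs terms
  linear in the number of edges into the product with the arboricity.\<close>

lemma card_edges_le_arboricity:
  assumes G: "simple_graph G"
  shows "card (edges G) \<le> 2 * arboricity G * card (edges G)"
proof -
  have "1 \<le> Min (degree G ` e)" if e: "e \<in> edges G" for e
  proof -
    obtain x y where xy: "e = {x, y}" "y \<in> nbrs G x" using edge_endpoints[OF G e] by metis
    then have "x \<in> nbrs G y" by (simp add: nbrs_def insert_commute)
    then have "0 < degree G x" "0 < degree G y"
      using xy(2) simple_graph_nbrs(3)[OF G] unfolding degree_def by (auto simp: card_gt_0_iff)
    then show ?thesis using xy(1) by simp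
  qed
  then have "card (edges G) * 1 \<le> (\<Sum>e\<in>edges G. Min (degree G ` e))"
    using sum_bounded_below[of "edges G" 1 "\<lambda>e. Min (degree G ` e)"] by simp
  also note sum_min_degree_le[OF G]
  finally show ?thesis by (simp only: mult_1_right)
qed

text \<open>A connected graph either has no isolated vertex, so that the degree sum bounds the
  number of vertices, or is a single vertex, which accounts for the additional 1. Terms in the
  number of vertices thereby become terms in the number of edges.\<close>

lemma card_verts_le:
  assumes G: "simple_graph G" "connected_graph G"
  shows "card (verts G) \<le> 2 * card (edges G) + 1"
proof (cases "\<exists>v\<in>verts G. degree G v = 0")
  case True
  then show ?thesis using degree_0_connected[OF G] by fastforce
next
  case False
  then have "1 \<le> degree G v" if "v \<in> verts G" for v using that by (simp add: Suc_le_eq)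
  from degree_bound_times_card[OF G(1) this] show ?thesis by simp
qed

text \<open>The program sees only numbers. Its results are carried over to \<open>G\<close> along
  \<open>(!) vs\<close>: core numbers and upper bounds by an isomorphism of the whole graph, scores
  by one isomorphism for each ego-network.\<close>

lemma topk_prog_correct:
  assumes G: "simple_graph G" "connected_graph G" and k: "1 \<le> k" "k \<le> card (verts G)"
    and inp: "adj_arrays G vs off adj"
  shows "\<exists>s. topk_prog (card (verts G)) k (init_mem off adj) = Some ((), s) \<and> TopK G k (result_set vs s) \<and>
    time s \<le> 12000 * max 1 (arboricity G * card (edges G)) \<and> space s \<le> 12000 * max 1 (card (edges G))"
proof -
  let ?n = "length vs" and ?f = "\<lambda>i. vs ! i" and ?m = "card (edges G)"
  define N where "N i = set (map ((!) adj) [off ! i..<off ! (i + 1)])" for i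
  have vs: "distinct vs" "set vs = verts G" and offs: "length off = ?n + 1" "off ! 0 = 0" "off ! ?n = length adj" "sorted off"
    using inp by (auto simp: adj_arrays_def)
  have ns: "distinct (map ((!) adj) [off ! i..<off ! (i + 1)])" "N i \<subseteq> {..<?n}" "?f ` N i = nbrs G (?f i)" if "i < ?n" for i
    using inp that unfolding adj_arrays_def N_def Let_def by auto
  have n: "card (verts G) = ?n" using distinct_card[OF vs(1)] vs(2) by simp
  have f: "inj_on ?f {..<?n}" using vs(1) by (simp add: inj_on_nth)
  have f_V: "?f ` {..<?n} = verts G" using vs(2) by (auto simp: set_conv_nth)
  have fV: "?f i \<in> verts G" if "i < ?n" for i using nth_mem[OF that] vs(2) by simp
  have N_iff: "y \<in> N x \<longleftrightarrow> ?f y \<in> nbrs G (?f x)" if "x < ?n" "y < ?n" for x y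
  proof -
    have "?f y \<in> ?f ` N x \<longleftrightarrow> y \<in> N x" by (rule inj_on_image_mem_iff[OF f _ ns(2)[OF that(1)]]) (use that in simp)
    then show ?thesis using ns(3)[OF that(1)] by simp
  qed
  have nb: "nbhd {..<?n} N"
  proof
    fix x y assume x: "x \<in> {..<?n}"
    then have xn: "x < ?n" by simp
    show "N x \<subseteq> {..<?n}" by (rule ns(2)[OF xn])
    show "x \<notin> N x" using N_iff[OF xn xn] simple_graph_nbrs(2)[OF G(1)] by blast
    show "y \<in> N x \<Longrightarrow> x \<in> N y"
    proof -
      assume y: "y \<in> N x"
      then have yn: "y < ?n" using ns(2)[OF xn] by blast
      have "?f y \<in> nbrs G (?f x)" using N_iff[OF xn yn] y by blast
      then have "?f x \<in> nbrs G (?f y)" using simple_graph_nbrs(5)[OF G(1), of "?f x" "?f y"] by blast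
      then show "x \<in> N y" using N_iff[OF yn xn] by blast
    qed
  qed simp
  interpret input ?n off adj N
  proof (rule input.intro)
    show "length off = Suc ?n" "sorted off" "off ! ?n = length adj" using offs by simp_all
    show "bij_betw (\<lambda>j. adj ! j) {off ! i..<off ! Suc i} (N i)" if "i < ?n" for i
      using ns(1)[OF that] by (simp add: bij_betw_def N_def distinct_map)
    show "nbhd {..<?n} N" by (rule nb)
  qed
  interpret S: sgraph G by (rule sgraph.intro[OF G(1)])
  interpret iso: nbhd_iso "{..<?n}" N "verts G" "nbrs G" ?f
    by unfold_locales (use f f_V ns(3) in auto)
  have score: "hscore G (?f v) = h_index (N v) (\<lambda>u. N u \<inter> N v)" if v: "v < ?n" for v
  proof -
    interpret E: sgraph "ego G (?f v)" by (rule sgraph_ego[OF G(1)])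
    have "nbhd_iso (N v) (\<lambda>u. N u \<inter> N v) (nbrs G (?f v)) (nbrs (ego G (?f v))) ?f"
    proof (rule nbhd_iso.intro[OF nbhd_ego[OF v]])
      show "nbhd (nbrs G (?f v)) (nbrs (ego G (?f v)))" using E.nbhd_axioms by simp
      show "nbhd_iso_axioms (N v) (\<lambda>u. N u \<inter> N v) (nbrs G (?f v)) (nbrs (ego G (?f v))) ?f"
      proof
        show "inj_on ?f (N v)" using f ns(2)[OF v] inj_on_subset by blast
        show fv: "nbrs G (?f v) = ?f ` N v" using ns(3)[OF v] by simp
        fix u assume u: "u \<in> N v"
        then have un: "u < ?n" using ns(2)[OF v] by blast
        have "?f u \<in> nbrs G (?f v)" using u fv by blast
        then have "nbrs (ego G (?f v)) (?f u) = ?f ` N u \<inter> ?f ` N v"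
          unfolding ns(3)[OF un] fv[symmetric] by (rule nbrs_ego)
        then show "nbrs (ego G (?f v)) (?f u) = ?f ` (N u \<inter> N v)"
          using inj_on_image_Int[OF f ns(2)[OF un] ns(2)[OF v]] by simp
      qed
    qed
    from nbhd_iso.h_index_image[OF this] show ?thesis by (simp add: hscore_eq[OF G(1)])
  qed
  obtain c where c: "core_decomposition G c" using S.core_decomposition_exists by blast
  have cn: "c (?f v) = cn v" if "v < ?n" for v
    using S.core_decomposition_core_number[OF c fV[OF that]] iso.core_number_image[of v] that by simp
  have hh: "upper_bound G c (?f v) = bound v" if v: "v < ?n" for v
  proof -
    have "{u \<in> nbrs G (?f v). min (c (?f v)) (c u - 1) \<ge> x} = ?f ` {u \<in> N v. x \<le> min (cn v) (cn u - 1)}" for x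
      unfolding ns(3)[OF v, symmetric] using cn v ns(2)[OF v] by (auto simp: image_iff Bex_def subset_iff)
    moreover have "card (?f ` {u \<in> N v. x \<le> min (cn v) (cn u - 1)}) = card {u \<in> N v. x \<le> min (cn v) (cn u - 1)}" for x
      by (rule card_image, rule inj_on_subset[OF f]) (use ns(2)[OF v] in auto)
    ultimately show ?thesis unfolding upper_bound_def bound_def by simp
  qed
  have "wp (topk_prog ?n k) (\<lambda>_ s'. (\<exists>rk. distinct rk \<and> set rk = {..<?n} \<and> sorted_wrt (\<lambda>u w. bound u \<ge> bound w) rk \<and>
      topk_loop G k (upper_bound G c) (map ?f rk) {} (\<lambda>_. 0) (result_set vs s')) \<and>
    time s' \<le> 1000 * work_total \<and> space s' \<le> 22 * ?n + 2 + 3 * length adj) (init_mem off adj)"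
    by (rule topk_prog_wp[OF f _ hh]) (use score Score_hscore[OF G(1)] k n in \<open>auto simp: score[symmetric]\<close>)
  then obtain s rk where s: "topk_prog ?n k (init_mem off adj) = Some ((), s)" and rk: "distinct rk" "set rk = {..<?n}"
      "sorted_wrt (\<lambda>u w. bound u \<ge> bound w) rk"
      "topk_loop G k (upper_bound G c) (map ?f rk) {} (\<lambda>_. 0) (result_set vs s)"
    and t: "time s \<le> 1000 * work_total" and sp: "space s \<le> 22 * ?n + 2 + 3 * length adj"
    unfolding wp_def by (auto split: option.splits)
  have "TopK G k (result_set vs s)"
    unfolding TopK_def
  proof (intro exI conjI)
    show "core_decomposition G c" by (rule c)
    show "distinct (map ?f rk)" using rk(1,2) f by (simp add: distinct_map)
    show "set (map ?f rk) = verts G" using rk(2) f_V by simp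
    show "sorted_wrt (\<lambda>x y. upper_bound G c x \<ge> upper_bound G c y) (map ?f rk)"
      unfolding sorted_wrt_map by (rule sorted_wrt_mono_rel[OF _ rk(3)]) (use hh rk(2) in auto)
    show "topk_loop G k (upper_bound G c) (map ?f rk) {} (\<lambda>_. 0) (result_set vs s)" by (rule rk(4))
  qed
  moreover have la: "length adj = 2 * ?m"
  proof -
    have "(\<Sum>v<i. card (N v)) = off ! i" if "i \<le> ?n" for i
      using that by (induction i) (auto simp: off_Suc offs(2))
    then have "length adj = (\<Sum>v<?n. card (N v))" using off(3) by simp
    also have "\<dots> = (\<Sum>v<?n. degree G (?f v))"
    proof (rule sum.cong[OF refl])
      fix v assume "v \<in> {..<?n}"
      then have v: "v < ?n" by simp
      show "card (N v) = degree G (?f v)" unfolding degree_def ns(3)[OF v, symmetric]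
        by (rule card_image[symmetric], rule inj_on_subset[OF f ns(2)[OF v]])
    qed
    also have "\<dots> = (\<Sum>v\<in>verts G. degree G v)" unfolding f_V[symmetric] using f by (simp add: sum.reindex)
    finally show ?thesis using sum_degree[OF G(1)] by simp
  qed
  have nm: "?n \<le> 2 * ?m + 1" using card_verts_le[OF G] n by simp
  have out: "(\<Sum>v<?n. \<Sum>u\<in>N v. card (Out u)) \<le> 2 * arboricity G * ?m"
    by (rule sum_out_degree_le[OF input_axioms G(1) f]) (use ns(3) in simp)
  have am: "?m \<le> 2 * arboricity G * ?m" by (rule card_edges_le_arboricity[OF G(1)])
  let ?X = "max 1 (arboricity G * ?m)"
  have X: "1 \<le> ?X" "2 * arboricity G * ?m \<le> 2 * ?X" by (simp_all add: mult.assoc)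
  \<comment> \<open>The size of the graph contributes at most \<open>2 + 4 * ?m\<close>, where
    \<open>?m \<le> 2 * ?X\<close>, and the out-degrees at most \<open>2 * ?X\<close>: together no
    more than \<open>(2 + 8 + 2) * ?X\<close>.\<close>
  have "work_total \<le> 12 * ?X" unfolding work_total_def using la nm out am X by linarith
  then have "time s \<le> 12000 * ?X" using t by simp
  moreover have "space s \<le> 12000 * max 1 ?m" using sp la nm by (simp add: max_def)
  ultimately show ?thesis using s n by simp
qed

text \<open>The \<open>max 1\<close> is for the graph with a single vertex, which has no edges but
  still costs time and space. Optimality is stated for the results of all runs of the
  nondeterministic algorithm; the machine program realises one of these runs within the bounds, for
  every representation of \<open>G\<close> by adjacency arrays.\<close>

theorem theorem5p7:
  shows "\<exists>C::nat. \<forall>(G :: 'a ugraph) (k :: nat).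
    simple_graph G \<and> connected_graph G \<and> 1 \<le> k \<and> k \<le> card (verts G) \<longrightarrow>
      (\<forall>S. TopK G k S \<longrightarrow>
         is_arg_max (\<lambda>S. Min (hscore G ` S)) (\<lambda>S. S \<subseteq> verts G \<and> card S = k) S \<and>
         (\<forall>u\<in>S. \<forall>w\<in>verts G - S. hscore G w \<le> hscore G u)) \<and>
      (\<forall>vs off adj. adj_arrays G vs off adj \<longrightarrow>
         (\<exists>s. topk_prog (card (verts G)) k (init_mem off adj) = Some ((), s) \<and>
            TopK G k (result_set vs s) \<and>
            time s \<le> C * max 1 (arboricity G * card (edges G)) \<and>
            space s \<le> C * max 1 (card (edges G)))) \<and>
      real (arboricity G) \<le> min (real (max_degree G)) (real_of_int \<lceil>sqrt (real (card (edges G)))\<rceil>) \<and>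
      (\<not> (card (verts G) = 3 \<and> card (edges G) = 3) \<longrightarrow>
         real (arboricity G) \<le> min (real (max_degree G)) (sqrt (real (card (edges G)))))"
proof (intro exI[of _ 12000] allI impI, elim conjE)
  fix G :: "'a ugraph" and k
  assume G: "simple_graph G" "connected_graph G" and k: "1 \<le> k" "k \<le> card (verts G)"
  have fin: "finite (verts G)" and ne: "verts G \<noteq> {}" using G by (auto simp: simple_graph_def connected_graph_def)
  have "is_arg_max (\<lambda>S. Min (hscore G ` S)) (\<lambda>S. S \<subseteq> verts G \<and> card S = k) S \<and>
      (\<forall>u\<in>S. \<forall>w\<in>verts G - S. hscore G w \<le> hscore G u)" if "TopK G k S" for S
    using TopK_correct[OF G(1) k that] best_imp_arg_max[OF fin _ _ k(1)] by blast
  moreover have "real (arboricity G) \<le> real (max_degree G)" using arboricity_le_max_degree[OF G(1) ne] by simp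
  ultimately show "(\<forall>S. TopK G k S \<longrightarrow>
         is_arg_max (\<lambda>S. Min (hscore G ` S)) (\<lambda>S. S \<subseteq> verts G \<and> card S = k) S \<and>
         (\<forall>u\<in>S. \<forall>w\<in>verts G - S. hscore G w \<le> hscore G u)) \<and>
      (\<forall>vs off adj. adj_arrays G vs off adj \<longrightarrow>
         (\<exists>s. topk_prog (card (verts G)) k (init_mem off adj) = Some ((), s) \<and>
            TopK G k (result_set vs s) \<and>
            time s \<le> 12000 * max 1 (arboricity G * card (edges G)) \<and>
            space s \<le> 12000 * max 1 (card (edges G)))) \<and>
      real (arboricity G) \<le> min (real (max_degree G)) (real_of_int \<lceil>sqrt (real (card (edges G)))\<rceil>) \<and>
      (\<not> (card (verts G) = 3 \<and> card (edges G) = 3) \<longrightarrow>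
         real (arboricity G) \<le> min (real (max_degree G)) (sqrt (real (card (edges G)))))"
    using topk_prog_correct[OF G k] arboricity_le_ceiling_sqrt[OF G] arboricity_le_sqrt[OF G] by simp
qed

end
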